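(* For any $\delta\in(0,1]$, define $c_{T,m,\delta}:=2\left(1+4\log(2Tm/\delta)\right)$. Also let $\tau:=\max\left(\mathrm{Tr}[X_0],1\right)$, where $X_0=f_\beta(C-\mu\mathbf I_n)$ is the initial condition. Consider the stochastic mirror descent algorithm described in the context, in its proximal form, with step size $$\eta_t=\eta:=\sqrt{\frac{2D(X_\star\|X_0)}{\tau\,c_{T,m,\delta}^2\,\tilde c_{\mathrm h}^2\,T}},$$ or equivalently in its mirror descent form with $\gamma_t:=\frac{\eta\beta}{\eta+\beta}$, where $$\tilde c_{\mathrm h}:=\max\left(\big\|\,|V|\,\rho(X_\star)\big\|_\infty,\ \max_{t=0,\dots,T-1}\big\|\,|V|\,\rho(X_t)\big\|_\infty\right).$$ Then $$\frac1T\sum_{t=0}^{T-1}\left(F_\beta(X_t)-\mu\,\mathrm{Tr}[X_t]\right)\le F_\beta(X_\star)-\mu\,\mathrm{Tr}[X_\star]+\frac{\left(\sqrt{2\tau\,D(X_\star\|X_0)}+2\tau\right)c_{T,m,\delta}\,\tilde c_{\mathrm h}}{\sqrt T}$$ holds with probability at least $1-\delta$.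
   Context: Problem setting. Let $n,m$ be positive integers, $\Psi\in\mathbb R^{m\times n}$ with $\Psi^\top\Psi=\mathbf I_n$, $V\in\mathbb R^{m\times m}$ symmetric positive semidefinite, $C\in\mathbb R^{n\times n}$ symmetric, $\mu\in\mathbb R$, and $\beta\in(0,+\infty)$. Let $\mathcal X=\{X\in\mathbb R^{n\times n}\text{ symmetric}: 0\preceq X\preceq \mathbf I_n\}$; $\langle\cdot,\cdot\rangle$ is the Frobenius inner product; $|V|$ is the entrywise absolute value of $V$; for a vector, $\|\cdot\|_\infty$ is the max norm. For $Y\in\mathbb R^{n\times n}$ put $\rho(Y)=\mathrm{diag}[\Psi Y\Psi^\top]\in\mathbb R^m$ (the vector of diagonal entries), $\tilde E(Y)=\frac12\rho(Y)^\top V\rho(Y)$, so that $\nabla\tilde E(Y)=\Psi^\top\mathrm{diag}^*[V\rho(Y)]\Psi$, where $\mathrm{diag}^*[v]$ is the diagonal matrix with diagonal $v$. Standing assumption: $\nabla\tilde E(X)\succeq0$ for all $X\in\mathcal X$. Define $E(X)=\mathrm{Tr}[CX]+\tilde E(X)$, $S_{\mathrm{FD}}(X)=\mathrm{Tr}[X\log X]+\mathrm{Tr}[(\mathbf I_n-X)\log(\mathbf I_n-X)]$ on $\mathcal X$ (with $0\log0=0$), $F_\beta(X)=E(X)+\beta^{-1}S_{\mathrm{FD}}(X)$, $D(Y\|X)=S_{\mathrm{FD}}(Y)-S_{\mathrm{FD}}(X)-\langle\nabla S_{\mathrm{FD}}(X),Y-X\rangle$, and $f_\beta(x)=\frac1{1+e^{\beta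 x}}$, applied to symmetric matrices as a matrix function. $X_\star$ denotes the minimizer of $F_\beta(X)-\mu\,\mathrm{Tr}[X]$ over $\mathcal X$. Algorithm. Let $T$ be a positive integer (the number of iterations) and let $z_0,\dots,z_{T-1}$ be i.i.d. standard Gaussian vectors in $\mathbb R^n$. Start from $X_0=f_\beta(C-\mu\mathbf I_n)$. Given $X_t$, set $\hat X_t=X_t^{1/2}z_tz_t^\top X_t^{1/2}$, $\tilde G_t=\nabla\tilde E(\hat X_t)$, $G_t=C+\tilde G_t$. Mirror descent form with step size $\gamma_t$: $X_{t+1}$ is defined by $$\nabla S_{\mathrm{FD}}(X_{t+1})=(1-\beta^{-1}\gamma_t)\nabla S_{\mathrm{FD}}(X_t)-\gamma_t(G_t-\mu\mathbf I_n),$$ where $\nabla S_{\mathrm{FD}}(X)=\log(X(\mathbf I_n-X)^{-1})$ has inverse map $X^*\mapsto(\mathbf I_n+e^{-X^*})^{-1}$ on symmetric matrices. Proximal form with step size $\eta_t>0$ (equivalent when $\gamma_t=\frac{\eta_t\beta}{\eta_t+\beta}$): $X_{t+1}$ is the minimizer over $X\in\mathcal X$ of $E(X_t)+\langle G_t-\mu\mathbf I_n,X-X_t\rangle+\beta^{-1}S_{\mathrm{FD}}(X)+\eta_t^{-1}D(X\|X_t)$. *)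

theory Defs
  imports "HOL-Probability.Probability"
begin

section \<open>Symmetric matrices and matrix functions\<close>

definition diag_mat :: "real ^ 'n \<Rightarrow> real ^ 'n ^ 'n" where
  "diag_mat v = (\<chi> i j. if i = j then v $ i else 0)"

definition outer_prod :: "real ^ 'n \<Rightarrow> real ^ 'n \<Rightarrow> real ^ 'n ^ 'n" where
  "outer_prod x y = (\<chi> i j. x $ i * y $ j)"

definition abs_mat :: "real ^ 'n ^ 'm \<Rightarrow> real ^ 'n ^ 'm" where
  "abs_mat A = (\<chi> i j. \<bar>A $ i $ j\<bar>)"

definition pos_semidef :: "real ^ 'n ^ 'n \<Rightarrow> bool" where
  "pos_semidef A \<longleftrightarrow> transpose A = A \<and> (\<forall>x. 0 \<le> x \<bullet> (A *v x))"

definition pos_def :: "real ^ 'n ^ 'n \<Rightarrow> bool" where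
  "pos_def A \<longleftrightarrow> transpose A = A \<and> (\<forall>x. x \<noteq> 0 \<longrightarrow> 0 < x \<bullet> (A *v x))"

text \<open>The spectral functional calculus, meant for symmetric matrices only: a symmetric \<open>A\<close> has a
  decomposition \<open>A = Q diag(d) Q\<^sup>T\<close> with \<open>Q\<close> orthogonal, and \<open>Q diag(f(d)) Q\<^sup>T\<close> does not depend on
  the choice of the decomposition.\<close>

definition mat_fun :: "(real \<Rightarrow> real) \<Rightarrow> real ^ 'n ^ 'n \<Rightarrow> real ^ 'n ^ 'n" where
  "mat_fun f A = (THE B. \<exists>Q d. orthogonal_matrix Q \<and>
     A = Q ** diag_mat d ** transpose Q \<and>
     B = Q ** diag_mat (\<chi> i. f (d $ i)) ** transpose Q)"

lemma mat_fun_eq: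
  assumes Q: "orthogonal_matrix Q" and A: "A = Q ** diag_mat d ** transpose Q"
  shows "mat_fun f A = Q ** diag_mat (\<chi> i. f (d $ i)) ** transpose Q"
  unfolding mat_fun_def
proof (rule the_equality)
  show "\<exists>Q' d'. orthogonal_matrix Q' \<and> A = Q' ** diag_mat d' ** transpose Q' \<and>
      Q ** diag_mat (\<chi> i. f (d $ i)) ** transpose Q
        = Q' ** diag_mat (\<chi> i. f (d' $ i)) ** transpose Q'"
    using assms by blast
next
  fix B
  assume "\<exists>Q' d'. orthogonal_matrix Q' \<and> A = Q' ** diag_mat d' ** transpose Q' \<and>
      B = Q' ** diag_mat (\<chi> i. f (d' $ i)) ** transpose Q'"
  then obtain P e where P: "orthogonal_matrix P" and Ae: "A = P ** diag_mat e ** transpose P"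
    and B: "B = P ** diag_mat (\<chi> i. f (e $ i)) ** transpose P"
    by blast
  define W where "W = transpose P ** Q"
  have QQ: "transpose Q ** Q = mat 1" "Q ** transpose Q = mat 1"
    and PP: "transpose P ** P = mat 1" "P ** transpose P = mat 1"
    using Q P by (auto simp: orthogonal_matrix_def)
  have dr: "(N ** diag_mat v) $ i $ j = N $ i $ j * v $ j" for N :: "real ^ 'a ^ 'a" and v i j
    by (simp add: matrix_matrix_mult_def diag_mat_def if_distrib [of "\<lambda>x. _ * x"] cong: if_cong)
  have dl: "(diag_mat v ** N) $ i $ j = v $ i * N $ i $ j" for N :: "real ^ 'a ^ 'a" and v i j
    by (simp add: matrix_matrix_mult_def diag_mat_def if_distrib [of "\<lambda>x. x * _"] cong: if_cong)
  have "W ** diag_mat d = transpose P ** A ** Q"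
    unfolding W_def A by (metis QQ(1) matrix_mul_assoc matrix_mul_rid)
  also have "\<dots> = diag_mat e ** W"
    unfolding W_def Ae by (metis PP(1) matrix_mul_assoc matrix_mul_lid)
  finally have eq: "W $ i $ j * d $ j = e $ i * W $ i $ j" for i j
    by (metis dr dl)
  have "W $ i $ j * f (d $ j) = f (e $ i) * W $ i $ j" for i j
    using eq [of i j] by (cases "W $ i $ j = 0") (auto simp: mult.commute)
  then have WW: "W ** diag_mat (\<chi> i. f (d $ i)) = diag_mat (\<chi> i. f (e $ i)) ** W"
    by (simp add: vec_eq_iff dr dl)
  have "B = P ** diag_mat (\<chi> i. f (e $ i)) ** transpose P ** (Q ** transpose Q)"
    unfolding B QQ(2) by simp
  also have "\<dots> = P ** (diag_mat (\<chi> i. f (e $ i)) ** W) ** transpose Q"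
    unfolding W_def by (simp add: matrix_mul_assoc)
  also have "\<dots> = P ** transpose P ** Q ** diag_mat (\<chi> i. f (d $ i)) ** transpose Q"
    unfolding WW [symmetric] unfolding W_def by (simp add: matrix_mul_assoc)
  finally show "B = Q ** diag_mat (\<chi> i. f (d $ i)) ** transpose Q"
    by (simp add: PP(2))
qed

definition feasible :: "(real ^ 'n ^ 'n) set" where
  "feasible = {X. pos_semidef X \<and> pos_semidef (mat 1 - X)}"


section \<open>The objective\<close>

definition rho :: "real ^ 'n ^ 'm \<Rightarrow> real ^ 'n ^ 'n \<Rightarrow> real ^ 'm" where
  "rho \<Psi> Y = (\<chi> i. (\<Psi> ** Y ** transpose \<Psi>) $ i $ i)"

definition E_tilde :: "real ^ 'n ^ 'm \<Rightarrow> real ^ 'm ^ 'm \<Rightarrow> real ^ 'n ^ 'n \<Rightarrow> real" where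
  "E_tilde \<Psi> V Y = 1 / 2 * (rho \<Psi> Y \<bullet> (V *v rho \<Psi> Y))"

definition grad_E_tilde ::
    "real ^ 'n ^ 'm \<Rightarrow> real ^ 'm ^ 'm \<Rightarrow> real ^ 'n ^ 'n \<Rightarrow> real ^ 'n ^ 'n" where
  "grad_E_tilde \<Psi> V Y = transpose \<Psi> ** diag_mat (V *v rho \<Psi> Y) ** \<Psi>"

definition energy ::
    "real ^ 'n ^ 'm \<Rightarrow> real ^ 'm ^ 'm \<Rightarrow> real ^ 'n ^ 'n \<Rightarrow> real ^ 'n ^ 'n \<Rightarrow> real" where
  "energy \<Psi> V C X = trace (C ** X) + E_tilde \<Psi> V X"

text \<open>Fermi-Dirac entropy. The convention \<open>0 log 0 = 0\<close> holds since \<open>0 * ln 0 = 0\<close>.\<close>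

definition S_FD :: "real ^ 'n ^ 'n \<Rightarrow> real" where
  "S_FD X = trace (mat_fun (\<lambda>x. x * ln x) X) + trace (mat_fun (\<lambda>x. x * ln x) (mat 1 - X))"

text \<open>Meaningful for symmetric \<open>X\<close> with \<open>0 \<prec> X \<prec> I\<close>.\<close>

definition grad_S_FD :: "real ^ 'n ^ 'n \<Rightarrow> real ^ 'n ^ 'n" where
  "grad_S_FD X = mat_fun ln (X ** matrix_inv (mat 1 - X))"

definition free_energy ::
    "real ^ 'n ^ 'm \<Rightarrow> real ^ 'm ^ 'm \<Rightarrow> real ^ 'n ^ 'n \<Rightarrow> real \<Rightarrow> real ^ 'n ^ 'n \<Rightarrow> real" where
  "free_energy \<Psi> V C \<beta> X = energy \<Psi> V C X + inverse \<beta> * S_FD X"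

text \<open>The divergence \<open>D(Y \<parallel> X)\<close>. The library inner product of \<^typ>\<open>real ^ 'n ^ 'n\<close> is the Frobenius
  inner product.\<close>

definition bregman :: "real ^ 'n ^ 'n \<Rightarrow> real ^ 'n ^ 'n \<Rightarrow> real" where
  "bregman Y X = S_FD Y - S_FD X - grad_S_FD X \<bullet> (Y - X)"

definition fermi :: "real \<Rightarrow> real \<Rightarrow> real" where
  "fermi \<beta> x = 1 / (1 + exp (\<beta> * x))"


section \<open>Stochastic mirror descent\<close>

definition X_init :: "real ^ 'n ^ 'n \<Rightarrow> real \<Rightarrow> real \<Rightarrow> real ^ 'n ^ 'n" where
  "X_init C \<mu> \<beta> = mat_fun (fermi \<beta>) (C - \<mu> *\<^sub>R mat 1)"

definition X_hat :: "real ^ 'n ^ 'n \<Rightarrow> real ^ 'n \<Rightarrow> real ^ 'n ^ 'n" where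
  "X_hat X z = mat_fun sqrt X ** outer_prod z z ** mat_fun sqrt X"

definition stoch_grad ::
    "real ^ 'n ^ 'm \<Rightarrow> real ^ 'm ^ 'm \<Rightarrow> real ^ 'n ^ 'n \<Rightarrow> real ^ 'n ^ 'n \<Rightarrow> real ^ 'n
      \<Rightarrow> real ^ 'n ^ 'n" where
  "stoch_grad \<Psi> V C X z = C + grad_E_tilde \<Psi> V (X_hat X z)"

text \<open>\<open>X'\<close> is the successor of \<open>X\<close> for the sample \<open>z\<close> and step size \<open>\<gamma>\<close>. The gradient map is a
  bijection from \<open>{X'. 0 \<prec> X' \<prec> I}\<close> onto the symmetric matrices, so \<open>X'\<close> is determined.\<close>

definition mirror_step ::
    "real ^ 'n ^ 'm \<Rightarrow> real ^ 'm ^ 'm \<Rightarrow> real ^ 'n ^ 'n \<Rightarrow> real \<Rightarrow> real \<Rightarrow> real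
      \<Rightarrow> real ^ 'n ^ 'n \<Rightarrow> real ^ 'n \<Rightarrow> real ^ 'n ^ 'n \<Rightarrow> bool" where
  "mirror_step \<Psi> V C \<mu> \<beta> \<gamma> X z X' \<longleftrightarrow>
     pos_def X' \<and> pos_def (mat 1 - X') \<and>
     grad_S_FD X' = (1 - inverse \<beta> * \<gamma>) *\<^sub>R grad_S_FD X
       - \<gamma> *\<^sub>R (stoch_grad \<Psi> V C X z - \<mu> *\<^sub>R mat 1)"

definition prox_step ::
    "real ^ 'n ^ 'm \<Rightarrow> real ^ 'm ^ 'm \<Rightarrow> real ^ 'n ^ 'n \<Rightarrow> real \<Rightarrow> real \<Rightarrow> real
      \<Rightarrow> real ^ 'n ^ 'n \<Rightarrow> real ^ 'n \<Rightarrow> real ^ 'n ^ 'n \<Rightarrow> bool" where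
  "prox_step \<Psi> V C \<mu> \<beta> \<eta> X z X' \<longleftrightarrow>
     is_arg_min
       (\<lambda>Y. energy \<Psi> V C X + (stoch_grad \<Psi> V C X z - \<mu> *\<^sub>R mat 1) \<bullet> (Y - X)
            + inverse \<beta> * S_FD Y + inverse \<eta> * bregman Y X)
       (\<lambda>Y. Y \<in> feasible) X'"

definition std_gaussian_density :: "real ^ 'n \<Rightarrow> real" where
  "std_gaussian_density x = (\<Prod>i\<in>UNIV. std_normal_density (x $ i))"


section \<open>Constants of the error bound\<close>

definition c_conf :: "nat \<Rightarrow> nat \<Rightarrow> real \<Rightarrow> real" where
  "c_conf T m \<delta> = 2 * (1 + 4 * ln (2 * real T * real m / \<delta>))"

definition tau :: "real ^ 'n ^ 'n \<Rightarrow> real \<Rightarrow> real \<Rightarrow> real" where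
  "tau C \<mu> \<beta> = max (trace (X_init C \<mu> \<beta>)) 1"

definition c_h ::
    "real ^ 'n ^ 'm \<Rightarrow> real ^ 'm ^ 'm \<Rightarrow> nat \<Rightarrow> real ^ 'n ^ 'n \<Rightarrow> (nat \<Rightarrow> real ^ 'n ^ 'n) \<Rightarrow> real"
    where
  "c_h \<Psi> V T Xs X = max (infnorm (abs_mat V *v rho \<Psi> Xs))
     (Max ((\<lambda>t. infnorm (abs_mat V *v rho \<Psi> (X t))) ` {..<T}))"

end

theory Submission imports Defs begin

text \<open>The statement is a regret bound for mirror descent with a random gradient. Noise with a step size
  that is fixed in advance would be a matter of one martingale. Here the step size \<open>\<eta>\<close> is computed from
  \<open>c\<^sub>h\<close>, hence from the whole trajectory, so an iterate is not a function of the samples before it. The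
  proof therefore controls all step sizes at once.

  In log-odds coordinates every iterate is \<open>X\<^sub>t = f(H\<^sub>0 + \<Psi>\<^sup>T diag(k\<^sub>t) \<Psi>)\<close> with \<open>H\<^sub>0 = \<beta>(C - \<mu>I)\<close>, and
  both forms of the step read \<open>k\<^sub>t\<^sub>+\<^sub>1 = (1 - \<gamma>/\<beta>) k\<^sub>t + \<gamma> V r\<^sub>t\<close>, where \<open>r\<^sub>t\<close> is the density of the sampled
  state (\<open>prox_step_density\<close>, \<open>mirror_step_density\<close>). Since \<open>f(H)\<close> minimizes \<open>\<langle>H, X\<rangle> + S(X)\<close> with a gap
  that dominates the squared distance of the square roots (\<open>gibbs_gap\<close>), the divergences to the
  minimizer telescope (\<open>regret\<close>). The remaining loss of a step is either bounded by the sampled mass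
  (\<open>loss_crude\<close>) or split into centered noise, minus half of a curvature gap, plus a stability term
  that is quadratic in the sampled density (\<open>loss_refined\<close>). The curvature gap pays for the variance of
  the noise (\<open>weighted_force_le_gap\<close>). The traces of the iterates never exceed the initial one, because
  the sampled gradients are positive semidefinite (\<open>iterate_trace\<close>).

  For a deterministic step size the losses are sums of scores with bounded conditional exponential
  moments (\<open>total_score_exp\<close>, \<open>reaction_score_exp\<close>, \<open>noise_score_exp\<close>). Uniformity is obtained as
  follows. The potential \<open>|V| \<rho>\<close> is cut into dyadic cells, and in each cell the iterates are replaced
  by proxies: the minimizers of the same functionals over the states whose potential and trace respect
  the bounds of the cell. The proxies exist for every \<open>k\<close>, coincide with the iterates as long as these
  respect the bounds (\<open>path_eq_iterate\<close>), and satisfy a Lipschitz estimate that is weighted by their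
  own amplitudes (\<open>amplitude_lipschitz\<close>). Hence a change of the step size moves a proxy trajectory in
  \<open>L\<^sup>2\<close> at most at a geometric rate (\<open>amplitude_path_L2\<close>), and the expected total variation of
  \<open>exp (score)\<close> over the step sizes of a cell is finite (\<open>nn_integral_variation\<close>). At step size zero all
  cells share one trajectory, and the variations are summable over the cells, because a row of \<open>V\<close>
  matters only in the cells whose level is comparable to its diagonal entry (\<open>sum_crossover\<close>). Thus one
  application of Markov's inequality handles all step sizes in all cells (\<open>scores_uniform\<close>), and the
  price is a logarithm that the constants of the statement can pay (\<open>regret_high_probability\<close>).\<close>

section \<open>The spectral theorem for real symmetric matrices\<close>

lemma symmetric_inner_mult:
  fixes A :: "real^'n^'n"
  assumes "transpose A = A"
  shows "x \<bullet> (A *v y) = (A *v x) \<bullet> y"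
  by (metis assms dot_lmul_matrix transpose_matrix_vector)

text \<open>A maximizer of the Rayleigh quotient over the unit sphere of the subspace is an eigenvector: by
  the first-order condition \<open>A x\<close> has no component orthogonal to \<open>x\<close> within the subspace.\<close>

lemma symmetric_eigenvector_in_subspace:
  fixes A :: "real^'n^'n"
  assumes sym: "transpose A = A" and S: "subspace S" and inv: "\<And>x. x \<in> S \<Longrightarrow> A *v x \<in> S"
    and "S \<noteq> {0}"
  obtains x l where "x \<in> S" "norm x = 1" "A *v x = l *\<^sub>R x"
proof -
  let ?K = "S \<inter> sphere 0 1"
  have "compact ?K"
    using S by (simp add: closed_subspace closed_Int_compact)
  moreover obtain y where "y \<in> S" "y \<noteq> 0"
    using \<open>S \<noteq> {0}\<close> S subspace_0 by blast
  then have "(1 / norm y) *\<^sub>R y \<in> ?K"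
    using S by (auto simp: subspace_scale)
  then have "?K \<noteq> {}" by blast
  moreover have "continuous_on ?K (\<lambda>x. x \<bullet> (A *v x))"
    by (intro continuous_intros matrix_vector_mult_linear_continuous_on)
  ultimately obtain x where x: "x \<in> ?K" and mx: "\<And>y. y \<in> ?K \<Longrightarrow> y \<bullet> (A *v y) \<le> x \<bullet> (A *v x)"
    using continuous_attains_sup[of ?K "\<lambda>x. x \<bullet> (A *v x)"] by blast
  define l where "l = x \<bullet> (A *v x)"
  have xx: "x \<bullet> x = 1" and xS: "x \<in> S"
    using x by (auto simp: dot_square_norm)
  have ray: "v \<bullet> (A *v v) \<le> l * (v \<bullet> v)" if "v \<in> S" for v
  proof (cases "v = 0")
    case False
    have "((1 / norm v) *\<^sub>R v) \<bullet> (A *v ((1 / norm v) *\<^sub>R v)) \<le> l"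
      unfolding l_def using that S False by (intro mx) (auto simp: subspace_scale)
    then have "(v \<bullet> (A *v v)) / (norm v)\<^sup>2 \<le> l"
      by (simp add: matrix_vector_mult_scaleR power2_eq_square)
    then show ?thesis
      using False by (simp add: divide_le_eq dot_square_norm)
  qed auto
  (* first-order optimality of the Rayleigh quotient along x + t v *)
  have orth: "v \<bullet> (A *v x) = 0" if v: "v \<in> S" "x \<bullet> v = 0" for v
  proof -
    have vx: "v \<bullet> x = 0" and avx: "x \<bullet> (A *v v) = v \<bullet> (A *v x)"
      using v(2) symmetric_inner_mult[OF sym, of x v] by (simp_all add: inner_commute)
    have *: "2 * t * (v \<bullet> (A *v x)) \<le> t\<^sup>2 * (l * (v \<bullet> v) - v \<bullet> (A *v v))" for t
    proof -
      have "x + t *\<^sub>R v \<in> S" using xS v S by (simp add: subspace_add subspace_scale)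
      from ray[OF this] have "l + 2 * t * (v \<bullet> (A *v x)) + t\<^sup>2 * (v \<bullet> (A *v v)) \<le> l * (1 + t\<^sup>2 * (v \<bullet> v))"
        by (simp add: matrix_vector_right_distrib matrix_vector_mult_scaleR inner_add_left inner_add_right
            vx v(2) xx avx l_def[symmetric] power2_eq_square algebra_simps)
      then show ?thesis by (simp add: algebra_simps)
    qed
    let ?b = "v \<bullet> (A *v x)" and ?q = "\<bar>l * (v \<bullet> v) - v \<bullet> (A *v v)\<bar> + 1"
    have "2 * (?b / ?q) * ?b \<le> (?b / ?q)\<^sup>2 * (l * (v \<bullet> v) - v \<bullet> (A *v v))"
      by (rule *)
    also have "\<dots> \<le> (?b / ?q)\<^sup>2 * ?q"
      by (intro mult_left_mono) auto
    also have "\<dots> = (?b / ?q) * ?b"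
      by (simp add: power2_eq_square)
    finally have "?b * ?b / ?q \<le> 0" by simp
    moreover have "?q > 0" by simp
    ultimately have "?b * ?b \<le> 0" by (simp add: divide_le_0_iff)
    then show ?thesis
      by (metis mult_eq_0_iff order_antisym_conv zero_le_square)
  qed
  have "A *v x = l *\<^sub>R x"
  proof -
    let ?d = "A *v x - l *\<^sub>R x"
    have dS: "?d \<in> S" using inv xS S by (simp add: subspace_diff subspace_scale)
    have dx: "x \<bullet> ?d = 0" using xx by (simp add: inner_diff_right l_def)
    have "?d \<bullet> ?d = ?d \<bullet> (A *v x) - l * (x \<bullet> ?d)"
      by (subst inner_diff_right) (simp add: inner_commute[of x])
    also have "\<dots> = 0" using orth[OF dS dx] dx by simp
    finally show ?thesis by simp
  qed
  then show ?thesis using that x by auto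
qed

text \<open>Induction on the dimension. Symmetry makes the orthogonal complement of an eigenvector within an
  invariant subspace invariant again.\<close>

lemma symmetric_eigenbasis_of_subspace:
  fixes A :: "real^'n^'n"
  assumes sym: "transpose A = A"
  shows "subspace S \<Longrightarrow> (\<And>x. x \<in> S \<Longrightarrow> A *v x \<in> S) \<Longrightarrow> dim S = n \<Longrightarrow>
    \<exists>B. B \<subseteq> S \<and> finite B \<and> card B = n \<and> pairwise orthogonal B \<and>
        (\<forall>b\<in>B. norm b = 1 \<and> (\<exists>l. A *v b = l *\<^sub>R b))"
proof (induction n arbitrary: S)
  case 0
  show ?case by (rule exI[of _ "{}"]) auto
next
  case (Suc n)
  then have "S \<noteq> {0}" by auto
  then obtain x l where x: "x \<in> S" "norm x = 1" "A *v x = l *\<^sub>R x"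
    using symmetric_eigenvector_in_subspace[OF sym Suc.prems(1,2)] by metis
  define S' where "S' = {y \<in> S. \<forall>v\<in>span {x}. orthogonal v y}"
  have S'x: "orthogonal x y" if "y \<in> S'" for y
    using that by (simp add: S'_def span_base)
  have S'I: "y \<in> S'" if "y \<in> S" "x \<bullet> y = 0" for y
    using that by (auto simp: S'_def span_singleton orthogonal_def)
  have "subspace S'"
    using Suc.prems(1) unfolding S'_def subspace_def
    by (auto simp: orthogonal_def inner_right_distrib)
  moreover have "A *v y \<in> S'" if "y \<in> S'" for y
  proof (rule S'I)
    show "A *v y \<in> S" using that Suc.prems(2) by (simp add: S'_def)
    show "x \<bullet> (A *v y) = 0"
      using S'x[OF that] by (simp add: symmetric_inner_mult[OF sym] x(3) orthogonal_def)
  qed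
  moreover have "dim S' = n"
  proof -
    have "dim S' + dim (span {x}) = dim S"
      unfolding S'_def using Suc.prems(1) x(1)
      by (intro dim_subspace_orthogonal_to_vectors span_minimal) auto
    moreover have "dim (span {x}) = 1"
      using x(2) by (auto simp: dim_eq_card_independent)
    ultimately show ?thesis using Suc.prems(3) by simp
  qed
  ultimately obtain B where B: "B \<subseteq> S'" "finite B" "card B = n" "pairwise orthogonal B"
      "\<forall>b\<in>B. norm b = 1 \<and> (\<exists>l. A *v b = l *\<^sub>R b)"
    using Suc.IH by blast
  have "x \<notin> B" using B(1) S'x x(2) by (force simp: orthogonal_def)
  moreover have "insert x B \<subseteq> S" using B(1) x(1) by (auto simp: S'_def)
  moreover have "pairwise orthogonal (insert x B)"
    unfolding pairwise_insert using B(1,4) S'x orthogonal_commute by blast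
  ultimately show ?case
    using B(2,3,5) x(2,3) by (intro exI[of _ "insert x B"]) auto
qed

lemma symmetric_spectral_decomposition:
  fixes A :: "real^'n^'n"
  assumes sym: "transpose A = A"
  obtains Q d where "orthogonal_matrix Q" "A = Q ** diag_mat d ** transpose Q"
proof -
  obtain B :: "(real^'n) set" where B: "finite B" "card B = CARD('n)" "pairwise orthogonal B"
    "\<forall>b\<in>B. norm b = 1 \<and> (\<exists>l. A *v b = l *\<^sub>R b)"
    using symmetric_eigenbasis_of_subspace[OF sym, of UNIV "CARD('n)"] by auto
  then obtain h where h: "bij_betw h (UNIV :: 'n set) B"
    by (metis finite_same_card_bij finite)
  define Q :: "real^'n^'n" where "Q = (\<chi> i j. h j $ i)"
  have hB: "h i \<in> B" for i using h by (auto simp: bij_betw_def)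
  then have "\<forall>i. \<exists>l. A *v h i = l *\<^sub>R h i"
    using B(4) by blast
  then obtain d where d: "\<And>i. A *v h i = d i *\<^sub>R h i"
    using choice[of "\<lambda>i l. A *v h i = l *\<^sub>R h i"] by blast
  have on: "h i \<bullet> h j = (if i = j then 1 else 0)" for i j
  proof (cases "i = j")
    case True
    then show ?thesis using B(4) hB[of i] by (simp add: dot_square_norm)
  next
    case False
    then have "h i \<noteq> h j" using h by (auto simp: bij_betw_def inj_on_def)
    then show ?thesis using False B(3) hB by (auto simp: pairwise_def orthogonal_def)
  qed
  have QQ: "transpose Q ** Q = mat 1"
    using on by (auto simp: vec_eq_iff matrix_matrix_mult_def transpose_def Q_def mat_def inner_vec_def)
  then have oQ: "orthogonal_matrix Q" by (simp add: orthogonal_matrix)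
  have dr: "(N ** diag_mat v) $ i $ j = N $ i $ j * v $ j" for N :: "real ^ 'n ^ 'n" and v i j
    by (simp add: matrix_matrix_mult_def diag_mat_def if_distrib [of "\<lambda>x. _ * x"] cong: if_cong)
  have "A ** Q = Q ** diag_mat (\<chi> i. d i)"
  proof -
    have "(A ** Q) $ i $ j = (A *v h j) $ i" for i j
      by (simp add: matrix_matrix_mult_def matrix_vector_mult_def Q_def)
    then show ?thesis by (simp add: vec_eq_iff dr d Q_def)
  qed
  then have "A = Q ** diag_mat (\<chi> i. d i) ** transpose Q"
    by (metis matrix_mul_assoc matrix_mul_rid oQ orthogonal_matrix_def)
  then show ?thesis using that oQ by blast
qed


section \<open>Calculus of matrix functions\<close>

lemma inner_matrix_eq_trace:
  fixes A B :: "real^'n^'m"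
  shows "A \<bullet> B = trace (transpose A ** B)"
proof -
  have "trace (transpose A ** B) = (\<Sum>i\<in>UNIV. \<Sum>k\<in>UNIV. A $ k $ i * B $ k $ i)"
    by (simp add: trace_def matrix_matrix_mult_def transpose_def)
  also have "\<dots> = A \<bullet> B" by (subst sum.swap) (simp add: inner_vec_def)
  finally show ?thesis by simp
qed

lemma diag_mat_mult_diag_mat:
  "diag_mat a ** diag_mat b = diag_mat (\<chi> i. a $ i * b $ i)"
  by (auto simp: vec_eq_iff matrix_matrix_mult_def diag_mat_def if_distrib[of "\<lambda>x. x * _"]
      cong: if_cong)

lemma transpose_diag_mat [simp]: "transpose (diag_mat a) = diag_mat a"
  by (auto simp: vec_eq_iff transpose_def diag_mat_def)

lemma diag_mat_one: "diag_mat (\<chi> i. 1) = mat 1"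
  by (auto simp: vec_eq_iff diag_mat_def mat_def)

lemma diag_mat_add: "diag_mat a + diag_mat b = diag_mat (\<chi> i. a $ i + b $ i)"
  by (auto simp: vec_eq_iff diag_mat_def)

lemma diag_mat_scaleR: "c *\<^sub>R diag_mat a = diag_mat (\<chi> i. c * a $ i)"
  by (auto simp: vec_eq_iff diag_mat_def)

lemma diag_mat_entry_left: "(diag_mat v ** N) $ i $ j = v $ i * N $ i $ j"
  for N :: "real^'n^'m"
  by (simp add: matrix_matrix_mult_def diag_mat_def if_distrib [of "\<lambda>x. x * _"] cong: if_cong)

lemma matrix_scaleR_left: "(c *\<^sub>R A) ** B = c *\<^sub>R (A ** B)" for A :: "real^'n^'m"
  by (simp add: vec_eq_iff matrix_matrix_mult_def sum_distrib_left mult.assoc)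

lemma matrix_scaleR_right: "A ** (c *\<^sub>R B) = c *\<^sub>R (A ** B)" for A :: "real^'n^'m"
  by (simp add: vec_eq_iff matrix_matrix_mult_def sum_distrib_left algebra_simps)

lemma transpose_scaleR: "transpose (c *\<^sub>R A) = c *\<^sub>R transpose A" for A :: "real^'n^'m"
  by (simp add: vec_eq_iff transpose_def)

lemma transpose_add: "transpose (A + B) = transpose A + transpose B" for A B :: "real^'n^'m"
  by (simp add: vec_eq_iff transpose_def)

lemma transpose_diff: "transpose (A - B) = transpose A - transpose B" for A B :: "real^'n^'m"
  by (simp add: vec_eq_iff transpose_def)

lemma trace_eq_inner_mat_one: "trace A = mat 1 \<bullet> A" for A :: "real^'n^'n"
  by (simp add: inner_matrix_eq_trace)

locale spectral_decomp =
  fixes A Q :: "real^'n^'n" and d :: "real^'n"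
  assumes orth: "orthogonal_matrix Q" and decomp: "A = Q ** diag_mat d ** transpose Q"
begin

lemma QQ: "transpose Q ** Q = mat 1" "Q ** transpose Q = mat 1"
  using orth by (auto simp: orthogonal_matrix_def)

lemma mat_fun: "mat_fun f A = Q ** diag_mat (\<chi> i. f (d $ i)) ** transpose Q"
  by (rule mat_fun_eq[OF orth decomp])

lemma transpose_conj: "transpose (Q ** diag_mat a ** transpose Q) = Q ** diag_mat a ** transpose Q"
  by (simp add: matrix_transpose_mul matrix_mul_assoc)

lemma conj_mult: "(Q ** diag_mat a ** transpose Q) ** (Q ** diag_mat b ** transpose Q)
    = Q ** diag_mat (\<chi> i. a $ i * b $ i) ** transpose Q"
proof -
  have "(Q ** diag_mat a ** transpose Q) ** (Q ** diag_mat b ** transpose Q)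
      = Q ** diag_mat a ** (transpose Q ** Q) ** diag_mat b ** transpose Q"
    by (simp add: matrix_mul_assoc)
  also have "\<dots> = Q ** (diag_mat a ** diag_mat b) ** transpose Q"
    by (simp add: QQ matrix_mul_assoc)
  finally show ?thesis by (simp add: diag_mat_mult_diag_mat)
qed

lemma conj_add: "(Q ** diag_mat a ** transpose Q) + (Q ** diag_mat b ** transpose Q)
    = Q ** diag_mat (\<chi> i. a $ i + b $ i) ** transpose Q"
proof -
  have "(M + N) ** K = M ** K + N ** K" for M N K :: "real^'n^'n"
    by (simp add: vec_eq_iff matrix_matrix_mult_def sum.distrib algebra_simps)
  then show ?thesis by (simp add: matrix_add_ldistrib flip: diag_mat_add)
qed

lemma conj_scaleR: "c *\<^sub>R (Q ** diag_mat a ** transpose Q)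
    = Q ** diag_mat (\<chi> i. c * a $ i) ** transpose Q"
  by (simp add: matrix_scaleR_left matrix_scaleR_right flip: diag_mat_scaleR)

lemma conj_one: "Q ** diag_mat (\<chi> i. 1) ** transpose Q = mat 1"
  by (simp add: diag_mat_one QQ)

lemma eigenvector: "A *v column i Q = (d $ i) *\<^sub>R column i Q"
proof -
  have "A ** Q = Q ** diag_mat d"
    unfolding decomp by (metis QQ(1) matrix_mul_assoc matrix_mul_rid)
  moreover have "(A ** Q) $ k $ i = (A *v column i Q) $ k" for k
    by (simp add: matrix_matrix_mult_def matrix_vector_mult_def column_def)
  moreover have "(Q ** diag_mat d) $ k $ i = Q $ k $ i * d $ i" for k
    by (simp add: matrix_matrix_mult_def diag_mat_def if_distrib [of "\<lambda>x. _ * x"] cong: if_cong)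
  ultimately have "(A *v column i Q) $ k = Q $ k $ i * d $ i" for k by metis
  then show ?thesis by (simp add: vec_eq_iff column_def)
qed

lemma norm_column: "norm (column i Q) = 1"
  using orth by (auto simp: orthogonal_matrix_orthonormal_columns)

end

lemma spectral_decompE:
  fixes A :: "real^'n^'n"
  assumes "transpose A = A"
  obtains Q d where "spectral_decomp A Q d"
  using symmetric_spectral_decomposition[OF assms] by (metis spectral_decomp_def)

lemma transpose_mat_fun [simp]: "transpose A = A \<Longrightarrow> transpose (mat_fun f A) = mat_fun f A"
  by (erule spectral_decompE) (simp add: spectral_decomp.mat_fun spectral_decomp.transpose_conj)

lemma mat_fun_id: "transpose A = A \<Longrightarrow> mat_fun (\<lambda>x. x) A = A"
  by (erule spectral_decompE) (simp add: spectral_decomp.mat_fun flip: spectral_decomp.decomp)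

lemma mat_fun_const_one: "transpose A = A \<Longrightarrow> mat_fun (\<lambda>x. 1) A = mat 1"
  by (erule spectral_decompE) (simp add: spectral_decomp.mat_fun spectral_decomp.conj_one)

lemma mat_fun_add: "transpose A = A \<Longrightarrow> mat_fun f A + mat_fun g A = mat_fun (\<lambda>x. f x + g x) A"
  by (erule spectral_decompE) (simp add: spectral_decomp.mat_fun spectral_decomp.conj_add)

lemma mat_fun_scaleR: "transpose A = A \<Longrightarrow> c *\<^sub>R mat_fun f A = mat_fun (\<lambda>x. c * f x) A"
  by (erule spectral_decompE) (simp add: spectral_decomp.mat_fun spectral_decomp.conj_scaleR)

lemma mat_fun_mult: "transpose A = A \<Longrightarrow> mat_fun f A ** mat_fun g A = mat_fun (\<lambda>x. f x * g x) A"
  by (erule spectral_decompE) (simp add: spectral_decomp.mat_fun spectral_decomp.conj_mult)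

lemma mat_fun_compose:
  assumes "transpose A = A"
  shows "mat_fun g (mat_fun f A) = mat_fun (\<lambda>x. g (f x)) A"
proof -
  obtain Q d where "spectral_decomp A Q d" using spectral_decompE[OF assms] .
  then interpret spectral_decomp A Q d .
  show ?thesis
    using mat_fun_eq[OF orth mat_fun, of g f] by (simp add: mat_fun)
qed

lemma mat_fun_diff: "transpose A = A \<Longrightarrow> mat_fun f A - mat_fun g A = mat_fun (\<lambda>x. f x - g x) A"
proof -
  assume A: "transpose A = A"
  have "mat_fun f A - mat_fun g A = mat_fun f A + (-1) *\<^sub>R mat_fun g A" by simp
  then show ?thesis by (simp only: mat_fun_scaleR[OF A] mat_fun_add[OF A]) simp
qed

lemma mat_fun_one_minus:
  assumes "transpose A = A"
  shows "mat_fun f (mat 1 - A) = mat_fun (\<lambda>x. f (1 - x)) A"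
proof -
  have "mat 1 - A = mat_fun (\<lambda>x. 1 - x) A"
    using mat_fun_diff[OF assms, of "\<lambda>x. 1" "\<lambda>x. x"] by (simp add: mat_fun_id mat_fun_const_one assms)
  then show ?thesis by (simp add: mat_fun_compose assms)
qed

definition is_eigenvalue :: "real^'n^'n \<Rightarrow> real \<Rightarrow> bool" where
  "is_eigenvalue A l \<longleftrightarrow> (\<exists>x. norm x = 1 \<and> A *v x = l *\<^sub>R x)"

lemma (in spectral_decomp) is_eigenvalue: "is_eigenvalue A (d $ i)"
  using eigenvector norm_column is_eigenvalue_def by blast

lemma mat_fun_cong:
  assumes "transpose A = A" "\<And>l. is_eigenvalue A l \<Longrightarrow> f l = g l"
  shows "mat_fun f A = mat_fun g A"
proof -
  obtain Q d where "spectral_decomp A Q d" using spectral_decompE[OF assms(1)] .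
  then interpret spectral_decomp A Q d .
  show ?thesis unfolding mat_fun using assms(2)[OF is_eigenvalue] by simp
qed

lemma eigenvalue_rayleigh:
  assumes "is_eigenvalue A l"
  obtains x where "norm x = 1" "x \<bullet> (A *v x) = l" "A *v x = l *\<^sub>R x"
  using assms by (auto simp: is_eigenvalue_def dot_square_norm)

lemma pos_semidef_eigenvalue: "pos_semidef A \<Longrightarrow> is_eigenvalue A l \<Longrightarrow> 0 \<le> l"
  by (erule eigenvalue_rayleigh) (metis pos_semidef_def)

lemma pos_def_eigenvalue: "pos_def A \<Longrightarrow> is_eigenvalue A l \<Longrightarrow> 0 < l"
  by (erule eigenvalue_rayleigh) (metis pos_def_def norm_zero zero_neq_one)

lemma eigenvalue_one_minus: "is_eigenvalue A l \<Longrightarrow> is_eigenvalue (mat 1 - A) (1 - l)"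
  unfolding is_eigenvalue_def by (auto simp: matrix_vector_mult_diff_rdistrib scaleR_diff_left)

lemma feasible_eigenvalue: "X \<in> feasible \<Longrightarrow> is_eigenvalue X l \<Longrightarrow> 0 \<le> l \<and> l \<le> 1"
  using eigenvalue_one_minus pos_semidef_eigenvalue by (fastforce simp: feasible_def)

text \<open>Two symmetric matrices are compared through the squared overlaps of their eigenbases. These
  overlaps form a doubly stochastic matrix \<open>w\<close>, so every scalar inequality between the eigenvalues
  transfers to an inequality between inner products of matrix functions (Klein's inequality).\<close>

locale overlap =
  fixes A B :: "real^'n^'n" and a b :: "'n \<Rightarrow> real" and w :: "'n \<Rightarrow> 'n \<Rightarrow> real"
  assumes w: "0 \<le> w i j" and row: "(\<Sum>j\<in>UNIV. w i j) = 1" and col: "(\<Sum>i\<in>UNIV. w i j) = 1"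
    and AB: "mat_fun f A \<bullet> mat_fun g B = (\<Sum>i\<in>UNIV. \<Sum>j\<in>UNIV. w i j * (f (a i) * g (b j)))"
    and AA: "mat_fun f A \<bullet> mat_fun g A = (\<Sum>i\<in>UNIV. \<Sum>j\<in>UNIV. w i j * (f (a i) * g (a i)))"
    and BB: "mat_fun f B \<bullet> mat_fun g B = (\<Sum>i\<in>UNIV. \<Sum>j\<in>UNIV. w i j * (f (b j) * g (b j)))"
    and eigA: "is_eigenvalue A (a i)" and eigB: "is_eigenvalue B (b i)"
begin

lemma norm_diff: "(norm (mat_fun f A - mat_fun g B))\<^sup>2
    = (\<Sum>i\<in>UNIV. \<Sum>j\<in>UNIV. w i j * (f (a i) - g (b j))\<^sup>2)"
proof -
  have "(norm (mat_fun f A - mat_fun g B))\<^sup>2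
      = mat_fun f A \<bullet> mat_fun f A - 2 * (mat_fun f A \<bullet> mat_fun g B) + mat_fun g B \<bullet> mat_fun g B"
    by (simp add: power2_norm_eq_inner inner_diff_left inner_diff_right inner_commute)
  then show ?thesis
    unfolding AB AA BB
    by (simp add: power2_eq_square algebra_simps sum.distrib sum_subtractf sum_distrib_left)
qed

end

lemma overlapE:
  fixes A B :: "real^'n^'n"
  assumes "transpose A = A" "transpose B = B"
  obtains a b w where "overlap A B a b w"
proof -
  obtain Q d where "spectral_decomp A Q d" using spectral_decompE[OF assms(1)] .
  then interpret A: spectral_decomp A Q d .
  obtain P e where "spectral_decomp B P e" using spectral_decompE[OF assms(2)] .
  then interpret B: spectral_decomp B P e .
  define W where "W = transpose Q ** P"
  have pair: "(R1 ** diag_mat x ** transpose R1) \<bullet> (R2 ** diag_mat y ** transpose R2)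
     = (\<Sum>i\<in>UNIV. \<Sum>j\<in>UNIV. ((transpose R1 ** R2) $ i $ j)\<^sup>2 * (x $ i * y $ j))"
    for R1 R2 :: "real^'n^'n" and x y
  proof -
    let ?W = "transpose R1 ** R2"
    have "(R1 ** diag_mat x ** transpose R1) \<bullet> (R2 ** diag_mat y ** transpose R2)
        = trace (R1 ** (diag_mat x ** ?W ** diag_mat y ** transpose R2))"
      by (simp add: inner_matrix_eq_trace matrix_transpose_mul matrix_mul_assoc)
    also have "\<dots> = trace (diag_mat x ** (?W ** (diag_mat y ** transpose ?W)))"
      by (subst trace_mul_sym) (simp add: matrix_transpose_mul matrix_mul_assoc)
    also have "\<dots> = (\<Sum>i\<in>UNIV. x $ i * (\<Sum>j\<in>UNIV. ?W $ i $ j * (y $ j * ?W $ i $ j)))"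
      unfolding trace_def diag_mat_entry_left
      by (simp add: matrix_matrix_mult_def[of "?W"] diag_mat_entry_left) (simp add: transpose_def)
    finally show ?thesis
      by (simp add: sum_distrib_left power2_eq_square algebra_simps)
  qed
  have oW: "W ** transpose W = mat 1" "transpose W ** W = mat 1"
  proof -
    have "W ** transpose W = transpose Q ** (P ** transpose P) ** Q"
      by (simp add: W_def matrix_transpose_mul matrix_mul_assoc)
    then show "W ** transpose W = mat 1" by (simp add: A.QQ B.QQ)
    then show "transpose W ** W = mat 1" by (simp add: matrix_left_right_inverse)
  qed
  have row: "(\<Sum>j\<in>UNIV. (W $ i $ j)\<^sup>2) = 1" for i
      using arg_cong[OF oW(1), of "\<lambda>M. M $ i $ i"]
      by (simp add: matrix_matrix_mult_def transpose_def mat_def power2_eq_square)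
  have col: "(\<Sum>i\<in>UNIV. (W $ i $ j)\<^sup>2) = 1" for j
      using arg_cong[OF oW(2), of "\<lambda>M. M $ j $ j"]
      by (simp add: matrix_matrix_mult_def transpose_def mat_def power2_eq_square)
  have diag: "(\<Sum>i\<in>UNIV. \<Sum>j\<in>UNIV. ((mat 1 :: real^'n^'n) $ i $ j)\<^sup>2 * (x i * y j))
      = (\<Sum>i\<in>UNIV. x i * y i)" for x y :: "'n \<Rightarrow> real"
    by (simp add: mat_def if_distrib[of "\<lambda>x. x * _"] if_distrib[of "\<lambda>x. x ^ _"] cong: if_cong)
  have "overlap A B (\<lambda>i. d $ i) (\<lambda>i. e $ i) (\<lambda>i j. (W $ i $ j)\<^sup>2)"
  proof
    show "mat_fun f A \<bullet> mat_fun g B = (\<Sum>i\<in>UNIV. \<Sum>j\<in>UNIV. (W $ i $ j)\<^sup>2 * (f (d $ i) * g (e $ j)))" for f g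
      unfolding A.mat_fun B.mat_fun pair W_def by simp
    show "mat_fun f A \<bullet> mat_fun g A = (\<Sum>i\<in>UNIV. \<Sum>j\<in>UNIV. (W $ i $ j)\<^sup>2 * (f (d $ i) * g (d $ i)))" for f g
      unfolding A.mat_fun pair A.QQ diag sum_distrib_right[symmetric] row by simp
    show "mat_fun f B \<bullet> mat_fun g B = (\<Sum>i\<in>UNIV. \<Sum>j\<in>UNIV. (W $ i $ j)\<^sup>2 * (f (e $ j) * g (e $ j)))" for f g
      unfolding B.mat_fun pair B.QQ diag
      by (subst sum.swap) (simp add: sum_distrib_right[symmetric] col)
  qed (auto intro: A.is_eigenvalue B.is_eigenvalue row col)
  then show ?thesis by (rule that)
qed


section \<open>Entropy and the Gibbs variational principle\<close>

definition entropy :: "real \<Rightarrow> real" where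
  "entropy x = x * ln x + (1 - x) * ln (1 - x)"

abbreviation msqrt :: "real^'n^'n \<Rightarrow> real^'n^'n" where
  "msqrt X \<equiv> mat_fun sqrt X"

lemma xlnx_continuous: "continuous_on {0..1} (\<lambda>x::real. x * ln x)"
proof (rule continuous_on_eq_continuous_within[THEN iffD2], rule ballI)
  fix x :: real assume x: "x \<in> {0..1}"
  show "continuous (at x within {0..1}) (\<lambda>x. x * ln x)"
  proof (cases "x = 0")
    case False
    then show ?thesis using x by (auto intro!: continuous_intros)
  next
    case True
    have b: "\<bar>y * ln y\<bar> \<le> 2 * sqrt y" if "y \<in> {0..1}" for y :: real
    proof (cases "y = 0")
      case False
      then have y: "0 < y" "y \<le> 1" using that by auto
      have "ln (1 / sqrt y) \<le> 1 / sqrt y - 1" using y by (intro ln_le_minus_one) auto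
      then have "- ln y \<le> 2 * (1 / sqrt y)" using y by (simp add: ln_div ln_sqrt)
      then have "y * - ln y \<le> y * (2 * (1 / sqrt y))" using y by (intro mult_left_mono) auto
      also have "\<dots> = 2 * sqrt y" using y by (simp add: field_simps)
      finally show ?thesis using y by (simp add: abs_mult abs_of_nonpos)
    qed auto
    have lim: "((\<lambda>y. 2 * sqrt y) \<longlongrightarrow> 0) (at 0 within {0..1::real})"
      by (intro tendsto_eq_intros) auto
    have "\<forall>\<^sub>F y in at 0 within {0..1::real}. norm (y * ln y) \<le> 2 * sqrt y"
      unfolding eventually_at_filter using b by (intro always_eventually) auto
    then have "((\<lambda>y. y * ln y) \<longlongrightarrow> 0) (at 0 within {0..1::real})"
      using lim by (rule Lim_null_comparison)
    then show ?thesis using True by (simp add: continuous_within)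
  qed
qed

lemma entropy_continuous: "continuous_on {0..1} entropy"
proof -
  have "continuous_on {0..1} (\<lambda>x::real. (1 - x) * ln (1 - x))"
    by (rule continuous_on_compose2[OF xlnx_continuous]) (auto intro!: continuous_intros)
  then show ?thesis unfolding entropy_def[abs_def] by (intro continuous_on_add xlnx_continuous)
qed

text \<open>A binary relative entropy dominates the squared distance of the square roots, by the tangent
  inequality for \<open>ln\<close> at \<open>sqrt m / sqrt x\<close>. The conditions on \<open>m = 0\<close> and \<open>m = 1\<close> exclude the cases of
  infinite relative entropy, which the convention \<open>ln 0 = 0\<close> would hide.\<close>

lemma entropy_gap_scalar:
  fixes x m :: real
  assumes "0 \<le> x" "x \<le> 1" "0 \<le> m" "m \<le> 1" "m = 0 \<Longrightarrow> x = 0" "m = 1 \<Longrightarrow> x = 1"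
  shows "(sqrt x - sqrt m)\<^sup>2 \<le> entropy x - entropy m - (ln m - ln (1 - m)) * (x - m)"
proof (cases "m = 0 \<or> m = 1")
  case True
  then show ?thesis using assms by (auto simp: entropy_def)
next
  case False
  then have m: "0 < m" "m < 1" using assms by auto
  have kl: "2 * x - 2 * sqrt x * sqrt m \<le> x * ln x - x * ln m"
  proof (cases "x = 0")
    case False
    then have x: "0 < x" using assms by auto
    have "ln (sqrt m / sqrt x) \<le> sqrt m / sqrt x - 1" using x m by (intro ln_le_minus_one) auto
    then have "ln m - ln x \<le> 2 * (sqrt m / sqrt x) - 2" using x m by (simp add: ln_div ln_sqrt)
    then have "x * (ln m - ln x) \<le> x * (2 * (sqrt m / sqrt x) - 2)" using x by (intro mult_left_mono) auto
    also have "\<dots> = 2 * (x / sqrt x * sqrt m) - 2 * x" by (simp add: algebra_simps)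
    also have "x / sqrt x = sqrt x" using x by (simp add: real_div_sqrt)
    finally show ?thesis by (simp add: algebra_simps)
  qed simp
  have kl': "x' - m' \<le> x' * ln x' - x' * ln m'" if "0 \<le> x'" "0 < m'" for x' m' :: real
  proof (cases "x' = 0")
    case False
    then have x: "0 < x'" using that by auto
    have "ln (m' / x') \<le> m' / x' - 1" using x that by (intro ln_le_minus_one) auto
    then have "x' * (ln m' - ln x') \<le> x' * (m' / x' - 1)"
      using x that by (intro mult_left_mono) (auto simp: ln_div)
    also have "\<dots> = m' - x'" using x by (simp add: algebra_simps)
    finally show ?thesis by (simp add: algebra_simps)
  qed (use that in simp)
  have "(1 - x) - (1 - m) \<le> (1 - x) * ln (1 - x) - (1 - x) * ln (1 - m)"
    using assms m by (intro kl') auto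
  moreover have "(sqrt x - sqrt m)\<^sup>2 = x + m - 2 * sqrt x * sqrt m"
    using assms by (simp add: power2_diff)
  ultimately show ?thesis using kl by (simp add: entropy_def algebra_simps)
qed

lemma feasible_symmetric: "X \<in> feasible \<Longrightarrow> transpose X = X"
  by (simp add: feasible_def pos_semidef_def)

lemma feasible_pos_semidef: "X \<in> feasible \<Longrightarrow> pos_semidef X"
  by (simp add: feasible_def)

lemma feasible_convex:
  assumes "X \<in> feasible" "Y \<in> feasible" "0 \<le> s" "s \<le> 1"
  shows "(1 - s) *\<^sub>R X + s *\<^sub>R Y \<in> feasible"
proof -
  have psd: "pos_semidef (a *\<^sub>R A + b *\<^sub>R B)" if "pos_semidef A" "pos_semidef B" "0 \<le> a" "0 \<le> b" for A B a b
    using that by (auto simp: pos_semidef_def transpose_add transpose_scaleR matrix_vector_mult_add_rdistrib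
        scaleR_matrix_vector_assoc[symmetric] inner_add_right)
  have "mat 1 - ((1 - s) *\<^sub>R X + s *\<^sub>R Y) = (1 - s) *\<^sub>R (mat 1 - X) + s *\<^sub>R (mat 1 - Y)"
    by (simp add: algebra_simps)
  then show ?thesis using assms psd[of X Y "1 - s" s] psd[of "mat 1 - X" "mat 1 - Y" "1 - s" s]
    by (simp add: feasible_def)
qed

lemma mat_fun_pos_semidef:
  assumes A: "transpose A = A" and f: "\<And>l. is_eigenvalue A l \<Longrightarrow> 0 \<le> f l"
  shows "pos_semidef (mat_fun f A)"
proof -
  let ?R = "mat_fun (\<lambda>x. sqrt (f x)) A"
  have "mat_fun f A = ?R ** ?R"
    unfolding mat_fun_mult[OF A] using f by (intro mat_fun_cong[OF A]) auto
  moreover have "x \<bullet> ((?R ** ?R) *v x) = (?R *v x) \<bullet> (?R *v x)" for x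
    by (simp add: symmetric_inner_mult A flip: matrix_vector_mul_assoc)
  ultimately show ?thesis using A unfolding pos_semidef_def
    by (metis inner_ge_zero transpose_mat_fun)
qed

lemma mat_fun_feasible:
  assumes A: "transpose A = A" and "\<And>l. is_eigenvalue A l \<Longrightarrow> 0 \<le> f l \<and> f l \<le> 1"
  shows "mat_fun f A \<in> feasible"
proof -
  have "mat 1 - mat_fun f A = mat_fun (\<lambda>x. 1 - f x) A"
    using mat_fun_diff[OF A, of "\<lambda>x. 1" f] by (simp add: mat_fun_const_one A)
  then show ?thesis using assms by (simp add: feasible_def mat_fun_pos_semidef)
qed

lemma pos_semidef_inner_nonneg:
  assumes "pos_semidef A" "pos_semidef B"
  shows "0 \<le> A \<bullet> B"
proof -
  have sAB: "transpose A = A" "transpose B = B" using assms by (auto simp: pos_semidef_def)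
  obtain a b w where "overlap A B a b w" by (rule overlapE[OF sAB])
  then interpret overlap A B a b w .
  have "A \<bullet> B = (\<Sum>i\<in>UNIV. \<Sum>j\<in>UNIV. w i j * (a i * b j))"
    using AB[of "\<lambda>x. x" "\<lambda>x. x"] by (simp only: mat_fun_id sAB)
  also have "\<dots> \<ge> 0"
    using w eigA eigB assms pos_semidef_eigenvalue by (intro sum_nonneg mult_nonneg_nonneg) blast+
  finally show ?thesis .
qed

lemma S_FD_eq: "transpose X = X \<Longrightarrow> S_FD X = mat 1 \<bullet> mat_fun entropy X"
proof -
  assume X: "transpose X = X"
  have "S_FD X = mat 1 \<bullet> (mat_fun (\<lambda>x. x * ln x) X + mat_fun (\<lambda>x. (1 - x) * ln (1 - x)) X)"
    by (simp add: S_FD_def trace_eq_inner_mat_one mat_fun_one_minus[OF X] inner_add_right)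
  then show ?thesis by (simp add: mat_fun_add[OF X] entropy_def[abs_def])
qed

lemma double_sum_zeroD:
  fixes h :: "'i::finite \<Rightarrow> 'j::finite \<Rightarrow> real"
  assumes "(\<Sum>i\<in>UNIV. \<Sum>j\<in>UNIV. h i j) = 0" "\<And>i j. 0 \<le> h i j"
  shows "h i j = 0"
proof -
  have "(\<Sum>j\<in>UNIV. h i j) = 0"
    using assms sum_nonneg_eq_0_iff[of UNIV "\<lambda>i. \<Sum>j\<in>UNIV. h i j"] by (simp add: sum_nonneg)
  then show ?thesis using assms(2) sum_nonneg_eq_0_iff[of UNIV "\<lambda>j. h i j"] by simp
qed

text \<open>Klein's inequality lifts the scalar estimate. The two kernel conditions say that \<open>X\<close> vanishes on
  the kernel of \<open>M\<close> and is the identity on the kernel of \<open>mat 1 - M\<close>.\<close>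

lemma entropy_gap:
  fixes X M :: "real^'n^'n"
  assumes X: "X \<in> feasible" and M: "M \<in> feasible"
    and ker0: "X \<bullet> mat_fun (\<lambda>x. if x = 0 then 1 else 0) M = 0"
    and ker1: "(mat 1 - X) \<bullet> mat_fun (\<lambda>x. if x = 1 then 1 else 0) M = 0"
  shows "(norm (msqrt X - msqrt M))\<^sup>2 \<le> S_FD X - S_FD M - mat_fun (\<lambda>x. ln x - ln (1 - x)) M \<bullet> (X - M)"
proof -
  have s: "transpose X = X" "transpose M = M" using X M by (auto simp: feasible_symmetric)
  obtain a b w where "overlap X M a b w" by (rule overlapE[OF s])
  then interpret overlap X M a b w .
  have ab: "0 \<le> a i \<and> a i \<le> 1" "0 \<le> b i \<and> b i \<le> 1" for i
    using eigA eigB X M feasible_eigenvalue by blast+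
  have "(\<Sum>i\<in>UNIV. \<Sum>j\<in>UNIV. w i j * (a i * (if b j = 0 then 1 else 0))) = 0"
    using ker0 AB[of "\<lambda>x. x" "\<lambda>x. if x = 0 then 1 else 0"] by (simp only: mat_fun_id s)
  then have k0: "b j = 0 \<Longrightarrow> w i j \<noteq> 0 \<Longrightarrow> a i = 0" for i j
    using double_sum_zeroD[of "\<lambda>i j. w i j * (a i * (if b j = 0 then 1 else 0))" i j] w ab by simp
  have "(\<Sum>i\<in>UNIV. \<Sum>j\<in>UNIV. w i j * ((1 - a i) * (if b j = 1 then 1 else 0))) = 0"
    using ker1 AB[of "\<lambda>x. 1 - x" "\<lambda>x. if x = 1 then 1 else 0"]
    by (simp only: mat_fun_one_minus[OF s(1), of "\<lambda>x. x", symmetric]) (simp only: mat_fun_id s transpose_diff transpose_mat)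
  then have k1: "b j = 1 \<Longrightarrow> w i j \<noteq> 0 \<Longrightarrow> a i = 1" for i j
    using double_sum_zeroD[of "\<lambda>i j. w i j * ((1 - a i) * (if b j = 1 then 1 else 0))" i j] w ab by simp
  let ?g = "\<lambda>x. ln x - ln (1 - x :: real)"
  have "(norm (msqrt X - msqrt M))\<^sup>2 = (\<Sum>i\<in>UNIV. \<Sum>j\<in>UNIV. w i j * (sqrt (a i) - sqrt (b j))\<^sup>2)"
    by (rule norm_diff)
  also have "\<dots> \<le> (\<Sum>i\<in>UNIV. \<Sum>j\<in>UNIV. w i j * (entropy (a i) - entropy (b j) - ?g (b j) * (a i - b j)))"
  proof (intro sum_mono)
    fix i j
    show "w i j * (sqrt (a i) - sqrt (b j))\<^sup>2 \<le> w i j * (entropy (a i) - entropy (b j) - ?g (b j) * (a i - b j))"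
    proof (cases "w i j = 0")
      case False
      then show ?thesis using ab[of i] ab(2)[of j] w k0[of j i] k1[of j i]
        by (intro mult_left_mono entropy_gap_scalar) auto
    qed simp
  qed
  also have "\<dots> = mat_fun entropy X \<bullet> mat_fun (\<lambda>x. 1) X - mat_fun entropy M \<bullet> mat_fun (\<lambda>x. 1) M
      - (mat_fun (\<lambda>x. x) X \<bullet> mat_fun ?g M - mat_fun (\<lambda>x. x) M \<bullet> mat_fun ?g M)"
    unfolding AB AA BB by (simp add: algebra_simps sum.distrib sum_subtractf)
  also have "\<dots> = S_FD X - S_FD M - mat_fun ?g M \<bullet> (X - M)"
    by (simp add: S_FD_eq s mat_fun_const_one mat_fun_id inner_commute[of "mat_fun ?g M"]
        inner_commute[of "mat 1"] inner_diff_left)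
  finally show ?thesis .
qed

text \<open>The relative entropies of \<open>X\<close> and \<open>Y\<close> with respect to their convex combination \<open>M\<close> are compared; the
  terms linear in \<open>X - M\<close> and \<open>Y - M\<close> cancel. The kernel conditions hold since a vector in the kernel
  of \<open>M\<close> is in the kernels of both \<open>X\<close> and \<open>Y\<close>.\<close>

lemma entropy_strongly_convex:
  fixes X Y :: "real^'n^'n"
  assumes X: "X \<in> feasible" and Y: "Y \<in> feasible" and s: "0 < s" "s < 1"
  shows "S_FD ((1 - s) *\<^sub>R X + s *\<^sub>R Y)
    \<le> (1 - s) * S_FD X + s * S_FD Y - s * (1 - s) * (norm (msqrt X - msqrt Y))\<^sup>2"
proof -
  define M where "M = (1 - s) *\<^sub>R X + s *\<^sub>R Y"
  have M: "M \<in> feasible" unfolding M_def using assms by (intro feasible_convex) auto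
  note sM = feasible_symmetric[OF M]
  let ?P = "\<lambda>c. mat_fun (\<lambda>x. if x = c then 1 else 0) M"
  have P: "pos_semidef (?P c)" for c by (intro mat_fun_pos_semidef sM) auto
  have MP: "mat_fun f M \<bullet> ?P c = 0" if "f c = 0" for f c
  proof -
    have "mat_fun f M \<bullet> ?P c = mat 1 \<bullet> (mat_fun f M ** ?P c)"
      by (simp add: inner_matrix_eq_trace sM)
    also have "mat_fun f M ** ?P c = mat_fun (\<lambda>x. 0 * 1) M"
      unfolding mat_fun_mult[OF sM] using that by (intro mat_fun_cong sM) auto
    also have "\<dots> = 0" by (simp only: mat_fun_scaleR[OF sM, symmetric]) simp
    finally show ?thesis by simp
  qed
  have split: "A \<bullet> P0 = 0 \<and> B \<bullet> P0 = 0"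
    if "((1 - s) *\<^sub>R A + s *\<^sub>R B) \<bullet> P0 = 0" "0 \<le> A \<bullet> P0" "0 \<le> B \<bullet> P0" for A B P0 :: "real^'n^'n"
  proof -
    have "(1 - s) * (A \<bullet> P0) + s * (B \<bullet> P0) = 0" using that(1) by (simp add: inner_add_left)
    then show ?thesis using s that(2,3)
      by (smt (verit, best) mult_nonneg_nonneg mult_eq_0_iff)
  qed
  have k0: "X \<bullet> ?P 0 = 0 \<and> Y \<bullet> ?P 0 = 0"
    using MP[of "\<lambda>x. x" 0] X Y P
    by (intro split) (auto simp: mat_fun_id sM M_def[symmetric] intro: pos_semidef_inner_nonneg feasible_pos_semidef)
  have k1: "(mat 1 - X) \<bullet> ?P 1 = 0 \<and> (mat 1 - Y) \<bullet> ?P 1 = 0"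
  proof (intro split)
    have "(1 - s) *\<^sub>R (mat 1 - X) + s *\<^sub>R (mat 1 - Y) = mat 1 - M"
      by (simp add: M_def algebra_simps)
    also have "\<dots> = mat_fun (\<lambda>x. 1 - x) M"
      using mat_fun_one_minus[OF sM, of "\<lambda>x. x"] by (simp add: mat_fun_id sM transpose_diff)
    finally show "((1 - s) *\<^sub>R (mat 1 - X) + s *\<^sub>R (mat 1 - Y)) \<bullet> ?P 1 = 0"
      using MP[of "\<lambda>x. 1 - x" 1] by simp
  qed (use X Y P in \<open>auto intro!: pos_semidef_inner_nonneg simp: feasible_def\<close>)
  let ?G = "mat_fun (\<lambda>x. ln x - ln (1 - x)) M" and ?x = "msqrt X - msqrt M" and ?y = "msqrt Y - msqrt M"
  have "(1 - s) * (norm ?x)\<^sup>2 \<le> (1 - s) * (S_FD X - S_FD M - ?G \<bullet> (X - M))"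
    using k0 k1 s by (intro mult_left_mono entropy_gap X M) auto
  moreover have "s * (norm ?y)\<^sup>2 \<le> s * (S_FD Y - S_FD M - ?G \<bullet> (Y - M))"
    using k0 k1 s by (intro mult_left_mono entropy_gap Y M) auto
  moreover have "(1 - s) * (?G \<bullet> (X - M)) + s * (?G \<bullet> (Y - M)) = 0"
  proof -
    have "(1 - s) *\<^sub>R (X - M) + s *\<^sub>R (Y - M) = 0" by (simp add: M_def algebra_simps)
    then have "?G \<bullet> ((1 - s) *\<^sub>R (X - M) + s *\<^sub>R (Y - M)) = 0" by simp
    then show ?thesis by (simp only: inner_add_right inner_scaleR_right)
  qed
  moreover have "s * (1 - s) * (norm (?x - ?y))\<^sup>2 \<le> (1 - s) * (norm ?x)\<^sup>2 + s * (norm ?y)\<^sup>2"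
  proof -
    have "(1 - s) * (norm ?x)\<^sup>2 + s * (norm ?y)\<^sup>2 - s * (1 - s) * (norm (?x - ?y))\<^sup>2
        = (norm ((1 - s) *\<^sub>R ?x + s *\<^sub>R ?y))\<^sup>2"
      unfolding power2_norm_eq_inner
      by (simp only: inner_add_left inner_add_right inner_scaleR_left inner_scaleR_right inner_diff_left
          inner_diff_right inner_commute) (simp add: algebra_simps power2_eq_square)
    then show ?thesis by (smt (verit) zero_le_power2)
  qed
  ultimately show ?thesis
    unfolding M_def[symmetric] by (simp add: algebra_simps)
qed


lemma feasible_interval: "X \<in> feasible \<Longrightarrow> transpose X = X \<and> (\<forall>l. is_eigenvalue X l \<longrightarrow> l \<in> {0..1})"
  using feasible_eigenvalue feasible_symmetric by auto

text \<open>A modulus of continuity of \<open>f\<close> is applied to pairs of eigenvalues and averaged with the overlaps.\<close>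

lemma mat_fun_continuous_on_feasible:
  assumes f: "continuous_on {0..1} f"
  shows "continuous_on feasible (mat_fun f :: real^'n^'n \<Rightarrow> real^'n^'n)"
proof (rule continuous_onI)
  fix A :: "real^'n^'n" and e :: real assume A: "A \<in> feasible" and e: "0 < e"
  define N where "N = real CARD('n)"
  have N: "N > 0" by (simp add: N_def)
  define e' where "e' = e\<^sup>2 / (4 * N)"
  have e': "0 < e'" using e N by (simp add: e'_def)
  have "compact (f ` {0..1})" using f by (intro compact_continuous_image) auto
  then obtain K where K: "\<And>x. x \<in> {0..1} \<Longrightarrow> \<bar>f x\<bar> \<le> K"
    using compact_imp_bounded bounded_iff by (metis imageI real_norm_def)
  have K0: "0 \<le> K" using K[of 0] by auto
  have "uniformly_continuous_on {0..1} f" by (rule compact_uniformly_continuous[OF f]) simp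
  then obtain d where d: "0 < d" "\<And>x y. x \<in> {0..1} \<Longrightarrow> y \<in> {0..1} \<Longrightarrow> dist y x < d \<Longrightarrow> dist (f y) (f x) < sqrt e'"
    using e' unfolding uniformly_continuous_on_def by (metis real_sqrt_gt_0_iff)
  (* close arguments give close values; far ones are controlled by the squared distance *)
  have mod: "(f x - f y)\<^sup>2 \<le> e' + (2 * K)\<^sup>2 / d\<^sup>2 * (x - y)\<^sup>2" if "x \<in> {0..1}" "y \<in> {0..1}" for x y
  proof (cases "\<bar>x - y\<bar> < d")
    case True
    then have "\<bar>f x - f y\<bar> \<le> sqrt e'" using d(2)[of y x] that by (auto simp: dist_real_def)
    then have "(f x - f y)\<^sup>2 \<le> e'" using e' by (metis abs_ge_zero power2_abs power_mono real_sqrt_pow2 less_imp_le)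
    then show ?thesis by (smt (verit) mult_nonneg_nonneg divide_nonneg_nonneg zero_le_power2)
  next
    case False
    have "\<bar>f x - f y\<bar> \<le> 2 * K" using K[OF that(1)] K[OF that(2)] by linarith
    then have "(f x - f y)\<^sup>2 \<le> (2 * K)\<^sup>2" by (metis abs_ge_zero power2_abs power_mono)
    also have "\<dots> \<le> (2 * K)\<^sup>2 * ((x - y)\<^sup>2 / d\<^sup>2)"
    proof -
      have "d\<^sup>2 \<le> (x - y)\<^sup>2" using False d(1) by (metis linorder_not_less power2_abs power_mono less_imp_le)
      then have "1 \<le> (x - y)\<^sup>2 / d\<^sup>2" using d(1) by simp
      then show ?thesis using mult_left_mono[of 1 "(x - y)\<^sup>2 / d\<^sup>2" "(2 * K)\<^sup>2"] by simp
    qed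
    finally show ?thesis using e' by (simp add: field_simps)
  qed
  define L where "L = (2 * K)\<^sup>2 / d\<^sup>2"
  have L: "0 \<le> L" by (simp add: L_def)
  show "\<exists>\<delta>>0. \<forall>B\<in>feasible. dist B A < \<delta> \<longrightarrow> dist (mat_fun f B) (mat_fun f A) \<le> e"
  proof (intro exI conjI ballI impI)
    show "0 < e / (2 * (L + 1))" using e L by simp
    fix B :: "real^'n^'n" assume B: "B \<in> feasible" and dist: "dist B A < e / (2 * (L + 1))"
    have s: "transpose B = B" "transpose A = A" using A B by (auto simp: feasible_symmetric)
    obtain a b w where "overlap B A a b w" by (rule overlapE[OF s])
    then interpret overlap B A a b w .
    have ab: "a i \<in> {0..1}" "b i \<in> {0..1}" for i
      using eigA eigB A B feasible_interval by blast+
    have "(norm (mat_fun f B - mat_fun f A))\<^sup>2 = (\<Sum>i\<in>UNIV. \<Sum>j\<in>UNIV. w i j * (f (a i) - f (b j))\<^sup>2)"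
      by (rule norm_diff)
    also have "\<dots> \<le> (\<Sum>i\<in>UNIV. \<Sum>j\<in>UNIV. w i j * (e' + L * (a i - b j)\<^sup>2))"
      using w mod ab unfolding L_def by (intro sum_mono mult_left_mono) auto
    also have "\<dots> = e' * N + L * (\<Sum>i\<in>UNIV. \<Sum>j\<in>UNIV. w i j * (a i - b j)\<^sup>2)"
    proof -
      have "(\<Sum>i\<in>UNIV. \<Sum>j\<in>UNIV. w i j * e') = e' * N"
        by (simp add: sum_distrib_right[symmetric] row N_def)
      then show ?thesis by (simp add: distrib_left sum.distrib sum_distrib_left mult.left_commute)
    qed
    also have "(\<Sum>i\<in>UNIV. \<Sum>j\<in>UNIV. w i j * (a i - b j)\<^sup>2) = (norm (B - A))\<^sup>2"
      using norm_diff[of "\<lambda>x. x" "\<lambda>x. x"] by (simp add: mat_fun_id s)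
    also have "e' * N + L * (norm (B - A))\<^sup>2 \<le> e\<^sup>2"
    proof -
      have "(norm (B - A))\<^sup>2 \<le> (e / (2 * (L + 1)))\<^sup>2"
        using dist by (intro power_mono) (auto simp: dist_norm)
      then have "L * (norm (B - A))\<^sup>2 \<le> L * (e / (2 * (L + 1)))\<^sup>2" using L by (rule mult_left_mono)
      also have "\<dots> = (L / (L + 1)\<^sup>2) * (e\<^sup>2 / 4)"
        by (simp only: power_divide power_mult_distrib) simp
      also have "\<dots> \<le> 1 * (e\<^sup>2 / 4)"
      proof (intro mult_right_mono)
        have "L \<le> (L + 1)\<^sup>2" using L by (simp add: power2_eq_square algebra_simps)
        then show "L / (L + 1)\<^sup>2 \<le> 1" using L by simp
      qed simp
      finally have "L * (norm (B - A))\<^sup>2 \<le> e\<^sup>2 / 4" by simp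
      moreover have "e' * N = e\<^sup>2 / 4" using N by (simp add: e'_def)
      moreover have "0 \<le> e\<^sup>2" by simp
      ultimately show ?thesis by linarith
    qed
    finally have "norm (mat_fun f B - mat_fun f A) \<le> e"
      using e by (simp add: power2_le_iff_abs_le)
    then show "dist (mat_fun f B) (mat_fun f A) \<le> e" by (simp add: dist_norm)
  qed
qed

lemma S_FD_continuous: "continuous_on feasible (S_FD :: real^'n^'n \<Rightarrow> real)"
proof -
  have "continuous_on feasible (\<lambda>X :: real^'n^'n. mat 1 \<bullet> mat_fun entropy X)"
    by (intro continuous_intros mat_fun_continuous_on_feasible entropy_continuous)
  then show ?thesis by (rule continuous_on_eq) (simp add: S_FD_eq feasible_symmetric)
qed

lemma msqrt_square: "pos_semidef X \<Longrightarrow> msqrt X ** msqrt X = X"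
proof -
  assume X: "pos_semidef X"
  then have s: "transpose X = X" by (simp add: pos_semidef_def)
  have "msqrt X ** msqrt X = mat_fun (\<lambda>x. x) X"
    unfolding mat_fun_mult[OF s] using pos_semidef_eigenvalue[OF X] by (intro mat_fun_cong s) auto
  then show ?thesis by (simp add: mat_fun_id s)
qed

abbreviation logistic :: "real^'n^'n \<Rightarrow> real^'n^'n" where
  "logistic H \<equiv> mat_fun (fermi 1) H"

lemma fermi_bounds: "0 < fermi \<beta> x" "fermi \<beta> x < 1"
  by (auto simp: fermi_def add_pos_pos)

lemma logistic_feasible: "transpose H = H \<Longrightarrow> logistic H \<in> feasible"
  using fermi_bounds by (intro mat_fun_feasible) (auto intro: less_imp_le)

lemma fermi_log_odds: "ln (fermi 1 x) - ln (1 - fermi 1 x) = - x"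
proof -
  have "1 - fermi 1 x = exp x * fermi 1 x"
  proof -
    have "1 + exp x \<noteq> 0" using exp_gt_zero[of x] by linarith
    then show ?thesis by (simp add: fermi_def field_simps)
  qed
  then show ?thesis using fermi_bounds(1)[of 1 x] by (simp add: ln_mult)
qed

text \<open>Gibbs variational principle: \<open>f(H)\<close> minimizes \<open>\<langle>H, \<cdot>\<rangle> + S\<close> over the feasible set.\<close>

lemma gibbs_gap:
  fixes H Y :: "real^'n^'n"
  assumes H: "transpose H = H" and Y: "Y \<in> feasible"
  shows "(norm (msqrt Y - msqrt (logistic H)))\<^sup>2
    \<le> (H \<bullet> Y + S_FD Y) - (H \<bullet> logistic H + S_FD (logistic H))"
proof -
  have z: "mat_fun (\<lambda>x. 0) H = 0"
    using mat_fun_scaleR[OF H, of 0 "\<lambda>x. 0"] by simp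
  have P: "mat_fun (\<lambda>x. if x = c then 1 else 0) (logistic H) = 0" if "c = 0 \<or> c = 1" for c :: real
  proof -
    have "(\<lambda>x. if fermi 1 x = c then 1 else 0) = (\<lambda>x. 0 :: real)"
      using fermi_bounds[of 1] that by (auto simp: fun_eq_iff less_le)
    then show ?thesis by (simp only: mat_fun_compose[OF H] z)
  qed
  have "mat_fun (\<lambda>x. ln x - ln (1 - x)) (logistic H) = (-1) *\<^sub>R H"
    using mat_fun_scaleR[OF H, of "-1" "\<lambda>x. x"]
    by (simp add: mat_fun_compose[OF H] fermi_log_odds mat_fun_id H)
  then show ?thesis
    using entropy_gap[OF Y logistic_feasible[OF H]] by (simp add: P inner_diff_right)
qed


section \<open>Trace and continuity of the logistic map\<close>

lemma norm_matrix_square: "(norm A)\<^sup>2 = (\<Sum>j\<in>UNIV. (norm (A $ j))\<^sup>2)" for A :: "real^'n^'m"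
  by (simp add: power2_norm_eq_inner inner_vec_def)

lemma fermi_deriv: "((fermi 1) has_real_derivative - (fermi 1 x * (1 - fermi 1 x))) (at x)"
proof -
  have nz: "1 + exp x \<noteq> 0" using exp_gt_zero[of x] by linarith
  have "((\<lambda>x. 1 / (1 + exp x)) has_real_derivative - exp x / ((1 + exp x) * (1 + exp x))) (at x)"
    using nz by (auto intro!: derivative_eq_intros)
  moreover have "- exp x / ((1 + exp x) * (1 + exp x)) = - (fermi 1 x * (1 - fermi 1 x))"
    using nz by (simp add: fermi_def field_simps)
  moreover have "fermi 1 = (\<lambda>x. 1 / (1 + exp x))" by (simp add: fermi_def fun_eq_iff)
  ultimately show ?thesis by simp
qed

lemma fermi_lipschitz: "\<bar>fermi 1 x - fermi 1 y\<bar> \<le> \<bar>x - y\<bar>"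
proof -
  have "norm (fermi 1 x - fermi 1 y) \<le> 1 * norm (x - y)"
  proof (rule field_differentiable_bound[of UNIV "fermi 1"])
    show "norm (- (fermi 1 z * (1 - fermi 1 z))) \<le> 1" for z
      using fermi_bounds[of 1 z] by (simp add: abs_mult mult_le_one)
  qed (auto intro: has_field_derivative_at_within fermi_deriv)
  then show ?thesis by simp
qed

text \<open>Taylor's formula of second order from above, which the trace inequality below applies to pairs of
  eigenvalues.\<close>

lemma fermi_taylor:
  "fermi 1 y \<le> fermi 1 x - (fermi 1 x * (1 - fermi 1 x)) * (y - x) + (y - x)\<^sup>2"
proof -
  let ?d = "\<lambda>x. - (fermi 1 x * (1 - fermi 1 x))"
  have lip: "\<bar>?d z - ?d x\<bar> \<le> \<bar>z - x\<bar>" for z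
  proof -
    have "?d z - ?d x = (fermi 1 z - fermi 1 x) * (fermi 1 z + fermi 1 x - 1)"
      by (simp add: algebra_simps)
    also have "\<bar>\<dots>\<bar> \<le> \<bar>z - x\<bar> * 1"
      unfolding abs_mult using fermi_bounds[of 1 z] fermi_bounds[of 1 x]
      by (intro mult_mono fermi_lipschitz) auto
    finally show ?thesis by simp
  qed
  obtain z where z: "fermi 1 y - fermi 1 x = (y - x) * ?d z" "\<bar>z - x\<bar> \<le> \<bar>y - x\<bar>"
  proof (cases "x = y")
    case False
    show ?thesis
    proof (cases "x < y")
      case True
      then obtain z where "x < z" "z < y" "fermi 1 y - fermi 1 x = (y - x) * ?d z"
        using MVT2[of x y "fermi 1" ?d] fermi_deriv by blast
      then show ?thesis using that by auto
    next
      case False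
      with \<open>x \<noteq> y\<close> have "y < x" by simp
      then obtain z where "y < z" "z < x" "fermi 1 x - fermi 1 y = (x - y) * ?d z"
        using MVT2[of y x "fermi 1" ?d] fermi_deriv by blast
      then show ?thesis using that[of z] by (auto simp: algebra_simps)
    qed
  qed (use that in auto)
  have "(y - x) * (?d z - ?d x) \<le> \<bar>y - x\<bar> * \<bar>?d z - ?d x\<bar>"
    by (metis abs_ge_self abs_mult)
  also have "\<dots> \<le> \<bar>y - x\<bar> * \<bar>y - x\<bar>"
    using lip[of z] z(2) by (intro mult_left_mono) auto
  finally show ?thesis using z(1) by (simp add: power2_eq_square algebra_simps)
qed

text \<open>The derivative of \<open>trace (f(H + sK))\<close> in \<open>s\<close> is \<open>f'(H + sK) \<bullet> K \<le> 0\<close>. Cutting the segment into \<open>N\<close>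
  pieces, each with an error of second order, replaces the differentiation of a matrix function.\<close>

lemma trace_logistic_antimono:
  fixes H K :: "real^'n^'n"
  assumes H: "transpose H = H" and K: "pos_semidef K"
  shows "trace (logistic (H + K)) \<le> trace (logistic H)"
proof -
  have sK: "transpose K = K" using K by (simp add: pos_semidef_def)
  (* one step along the segment increases the trace at most to second order *)
  have step: "trace (logistic (A + h *\<^sub>R K)) \<le> trace (logistic A) + h\<^sup>2 * (norm K)\<^sup>2"
    if A: "transpose A = A" and h: "0 \<le> h" for A h
  proof -
    have s: "transpose (A + h *\<^sub>R K) = A + h *\<^sub>R K" by (simp add: A sK transpose_add transpose_scaleR)
    obtain a b w where "overlap (A + h *\<^sub>R K) A a b w" by (rule overlapE[OF s A])
    then interpret overlap "A + h *\<^sub>R K" A a b w .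
    let ?B = "A + h *\<^sub>R K" and ?D = "\<lambda>x. fermi 1 x * (1 - fermi 1 x)"
    have "trace (logistic ?B) = mat_fun (fermi 1) ?B \<bullet> mat_fun (\<lambda>x. 1) ?B"
      by (simp add: trace_eq_inner_mat_one mat_fun_const_one s inner_commute)
    also have "\<dots> = (\<Sum>i\<in>UNIV. \<Sum>j\<in>UNIV. w i j * fermi 1 (a i))" by (simp add: AA)
    also have "\<dots> \<le> (\<Sum>i\<in>UNIV. \<Sum>j\<in>UNIV. w i j * (fermi 1 (b j) - ?D (b j) * (a i - b j) + (a i - b j)\<^sup>2))"
      using w by (intro sum_mono mult_left_mono fermi_taylor)
    also have "\<dots> = mat_fun (fermi 1) A \<bullet> mat_fun (\<lambda>x. 1) A
         - (mat_fun (\<lambda>x. x) ?B \<bullet> mat_fun ?D A - mat_fun (\<lambda>x. x) A \<bullet> mat_fun ?D A)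
         + (norm (mat_fun (\<lambda>x. x) ?B - mat_fun (\<lambda>x. x) A))\<^sup>2"
      unfolding AA AB BB norm_diff by (simp add: algebra_simps sum.distrib sum_subtractf)
    also have "\<dots> = trace (logistic A) - h * (mat_fun ?D A \<bullet> K) + h\<^sup>2 * (norm K)\<^sup>2"
      by (simp only: mat_fun_id s A mat_fun_const_one)
         (simp add: trace_eq_inner_mat_one inner_commute inner_add_left power_mult_distrib)
    also have "\<dots> \<le> trace (logistic A) + h\<^sup>2 * (norm K)\<^sup>2"
    proof -
      have "pos_semidef (mat_fun ?D A)"
        using fermi_bounds[of 1] by (intro mat_fun_pos_semidef A mult_nonneg_nonneg) (auto intro: less_imp_le)
      then have "0 \<le> h * (mat_fun ?D A \<bullet> K)" using h K by (intro mult_nonneg_nonneg pos_semidef_inner_nonneg)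
      then show ?thesis by simp
    qed
    finally show ?thesis .
  qed
  have bound: "trace (logistic (H + K)) \<le> trace (logistic H) + (norm K)\<^sup>2 * inverse (real (Suc N))" for N
  proof -
    define h where "h = 1 / real (Suc N)"
    have h0: "0 \<le> h" by (simp add: h_def)
    have "trace (logistic (H + (real k * h) *\<^sub>R K)) \<le> trace (logistic H) + real k * (h\<^sup>2 * (norm K)\<^sup>2)" for k
    proof (induction k)
      case (Suc k)
      have "transpose (H + (real k * h) *\<^sub>R K) = H + (real k * h) *\<^sub>R K"
        by (simp add: H sK transpose_add transpose_scaleR)
      from step[OF this h0] Suc show ?case by (simp add: algebra_simps)
    qed simp
    from this[of "Suc N"] have "trace (logistic (H + K)) \<le> trace (logistic H) + real (Suc N) * (h\<^sup>2 * (norm K)\<^sup>2)"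
      by (simp add: h_def)
    also have "real (Suc N) * (h\<^sup>2 * (norm K)\<^sup>2) = (norm K)\<^sup>2 * inverse (real (Suc N))"
    proof -
      have 1: "real (Suc N) * h = 1" by (simp add: h_def)
      have "real (Suc N) * (h\<^sup>2 * (norm K)\<^sup>2) = (real (Suc N) * h) * (h * (norm K)\<^sup>2)"
        by (simp add: power2_eq_square)
      then show ?thesis unfolding 1 by (simp add: h_def divide_inverse)
    qed
    finally show ?thesis .
  qed
  have "(\<lambda>N. trace (logistic H) + (norm K)\<^sup>2 * inverse (real (Suc N))) \<longlonglongrightarrow> trace (logistic H) + (norm K)\<^sup>2 * 0"
    by (intro tendsto_intros LIMSEQ_inverse_real_of_nat)
  then show ?thesis using bound by (intro LIMSEQ_le_const) auto
qed

text \<open>The scalar Lipschitz bound holds for every pair of eigenvalues and passes to the overlap average.\<close>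

lemma logistic_lipschitz:
  fixes A B :: "real^'n^'n"
  assumes "transpose A = A" "transpose B = B"
  shows "norm (logistic A - logistic B) \<le> norm (A - B)"
proof -
  obtain a b w where "overlap A B a b w" by (rule overlapE[OF assms])
  then interpret overlap A B a b w .
  have "(norm (logistic A - logistic B))\<^sup>2 = (\<Sum>i\<in>UNIV. \<Sum>j\<in>UNIV. w i j * (fermi 1 (a i) - fermi 1 (b j))\<^sup>2)"
    by (rule norm_diff)
  also have "\<dots> \<le> (\<Sum>i\<in>UNIV. \<Sum>j\<in>UNIV. w i j * (a i - b j)\<^sup>2)"
    using w fermi_lipschitz by (intro sum_mono mult_left_mono) (auto simp: abs_le_square_iff[symmetric])
  also have "\<dots> = (norm (A - B))\<^sup>2"
    using norm_diff[of "\<lambda>x. x" "\<lambda>x. x"] by (simp add: mat_fun_id assms)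
  finally show ?thesis by (rule power2_le_imp_le) simp
qed


section \<open>Densities and amplitudes\<close>

lemma pos_semidef_cauchy_schwarz:
  fixes V :: "real^'m^'m"
  assumes V: "pos_semidef V"
  shows "(x \<bullet> (V *v y))\<^sup>2 \<le> (x \<bullet> (V *v x)) * (y \<bullet> (V *v y))"
proof -
  have s: "transpose V = V" using V by (simp add: pos_semidef_def)
  have "u \<bullet> (V *v v) = (msqrt V *v u) \<bullet> (msqrt V *v v)" for u v
  proof -
    have "u \<bullet> (V *v v) = u \<bullet> ((msqrt V ** msqrt V) *v v)" by (simp only: msqrt_square[OF V])
    also have "\<dots> = (msqrt V *v u) \<bullet> (msqrt V *v v)"
      by (simp add: symmetric_inner_mult s flip: matrix_vector_mul_assoc)
    finally show ?thesis .
  qed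
  then show ?thesis by (metis Cauchy_Schwarz_ineq)
qed

lemma matrix_entry_inner: "V $ i $ j = axis i 1 \<bullet> (V *v axis j 1)" for V :: "real^'n^'m"
  by (simp add: inner_axis' matrix_vector_mult_basis column_def)

lemma pos_semidef_diag_nonneg: "pos_semidef V \<Longrightarrow> 0 \<le> V $ i $ i"
  by (simp add: matrix_entry_inner pos_semidef_def)

lemma pos_semidef_entry_bound:
  assumes "pos_semidef V"
  shows "\<bar>V $ i $ j\<bar> \<le> sqrt (V $ i $ i) * sqrt (V $ j $ j)"
proof -
  have "(V $ i $ j)\<^sup>2 \<le> V $ i $ i * V $ j $ j"
    using pos_semidef_cauchy_schwarz[OF assms] by (simp add: matrix_entry_inner)
  then have "sqrt ((V $ i $ j)\<^sup>2) \<le> sqrt (V $ i $ i * V $ j $ j)" by (rule real_sqrt_le_mono)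
  then show ?thesis by (simp add: real_sqrt_mult)
qed

lemma matrix_mul_row: "(\<Psi> ** A) $ j = transpose A *v (\<Psi> $ j)" for \<Psi> :: "real^'n^'m" and A :: "real^'n^'n"
  by (simp add: vec_eq_iff matrix_matrix_mult_def matrix_vector_mult_def transpose_def mult.commute)

lemma rho_entry: "rho \<Psi> X $ j = (\<Psi> $ j) \<bullet> (X *v (\<Psi> $ j))"
  by (simp add: rho_def matrix_matrix_mult_def matrix_vector_mult_def inner_vec_def transpose_def
      sum_distrib_left sum_distrib_right) (subst sum.swap, simp add: algebra_simps)

lemma rho_amplitude:
  assumes "pos_semidef X"
  shows "rho \<Psi> X $ j = (norm ((\<Psi> ** msqrt X) $ j))\<^sup>2"
proof -
  have s: "transpose X = X" using assms by (simp add: pos_semidef_def)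
  have "rho \<Psi> X $ j = (\<Psi> $ j) \<bullet> ((msqrt X ** msqrt X) *v (\<Psi> $ j))"
    by (simp add: rho_entry msqrt_square assms)
  then show ?thesis
    by (simp add: symmetric_inner_mult s matrix_mul_row power2_norm_eq_inner flip: matrix_vector_mul_assoc)
qed

lemma rho_X_hat:
  assumes "transpose X = X"
  shows "rho \<Psi> (X_hat X z) $ j = ((\<Psi> ** msqrt X) $ j \<bullet> z)\<^sup>2"
proof -
  have o: "outer_prod z z *v u = (z \<bullet> u) *\<^sub>R z" for u
  proof -
    have "(outer_prod z z *v u) $ i = z $ i * (z \<bullet> u)" for i
      by (simp add: outer_prod_def matrix_vector_mult_def inner_vec_def sum_distrib_left mult.assoc)
    then show ?thesis by (simp add: vec_eq_iff mult.commute)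
  qed
  let ?a = "msqrt X *v (\<Psi> $ j)"
  have "rho \<Psi> (X_hat X z) $ j = (\<Psi> $ j) \<bullet> (msqrt X *v ((z \<bullet> ?a) *\<^sub>R z))"
    by (simp add: rho_entry X_hat_def o flip: matrix_vector_mul_assoc)
  also have "\<dots> = (z \<bullet> ?a) * (?a \<bullet> z)"
    by (subst symmetric_inner_mult) (simp_all add: assms)
  finally show ?thesis by (simp add: matrix_mul_row assms power2_eq_square inner_commute)
qed

locale orthonormal_columns =
  fixes \<Psi> :: "real^'n^'m"
  assumes orthonormal: "transpose \<Psi> ** \<Psi> = mat 1"
begin

definition penalty :: "real^'m \<Rightarrow> real^'n^'n" where
  "penalty k = transpose \<Psi> ** diag_mat k ** \<Psi>"

lemma penalty_symmetric [simp]: "transpose (penalty k) = penalty k"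
  by (simp add: penalty_def matrix_transpose_mul matrix_mul_assoc)

lemma penalty_add: "penalty (a + b) = penalty a + penalty b"
proof -
  have "(M + N) ** K = M ** K + N ** K" for M N :: "real^'m^'n" and K :: "real^'n^'m"
    by (simp add: vec_eq_iff matrix_matrix_mult_def sum.distrib algebra_simps)
  moreover have "diag_mat (a + b) = diag_mat a + diag_mat b" by (auto simp: vec_eq_iff diag_mat_def)
  ultimately show ?thesis by (simp add: penalty_def matrix_add_ldistrib)
qed

lemma penalty_scaleR: "penalty (c *\<^sub>R a) = c *\<^sub>R penalty a"
proof -
  have "diag_mat (c *\<^sub>R a) = c *\<^sub>R diag_mat a" by (auto simp: vec_eq_iff diag_mat_def)
  then show ?thesis by (simp add: penalty_def matrix_scaleR_left matrix_scaleR_right)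
qed

lemma penalty_zero [simp]: "penalty 0 = 0"
  using penalty_scaleR[of 0 0] by simp

lemma penalty_inner: "penalty k \<bullet> X = k \<bullet> rho \<Psi> X"
proof -
  have "penalty k \<bullet> X = trace (transpose \<Psi> ** (diag_mat k ** \<Psi> ** X))"
    by (simp add: inner_matrix_eq_trace) (simp add: penalty_def matrix_mul_assoc)
  also have "\<dots> = trace (diag_mat k ** (\<Psi> ** X ** transpose \<Psi>))"
    by (subst trace_mul_sym) (simp add: matrix_mul_assoc)
  also have "\<dots> = k \<bullet> rho \<Psi> X"
    unfolding trace_def diag_mat_entry_left by (simp add: rho_def inner_vec_def)
  finally show ?thesis .
qed

lemma inner_amplitude: "(\<Psi> ** A) \<bullet> (\<Psi> ** B) = A \<bullet> B" for A B :: "real^'n^'n"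
proof -
  have "(\<Psi> ** A) \<bullet> (\<Psi> ** B) = trace (transpose A ** (transpose \<Psi> ** \<Psi>) ** B)"
    by (simp add: inner_matrix_eq_trace matrix_transpose_mul matrix_mul_assoc)
  then show ?thesis by (simp add: orthonormal inner_matrix_eq_trace)
qed

lemma norm_amplitude: "norm (\<Psi> ** A) = norm A" for A :: "real^'n^'n"
  by (simp add: norm_eq_sqrt_inner inner_amplitude)

lemma amplitude_diff: "\<Psi> ** A - \<Psi> ** B = \<Psi> ** (A - B)" for A B :: "real^'n^'n"
  by (simp add: vec_eq_iff matrix_matrix_mult_def sum_subtractf algebra_simps)

lemma norm_msqrt: "pos_semidef X \<Longrightarrow> (norm (msqrt X))\<^sup>2 = trace X"
  by (simp add: power2_norm_eq_inner inner_matrix_eq_trace pos_semidef_def)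
     (simp add: msqrt_square pos_semidef_def)

text \<open>The rows of an isometry: \<open>\<Psi> \<Psi>\<^sup>T\<close> is a projection, and its diagonal entries are at most one.\<close>

lemma norm_row: "norm (\<Psi> $ j) \<le> 1"
proof -
  let ?P = "\<Psi> ** transpose \<Psi>"
  have "?P ** ?P = \<Psi> ** (transpose \<Psi> ** \<Psi>) ** transpose \<Psi>" by (simp add: matrix_mul_assoc)
  then have PP: "?P ** ?P = ?P" by (simp add: orthonormal)
  have sym: "?P $ i $ k = ?P $ k $ i" for i k
    by (simp add: matrix_matrix_mult_def transpose_def mult.commute)
  have p: "?P $ j $ j = (norm (\<Psi> $ j))\<^sup>2"
    by (simp add: matrix_matrix_mult_def transpose_def power2_norm_eq_inner inner_vec_def)
  have "?P $ j $ j = (\<Sum>k\<in>UNIV. (?P $ j $ k)\<^sup>2)"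
    using arg_cong[OF PP, of "\<lambda>M. M $ j $ j"] sym
    by (subst (asm) (1) matrix_matrix_mult_def) (simp add: power2_eq_square)
  also have "\<dots> \<ge> (?P $ j $ j)\<^sup>2" by (rule member_le_sum) auto
  finally have "((norm (\<Psi> $ j))\<^sup>2)\<^sup>2 \<le> (norm (\<Psi> $ j))\<^sup>2" using p by simp
  then have "(norm (\<Psi> $ j))\<^sup>2 * (norm (\<Psi> $ j))\<^sup>2 \<le> (norm (\<Psi> $ j))\<^sup>2 * 1" by (simp add: power2_eq_square)
  then have "(norm (\<Psi> $ j))\<^sup>2 \<le> 1"
    by (metis mult_le_cancel_left_pos zero_le_power2 order_le_less zero_le_one)
  then show ?thesis by (simp add: power_le_one_iff abs_le_square_iff power2_le_iff_abs_le)
qed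

lemma amplitude_row_le_one:
  assumes "X \<in> feasible"
  shows "norm ((\<Psi> ** msqrt X) $ j) \<le> 1"
proof -
  have "0 \<le> (\<Psi> $ j) \<bullet> ((mat 1 - X) *v (\<Psi> $ j))" using assms by (simp add: feasible_def pos_semidef_def)
  then have "(norm ((\<Psi> ** msqrt X) $ j))\<^sup>2 \<le> (norm (\<Psi> $ j))\<^sup>2"
    unfolding rho_amplitude[OF feasible_pos_semidef[OF assms], symmetric]
    by (simp add: rho_entry matrix_vector_mult_diff_rdistrib inner_diff_right power2_norm_eq_inner)
  also have "\<dots> \<le> 1\<^sup>2" by (intro power_mono norm_row) auto
  finally show ?thesis by (rule power2_le_imp_le) simp
qed

lemma trace_amplitude: "pos_semidef X \<Longrightarrow> (norm (\<Psi> ** msqrt X))\<^sup>2 = trace X"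
  by (simp add: norm_amplitude norm_msqrt)

end

lemma feasible_norm: "X \<in> feasible \<Longrightarrow> (norm X)\<^sup>2 \<le> real CARD('n)" for X :: "real^'n^'n"
proof -
  assume X: "X \<in> feasible"
  note s = feasible_symmetric[OF X]
  obtain a b w where "overlap X X a b w" by (rule overlapE[OF s s])
  then interpret overlap X X a b w .
  have "(norm X)\<^sup>2 = (\<Sum>i\<in>UNIV. \<Sum>j\<in>UNIV. w i j * (a i * a i))"
    using AA[of "\<lambda>x. x" "\<lambda>x. x"] by (simp add: mat_fun_id s power2_norm_eq_inner)
  also have "\<dots> \<le> (\<Sum>i\<in>UNIV. \<Sum>j\<in>UNIV. w i j * 1)"
    using w feasible_eigenvalue[OF X eigA] by (intro sum_mono mult_left_mono mult_le_one) auto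
  finally show ?thesis by (simp add: row)
qed

lemma matrix_vector_mult_continuous: "continuous_on S (\<lambda>X :: real^'n^'m. X *v x)"
  unfolding matrix_vector_mult_def by (intro continuous_intros)

lemma closed_pos_semidef: "closed {X :: real^'n^'n. pos_semidef X}"
proof -
  have "{X :: real^'n^'n. pos_semidef X} = (\<Inter>i. \<Inter>j. {X. X $ j $ i = X $ i $ j}) \<inter> (\<Inter>x. {X. 0 \<le> x \<bullet> (X *v x)})"
    by (auto simp: pos_semidef_def vec_eq_iff transpose_def)
  then show ?thesis
    by (auto intro!: closed_Int closed_INT closed_Collect_eq closed_Collect_le continuous_intros
        matrix_vector_mult_continuous)
qed

lemma compact_feasible: "compact (feasible :: (real^'n^'n) set)"
proof -
  have "closed (feasible :: (real^'n^'n) set)"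
  proof -
    have eq: "(feasible :: (real^'n^'n) set) = {X. pos_semidef X} \<inter> (\<lambda>X. mat 1 - X) -` {X. pos_semidef X}"
      by (auto simp: feasible_def)
    have "closed ((\<lambda>X :: real^'n^'n. mat 1 - X) -` {X. pos_semidef X})"
      by (rule continuous_closed_vimage[OF closed_pos_semidef]) (intro continuous_intros)
    then show ?thesis unfolding eq by (rule closed_Int[OF closed_pos_semidef])
  qed
  moreover have "bounded (feasible :: (real^'n^'n) set)"
    unfolding bounded_iff using feasible_norm real_le_rsqrt by blast
  ultimately show ?thesis by (simp add: compact_eq_bounded_closed)
qed

lemma rho_continuous: "continuous_on S (rho \<Psi>)" for \<Psi> :: "real^'n^'m"
  unfolding rho_def matrix_matrix_mult_def by (intro continuous_intros)

lemma rho_convex_comb: "rho \<Psi> (a *\<^sub>R X + b *\<^sub>R Y) = a *\<^sub>R rho \<Psi> X + b *\<^sub>R rho \<Psi> Y"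
  by (simp add: vec_eq_iff rho_entry matrix_vector_mult_add_rdistrib inner_add_right
      scaleR_matrix_vector_assoc[symmetric])


section \<open>Minimizers over a window\<close>

text \<open>The proxies of the proof minimize the penalized free energy over a window: the part of the
  feasible set on which the potentials \<open>|V| \<rho>(X)\<close> and the trace stay below given levels.\<close>

locale window = orthonormal_columns \<Psi>
  for \<Psi> :: "real^'n^'m" +
  fixes V :: "real^'m^'m" and H0 :: "real^'n^'n" and c \<tau> :: real
  assumes V: "pos_semidef V" and H0: "transpose H0 = H0"
    and potential_X0: "\<And>i. (abs_mat V *v rho \<Psi> (logistic H0)) $ i \<le> c"
    and trace_X0: "trace (logistic H0) \<le> \<tau>"
begin

definition window :: "(real^'n^'n) set" where
  "window = {X \<in> feasible. (\<forall>i. (abs_mat V *v rho \<Psi> X) $ i \<le> c) \<and> trace X \<le> \<tau>}"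

definition objective :: "real^'m \<Rightarrow> real^'n^'n \<Rightarrow> real" where
  "objective k X = (H0 + penalty k) \<bullet> X + S_FD X"

lemma window_feasible: "X \<in> window \<Longrightarrow> X \<in> feasible"
  by (simp add: window_def)

lemma X0_window: "logistic H0 \<in> window"
  using logistic_feasible[OF H0] potential_X0 trace_X0 by (simp add: window_def)

lemma compact_window: "compact window"
proof -
  have "window = feasible \<inter> ((\<Inter>i. {X. (abs_mat V *v rho \<Psi> X) $ i \<le> c}) \<inter> {X. trace X \<le> \<tau>})"
    by (auto simp: window_def)
  moreover have "closed {X. (abs_mat V *v rho \<Psi> X) $ i \<le> c}" for i
    unfolding matrix_vector_mult_def
    by (intro closed_Collect_le) (simp_all add: continuous_intros rho_continuous)
  moreover have "closed {X :: real^'n^'n. trace X \<le> \<tau>}"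
    unfolding trace_def by (intro closed_Collect_le continuous_intros)
  ultimately show ?thesis
    by (simp only:) (intro compact_Int_closed compact_feasible closed_Int closed_INT ballI)
qed

lemma window_convex:
  assumes "X \<in> window" "Y \<in> window" "0 \<le> s" "s \<le> 1"
  shows "(1 - s) *\<^sub>R X + s *\<^sub>R Y \<in> window"
proof -
  have "(abs_mat V *v rho \<Psi> ((1 - s) *\<^sub>R X + s *\<^sub>R Y)) $ i
     \<le> (1 - s) * c + s * c" for i
    using assms unfolding rho_convex_comb
    by (simp add: matrix_vector_right_distrib matrix_vector_mult_scaleR)
       (intro add_mono mult_left_mono, auto simp: window_def)
  moreover have "trace ((1 - s) *\<^sub>R X + s *\<^sub>R Y) \<le> (1 - s) * \<tau> + s * \<tau>"
    using assms by (simp add: trace_eq_inner_mat_one inner_add_right)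
       (intro add_mono mult_left_mono, auto simp: window_def trace_eq_inner_mat_one)
  moreover have "(1 - s) * c + s * c = c" "(1 - s) * \<tau> + s * \<tau> = \<tau>" by (simp_all add: algebra_simps)
  moreover have "(1 - s) *\<^sub>R X + s *\<^sub>R Y \<in> feasible"
    using assms by (intro feasible_convex) (auto simp: window_def)
  ultimately show ?thesis by (simp add: window_def del: scaleR_left_diff_distrib)
qed

text \<open>The choice is immaterial, as strong convexity makes the minimizer unique (\<open>proxy_growth\<close>).\<close>

definition proxy :: "real^'m \<Rightarrow> real^'n^'n" where
  "proxy k = (SOME X. X \<in> window \<and> (\<forall>Y\<in>window. objective k X \<le> objective k Y))"

lemma proxy: "proxy k \<in> window" "\<And>Y. Y \<in> window \<Longrightarrow> objective k (proxy k) \<le> objective k Y"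
proof -
  have "continuous_on window (objective k)"
    unfolding objective_def
    by (intro continuous_intros continuous_on_subset[OF S_FD_continuous]) (auto simp: window_feasible)
  then have "\<exists>X. X \<in> window \<and> (\<forall>Y\<in>window. objective k X \<le> objective k Y)"
    using continuous_attains_inf[OF compact_window] X0_window by blast
  from someI_ex[OF this]
  show "proxy k \<in> window" "\<And>Y. Y \<in> window \<Longrightarrow> objective k (proxy k) \<le> objective k Y"
    unfolding proxy_def by auto
qed

text \<open>Minimality along the segment to \<open>Y\<close> and strong convexity of the entropy give the bound with a
  factor \<open>1 - s\<close>, which tends to one.\<close>

lemma proxy_growth:
  assumes Y: "Y \<in> window"
  shows "objective k (proxy k) + (norm (msqrt Y - msqrt (proxy k)))\<^sup>2 \<le> objective k Y"
proof -
  let ?X = "proxy k" and ?N = "(norm (msqrt (proxy k) - msqrt Y))\<^sup>2"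
  have "z * ?N \<le> objective k Y - objective k ?X" if z: "0 < z" "z < 1" for z
  proof -
    define s where "s = 1 - z"
    have s: "0 < s" "s < 1" using z by (auto simp: s_def)
    have "objective k ?X \<le> objective k ((1 - s) *\<^sub>R ?X + s *\<^sub>R Y)"
      using s by (intro proxy window_convex Y) auto
    also have "\<dots> \<le> (1 - s) * objective k ?X + s * objective k Y - s * (1 - s) * ?N"
      using entropy_strongly_convex[OF window_feasible[OF proxy(1)] window_feasible[OF Y] s, of k]
      unfolding objective_def inner_add_right inner_scaleR_right by (simp add: algebra_simps)
    finally have "s * ((1 - s) * ?N) \<le> s * (objective k Y - objective k ?X)" by (simp add: algebra_simps)
    then show ?thesis using s by (simp add: s_def)
  qed
  then have "?N \<le> objective k Y - objective k ?X" by (rule field_le_mult_one_interval)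
  then show ?thesis by (simp add: norm_minus_commute)
qed

text \<open>The unconstrained minimizer is known explicitly; when it respects the window, it is the proxy.\<close>

lemma proxy_eq_logistic:
  assumes "logistic (H0 + penalty k) \<in> window"
  shows "proxy k = logistic (H0 + penalty k)"
proof -
  let ?X = "logistic (H0 + penalty k)"
  have s: "transpose (H0 + penalty k) = H0 + penalty k" by (simp add: transpose_add H0)
  have "objective k ?X \<le> objective k (proxy k)"
    using gibbs_gap[OF s window_feasible[OF proxy(1)]] zero_le_power2
    unfolding objective_def by (smt (verit))
  then have "(norm (msqrt ?X - msqrt (proxy k)))\<^sup>2 \<le> 0"
    using proxy_growth[OF assms, of k] by linarith
  then have "msqrt ?X = msqrt (proxy k)" by simp
  then show ?thesis
    by (metis assms feasible_pos_semidef msqrt_square proxy(1) window_feasible)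
qed

definition amplitude :: "real^'m \<Rightarrow> real^'n^'m" where
  "amplitude k = \<Psi> ** msqrt (proxy k)"

lemma amplitude_rho: "rho \<Psi> (proxy k) $ j = (norm (amplitude k $ j))\<^sup>2"
  unfolding amplitude_def using proxy(1) by (simp add: rho_amplitude feasible_pos_semidef window_feasible)

lemma amplitude_potential: "(\<Sum>j\<in>UNIV. \<bar>V $ i $ j\<bar> * (norm (amplitude k $ j))\<^sup>2) \<le> c"
  using proxy(1)[of k] by (simp add: window_def matrix_vector_mult_def abs_mat_def amplitude_rho)

lemma amplitude_trace: "(norm (amplitude k))\<^sup>2 \<le> \<tau>"
  unfolding amplitude_def using proxy(1)[of k]
  by (simp add: trace_amplitude feasible_pos_semidef window_feasible) (simp add: window_def)

lemma amplitude_row: "norm (amplitude k $ j) \<le> 1"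
  unfolding amplitude_def using proxy(1)[of k] by (simp add: amplitude_row_le_one window_feasible)

lemma amplitude_zero: "amplitude 0 = \<Psi> ** msqrt (logistic H0)"
  using proxy_eq_logistic[of 0] X0_window by (simp add: amplitude_def)

text \<open>Two minimizers are compared through their variational inequalities. Weighting a change of
  the penalty on row \<open>j\<close> by the amplitude of that row keeps the bound free of dimension factors.\<close>

lemma amplitude_lipschitz:
  "2 * norm (amplitude k - amplitude k')
    \<le> L2_set (\<lambda>j. \<bar>k $ j - k' $ j\<bar> * (norm (amplitude k $ j) + norm (amplitude k' $ j))) UNIV"
proof -
  let ?y = "amplitude k" and ?y' = "amplitude k'"
  let ?q = "\<lambda>j. norm (?y $ j) + norm (?y' $ j)" and ?d = "\<lambda>j. \<bar>k $ j - k' $ j\<bar>"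
  have N: "norm (?y - ?y') = norm (msqrt (proxy k) - msqrt (proxy k'))"
    by (simp add: amplitude_def amplitude_diff norm_amplitude)
  have "2 * (norm (?y - ?y'))\<^sup>2 \<le> objective k (proxy k') - objective k (proxy k)
      + (objective k' (proxy k) - objective k' (proxy k'))"
    unfolding N using proxy_growth[OF proxy(1), of k k'] proxy_growth[OF proxy(1), of k' k]
    by (simp add: norm_minus_commute)
  also have "\<dots> = (k - k') \<bullet> (rho \<Psi> (proxy k') - rho \<Psi> (proxy k))"
    unfolding objective_def inner_add_left penalty_inner by (simp add: algebra_simps inner_diff_left inner_diff_right)
  also have "\<dots> = (\<Sum>j\<in>UNIV. (k $ j - k' $ j) * ((norm (?y' $ j))\<^sup>2 - (norm (?y $ j))\<^sup>2))"
    by (simp add: inner_vec_def amplitude_rho)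
  also have "\<dots> \<le> (\<Sum>j\<in>UNIV. \<bar>?d j * ?q j\<bar> * \<bar>norm ((?y - ?y') $ j)\<bar>)"
  proof (intro sum_mono)
    fix j
    have "\<bar>norm (?y' $ j) - norm (?y $ j)\<bar> \<le> norm ((?y - ?y') $ j)"
      using norm_triangle_ineq3[of "?y' $ j" "?y $ j"] by (simp add: norm_minus_commute)
    then have "?q j * \<bar>norm (?y' $ j) - norm (?y $ j)\<bar> \<le> ?q j * norm ((?y - ?y') $ j)"
      by (intro mult_left_mono) auto
    moreover have "\<bar>(norm (?y' $ j))\<^sup>2 - (norm (?y $ j))\<^sup>2\<bar> = \<bar>?q j * (norm (?y' $ j) - norm (?y $ j))\<bar>"
      by (simp add: power2_eq_square algebra_simps)
    ultimately have "\<bar>(norm (?y' $ j))\<^sup>2 - (norm (?y $ j))\<^sup>2\<bar> \<le> ?q j * norm ((?y - ?y') $ j)"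
      by (simp add: abs_mult)
    then have "?d j * \<bar>(norm (?y' $ j))\<^sup>2 - (norm (?y $ j))\<^sup>2\<bar> \<le> ?d j * (?q j * norm ((?y - ?y') $ j))"
      by (intro mult_left_mono) auto
    then have "\<bar>(k $ j - k' $ j) * ((norm (?y' $ j))\<^sup>2 - (norm (?y $ j))\<^sup>2)\<bar>
        \<le> \<bar>?d j * ?q j\<bar> * \<bar>norm ((?y - ?y') $ j)\<bar>"
      by (simp add: abs_mult mult.assoc)
    then show "(k $ j - k' $ j) * ((norm (?y' $ j))\<^sup>2 - (norm (?y $ j))\<^sup>2)
        \<le> \<bar>?d j * ?q j\<bar> * \<bar>norm ((?y - ?y') $ j)\<bar>" by linarith
  qed
  also have "\<dots> \<le> L2_set (\<lambda>j. ?d j * ?q j) UNIV * L2_set (\<lambda>j. norm ((?y - ?y') $ j)) UNIV"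
    by (rule L2_set_mult_ineq)
  also have "L2_set (\<lambda>j. norm ((?y - ?y') $ j)) UNIV = norm (?y - ?y')"
    by (simp add: norm_vec_def)
  finally have "2 * norm (?y - ?y') * norm (?y - ?y')
      \<le> L2_set (\<lambda>j. ?d j * ?q j) UNIV * norm (?y - ?y')"
    by (simp add: power2_eq_square)
  then show ?thesis
    by (cases "norm (?y - ?y') = 0") (auto simp: mult_le_cancel_right)
qed

end


section \<open>Trajectories driven by a family of amplitudes\<close>

text \<open>For \<open>y = \<Psi> ** msqrt X\<close> this is the density \<open>rho \<Psi> (X_hat X z)\<close> of the sampled state.\<close>

definition sample_density :: "real^'n^'m \<Rightarrow> real^'n \<Rightarrow> real^'m" where
  "sample_density y z = (\<chi> j. (y $ j \<bullet> z)\<^sup>2)"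

lemma L2_set_sum_le: "finite S \<Longrightarrow> L2_set (\<lambda>i. \<Sum>s\<in>S. f s i) A \<le> (\<Sum>s\<in>S. L2_set (f s) A)"
proof (induction S rule: finite_induct)
  case (insert s S)
  have "L2_set (\<lambda>i. f s i + (\<Sum>s\<in>S. f s i)) A \<le> L2_set (f s) A + L2_set (\<lambda>i. \<Sum>s\<in>S. f s i) A"
    by (rule L2_set_triangle_ineq)
  then show ?case using insert by simp
qed (simp add: L2_set_def)

text \<open>Schur test with the amplitudes themselves as weights.\<close>

lemma schur_test:
  fixes W :: "'i::finite \<Rightarrow> 'j::finite \<Rightarrow> real"
  assumes W: "\<And>i j. 0 \<le> W i j" and K: "0 \<le> K"
    and q: "\<And>j. (\<Sum>i\<in>UNIV. W i j * (q i)\<^sup>2) \<le> K" and r: "\<And>i. (\<Sum>j\<in>UNIV. W i j * (r j)\<^sup>2) \<le> K"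
  shows "L2_set (\<lambda>i. q i * (\<Sum>j\<in>UNIV. W i j * (r j * x j))) UNIV \<le> K * L2_set x UNIV"
proof -
  have cs: "(\<Sum>j\<in>UNIV. W i j * (r j * x j))\<^sup>2 \<le> K * (\<Sum>j\<in>UNIV. W i j * (x j)\<^sup>2)" for i
  proof -
    have "(\<Sum>j\<in>UNIV. W i j * (r j * x j)) \<le> (\<Sum>j\<in>UNIV. \<bar>sqrt (W i j) * r j\<bar> * \<bar>sqrt (W i j) * x j\<bar>)"
      "- (\<Sum>j\<in>UNIV. W i j * (r j * x j)) \<le> (\<Sum>j\<in>UNIV. \<bar>sqrt (W i j) * r j\<bar> * \<bar>sqrt (W i j) * x j\<bar>)"
    proof -
      have *: "\<bar>sqrt (W i j) * r j\<bar> * \<bar>sqrt (W i j) * x j\<bar> = \<bar>W i j * (r j * x j)\<bar>" for j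
      proof -
        have "\<bar>a * r j\<bar> * \<bar>a * x j\<bar> = \<bar>(a * a) * (r j * x j)\<bar>" for a by (simp add: abs_mult)
        from this[of "sqrt (W i j)"] show ?thesis using W[of i j] by simp
      qed
      show "(\<Sum>j\<in>UNIV. W i j * (r j * x j)) \<le> (\<Sum>j\<in>UNIV. \<bar>sqrt (W i j) * r j\<bar> * \<bar>sqrt (W i j) * x j\<bar>)"
        unfolding * by (intro sum_mono) simp
      show "- (\<Sum>j\<in>UNIV. W i j * (r j * x j)) \<le> (\<Sum>j\<in>UNIV. \<bar>sqrt (W i j) * r j\<bar> * \<bar>sqrt (W i j) * x j\<bar>)"
        unfolding * sum_negf[symmetric] by (intro sum_mono) simp
    qed
    then have "\<bar>\<Sum>j\<in>UNIV. W i j * (r j * x j)\<bar> \<le> (\<Sum>j\<in>UNIV. \<bar>sqrt (W i j) * r j\<bar> * \<bar>sqrt (W i j) * x j\<bar>)"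
      by (rule abs_leI)
    also have "\<dots> \<le> L2_set (\<lambda>j. sqrt (W i j) * r j) UNIV * L2_set (\<lambda>j. sqrt (W i j) * x j) UNIV"
      by (rule L2_set_mult_ineq)
    finally have "\<bar>\<Sum>j\<in>UNIV. W i j * (r j * x j)\<bar>\<^sup>2
        \<le> (L2_set (\<lambda>j. sqrt (W i j) * r j) UNIV * L2_set (\<lambda>j. sqrt (W i j) * x j) UNIV)\<^sup>2"
      by (rule power_mono) simp
    then have "(\<Sum>j\<in>UNIV. W i j * (r j * x j))\<^sup>2
        \<le> (L2_set (\<lambda>j. sqrt (W i j) * r j) UNIV * L2_set (\<lambda>j. sqrt (W i j) * x j) UNIV)\<^sup>2"
      by (simp only: power2_abs)
    also have "\<dots> = (\<Sum>j\<in>UNIV. W i j * (r j)\<^sup>2) * (\<Sum>j\<in>UNIV. W i j * (x j)\<^sup>2)"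
      using W by (simp add: L2_set_def power_mult_distrib sum_nonneg)
    also have "\<dots> \<le> K * (\<Sum>j\<in>UNIV. W i j * (x j)\<^sup>2)"
      using r W by (intro mult_right_mono sum_nonneg mult_nonneg_nonneg) auto
    finally show ?thesis .
  qed
  have "(\<Sum>i\<in>UNIV. (q i * (\<Sum>j\<in>UNIV. W i j * (r j * x j)))\<^sup>2)
      \<le> (\<Sum>i\<in>UNIV. (q i)\<^sup>2 * (K * (\<Sum>j\<in>UNIV. W i j * (x j)\<^sup>2)))"
    unfolding power_mult_distrib using cs by (intro sum_mono mult_left_mono) auto
  also have "\<dots> = K * (\<Sum>i\<in>UNIV. \<Sum>j\<in>UNIV. W i j * (q i)\<^sup>2 * (x j)\<^sup>2)"
    by (simp add: sum_distrib_left mult_ac)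
  also have "\<dots> = K * (\<Sum>j\<in>UNIV. (\<Sum>i\<in>UNIV. W i j * (q i)\<^sup>2) * (x j)\<^sup>2)"
    by (subst sum.swap) (simp add: sum_distrib_right)
  also have "\<dots> \<le> K * (\<Sum>j\<in>UNIV. K * (x j)\<^sup>2)"
    using q K by (intro mult_left_mono sum_mono mult_right_mono) auto
  also have "\<dots> = (K * L2_set x UNIV)\<^sup>2"
    by (simp add: L2_set_def power_mult_distrib sum_nonneg sum_distrib_left[symmetric] power2_eq_square)
  finally have "(L2_set (\<lambda>i. q i * (\<Sum>j\<in>UNIV. W i j * (r j * x j))) UNIV)\<^sup>2 \<le> (K * L2_set x UNIV)\<^sup>2"
    by (simp add: L2_set_def sum_nonneg)
  then show ?thesis using K by (intro power2_le_imp_le[OF _ mult_nonneg_nonneg]) (auto simp: L2_set_nonneg)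
qed

text \<open>The properties of the proxies of one window that the comparison of trajectories uses, with
  \<open>Y k = amplitude k\<close>. The path below is the recursion of the algorithm driven by these amplitudes.\<close>

locale amplitude_family =
  fixes V :: "real^'m^'m" and Y :: "real^'m \<Rightarrow> real^'n^'m" and c \<tau> \<beta> :: real
  assumes V: "pos_semidef V" and \<beta>: "0 < \<beta>" and \<tau>: "1 \<le> \<tau>"
    and potential: "(\<Sum>j\<in>UNIV. \<bar>V $ i $ j\<bar> * (norm (Y k $ j))\<^sup>2) \<le> c"
    and trace: "(norm (Y k))\<^sup>2 \<le> \<tau>"
    and row: "norm (Y k $ j) \<le> 1"
    and lipschitz: "2 * norm (Y k - Y k')
      \<le> L2_set (\<lambda>j. \<bar>k $ j - k' $ j\<bar> * (norm (Y k $ j) + norm (Y k' $ j))) UNIV"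
begin

lemma c_nonneg: "0 \<le> c"
proof -
  have "0 \<le> (\<Sum>j\<in>UNIV. \<bar>V $ undefined $ j\<bar> * (norm (Y 0 $ j))\<^sup>2)" by (intro sum_nonneg) auto
  then show ?thesis using potential[of undefined 0] by linarith
qed

lemma V_sym: "V $ i $ j = V $ j $ i"
proof -
  have "V $ i $ j = transpose V $ j $ i" by (simp add: transpose_def)
  then show ?thesis using V by (simp add: pos_semidef_def)
qed

lemma potential_sum:
  "(\<Sum>j\<in>UNIV. \<bar>V $ i $ j\<bar> * (norm (Y k $ j) + norm (Y k' $ j))\<^sup>2) \<le> 4 * c"
proof -
  have "(\<Sum>j\<in>UNIV. \<bar>V $ i $ j\<bar> * (norm (Y k $ j) + norm (Y k' $ j))\<^sup>2)
    \<le> (\<Sum>j\<in>UNIV. 2 * (\<bar>V $ i $ j\<bar> * (norm (Y k $ j))\<^sup>2) + 2 * (\<bar>V $ i $ j\<bar> * (norm (Y k' $ j))\<^sup>2))"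
  proof (intro sum_mono)
    fix j
    have "(norm (Y k $ j) + norm (Y k' $ j))\<^sup>2 \<le> 2 * (norm (Y k $ j))\<^sup>2 + 2 * (norm (Y k' $ j))\<^sup>2"
      using zero_le_power2[of "norm (Y k $ j) - norm (Y k' $ j)"] by (simp add: power2_eq_square algebra_simps)
    from mult_left_mono[OF this, of "\<bar>V $ i $ j\<bar>"]
    show "\<bar>V $ i $ j\<bar> * (norm (Y k $ j) + norm (Y k' $ j))\<^sup>2
      \<le> 2 * (\<bar>V $ i $ j\<bar> * (norm (Y k $ j))\<^sup>2) + 2 * (\<bar>V $ i $ j\<bar> * (norm (Y k' $ j))\<^sup>2)"
      by (simp add: distrib_left mult.left_commute)
  qed
  also have "\<dots> \<le> 4 * c"
    using potential[of i k] potential[of i k'] by (simp add: sum.distrib sum_distrib_left[symmetric])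
  finally show ?thesis .
qed

lemma diag_amplitude: "sqrt (V $ i $ i) * norm (Y k $ i) \<le> sqrt c"
proof -
  have "\<bar>V $ i $ i\<bar> * (norm (Y k $ i))\<^sup>2 \<le> (\<Sum>j\<in>UNIV. \<bar>V $ i $ j\<bar> * (norm (Y k $ j))\<^sup>2)"
    by (rule member_le_sum[of i UNIV "\<lambda>j. \<bar>V $ i $ j\<bar> * (norm (Y k $ j))\<^sup>2"]) auto
  also have "\<dots> \<le> c" by (rule potential)
  finally have "V $ i $ i * (norm (Y k $ i))\<^sup>2 \<le> c" by (simp add: pos_semidef_diag_nonneg V)
  then have "sqrt (V $ i $ i * (norm (Y k $ i))\<^sup>2) \<le> sqrt c" by (rule real_sqrt_le_mono)
  then show ?thesis by (simp add: real_sqrt_mult)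
qed

primrec path :: "real \<Rightarrow> (nat \<Rightarrow> real^'n) \<Rightarrow> nat \<Rightarrow> real^'m" where
  "path \<gamma> \<zeta> 0 = 0"
| "path \<gamma> \<zeta> (Suc t) = (1 - \<gamma> / \<beta>) *\<^sub>R path \<gamma> \<zeta> t
     + \<gamma> *\<^sub>R (V *v sample_density (Y (path \<gamma> \<zeta> t)) (\<zeta> t))"

abbreviation density :: "real \<Rightarrow> (nat \<Rightarrow> real^'n) \<Rightarrow> nat \<Rightarrow> 'm \<Rightarrow> real" where
  "density \<gamma> \<zeta> t j \<equiv> sample_density (Y (path \<gamma> \<zeta> t)) (\<zeta> t) $ j"

lemma density_nonneg: "0 \<le> sample_density y z $ j"
  by (simp add: sample_density_def)

lemma path_bound:
  assumes "0 \<le> \<gamma>" "\<gamma> \<le> \<beta>"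
  shows "\<bar>path \<gamma> \<zeta> t $ i\<bar> \<le> \<gamma> * (\<Sum>s<t. \<Sum>j\<in>UNIV. \<bar>V $ i $ j\<bar> * density \<gamma> \<zeta> s j)"
proof (induction t)
  case (Suc t)
  have p: "0 \<le> 1 - \<gamma> / \<beta>" "1 - \<gamma> / \<beta> \<le> 1" using assms \<beta> by auto
  have "\<bar>(V *v sample_density (Y (path \<gamma> \<zeta> t)) (\<zeta> t)) $ i\<bar> \<le> (\<Sum>j\<in>UNIV. \<bar>V $ i $ j\<bar> * density \<gamma> \<zeta> t j)"
    unfolding matrix_vector_mult_def by (simp, rule order_trans[OF sum_abs]) (simp add: abs_mult density_nonneg)
  then have "\<bar>\<gamma> * (V *v sample_density (Y (path \<gamma> \<zeta> t)) (\<zeta> t)) $ i\<bar> \<le> \<gamma> * (\<Sum>j\<in>UNIV. \<bar>V $ i $ j\<bar> * density \<gamma> \<zeta> t j)"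
    using assms(1) by (simp add: abs_mult mult_left_mono)
  moreover have "\<bar>(1 - \<gamma> / \<beta>) * path \<gamma> \<zeta> t $ i\<bar> \<le> \<bar>path \<gamma> \<zeta> t $ i\<bar>"
    using p unfolding abs_mult by (intro mult_left_le_one_le) auto
  moreover have "path \<gamma> \<zeta> (Suc t) $ i = (1 - \<gamma> / \<beta>) * path \<gamma> \<zeta> t $ i
      + \<gamma> * (V *v sample_density (Y (path \<gamma> \<zeta> t)) (\<zeta> t)) $ i" by simp
  moreover have "\<gamma> * (\<Sum>s<Suc t. \<Sum>j\<in>UNIV. \<bar>V $ i $ j\<bar> * density \<gamma> \<zeta> s j)
      = \<gamma> * (\<Sum>s<t. \<Sum>j\<in>UNIV. \<bar>V $ i $ j\<bar> * density \<gamma> \<zeta> s j)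
      + \<gamma> * (\<Sum>j\<in>UNIV. \<bar>V $ i $ j\<bar> * density \<gamma> \<zeta> t j)"
    by (simp only: sum.lessThan_Suc distrib_left)
  ultimately show ?case using Suc by linarith
qed simp

text \<open>A change of the step size acts through the damping factor, the gain and the sampled densities. The
  damping costs nothing: the path is at most \<open>\<gamma>\<close> times the accumulated potential (\<open>path_bound\<close>), so
  what the damping adds is compensated by what it removes.\<close>

lemma path_difference:
  assumes "0 \<le> \<gamma>" "\<gamma> \<le> \<gamma>'" "\<gamma>' \<le> \<beta>"
  shows "\<bar>path \<gamma>' \<zeta> t $ i - path \<gamma> \<zeta> t $ i\<bar> \<le>
    (\<Sum>s<t. \<Sum>j\<in>UNIV. \<bar>V $ i $ j\<bar> * (\<gamma>' * \<bar>density \<gamma>' \<zeta> s j - density \<gamma> \<zeta> s j\<bar>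
      + (\<gamma>' - \<gamma>) * density \<gamma> \<zeta> s j))"
proof -
  define A where "A t = (\<Sum>s<t. \<Sum>j\<in>UNIV. \<bar>V $ i $ j\<bar> * (\<gamma>' * \<bar>density \<gamma>' \<zeta> s j - density \<gamma> \<zeta> s j\<bar>))" for t
  define e where "e t = (\<Sum>s<t. \<Sum>j\<in>UNIV. \<bar>V $ i $ j\<bar> * density \<gamma> \<zeta> s j)" for t
  have e0: "0 \<le> e t" for t unfolding e_def by (intro sum_nonneg mult_nonneg_nonneg density_nonneg) auto
  have A0: "0 \<le> A t" for t unfolding A_def using assms by (intro sum_nonneg mult_nonneg_nonneg) auto
  have p: "0 \<le> 1 - \<gamma>' / \<beta>" "0 \<le> \<gamma>' / \<beta>" using assms \<beta> by auto
  have "\<bar>path \<gamma>' \<zeta> t $ i - path \<gamma> \<zeta> t $ i\<bar> \<le> A t + (\<gamma>' - \<gamma>) * e t"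
  proof (induction t)
    case 0
    show ?case using A0[of 0] by (simp add: A_def e_def)
  next
    case (Suc t)
    let ?k = "path \<gamma> \<zeta> t" and ?k' = "path \<gamma>' \<zeta> t"
    let ?r = "sample_density (Y ?k) (\<zeta> t)" and ?r' = "sample_density (Y ?k') (\<zeta> t)"
    have split: "path \<gamma>' \<zeta> (Suc t) $ i - path \<gamma> \<zeta> (Suc t) $ i = (1 - \<gamma>' / \<beta>) * (?k' $ i - ?k $ i)
        - (\<gamma>' - \<gamma>) * (?k $ i / \<beta>) + \<gamma>' * ((V *v ?r') $ i - (V *v ?r) $ i) + (\<gamma>' - \<gamma>) * (V *v ?r) $ i"
      using \<beta> by (simp add: field_simps)
    have 1: "\<bar>(1 - \<gamma>' / \<beta>) * (?k' $ i - ?k $ i)\<bar> \<le> A t + (1 - \<gamma>' / \<beta>) * ((\<gamma>' - \<gamma>) * e t)"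
    proof -
      have "\<bar>(1 - \<gamma>' / \<beta>) * (?k' $ i - ?k $ i)\<bar> \<le> (1 - \<gamma>' / \<beta>) * (A t + (\<gamma>' - \<gamma>) * e t)"
        using Suc p by (simp add: abs_mult mult_left_mono)
      also have "(1 - \<gamma>' / \<beta>) * A t \<le> 1 * A t" using p A0 by (intro mult_right_mono) auto
      ultimately show ?thesis by (simp add: distrib_left)
    qed
    have 2: "\<bar>(\<gamma>' - \<gamma>) * (?k $ i / \<beta>)\<bar> \<le> (\<gamma>' - \<gamma>) * ((\<gamma>' / \<beta>) * e t)"
    proof -
      have "\<bar>?k $ i / \<beta>\<bar> \<le> (\<gamma> * e t) / \<beta>"
        using path_bound[of \<gamma> \<zeta> t i] assms \<beta> by (simp add: e_def abs_divide divide_right_mono)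
      also have "\<dots> \<le> (\<gamma>' / \<beta>) * e t"
        using assms \<beta> e0[of t] by (simp add: divide_right_mono mult_right_mono)
      finally have "(\<gamma>' - \<gamma>) * \<bar>?k $ i / \<beta>\<bar> \<le> (\<gamma>' - \<gamma>) * ((\<gamma>' / \<beta>) * e t)"
        using assms by (intro mult_left_mono) auto
      moreover have "\<bar>\<gamma>' - \<gamma>\<bar> = \<gamma>' - \<gamma>" using assms by simp
      ultimately show ?thesis by (simp only: abs_mult)
    qed
    have 3: "\<bar>\<gamma>' * ((V *v ?r') $ i - (V *v ?r) $ i)\<bar> \<le> (\<Sum>j\<in>UNIV. \<bar>V $ i $ j\<bar> * (\<gamma>' * \<bar>?r' $ j - ?r $ j\<bar>))"
    proof -
      have "\<gamma>' * ((V *v ?r') $ i - (V *v ?r) $ i) = (\<Sum>j\<in>UNIV. V $ i $ j * (\<gamma>' * (?r' $ j - ?r $ j)))"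
        by (simp add: matrix_vector_mult_def right_diff_distrib sum_subtractf sum_distrib_left mult.left_commute)
      then show ?thesis
        using assms by (simp only:) (rule order_trans[OF sum_abs], simp add: abs_mult)
    qed
    have 4: "\<bar>(\<gamma>' - \<gamma>) * (V *v ?r) $ i\<bar> \<le> (\<gamma>' - \<gamma>) * (\<Sum>j\<in>UNIV. \<bar>V $ i $ j\<bar> * ?r $ j)"
    proof -
      have "\<bar>(V *v ?r) $ i\<bar> \<le> (\<Sum>j\<in>UNIV. \<bar>V $ i $ j\<bar> * ?r $ j)"
        unfolding matrix_vector_mult_def by (simp, rule order_trans[OF sum_abs]) (simp add: abs_mult density_nonneg)
      then show ?thesis using assms by (simp add: abs_mult mult_left_mono)
    qed
    have "(1 - p) * (D * x) + D * (p * x) = D * x" for p D x :: real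
      by (simp add: algebra_simps)
    from this[of "\<gamma>' / \<beta>" "\<gamma>' - \<gamma>" "e t"]
    have "(1 - \<gamma>' / \<beta>) * ((\<gamma>' - \<gamma>) * e t) + (\<gamma>' - \<gamma>) * ((\<gamma>' / \<beta>) * e t) = (\<gamma>' - \<gamma>) * e t" .
    moreover have Ae: "A (Suc t) = A t + (\<Sum>j\<in>UNIV. \<bar>V $ i $ j\<bar> * (\<gamma>' * \<bar>?r' $ j - ?r $ j\<bar>))"
      "e (Suc t) = e t + (\<Sum>j\<in>UNIV. \<bar>V $ i $ j\<bar> * ?r $ j)"
      by (simp_all add: A_def e_def)
    moreover have "\<bar>path \<gamma>' \<zeta> (Suc t) $ i - path \<gamma> \<zeta> (Suc t) $ i\<bar>
      \<le> (A t + (1 - \<gamma>' / \<beta>) * ((\<gamma>' - \<gamma>) * e t)) + (\<gamma>' - \<gamma>) * ((\<gamma>' / \<beta>) * e t)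
        + (\<Sum>j\<in>UNIV. \<bar>V $ i $ j\<bar> * (\<gamma>' * \<bar>?r' $ j - ?r $ j\<bar>)) + (\<gamma>' - \<gamma>) * (\<Sum>j\<in>UNIV. \<bar>V $ i $ j\<bar> * ?r $ j)"
    proof -
      have tri: "\<bar>a - b + c + d\<bar> \<le> \<bar>a\<bar> + \<bar>b\<bar> + \<bar>c\<bar> + \<bar>d\<bar>" for a b c d :: real by linarith
      show ?thesis unfolding split by (rule order_trans[OF tri]) (intro add_mono 1 2 3 4)
    qed
    moreover have "(\<gamma>' - \<gamma>) * e (Suc t) = (\<gamma>' - \<gamma>) * e t + (\<gamma>' - \<gamma>) * (\<Sum>j\<in>UNIV. \<bar>V $ i $ j\<bar> * ?r $ j)"
      unfolding Ae(2) by (rule distrib_left)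
    ultimately show ?case by linarith
  qed
  then show ?thesis
    by (simp add: A_def e_def sum.distrib sum_distrib_left distrib_left mult_ac)
qed

text \<open>The amplitude change of a row, tested against the sample and normalized so that it is
  comparable to the change itself.\<close>

definition sampled_change :: "real^'n^'m \<Rightarrow> real^'n^'m \<Rightarrow> real^'n \<Rightarrow> real" where
  "sampled_change y y' z = L2_set (\<lambda>j. \<bar>(y' $ j - y $ j) \<bullet> z\<bar> * \<bar>(y $ j + y' $ j) \<bullet> z\<bar>
     / (norm (y $ j) + norm (y' $ j))) UNIV"

definition sampled_mass :: "real^'n^'m \<Rightarrow> real^'n \<Rightarrow> real" where
  "sampled_mass y z = (\<Sum>j\<in>UNIV. sqrt (V $ j $ j) * sample_density y z $ j)"

text \<open>The changes of the sampled densities are handled by the Schur test. For the change of the gain,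
  \<open>|V\<^sub>i\<^sub>j|\<close> is bounded by \<open>sqrt (V\<^sub>i\<^sub>i V\<^sub>j\<^sub>j)\<close> and \<open>sqrt V\<^sub>i\<^sub>i\<close> is absorbed by the amplitude of row \<open>i\<close>.\<close>

lemma amplitude_difference:
  assumes "0 \<le> \<gamma>" "\<gamma> \<le> \<gamma>'" "\<gamma>' \<le> \<beta>"
  shows "norm (Y (path \<gamma>' \<zeta> t) - Y (path \<gamma> \<zeta> t)) \<le>
    (\<Sum>s<t. 2 * \<gamma>' * c * sampled_change (Y (path \<gamma> \<zeta> s)) (Y (path \<gamma>' \<zeta> s)) (\<zeta> s)
       + (\<gamma>' - \<gamma>) * sqrt (c * real CARD('m)) * sampled_mass (Y (path \<gamma> \<zeta> s)) (\<zeta> s))"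
proof -
  let ?y = "\<lambda>s. Y (path \<gamma> \<zeta> s)" and ?y' = "\<lambda>s. Y (path \<gamma>' \<zeta> s)"
  let ?q = "\<lambda>i. norm (?y' t $ i) + norm (?y t $ i)"
  let ?r = "\<lambda>s j. norm (?y s $ j) + norm (?y' s $ j)"
  let ?x = "\<lambda>s j. \<bar>(?y' s $ j - ?y s $ j) \<bullet> \<zeta> s\<bar> * \<bar>(?y s $ j + ?y' s $ j) \<bullet> \<zeta> s\<bar> / ?r s j"
  let ?D = "\<lambda>s j. \<bar>density \<gamma>' \<zeta> s j - density \<gamma> \<zeta> s j\<bar>"
  have D: "?D s j = ?r s j * ?x s j" for s j
  proof (cases "?r s j = 0")
    case True
    then have "?y s $ j = 0" "?y' s $ j = 0"
      by (smt (verit, ccfv_SIG) norm_ge_zero norm_eq_zero)+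
    then show ?thesis by (simp add: sample_density_def)
  next
    case False
    have "density \<gamma>' \<zeta> s j - density \<gamma> \<zeta> s j = ((?y' s $ j - ?y s $ j) \<bullet> \<zeta> s) * ((?y s $ j + ?y' s $ j) \<bullet> \<zeta> s)"
      by (simp add: sample_density_def inner_diff_left inner_add_left power2_eq_square algebra_simps)
    then show ?thesis using False by (simp add: abs_mult)
  qed
  have "2 * norm (?y' t - ?y t) \<le> L2_set (\<lambda>i. \<bar>path \<gamma>' \<zeta> t $ i - path \<gamma> \<zeta> t $ i\<bar> * ?q i) UNIV"
    by (rule lipschitz)
  also have "\<dots> \<le> L2_set (\<lambda>i. \<Sum>s<t. \<gamma>' * (?q i * (\<Sum>j\<in>UNIV. \<bar>V $ i $ j\<bar> * (?r s j * ?x s j)))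
       + (\<gamma>' - \<gamma>) * (?q i * (\<Sum>j\<in>UNIV. \<bar>V $ i $ j\<bar> * density \<gamma> \<zeta> s j))) UNIV"
  proof (rule L2_set_mono)
    fix i
    have "\<bar>path \<gamma>' \<zeta> t $ i - path \<gamma> \<zeta> t $ i\<bar> * ?q i
      \<le> (\<Sum>s<t. \<Sum>j\<in>UNIV. \<bar>V $ i $ j\<bar> * (\<gamma>' * ?D s j + (\<gamma>' - \<gamma>) * density \<gamma> \<zeta> s j)) * ?q i"
      by (intro mult_right_mono path_difference assms) auto
    also have "\<dots> = (\<Sum>s<t. \<gamma>' * (?q i * (\<Sum>j\<in>UNIV. \<bar>V $ i $ j\<bar> * (?r s j * ?x s j)))
       + (\<gamma>' - \<gamma>) * (?q i * (\<Sum>j\<in>UNIV. \<bar>V $ i $ j\<bar> * density \<gamma> \<zeta> s j)))"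
      unfolding sum_distrib_right
    proof (intro sum.cong refl)
      fix s
      have "(\<Sum>j\<in>UNIV. \<bar>V $ i $ j\<bar> * (\<gamma>' * ?D s j + (\<gamma>' - \<gamma>) * density \<gamma> \<zeta> s j) * ?q i)
        = (\<Sum>j\<in>UNIV. \<gamma>' * (?q i * (\<bar>V $ i $ j\<bar> * ?D s j)) + (\<gamma>' - \<gamma>) * (?q i * (\<bar>V $ i $ j\<bar> * density \<gamma> \<zeta> s j)))"
        by (intro sum.cong refl) (simp add: algebra_simps)
      then show "(\<Sum>j\<in>UNIV. \<bar>V $ i $ j\<bar> * (\<gamma>' * ?D s j + (\<gamma>' - \<gamma>) * density \<gamma> \<zeta> s j) * ?q i)
        = \<gamma>' * (?q i * (\<Sum>j\<in>UNIV. \<bar>V $ i $ j\<bar> * (?r s j * ?x s j)))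
       + (\<gamma>' - \<gamma>) * (?q i * (\<Sum>j\<in>UNIV. \<bar>V $ i $ j\<bar> * density \<gamma> \<zeta> s j))"
        by (simp only: sum.distrib sum_distrib_left D)
    qed
    finally show "\<bar>path \<gamma>' \<zeta> t $ i - path \<gamma> \<zeta> t $ i\<bar> * ?q i \<le> \<dots>" .
  qed auto
  also have "\<dots> \<le> (\<Sum>s<t. L2_set (\<lambda>i. \<gamma>' * (?q i * (\<Sum>j\<in>UNIV. \<bar>V $ i $ j\<bar> * (?r s j * ?x s j)))
       + (\<gamma>' - \<gamma>) * (?q i * (\<Sum>j\<in>UNIV. \<bar>V $ i $ j\<bar> * density \<gamma> \<zeta> s j))) UNIV)"
    by (rule L2_set_sum_le) simp
  also have "\<dots> \<le> (\<Sum>s<t. \<gamma>' * (4 * c * sampled_change (?y s) (?y' s) (\<zeta> s))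
       + (\<gamma>' - \<gamma>) * (2 * sqrt (c * real CARD('m)) * sampled_mass (?y s) (\<zeta> s)))"
  proof (intro sum_mono order_trans[OF L2_set_triangle_ineq] add_mono)
    fix s
    have "L2_set (\<lambda>i. ?q i * (\<Sum>j\<in>UNIV. \<bar>V $ i $ j\<bar> * (?r s j * ?x s j))) UNIV \<le> 4 * c * L2_set (?x s) UNIV"
    proof (rule schur_test)
      show "(\<Sum>i\<in>UNIV. \<bar>V $ i $ j\<bar> * (?q i)\<^sup>2) \<le> 4 * c" for j
        using potential_sum[of j "path \<gamma>' \<zeta> t" "path \<gamma> \<zeta> t"] by (simp add: V_sym[of _ j])
    qed (use c_nonneg potential_sum in auto)
    then show "L2_set (\<lambda>i. \<gamma>' * (?q i * (\<Sum>j\<in>UNIV. \<bar>V $ i $ j\<bar> * (?r s j * ?x s j)))) UNIV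
       \<le> \<gamma>' * (4 * c * sampled_change (?y s) (?y' s) (\<zeta> s))"
      using assms by (subst L2_set_right_distrib[symmetric]) (auto simp: sampled_change_def intro!: mult_left_mono)
    have "?q i * (\<Sum>j\<in>UNIV. \<bar>V $ i $ j\<bar> * density \<gamma> \<zeta> s j) \<le> 2 * sqrt c * sampled_mass (?y s) (\<zeta> s)" for i
    proof -
      have q: "?q i * sqrt (V $ i $ i) \<le> 2 * sqrt c"
        using diag_amplitude[of i "path \<gamma>' \<zeta> t"] diag_amplitude[of i "path \<gamma> \<zeta> t"] by (simp add: algebra_simps)
      have "?q i * (\<Sum>j\<in>UNIV. \<bar>V $ i $ j\<bar> * density \<gamma> \<zeta> s j)
        \<le> ?q i * (\<Sum>j\<in>UNIV. (sqrt (V $ i $ i) * sqrt (V $ j $ j)) * density \<gamma> \<zeta> s j)"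
        by (intro mult_left_mono sum_mono mult_right_mono pos_semidef_entry_bound V density_nonneg) auto
      also have "\<dots> = (?q i * sqrt (V $ i $ i)) * sampled_mass (?y s) (\<zeta> s)"
        by (simp add: sampled_mass_def sum_distrib_left mult_ac)
      also have "\<dots> \<le> 2 * sqrt c * sampled_mass (?y s) (\<zeta> s)"
        using q by (intro mult_right_mono)
          (auto simp: sampled_mass_def intro!: sum_nonneg mult_nonneg_nonneg density_nonneg pos_semidef_diag_nonneg V)
      finally show ?thesis .
    qed
    then have "L2_set (\<lambda>i. ?q i * (\<Sum>j\<in>UNIV. \<bar>V $ i $ j\<bar> * density \<gamma> \<zeta> s j)) UNIV
      \<le> L2_set (\<lambda>i::'m. 2 * sqrt c * sampled_mass (?y s) (\<zeta> s)) UNIV"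
      by (intro L2_set_mono mult_nonneg_nonneg sum_nonneg density_nonneg) auto
    also have "\<dots> = sqrt (real CARD('m)) * (2 * sqrt c * sampled_mass (?y s) (\<zeta> s))"
    proof -
      have "0 \<le> 2 * sqrt c * sampled_mass (?y s) (\<zeta> s)"
        unfolding sampled_mass_def using c_nonneg
        by (intro mult_nonneg_nonneg sum_nonneg density_nonneg real_sqrt_ge_zero pos_semidef_diag_nonneg V) auto
      then show ?thesis by (subst L2_set_constant) auto
    qed
    also have "\<dots> = 2 * sqrt (c * real CARD('m)) * sampled_mass (?y s) (\<zeta> s)"
      by (simp add: real_sqrt_mult)
    finally show "L2_set (\<lambda>i. (\<gamma>' - \<gamma>) * (?q i * (\<Sum>j\<in>UNIV. \<bar>V $ i $ j\<bar> * density \<gamma> \<zeta> s j))) UNIV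
       \<le> (\<gamma>' - \<gamma>) * (2 * sqrt (c * real CARD('m)) * sampled_mass (?y s) (\<zeta> s))"
      using assms by (subst L2_set_right_distrib[symmetric]) (auto intro!: mult_left_mono)
  qed
  also have "\<dots> = 2 * (\<Sum>s<t. 2 * \<gamma>' * c * sampled_change (?y s) (?y' s) (\<zeta> s)
       + (\<gamma>' - \<gamma>) * sqrt (c * real CARD('m)) * sampled_mass (?y s) (\<zeta> s))"
    by (simp add: sum_distrib_left algebra_simps)
  finally show ?thesis by simp
qed

end


section \<open>Gaussian vectors\<close>

definition gaussian :: "(real^'n) measure" where
  "gaussian = density lborel std_gaussian_density"

lemma std_gaussian_density_norm:
  "std_gaussian_density (z :: real^'n) = (1 / sqrt (2 * pi)) ^ CARD('n) * exp (- (norm z)\<^sup>2 / 2)"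
proof -
  have "std_gaussian_density z = (\<Prod>i\<in>UNIV. (1 / sqrt (2 * pi)) * exp (- (z $ i)\<^sup>2 / 2))"
    by (simp add: std_gaussian_density_def std_normal_density_def)
  also have "\<dots> = (1 / sqrt (2 * pi)) ^ CARD('n) * (\<Prod>i\<in>UNIV. exp (- (z $ i)\<^sup>2 / 2))"
    by (subst prod.distrib) simp
  also have "(\<Prod>i\<in>UNIV. exp (- (z $ i)\<^sup>2 / 2)) = exp (\<Sum>i\<in>UNIV. - (z $ i)\<^sup>2 / 2)"
    by (simp add: exp_sum)
  also have "(\<Sum>i\<in>UNIV. - (z $ i)\<^sup>2 / 2) = - (norm z)\<^sup>2 / 2"
  proof -
    have "(norm z)\<^sup>2 = (\<Sum>i\<in>UNIV. (z $ i)\<^sup>2)"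
      unfolding power2_norm_eq_inner inner_vec_def by (simp add: power2_eq_square)
    then show ?thesis by (simp only:) (simp add: sum_negf sum_divide_distrib)
  qed
  finally show ?thesis .
qed

lemma std_gaussian_density_nonneg: "0 \<le> std_gaussian_density z"
  by (simp add: std_gaussian_density_norm)

lemma std_gaussian_density_measurable [measurable]:
  "(std_gaussian_density :: real^'n \<Rightarrow> real) \<in> borel_measurable borel"
proof -
  have "std_gaussian_density = (\<lambda>z :: real^'n. (1 / sqrt (2 * pi)) ^ CARD('n) * exp (- (norm z)\<^sup>2 / 2))"
    by (intro ext std_gaussian_density_norm)
  moreover have "(\<lambda>z :: real^'n. (1 / sqrt (2 * pi)) ^ CARD('n) * exp (- (norm z)\<^sup>2 / 2)) \<in> borel_measurable borel"
    by measurable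
  ultimately show ?thesis by (simp only:)
qed

lemma sets_gaussian [measurable_cong, simp]: "sets gaussian = sets borel"
  by (simp add: gaussian_def)

lemma space_gaussian [simp]: "space gaussian = UNIV"
  by (simp add: gaussian_def)

lemma std_gaussian_density_basis:
  "std_gaussian_density (z :: real^'n) = (\<Prod>b\<in>Basis. std_normal_density (z \<bullet> b))"
proof -
  have B: "(Basis :: (real^'n) set) = (\<lambda>i. axis i 1) ` UNIV" by (auto simp: Basis_vec_def)
  have "inj (\<lambda>i::'n. axis i (1::real))" by (auto simp: inj_on_def axis_eq_axis)
  then show ?thesis
    unfolding B by (subst prod.reindex) (auto simp: inner_axis std_gaussian_density_def)
qed

lemma prob_space_gaussian: "prob_space (gaussian :: (real^'n) measure)"
proof
  have "emeasure (gaussian :: (real^'n) measure) (space gaussian) = (\<integral>\<^sup>+z. ennreal (std_gaussian_density (z :: real^'n)) \<partial>lborel)"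
    unfolding gaussian_def by (subst emeasure_density) auto
  also have "\<dots> = (\<integral>\<^sup>+z. (\<Prod>b\<in>Basis. ennreal (std_normal_density ((z :: real^'n) \<bullet> b))) \<partial>lborel)"
    by (simp add: std_gaussian_density_basis prod_ennreal)
  also have "\<dots> = (\<Prod>b\<in>(Basis :: (real^'n) set). (\<integral>\<^sup>+x. ennreal (std_normal_density x) \<partial>lborel))"
    by (rule nn_integral_lborel_prod) auto
  also have "(\<integral>\<^sup>+x. ennreal (std_normal_density x) \<partial>lborel) = 1"
    by (subst nn_integral_eq_integral) (auto simp: integral_normal_density integrable_normal_density)
  finally show "emeasure (gaussian :: (real^'n) measure) (space gaussian) = 1" by simp
qed

lemma integral_lborel_prod:
  fixes F :: "'a::euclidean_space \<Rightarrow> real \<Rightarrow> complex"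
  assumes F: "\<And>b. b \<in> Basis \<Longrightarrow> integrable lborel (F b)"
  shows "(\<integral>z. (\<Prod>b\<in>Basis. F b (z \<bullet> b)) \<partial>lborel) = (\<Prod>b\<in>Basis. integral\<^sup>L lborel (F b))"
proof -
  interpret product_sigma_finite "\<lambda>_::'a. lborel :: real measure" by standard
  have [measurable]: "F b \<in> borel_measurable borel" if "b \<in> Basis" for b
    using borel_measurable_integrable[OF F[OF that]] by simp
  have "(\<integral>z. (\<Prod>b\<in>Basis. F b (z \<bullet> b)) \<partial>lborel)
      = (\<integral>f. (\<Prod>b\<in>Basis. F b ((\<Sum>b\<in>Basis. f b *\<^sub>R b) \<bullet> b)) \<partial>(\<Pi>\<^sub>M b\<in>Basis. lborel))"
    by (subst lborel_eq) (rule integral_distr; measurable)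
  also have "\<dots> = (\<integral>f. (\<Prod>b\<in>Basis. F b (f b)) \<partial>(\<Pi>\<^sub>M b\<in>Basis. lborel))"
    by (simp add: inner_sum_left_Basis)
  also have "\<dots> = (\<Prod>b\<in>Basis. integral\<^sup>L lborel (F b))"
    using F by (intro product_integral_prod) auto
  finally show ?thesis .
qed

text \<open>A linear functional of a standard Gaussian vector is a scaled standard normal variable: both
  have the characteristic function \<open>exp (- \<parallel>y\<parallel>\<^sup>2 t\<^sup>2 / 2)\<close>.\<close>

lemma distr_gaussian_inner:
  fixes y :: "real^'n"
  shows "distr gaussian borel (\<lambda>z. y \<bullet> z) = distr std_normal_distribution borel (\<lambda>x. norm y * x)"
    (is "?A = ?B")
proof (rule Levy_uniqueness)
  interpret G: prob_space "gaussian :: (real^'n) measure" by (rule prob_space_gaussian)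
  show "real_distribution ?A"
    by (intro G.real_distribution_distr) simp
  interpret S: real_distribution std_normal_distribution by (rule real_dist_normal_dist)
  show "real_distribution ?B"
    by (intro S.real_distribution_distr) simp
  have cn: "(\<integral>x. std_normal_density x *\<^sub>R iexp (s * x) \<partial>lborel) = complex_of_real (exp (- s\<^sup>2 / 2))" for s
    using fun_cong[OF char_std_normal_distribution, of s]
    by (simp add: char_def integral_density)
  show "char ?A = char ?B"
  proof
    fix t
    let ?F = "\<lambda>b x. std_normal_density x *\<^sub>R iexp ((t * (y \<bullet> b)) * x)"
    have int: "integrable lborel (?F b)" for b :: "real^'n"
    proof (rule Bochner_Integration.integrable_bound[OF integrable_normal_density[of 1 0]])
      show "AE x in lborel. norm (?F b x) \<le> norm (std_normal_density x)" by simp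
    qed auto
    have "char ?A t = (\<integral>z. iexp (t * (y \<bullet> z)) \<partial>gaussian)"
      unfolding char_def by (rule integral_distr) auto
    also have "\<dots> = (\<integral>z. std_gaussian_density z *\<^sub>R iexp (t * (y \<bullet> z)) \<partial>lborel)"
      unfolding gaussian_def by (rule integral_density) (auto simp: std_gaussian_density_nonneg)
    also have "\<dots> = (\<integral>z. (\<Prod>b\<in>Basis. ?F b (z \<bullet> b)) \<partial>lborel)"
    proof (rule Bochner_Integration.integral_cong[OF refl])
      fix z :: "real^'n"
      have "iexp (t * (y \<bullet> z)) = (\<Prod>b\<in>Basis. iexp ((t * (y \<bullet> b)) * (z \<bullet> b)))"
        by (subst euclidean_inner) (simp add: exp_sum[symmetric] sum_distrib_left mult_ac)
      then show "std_gaussian_density z *\<^sub>R iexp (t * (y \<bullet> z)) = (\<Prod>b\<in>Basis. ?F b (z \<bullet> b))"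
        by (simp add: std_gaussian_density_basis scaleR_conv_of_real prod.distrib)
    qed
    also have "\<dots> = (\<Prod>b\<in>(Basis :: (real^'n) set). complex_of_real (exp (- (t * (y \<bullet> b))\<^sup>2 / 2)))"
      by (simp only: integral_lborel_prod[OF int] cn)
    also have "\<dots> = complex_of_real (exp (- (t * norm y)\<^sup>2 / 2))"
    proof -
      have "(t * norm y)\<^sup>2 = (\<Sum>b\<in>Basis. (t * (y \<bullet> b))\<^sup>2)"
        unfolding power_mult_distrib power2_norm_eq_inner
        by (subst euclidean_inner) (simp add: sum_distrib_left power2_eq_square)
      then have e: "- (t * norm y)\<^sup>2 / 2 = (\<Sum>b\<in>Basis. - (t * (y \<bullet> b))\<^sup>2 / 2)"
        by (simp only: sum_negf sum_divide_distrib[symmetric])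
      show ?thesis unfolding e exp_sum[OF finite_Basis] by (simp only: of_real_prod)
    qed
    also have "\<dots> = char ?B t"
    proof -
      have "char ?B t = (\<integral>x. iexp (t * (norm y * x)) \<partial>std_normal_distribution)"
        unfolding char_def by (rule integral_distr) auto
      also have "\<dots> = char std_normal_distribution (t * norm y)"
        unfolding char_def by (simp add: mult.assoc)
      finally show ?thesis by (simp add: char_std_normal_distribution)
    qed
    finally show "char ?A t = char ?B t" .
  qed
qed

lemma nn_integral_gaussian_inner:
  fixes y :: "real^'n" and g :: "real \<Rightarrow> ennreal"
  assumes g [measurable]: "g \<in> borel_measurable borel"
  shows "(\<integral>\<^sup>+z. g (y \<bullet> z) \<partial>gaussian) = (\<integral>\<^sup>+x. ennreal (std_normal_density x) * g (norm y * x) \<partial>lborel)"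
proof -
  have "(\<integral>\<^sup>+z. g (y \<bullet> z) \<partial>gaussian) = (\<integral>\<^sup>+x. g x \<partial>distr gaussian borel (\<lambda>z. y \<bullet> z))"
    by (simp add: nn_integral_distr)
  also have "\<dots> = (\<integral>\<^sup>+x. g (norm y * x) \<partial>std_normal_distribution)"
    unfolding distr_gaussian_inner by (simp add: nn_integral_distr)
  also have "\<dots> = (\<integral>\<^sup>+x. ennreal (std_normal_density x) * g (norm y * x) \<partial>lborel)"
    by (simp add: nn_integral_density)
  finally show ?thesis .
qed

lemma gaussian_even_moment:
  "(\<integral>\<^sup>+z. ennreal ((y \<bullet> z) ^ (2 * k)) \<partial>gaussian) = ennreal (norm y ^ (2 * k) * (fact (2 * k) / (2 ^ k * fact k)))"
  for y :: "real^'n"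
proof -
  have "(\<integral>\<^sup>+z. ennreal ((y \<bullet> z) ^ (2 * k)) \<partial>gaussian)
      = (\<integral>\<^sup>+x. ennreal (std_normal_density x) * ennreal ((norm y * x) ^ (2 * k)) \<partial>lborel)"
    by (rule nn_integral_gaussian_inner) simp
  also have "\<dots> = (\<integral>\<^sup>+x. ennreal (norm y ^ (2 * k) * (std_normal_density x * x ^ (2 * k))) \<partial>lborel)"
    by (intro nn_integral_cong) (simp add: ennreal_mult'[symmetric] power_mult_distrib mult_ac)
  also have "\<dots> = ennreal (\<integral>x. norm y ^ (2 * k) * (std_normal_density x * x ^ (2 * k)) \<partial>lborel)"
    using std_normal_moment_even[of k]
    by (intro nn_integral_eq_integral) (auto simp: has_bochner_integral_iff intro!: AE_I2 mult_nonneg_nonneg zero_le_even_power)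
  also have "\<dots> = ennreal (norm y ^ (2 * k) * (fact (2 * k) / (2 ^ k * fact k)))"
    using std_normal_moment_even[of k] by (simp add: has_bochner_integral_iff)
  finally show ?thesis .
qed

lemma gaussian_moment_4: "(\<integral>\<^sup>+z. ennreal ((y \<bullet> z) ^ 4) \<partial>gaussian) = ennreal (3 * norm y ^ 4)" for y :: "real^'n"
  using gaussian_even_moment[of y 2] by (simp add: fact_numeral mult.commute)

lemma gaussian_moment_8: "(\<integral>\<^sup>+z. ennreal ((y \<bullet> z) ^ 8) \<partial>gaussian) = ennreal (105 * norm y ^ 8)" for y :: "real^'n"
  using gaussian_even_moment[of y 4] by (simp add: fact_numeral mult.commute)

text \<open>The integrand is an unnormalized normal density with variance \<open>1 / (1 - 2 v \<parallel>y\<parallel>\<^sup>2)\<close>.\<close>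

lemma gaussian_exp_square:
  fixes y :: "real^'n"
  assumes v: "2 * v * (norm y)\<^sup>2 < 1"
  shows "(\<integral>\<^sup>+z. ennreal (exp (v * (y \<bullet> z)\<^sup>2)) \<partial>gaussian) = ennreal (1 / sqrt (1 - 2 * v * (norm y)\<^sup>2))"
proof -
  define q where "q = 1 - 2 * v * (norm y)\<^sup>2"
  have q: "0 < q" using v by (simp add: q_def)
  define s where "s = 1 / sqrt q"
  have s: "0 < s" "s\<^sup>2 = 1 / q" using q by (auto simp: s_def power_divide)
  have eq: "std_normal_density x * exp (v * (norm y * x)\<^sup>2) = s * normal_density 0 s x" for x
  proof -
    have "s * normal_density 0 s x = 1 / sqrt (2 * pi) * exp (- x\<^sup>2 / (2 * s\<^sup>2))"
    proof -
      have "sqrt (2 * pi * s\<^sup>2) = sqrt (2 * pi) * s" using s(1) by (simp add: real_sqrt_mult)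
      then show ?thesis using s(1) unfolding normal_density_def by simp
    qed
    also have "- x\<^sup>2 / (2 * s\<^sup>2) = - x\<^sup>2 / 2 + v * (norm y * x)\<^sup>2"
      using q s(2) by (simp add: q_def power_mult_distrib algebra_simps diff_divide_distrib)
    finally have "s * normal_density 0 s x = 1 / sqrt (2 * pi) * exp (- x\<^sup>2 / 2 + v * (norm y * x)\<^sup>2)" .
    then show ?thesis by (simp only: exp_add std_normal_density_def mult.assoc)
  qed
  have "(\<integral>\<^sup>+z. ennreal (exp (v * (y \<bullet> z)\<^sup>2)) \<partial>gaussian)
     = (\<integral>\<^sup>+x. ennreal (std_normal_density x) * ennreal (exp (v * (norm y * x)\<^sup>2)) \<partial>lborel)"
    by (rule nn_integral_gaussian_inner) simp
  also have "\<dots> = (\<integral>\<^sup>+x. ennreal (s * normal_density 0 s x) \<partial>lborel)"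
    by (intro nn_integral_cong) (simp add: ennreal_mult'[symmetric] eq)
  also have "\<dots> = ennreal (\<integral>x. s * normal_density 0 s x \<partial>lborel)"
    using s by (intro nn_integral_eq_integral) (auto intro!: AE_I2)
  also have "\<dots> = ennreal s" using s by simp
  finally show ?thesis by (simp add: s_def q_def)
qed


section \<open>Square-integrable functions\<close>

definition L2_le :: "'a measure \<Rightarrow> ('a \<Rightarrow> real) \<Rightarrow> real \<Rightarrow> bool" where
  "L2_le N f p \<longleftrightarrow> f \<in> borel_measurable N \<and> 0 \<le> p \<and> (\<integral>\<^sup>+x. ennreal ((f x)\<^sup>2) \<partial>N) \<le> ennreal (p\<^sup>2)"

lemma L2_leD:
  "L2_le N f p \<Longrightarrow> f \<in> borel_measurable N" "L2_le N f p \<Longrightarrow> 0 \<le> p"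
  "L2_le N f p \<Longrightarrow> (\<integral>\<^sup>+x. ennreal ((f x)\<^sup>2) \<partial>N) \<le> ennreal (p\<^sup>2)"
  by (auto simp: L2_le_def)

lemma L2_le_mono:
  assumes g: "L2_le N g p" and "f \<in> borel_measurable N" "\<And>x. x \<in> space N \<Longrightarrow> \<bar>f x\<bar> \<le> \<bar>g x\<bar>" "p \<le> q"
  shows "L2_le N f q"
proof -
  have "(\<integral>\<^sup>+x. ennreal ((f x)\<^sup>2) \<partial>N) \<le> (\<integral>\<^sup>+x. ennreal ((g x)\<^sup>2) \<partial>N)"
    using assms(3) by (intro nn_integral_mono ennreal_leI) (simp add: abs_le_square_iff)
  also have "\<dots> \<le> ennreal (p\<^sup>2)" using g by (rule L2_leD)
  also have "\<dots> \<le> ennreal (q\<^sup>2)" using assms(4) L2_leD(2)[OF g] by (intro ennreal_leI power_mono)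
  finally show ?thesis using assms L2_leD(2)[OF g] by (simp add: L2_le_def)
qed

lemma L2_le_zero: "L2_le N (\<lambda>x. 0) 0"
  by (simp add: L2_le_def)

lemma L2_le_scale:
  assumes f: "L2_le N f p"
  shows "L2_le N (\<lambda>x. a * f x) (\<bar>a\<bar> * p)"
proof -
  have [measurable]: "f \<in> borel_measurable N" using f by (rule L2_leD)
  have "(\<integral>\<^sup>+x. ennreal ((a * f x)\<^sup>2) \<partial>N) = ennreal (a\<^sup>2) * (\<integral>\<^sup>+x. ennreal ((f x)\<^sup>2) \<partial>N)"
    by (subst nn_integral_cmult[symmetric]) (auto simp: power_mult_distrib ennreal_mult')
  also have "\<dots> \<le> ennreal (a\<^sup>2) * ennreal (p\<^sup>2)" using f by (intro mult_left_mono L2_leD) auto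
  also have "\<dots> = ennreal ((\<bar>a\<bar> * p)\<^sup>2)" by (simp add: power_mult_distrib ennreal_mult')
  finally show ?thesis using L2_leD(2)[OF f] by (simp add: L2_le_def)
qed

text \<open>Minkowski's inequality, obtained from the weighted inequality \<open>(a + b)\<^sup>2 \<le> (1 + q/p) a\<^sup>2 + (1 + p/q) b\<^sup>2\<close>.\<close>

lemma L2_le_add:
  assumes f: "L2_le N f p" and g: "L2_le N g q"
  shows "L2_le N (\<lambda>x. f x + g x) (p + q)"
proof -
  have [measurable]: "f \<in> borel_measurable N" "g \<in> borel_measurable N" using f g by (auto intro: L2_leD)
  have pq: "0 \<le> p" "0 \<le> q" using f g by (auto intro: L2_leD)
  have null: "AE x in N. h x = 0" if "L2_le N h 0" for h
  proof -
    have [measurable]: "h \<in> borel_measurable N" using that by (rule L2_leD)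
    have "(\<integral>\<^sup>+x. ennreal ((h x)\<^sup>2) \<partial>N) = 0" using L2_leD(3)[OF that] by simp
    then have "AE x in N. ennreal ((h x)\<^sup>2) = 0" by (subst (asm) nn_integral_0_iff_AE) auto
    then show ?thesis by eventually_elim (simp add: ennreal_eq_0_iff)
  qed
  have "(\<integral>\<^sup>+x. ennreal ((f x + g x)\<^sup>2) \<partial>N) \<le> ennreal ((p + q)\<^sup>2)"
  proof (cases "p = 0 \<or> q = 0")
    case True
    then consider "p = 0" | "q = 0" by blast
    then show ?thesis
    proof cases
      case 1
      have "(\<integral>\<^sup>+x. ennreal ((f x + g x)\<^sup>2) \<partial>N) = (\<integral>\<^sup>+x. ennreal ((g x)\<^sup>2) \<partial>N)"
        using null[of f] f 1 by (intro nn_integral_cong_AE) (auto elim: eventually_mono)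
      then show ?thesis using L2_leD(3)[OF g] 1 by simp
    next
      case 2
      have "(\<integral>\<^sup>+x. ennreal ((f x + g x)\<^sup>2) \<partial>N) = (\<integral>\<^sup>+x. ennreal ((f x)\<^sup>2) \<partial>N)"
        using null[of g] g 2 by (intro nn_integral_cong_AE) (auto elim: eventually_mono)
      then show ?thesis using L2_leD(3)[OF f] 2 by simp
    qed
  next
    case False
    then have p: "0 < p" "0 < q" using pq by auto
    have *: "(a + b)\<^sup>2 \<le> ((p + q) / p) * a\<^sup>2 + ((p + q) / q) * b\<^sup>2" for a b
    proof -
      have "((p + q) / p) * a\<^sup>2 + ((p + q) / q) * b\<^sup>2 - (a + b)\<^sup>2 = (q * a - p * b)\<^sup>2 / (p * q)"
        using p by (simp add: field_simps power2_eq_square)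
      also have "\<dots> \<ge> 0" using p by simp
      finally show ?thesis by simp
    qed
    have "(\<integral>\<^sup>+x. ennreal ((f x + g x)\<^sup>2) \<partial>N)
      \<le> (\<integral>\<^sup>+x. ennreal ((p + q) / p) * ennreal ((f x)\<^sup>2) + ennreal ((p + q) / q) * ennreal ((g x)\<^sup>2) \<partial>N)"
      using * p by (intro nn_integral_mono) (simp add: ennreal_mult'[symmetric] ennreal_plus[symmetric] del: ennreal_plus)
    also have "\<dots> = ennreal ((p + q) / p) * (\<integral>\<^sup>+x. ennreal ((f x)\<^sup>2) \<partial>N) + ennreal ((p + q) / q) * (\<integral>\<^sup>+x. ennreal ((g x)\<^sup>2) \<partial>N)"
      by (subst nn_integral_add) (auto simp: nn_integral_cmult)
    also have "\<dots> \<le> ennreal ((p + q) / p) * ennreal (p\<^sup>2) + ennreal ((p + q) / q) * ennreal (q\<^sup>2)"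
      using f g by (intro add_mono mult_left_mono L2_leD) auto
    also have "\<dots> = ennreal ((p + q) / p * p\<^sup>2 + (p + q) / q * q\<^sup>2)"
      using p by (simp add: ennreal_mult'[symmetric] ennreal_plus[symmetric] del: ennreal_plus)
    also have "(p + q) / p * p\<^sup>2 + (p + q) / q * q\<^sup>2 = (p + q)\<^sup>2"
    proof -
      have "(p + q) / p * p\<^sup>2 = (p + q) * p" "(p + q) / q * q\<^sup>2 = (p + q) * q"
        using p by (simp_all add: power2_eq_square)
      then show ?thesis by (simp add: power2_eq_square algebra_simps)
    qed
    finally show ?thesis .
  qed
  then show ?thesis using pq by (simp add: L2_le_def)
qed

lemma L2_le_sum:
  "finite I \<Longrightarrow> (\<And>i. i \<in> I \<Longrightarrow> L2_le N (f i) (p i)) \<Longrightarrow> L2_le N (\<lambda>x. \<Sum>i\<in>I. f i x) (\<Sum>i\<in>I. p i)"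
proof (induction I rule: finite_induct)
  case (insert i I)
  then show ?case using L2_le_add[of N "f i" "p i"] by simp
qed (simp add: L2_le_zero)

lemma L2_le_abs: "L2_le N f p \<Longrightarrow> L2_le N (\<lambda>x. \<bar>f x\<bar>) p"
  by (auto simp: L2_le_def)

lemma L2_le_const: "prob_space N \<Longrightarrow> 0 \<le> a \<Longrightarrow> L2_le N (\<lambda>x. a) a"
  by (simp add: L2_le_def prob_space.emeasure_space_1)

lemma nn_integral_mult_L2:
  assumes f: "L2_le N f p" and g: "L2_le N g q" and nn: "\<And>x. 0 \<le> f x" "\<And>x. 0 \<le> g x"
  shows "(\<integral>\<^sup>+x. ennreal (f x * g x) \<partial>N) \<le> ennreal (p * q)"
proof -
  have [measurable]: "f \<in> borel_measurable N" "g \<in> borel_measurable N" using f g by (auto intro: L2_leD)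
  have pq: "0 \<le> p" "0 \<le> q" using f g by (auto intro: L2_leD)
  have key: "(\<integral>\<^sup>+x. ennreal (f x * g x) \<partial>N) \<le> ennreal (p' * q')" if p: "0 < p'" "0 < q'" "p \<le> p'" "q \<le> q'" for p' q'
  proof -
    have *: "a * b \<le> (q' / (2 * p')) * a\<^sup>2 + (p' / (2 * q')) * b\<^sup>2" for a b
    proof -
      have "(q' / (2 * p')) * a\<^sup>2 + (p' / (2 * q')) * b\<^sup>2 - a * b = (q' * a - p' * b)\<^sup>2 / (2 * p' * q')"
        using p by (simp add: field_simps power2_eq_square)
      also have "\<dots> \<ge> 0" using p by simp
      finally show ?thesis by simp
    qed
    have "(\<integral>\<^sup>+x. ennreal (f x * g x) \<partial>N)
      \<le> (\<integral>\<^sup>+x. ennreal (q' / (2 * p')) * ennreal ((f x)\<^sup>2) + ennreal (p' / (2 * q')) * ennreal ((g x)\<^sup>2) \<partial>N)"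
      using * p by (intro nn_integral_mono) (simp add: ennreal_mult'[symmetric] ennreal_plus[symmetric] del: ennreal_plus)
    also have "\<dots> = ennreal (q' / (2 * p')) * (\<integral>\<^sup>+x. ennreal ((f x)\<^sup>2) \<partial>N) + ennreal (p' / (2 * q')) * (\<integral>\<^sup>+x. ennreal ((g x)\<^sup>2) \<partial>N)"
      by (subst nn_integral_add) (auto simp: nn_integral_cmult)
    also have "\<dots> \<le> ennreal (q' / (2 * p')) * ennreal (p'\<^sup>2) + ennreal (p' / (2 * q')) * ennreal (q'\<^sup>2)"
      using p pq by (intro add_mono mult_left_mono order_trans[OF L2_leD(3)[OF f]] order_trans[OF L2_leD(3)[OF g]]
          ennreal_leI power_mono) auto
    also have "\<dots> = ennreal (p' * q')"
      using p by (simp add: ennreal_mult'[symmetric] ennreal_plus[symmetric] power2_eq_square field_simps del: ennreal_plus)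
    finally show ?thesis .
  qed
  have "(\<lambda>n. ennreal ((p + inverse (real (Suc n))) * (q + inverse (real (Suc n))))) \<longlonglongrightarrow> ennreal ((p + 0) * (q + 0))"
    by (intro tendsto_ennrealI tendsto_intros LIMSEQ_inverse_real_of_nat)
  moreover have "(\<integral>\<^sup>+x. ennreal (f x * g x) \<partial>N) \<le> ennreal ((p + inverse (real (Suc n))) * (q + inverse (real (Suc n))))" for n
    using pq by (intro key) (auto intro: add_nonneg_pos)
  ultimately show ?thesis by (intro LIMSEQ_le_const) auto
qed

lemma gaussian_measurable_inner [measurable]: "(\<lambda>z. y \<bullet> z) \<in> borel_measurable gaussian"
  by (simp add: measurable_cong_sets[OF sets_gaussian])

lemma exp_weighted_sum:
  fixes x \<pi> :: "'j \<Rightarrow> real"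
  assumes "finite J" "\<And>j. j \<in> J \<Longrightarrow> 0 \<le> \<pi> j" "(\<Sum>j\<in>J. \<pi> j) \<le> 1"
  shows "exp (\<Sum>j\<in>J. \<pi> j * x j) \<le> (1 - (\<Sum>j\<in>J. \<pi> j)) + (\<Sum>j\<in>J. \<pi> j * exp (x j))"
proof -
  let ?P = "\<Sum>j\<in>J. \<pi> j" and ?m = "\<Sum>j\<in>J. \<pi> j * x j"
  (* the tangent of exp at the mean lies below exp *)
  have t: "exp ?m * (1 + (u - ?m)) \<le> exp u" for u
  proof -
    have "exp ?m * (1 + (u - ?m)) \<le> exp ?m * exp (u - ?m)"
      by (intro mult_left_mono exp_ge_add_one_self) auto
    then show ?thesis by (simp add: exp_diff)
  qed
  have "exp ?m = (1 - ?P) * (exp ?m * (1 + (0 - ?m))) + (\<Sum>j\<in>J. \<pi> j * (exp ?m * (1 + (x j - ?m))))"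
  proof -
    have "(\<Sum>j\<in>J. \<pi> j * (1 + (x j - k))) = ?P + ?m - ?P * k" for k
      by (simp add: algebra_simps sum.distrib sum_subtractf sum_distrib_left)
    then have "(\<Sum>j\<in>J. \<pi> j * (exp ?m * (1 + (x j - ?m)))) = exp ?m * (?P + ?m - ?P * ?m)"
      by (simp only: mult.left_commute[of "\<pi> _" "exp ?m"] sum_distrib_left[symmetric])
    then show ?thesis by (simp only:) (simp add: algebra_simps)
  qed
  also have "\<dots> \<le> (1 - ?P) * exp 0 + (\<Sum>j\<in>J. \<pi> j * exp (x j))"
    using assms by (intro add_mono mult_left_mono sum_mono t) auto
  finally show ?thesis by simp
qed

text \<open>Convexity of the exponential, with the missing weight placed at zero. It takes the place of
  independence when the summands are functionals of the same Gaussian vector.\<close>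

lemma nn_integral_exp_weighted_sum:
  fixes \<pi> :: "'j \<Rightarrow> real"
  assumes N: "prob_space N" and J: "finite J" "\<And>j. j \<in> J \<Longrightarrow> 0 \<le> \<pi> j" "(\<Sum>j\<in>J. \<pi> j) \<le> 1"
    and x: "\<And>j. j \<in> J \<Longrightarrow> x j \<in> borel_measurable N"
    and e: "\<And>j. j \<in> J \<Longrightarrow> (\<integral>\<^sup>+z. ennreal (exp (x j z)) \<partial>N) \<le> ennreal (1 + K j)" and K: "\<And>j. 0 \<le> K j"
  shows "(\<integral>\<^sup>+z. ennreal (exp (\<Sum>j\<in>J. \<pi> j * x j z)) \<partial>N) \<le> ennreal (1 + (\<Sum>j\<in>J. \<pi> j * K j))"
proof -
  note [measurable] = x
  let ?P = "\<Sum>j\<in>J. \<pi> j"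
  have "(\<integral>\<^sup>+z. ennreal (exp (\<Sum>j\<in>J. \<pi> j * x j z)) \<partial>N)
    \<le> (\<integral>\<^sup>+z. ennreal (1 - ?P) + (\<Sum>j\<in>J. ennreal (\<pi> j) * ennreal (exp (x j z))) \<partial>N)"
  proof (rule nn_integral_mono)
    fix z
    have "(\<Sum>j\<in>J. ennreal (\<pi> j) * ennreal (exp (x j z))) = ennreal (\<Sum>j\<in>J. \<pi> j * exp (x j z))"
      using J by (subst sum_ennreal[symmetric]) (auto simp: ennreal_mult' intro!: sum.cong)
    then have "ennreal (1 - ?P) + (\<Sum>j\<in>J. ennreal (\<pi> j) * ennreal (exp (x j z)))
        = ennreal ((1 - ?P) + (\<Sum>j\<in>J. \<pi> j * exp (x j z)))"
      using J by (simp add: ennreal_plus sum_nonneg)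
    then show "ennreal (exp (\<Sum>j\<in>J. \<pi> j * x j z)) \<le> ennreal (1 - ?P) + (\<Sum>j\<in>J. ennreal (\<pi> j) * ennreal (exp (x j z)))"
      using exp_weighted_sum[OF J] by (simp add: ennreal_leI)
  qed
  also have "\<dots> = ennreal (1 - ?P) + (\<Sum>j\<in>J. ennreal (\<pi> j) * (\<integral>\<^sup>+z. ennreal (exp (x j z)) \<partial>N))"
    using prob_space.emeasure_space_1[OF N] by (subst nn_integral_add) (auto simp: nn_integral_sum nn_integral_cmult)
  also have "\<dots> \<le> ennreal (1 - ?P) + (\<Sum>j\<in>J. ennreal (\<pi> j) * ennreal (1 + K j))"
    using e by (intro add_left_mono sum_mono mult_left_mono) auto
  also have "\<dots> = ennreal ((1 - ?P) + (\<Sum>j\<in>J. \<pi> j * (1 + K j)))"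
  proof -
    have "(\<Sum>j\<in>J. ennreal (\<pi> j) * ennreal (1 + K j)) = ennreal (\<Sum>j\<in>J. \<pi> j * (1 + K j))"
    proof -
      have "(\<Sum>j\<in>J. ennreal (\<pi> j) * ennreal (1 + K j)) = (\<Sum>j\<in>J. ennreal (\<pi> j * (1 + K j)))"
        using J by (intro sum.cong refl) (simp only: ennreal_mult')
      then show ?thesis using J K by (simp only: sum_ennreal mult_nonneg_nonneg add_nonneg_nonneg zero_le_one)
    qed
    then show ?thesis using J K by (simp add: ennreal_plus sum_nonneg)
  qed
  also have "(1 - ?P) + (\<Sum>j\<in>J. \<pi> j * (1 + K j)) = 1 + (\<Sum>j\<in>J. \<pi> j * K j)"
    by (simp add: distrib_left sum.distrib)
  finally show ?thesis .
qed

lemma gaussian_square_square: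
  fixes u v :: "real^'n"
  shows "L2_le gaussian (\<lambda>z. (u \<bullet> z) * (v \<bullet> z)) (sqrt 3 * (norm u * norm v))"
proof (cases "u = 0 \<or> v = 0")
  case True
  then show ?thesis using L2_le_zero[of gaussian] by auto
next
  case False
  define s where "s = (norm v)\<^sup>2 / (norm u)\<^sup>2"
  have s: "0 < s" using False by (simp add: s_def)
  have *: "((u \<bullet> z) * (v \<bullet> z))\<^sup>2 \<le> (s / 2) * (u \<bullet> z) ^ 4 + (1 / (2 * s)) * (v \<bullet> z) ^ 4" for z
  proof -
    have "(s / 2) * (u \<bullet> z) ^ 4 + (1 / (2 * s)) * (v \<bullet> z) ^ 4 - ((u \<bullet> z) * (v \<bullet> z))\<^sup>2
      = (s * (u \<bullet> z)\<^sup>2 - (v \<bullet> z)\<^sup>2)\<^sup>2 / (2 * s)"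
      using s by (simp add: field_simps power2_eq_square power4_eq_xxxx)
    also have "\<dots> \<ge> 0" using s by simp
    finally show ?thesis by simp
  qed
  have "(\<integral>\<^sup>+z. ennreal (((u \<bullet> z) * (v \<bullet> z))\<^sup>2) \<partial>gaussian)
    \<le> (\<integral>\<^sup>+z. ennreal (s / 2) * ennreal ((u \<bullet> z) ^ 4) + ennreal (1 / (2 * s)) * ennreal ((v \<bullet> z) ^ 4) \<partial>gaussian)"
    using * s by (intro nn_integral_mono) (simp add: ennreal_mult'[symmetric] ennreal_plus[symmetric] del: ennreal_plus)
  also have "\<dots> = ennreal (s / 2) * ennreal (3 * norm u ^ 4) + ennreal (1 / (2 * s)) * ennreal (3 * norm v ^ 4)"
    by (subst nn_integral_add) (auto simp: nn_integral_cmult gaussian_moment_4)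
  also have "\<dots> = ennreal ((sqrt 3 * (norm u * norm v))\<^sup>2)"
    using s False by (simp add: ennreal_mult'[symmetric] ennreal_plus[symmetric] power_mult_distrib s_def
       field_simps power2_eq_square power4_eq_xxxx del: ennreal_plus)
  finally show ?thesis by (simp add: L2_le_def)
qed

text \<open>The square of the integrand is bounded pointwise by an average of eighth powers; the eighth moment of
  a standard normal variable is 105.\<close>

lemma gaussian_density_density:
  fixes u v w :: "real^'n"
  shows "L2_le gaussian (\<lambda>z. (u \<bullet> z) * (v \<bullet> z) * (w \<bullet> z)\<^sup>2) (sqrt 105 * (norm u * norm v * (norm w)\<^sup>2))"
proof -
  have unit: "(\<integral>\<^sup>+z. ennreal (((u \<bullet> z) * (v \<bullet> z) * (w \<bullet> z)\<^sup>2)\<^sup>2) \<partial>gaussian) \<le> ennreal 105"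
    if n: "norm u = 1" "norm v = 1" "norm w = 1" for u v w :: "real^'n"
  proof -
    define q h :: real where "q = 1 / 4" and "h = 1 / 2"
    have q: "0 \<le> q" "0 \<le> h" by (auto simp: q_def h_def)
    have *: "((a * b * c\<^sup>2)\<^sup>2) \<le> q * a ^ 8 + (q * b ^ 8 + h * c ^ 8)" for a b c :: real
    proof -
      have "q * a ^ 8 + (q * b ^ 8 + h * c ^ 8) - (a * b * c\<^sup>2)\<^sup>2
        = (1/4) * (a ^ 4 - b ^ 4)\<^sup>2 + (1/2) * (a\<^sup>2 * b\<^sup>2 - c ^ 4)\<^sup>2"
        by (simp add: q_def h_def power2_eq_square algebra_simps eval_nat_numeral)
      also have "\<dots> \<ge> 0" by simp
      finally show ?thesis by simp
    qed
    have "(\<integral>\<^sup>+z. ennreal (((u \<bullet> z) * (v \<bullet> z) * (w \<bullet> z)\<^sup>2)\<^sup>2) \<partial>gaussian)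
      \<le> (\<integral>\<^sup>+z. ennreal q * ennreal ((u \<bullet> z) ^ 8) + (ennreal q * ennreal ((v \<bullet> z) ^ 8)
          + ennreal h * ennreal ((w \<bullet> z) ^ 8)) \<partial>gaussian)"
      using * q by (intro nn_integral_mono) (simp add: ennreal_mult'[symmetric] ennreal_plus[symmetric] del: ennreal_plus)
    also have "\<dots> = ennreal q * ennreal 105 + (ennreal q * ennreal 105 + ennreal h * ennreal 105)"
      by (subst nn_integral_add; (subst nn_integral_add)?) (auto simp: nn_integral_cmult gaussian_moment_8 n)
    also have "\<dots> = ennreal (q * 105 + (q * 105 + h * 105))"
      by (simp only: ennreal_plus ennreal_mult' q mult_nonneg_nonneg add_nonneg_nonneg zero_le_numeral)
    also have "q * 105 + (q * 105 + h * 105) = 105" by (simp add: q_def h_def)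
    finally show ?thesis .
  qed
  show ?thesis
  proof (cases "u = 0 \<or> v = 0 \<or> w = 0")
    case True
    then show ?thesis using L2_le_zero[of gaussian] by auto
  next
    case False
    let ?u = "(1 / norm u) *\<^sub>R u" and ?v = "(1 / norm v) *\<^sub>R v" and ?w = "(1 / norm w) *\<^sub>R w"
    have "L2_le gaussian (\<lambda>z. (?u \<bullet> z) * (?v \<bullet> z) * (?w \<bullet> z)\<^sup>2) (sqrt 105)"
      unfolding L2_le_def using unit[of ?u ?v ?w] False by simp
    from L2_le_scale[OF this, of "norm u * norm v * (norm w)\<^sup>2"]
    show ?thesis using False by (simp add: power2_eq_square field_simps abs_mult)
  qed
qed


section \<open>Independent samples\<close>

text \<open>Functionals of the noise sequence that only look at the samples before time \<open>t\<close>.\<close>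

definition adapted :: "nat \<Rightarrow> ((nat \<Rightarrow> real^'n) \<Rightarrow> 's::topological_space) \<Rightarrow> bool" where
  "adapted t S \<longleftrightarrow> (\<exists>g \<in> borel_measurable (\<Pi>\<^sub>M i\<in>{..<t}. borel). \<forall>\<zeta>. S \<zeta> = g (restrict \<zeta> {..<t}))"

lemma adapted_mono:
  assumes "adapted t S" "t \<le> t'"
  shows "adapted t' S"
proof -
  obtain g where g: "g \<in> borel_measurable (\<Pi>\<^sub>M i\<in>{..<t}. borel)" "\<And>\<zeta>. S \<zeta> = g (restrict \<zeta> {..<t})"
    using assms by (auto simp: adapted_def)
  have "(\<lambda>\<zeta>. g (restrict \<zeta> {..<t})) \<in> borel_measurable (\<Pi>\<^sub>M i\<in>{..<t'}. borel)"
    using assms(2) by (intro measurable_compose[OF measurable_restrict_subset g(1)]) auto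
  moreover have "S \<zeta> = g (restrict (restrict \<zeta> {..<t'}) {..<t})" for \<zeta>
    using assms(2) by (simp add: g(2) Int_absorb1)
  ultimately show ?thesis
    unfolding adapted_def by (intro bexI[of _ "\<lambda>\<zeta>. g (restrict \<zeta> {..<t})"] allI)
qed

lemma adapted_comp:
  assumes "adapted t S" "h \<in> borel_measurable borel"
  shows "adapted t (\<lambda>\<zeta>. h (S \<zeta>))"
proof -
  obtain g where g: "g \<in> borel_measurable (\<Pi>\<^sub>M i\<in>{..<t}. borel)" "\<And>\<zeta>. S \<zeta> = g (restrict \<zeta> {..<t})"
    using assms by (auto simp: adapted_def)
  have "(\<lambda>x. h (g x)) \<in> borel_measurable (\<Pi>\<^sub>M i\<in>{..<t}. borel)"
    by (rule measurable_compose[OF g(1) assms(2)])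
  then show ?thesis unfolding adapted_def using g(2) by (intro bexI[of _ "\<lambda>x. h (g x)"]) auto
qed

lemma adapted_Pair:
  fixes S1 :: "(nat \<Rightarrow> real^'n) \<Rightarrow> 's::second_countable_topology"
    and S2 :: "(nat \<Rightarrow> real^'n) \<Rightarrow> 't::second_countable_topology"
  assumes "adapted t S1" "adapted t S2"
  shows "adapted t (\<lambda>\<zeta>. (S1 \<zeta>, S2 \<zeta>))"
proof -
  obtain g1 g2 where g: "g1 \<in> borel_measurable (\<Pi>\<^sub>M i\<in>{..<t}. borel)" "\<And>\<zeta>. S1 \<zeta> = g1 (restrict \<zeta> {..<t})"
    "g2 \<in> borel_measurable (\<Pi>\<^sub>M i\<in>{..<t}. borel)" "\<And>\<zeta>. S2 \<zeta> = g2 (restrict \<zeta> {..<t})"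
    using assms by (auto simp: adapted_def)
  have "(\<lambda>x. (g1 x, g2 x)) \<in> borel_measurable (\<Pi>\<^sub>M i\<in>{..<t}. borel)"
    using g(1,3) by (rule borel_measurable_Pair)
  then show ?thesis unfolding adapted_def using g(2,4) by (intro bexI[of _ "\<lambda>x. (g1 x, g2 x)"]) auto
qed

lemma adapted_sample: "s < t \<Longrightarrow> adapted t (\<lambda>\<zeta>. \<zeta> s)"
  unfolding adapted_def by (intro bexI[of _ "\<lambda>x. x s"]) auto

lemma adapted_const: "adapted t (\<lambda>\<zeta>. a)"
  unfolding adapted_def by (intro bexI[of _ "\<lambda>x. a"]) auto

locale gaussian_sequence = prob_space M for M :: "'w measure" +
  fixes z :: "nat \<Rightarrow> 'w \<Rightarrow> real^'n" and T :: nat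
  assumes indep: "indep_vars (\<lambda>_. borel) z {..<T}"
    and law: "t < T \<Longrightarrow> distr M borel (z t) = gaussian"
begin

abbreviation sample :: "'w \<Rightarrow> nat \<Rightarrow> real^'n" where
  "sample \<omega> \<equiv> \<lambda>i. z i \<omega>"

lemma z_measurable: "t < T \<Longrightarrow> z t \<in> borel_measurable M"
  using indep by (auto simp: indep_vars_def)

lemma adapted_measurable:
  assumes "adapted t S" "t \<le> T"
  shows "(\<lambda>\<omega>. S (sample \<omega>)) \<in> borel_measurable M"
proof -
  obtain g where g: "g \<in> borel_measurable (\<Pi>\<^sub>M i\<in>{..<t}. borel)" "\<And>\<zeta>. S \<zeta> = g (restrict \<zeta> {..<t})"
    using assms by (auto simp: adapted_def)
  have "(\<lambda>\<omega>. restrict (sample \<omega>) {..<t}) \<in> measurable M (\<Pi>\<^sub>M i\<in>{..<t}. borel)"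
    using assms(2) by (intro measurable_restrict z_measurable) auto
  from measurable_compose[OF this g(1)] show ?thesis by (simp add: g(2))
qed

text \<open>The sample at time \<open>t\<close> is independent of the past and can be integrated out first.\<close>

lemma nn_integral_adapted:
  fixes S :: "(nat \<Rightarrow> real^'n) \<Rightarrow> 's::second_countable_topology" and F :: "'s \<Rightarrow> real^'n \<Rightarrow> ennreal"
  assumes S: "adapted t S" and t: "t < T" and F: "(\<lambda>p. F (fst p) (snd p)) \<in> borel_measurable borel"
  shows "(\<integral>\<^sup>+\<omega>. F (S (sample \<omega>)) (z t \<omega>) \<partial>M) = (\<integral>\<^sup>+\<omega>. (\<integral>\<^sup>+x. F (S (sample \<omega>)) x \<partial>gaussian) \<partial>M)"
proof -
  obtain g where g: "g \<in> borel_measurable (\<Pi>\<^sub>M i\<in>{..<t}. borel)" "\<And>\<zeta>. S \<zeta> = g (restrict \<zeta> {..<t})"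
    using S by (auto simp: adapted_def)
  let ?PA = "\<Pi>\<^sub>M i\<in>{..<t}. (borel :: (real^'n) measure)" and ?PB = "\<Pi>\<^sub>M i\<in>{t}. (borel :: (real^'n) measure)"
  let ?A = "\<lambda>\<omega>. restrict (sample \<omega>) {..<t}" and ?B = "\<lambda>\<omega>. restrict (sample \<omega>) {t}"
  have ind: "indep_var ?PA ?A ?PB ?B"
    using indep t by (intro indep_var_restrict[of "\<lambda>_. borel" z "{..<T}"]) auto
  then have Am [measurable]: "?A \<in> measurable M ?PA" and Bm [measurable]: "?B \<in> measurable M ?PB"
    and eq: "distr M ?PA ?A \<Otimes>\<^sub>M distr M ?PB ?B = distr M (?PA \<Otimes>\<^sub>M ?PB) (\<lambda>\<omega>. (?A \<omega>, ?B \<omega>))"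
    unfolding indep_var_distribution_eq by auto
  have Fm: "(\<lambda>p. F (fst p) (snd p)) \<in> borel_measurable (borel \<Otimes>\<^sub>M borel)" using F by (simp add: borel_prod)
  have gm: "(\<lambda>p. (g (fst p), snd p t)) \<in> measurable (?PA \<Otimes>\<^sub>M ?PB) (borel \<Otimes>\<^sub>M borel)"
  proof (rule measurable_Pair)
    show "(\<lambda>p. g (fst p)) \<in> borel_measurable (?PA \<Otimes>\<^sub>M ?PB)"
      by (rule measurable_compose[OF measurable_fst g(1)])
    show "(\<lambda>p. snd p t) \<in> borel_measurable (?PA \<Otimes>\<^sub>M ?PB)"
      by (rule measurable_compose[OF measurable_snd measurable_component_singleton]) simp
  qed
  have Gm [measurable]: "(\<lambda>p. F (g (fst p)) (snd p t)) \<in> borel_measurable (?PA \<Otimes>\<^sub>M ?PB)"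
    using measurable_compose[OF gm Fm] by simp
  interpret B: prob_space "distr M ?PB ?B" by (rule prob_space_distr) (rule Bm)
  have inner: "(\<integral>\<^sup>+b. F s (b t) \<partial>distr M ?PB ?B) = (\<integral>\<^sup>+x. F s x \<partial>gaussian)" for s
  proof -
    have m1: "F s \<in> borel_measurable borel"
      using measurable_compose[OF measurable_Pair1' Fm, of s] by simp
    have m2: "(\<lambda>b. F s (b t)) \<in> borel_measurable ?PB"
    proof -
      have "(\<lambda>b. b t) \<in> borel_measurable ?PB" by (rule measurable_component_singleton) simp
      from measurable_compose[OF this m1] show ?thesis .
    qed
    have "(\<integral>\<^sup>+b. F s (b t) \<partial>distr M ?PB ?B) = (\<integral>\<^sup>+\<omega>. F s (z t \<omega>) \<partial>M)"
      using m2 by (subst nn_integral_distr[OF Bm]) simp_all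
    also have "\<dots> = (\<integral>\<^sup>+x. F s x \<partial>gaussian)"
      unfolding law[OF t, symmetric] using m1 by (subst nn_integral_distr[OF z_measurable[OF t]]) simp_all
    finally show ?thesis .
  qed
  have "(\<integral>\<^sup>+\<omega>. F (S (sample \<omega>)) (z t \<omega>) \<partial>M)
      = (\<integral>\<^sup>+p. F (g (fst p)) (snd p t) \<partial>distr M (?PA \<Otimes>\<^sub>M ?PB) (\<lambda>\<omega>. (?A \<omega>, ?B \<omega>)))"
    by (subst nn_integral_distr) (auto simp: g(2))
  also have "\<dots> = (\<integral>\<^sup>+a. \<integral>\<^sup>+b. F (g a) (b t) \<partial>distr M ?PB ?B \<partial>distr M ?PA ?A)"
    unfolding eq[symmetric] by (subst B.nn_integral_fst[symmetric]) (simp_all cong: measurable_cong_sets sets_pair_measure_cong)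
  also have "\<dots> = (\<integral>\<^sup>+a. (\<integral>\<^sup>+x. F (g a) x \<partial>gaussian) \<partial>distr M ?PA ?A)"
    by (simp only: inner)
  also have "\<dots> = (\<integral>\<^sup>+\<omega>. (\<integral>\<^sup>+x. F (S (sample \<omega>)) x \<partial>gaussian) \<partial>M)"
  proof (subst nn_integral_distr[OF Am])
    interpret G: prob_space "gaussian :: (real^'n) measure" by (rule prob_space_gaussian)
    have "(\<lambda>p. F (fst p) (snd p)) \<in> borel_measurable (borel \<Otimes>\<^sub>M gaussian)"
      using Fm by (simp cong: measurable_cong_sets sets_pair_measure_cong)
    from G.borel_measurable_nn_integral_fst[OF this]
    have "(\<lambda>s. \<integral>\<^sup>+x. F s x \<partial>gaussian) \<in> borel_measurable borel" by simp
    from measurable_compose[OF g(1) this]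
    show "(\<lambda>a. \<integral>\<^sup>+x. F (g a) x \<partial>gaussian) \<in> borel_measurable (distr M ?PA ?A)" by simp
  qed (simp add: g(2))
  finally show ?thesis .
qed

lemma L2_le_adapted:
  fixes S :: "(nat \<Rightarrow> real^'n) \<Rightarrow> 's::second_countable_topology" and F :: "'s \<Rightarrow> real^'n \<Rightarrow> real"
  assumes S: "adapted t S" and t: "t < T" and F: "(\<lambda>p. F (fst p) (snd p)) \<in> borel_measurable borel"
    and cond: "\<And>s. L2_le gaussian (F s) (p s)" and p: "L2_le M (\<lambda>\<omega>. p (S (sample \<omega>))) q"
  shows "L2_le M (\<lambda>\<omega>. F (S (sample \<omega>)) (z t \<omega>)) q"
proof -
  have Sm: "(\<lambda>\<omega>. S (sample \<omega>)) \<in> borel_measurable M" using t by (intro adapted_measurable[OF S]) auto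
  have m: "(\<lambda>\<omega>. F (S (sample \<omega>)) (z t \<omega>)) \<in> borel_measurable M"
    using measurable_compose[OF borel_measurable_Pair[OF Sm z_measurable[OF t]] F] by simp
  have "(\<integral>\<^sup>+\<omega>. ennreal ((F (S (sample \<omega>)) (z t \<omega>))\<^sup>2) \<partial>M)
     = (\<integral>\<^sup>+\<omega>. (\<integral>\<^sup>+x. ennreal ((F (S (sample \<omega>)) x)\<^sup>2) \<partial>gaussian) \<partial>M)"
    using F by (intro nn_integral_adapted[OF S t]) measurable
  also have "\<dots> \<le> (\<integral>\<^sup>+\<omega>. ennreal ((p (S (sample \<omega>)))\<^sup>2) \<partial>M)"
    using cond by (intro nn_integral_mono L2_leD)
  also have "\<dots> \<le> ennreal (q\<^sup>2)" using p by (rule L2_leD)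
  finally show ?thesis using m L2_leD(2)[OF p] by (simp add: L2_le_def)
qed

end

lemma (in amplitude_family) Y_lipschitz: "norm (Y k - Y k') \<le> norm (k - k')"
proof -
  have "2 * norm (Y k - Y k') \<le> L2_set (\<lambda>j. \<bar>k $ j - k' $ j\<bar> * (norm (Y k $ j) + norm (Y k' $ j))) UNIV"
    by (rule lipschitz)
  also have "\<dots> \<le> L2_set (\<lambda>j. 2 * \<bar>k $ j - k' $ j\<bar>) UNIV"
  proof (rule L2_set_mono)
    fix j
    have "\<bar>k $ j - k' $ j\<bar> * (norm (Y k $ j) + norm (Y k' $ j)) \<le> \<bar>k $ j - k' $ j\<bar> * 2"
      using row[of k j] row[of k' j] by (intro mult_left_mono) auto
    then show "\<bar>k $ j - k' $ j\<bar> * (norm (Y k $ j) + norm (Y k' $ j)) \<le> 2 * \<bar>k $ j - k' $ j\<bar>" by simp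
  qed auto
  also have "\<dots> = 2 * norm (k - k')"
    by (subst L2_set_right_distrib[symmetric]) (auto simp: norm_vec_def)
  finally show ?thesis by simp
qed

lemma (in amplitude_family) Y_continuous: "continuous_on UNIV Y"
proof (rule continuous_onI)
  fix k e assume "0 < (e :: real)"
  moreover have "dist (Y k') (Y k) \<le> dist k' k" for k'
    using Y_lipschitz[of k' k] by (simp add: dist_norm)
  ultimately show "\<exists>d>0. \<forall>k'\<in>UNIV. dist k' k < d \<longrightarrow> dist (Y k') (Y k) \<le> e"
    by (intro exI[of _ e]) (auto intro: order_trans less_imp_le)
qed

lemma sample_density_continuous:
  "continuous_on S f \<Longrightarrow> continuous_on S g \<Longrightarrow> continuous_on S (\<lambda>x. sample_density (f x) (g x))"
  unfolding sample_density_def by (intro continuous_intros)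

lemma matrix_vector_continuous:
  "continuous_on S f \<Longrightarrow> continuous_on S (\<lambda>x. V *v f x)" for V :: "real^'n^'m"
  unfolding matrix_vector_mult_def by (intro continuous_intros)

lemma (in amplitude_family) path_continuous: "continuous_on UNIV (\<lambda>\<gamma>. path \<gamma> \<zeta> t)"
proof (induction t)
  case (Suc t)
  have "continuous_on UNIV (\<lambda>\<gamma>. Y (path \<gamma> \<zeta> t))"
    using continuous_on_compose2[OF Y_continuous Suc] by simp
  then show ?case using Suc \<beta>
    by (simp, intro continuous_intros matrix_vector_continuous sample_density_continuous) auto
qed simp

lemma (in amplitude_family) path_adapted: "adapted t (\<lambda>\<zeta>. path \<gamma> \<zeta> t)"
proof (induction t)
  case 0
  then show ?case by (simp add: adapted_const)
next
  case (Suc t)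
  have a: "adapted (Suc t) (\<lambda>\<zeta>. (path \<gamma> \<zeta> t, \<zeta> t))"
    by (intro adapted_Pair adapted_mono[OF Suc] adapted_sample) auto
  have "continuous_on UNIV (\<lambda>p. (1 - \<gamma> / \<beta>) *\<^sub>R fst p + \<gamma> *\<^sub>R (V *v sample_density (Y (fst p)) (snd p)))"
    by (intro continuous_intros matrix_vector_continuous sample_density_continuous
        continuous_on_compose2[OF Y_continuous]) auto
  from adapted_comp[OF a borel_measurable_continuous_onI[OF this]]
  show ?case by simp
qed


section \<open>Scores along a trajectory\<close>

lemma L2_le_weaken: "L2_le N f p \<Longrightarrow> p \<le> q \<Longrightarrow> L2_le N f q"
  by (rule L2_le_mono) (auto simp: L2_le_def)

lemma (in amplitude_family) sampled_mass_L2: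
  assumes mass: "(\<Sum>j\<in>UNIV. sqrt (V $ j $ j) * (norm (y $ j))\<^sup>2) \<le> m"
  shows "L2_le gaussian (sampled_mass y) (sqrt 3 * m)"
proof -
  have "L2_le gaussian (\<lambda>z. \<Sum>j\<in>UNIV. sqrt (V $ j $ j) * ((y $ j \<bullet> z) * (y $ j \<bullet> z)))
     (\<Sum>j\<in>UNIV. \<bar>sqrt (V $ j $ j)\<bar> * (sqrt 3 * (norm (y $ j) * norm (y $ j))))"
    by (intro L2_le_sum L2_le_scale gaussian_square_square) auto
  moreover have "(\<lambda>z. \<Sum>j\<in>UNIV. sqrt (V $ j $ j) * ((y $ j \<bullet> z) * (y $ j \<bullet> z))) = sampled_mass y"
    by (simp add: sampled_mass_def sample_density_def power2_eq_square fun_eq_iff)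
  moreover have "(\<Sum>j\<in>UNIV. \<bar>sqrt (V $ j $ j)\<bar> * (sqrt 3 * (norm (y $ j) * norm (y $ j))))
      = sqrt 3 * (\<Sum>j\<in>UNIV. sqrt (V $ j $ j) * (norm (y $ j))\<^sup>2)"
    by (simp add: sum_distrib_left power2_eq_square pos_semidef_diag_nonneg V mult_ac)
  ultimately have "L2_le gaussian (sampled_mass y) (sqrt 3 * (\<Sum>j\<in>UNIV. sqrt (V $ j $ j) * (norm (y $ j))\<^sup>2))"
    by (simp only:)
  then show ?thesis by (rule L2_le_weaken) (use mass in simp)
qed

lemma (in amplitude_family) sampled_change_L2:
  "L2_le gaussian (sampled_change y y') (sqrt 3 * norm (y' - y))" for y y' :: "real^'n^'m"
proof -
  let ?f = "\<lambda>j z. \<bar>(y' $ j - y $ j) \<bullet> z\<bar> * \<bar>(y $ j + y' $ j) \<bullet> z\<bar> / (norm (y $ j) + norm (y' $ j))"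
  have f: "L2_le gaussian (?f j) (sqrt 3 * norm ((y' - y) $ j))" for j
  proof (cases "norm (y $ j) + norm (y' $ j) = 0")
    case True
    then have "?f j = (\<lambda>z. 0)" by (simp add: fun_eq_iff)
    then show ?thesis using L2_le_mono[OF L2_le_zero[of gaussian], of "\<lambda>z. 0" "sqrt 3 * norm ((y' - y) $ j)"] by simp
  next
    case False
    let ?r = "norm (y $ j) + norm (y' $ j)"
    have r: "0 < ?r" using False norm_ge_zero[of "y $ j"] norm_ge_zero[of "y' $ j"] by linarith
    have "L2_le gaussian (\<lambda>z. (1 / ?r) * (((y' $ j - y $ j) \<bullet> z) * ((y $ j + y' $ j) \<bullet> z)))
       (\<bar>1 / ?r\<bar> * (sqrt 3 * (norm (y' $ j - y $ j) * norm (y $ j + y' $ j))))"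
      by (intro L2_le_scale gaussian_square_square)
    from L2_le_abs[OF this] have "L2_le gaussian (?f j) (\<bar>1 / ?r\<bar> * (sqrt 3 * (norm (y' $ j - y $ j) * norm (y $ j + y' $ j))))"
      using r by (simp add: abs_mult)
    moreover have "\<bar>1 / ?r\<bar> * (sqrt 3 * (norm (y' $ j - y $ j) * norm (y $ j + y' $ j))) \<le> sqrt 3 * norm ((y' - y) $ j)"
    proof -
      have "norm (y' $ j - y $ j) * norm (y $ j + y' $ j) \<le> norm (y' $ j - y $ j) * ?r"
        by (intro mult_left_mono norm_triangle_ineq) auto
      then show ?thesis using r by (simp add: divide_le_eq mult.assoc)
    qed
    ultimately show ?thesis by (rule L2_le_weaken)
  qed
  define g where "g = ?f"
  have g: "L2_le gaussian (g j) (sqrt 3 * norm ((y' - y) $ j))" for j unfolding g_def by (rule f)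
  have [measurable]: "g j \<in> borel_measurable gaussian" for j using g by (rule L2_leD)
  have eq: "sampled_change y y' = (\<lambda>z. sqrt (\<Sum>j\<in>UNIV. (g j z)\<^sup>2))"
    by (simp add: sampled_change_def L2_set_def g_def fun_eq_iff)
  have "(\<integral>\<^sup>+z. ennreal ((sampled_change y y' z)\<^sup>2) \<partial>gaussian) = (\<integral>\<^sup>+z. (\<Sum>j\<in>UNIV. ennreal ((g j z)\<^sup>2)) \<partial>gaussian)"
    unfolding eq by (intro nn_integral_cong) (simp add: sum_nonneg)
  also have "\<dots> = (\<Sum>j\<in>UNIV. (\<integral>\<^sup>+z. ennreal ((g j z)\<^sup>2) \<partial>gaussian))"
    by (rule nn_integral_sum) measurable
  also have "\<dots> \<le> (\<Sum>j\<in>UNIV. ennreal ((sqrt 3 * norm ((y' - y) $ j))\<^sup>2))"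
    using g by (intro sum_mono L2_leD)
  also have "\<dots> = ennreal ((sqrt 3 * norm (y' - y))\<^sup>2)"
    by (simp add: norm_matrix_square power_mult_distrib sum_distrib_left)
  finally show ?thesis unfolding L2_le_def by (simp add: eq)
qed

lemma geometric_growth: "(r - 1) * (\<Sum>i<s. \<sigma> * r ^ i) + \<sigma> = \<sigma> * r ^ s" for r \<sigma> :: real
  by (induction s) (simp_all add: algebra_simps)

text \<open>A score is the contribution of one time step to a quantity that is to be controlled. The exponential
  moment yields concentration for a fixed step size; it is assumed for twice the score, so that
  \<open>exp (score)\<close> is square integrable. The Lipschitz estimate compares two step sizes. The number \<open>\<mu>\<close>
  measures how strongly the gain of the recursion is felt by the amplitudes.\<close>

locale scored_family = amplitude_family V Y c \<tau> \<beta> + gaussian_sequence M z T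
  for V :: "real^'m^'m" and Y :: "real^'m \<Rightarrow> real^'n^'m" and c \<tau> \<beta> :: real
    and M :: "'w measure" and z :: "nat \<Rightarrow> 'w \<Rightarrow> real^'n" and T :: nat +
  fixes b :: "real^'n^'m \<Rightarrow> real^'n \<Rightarrow> real" and h L \<mu> \<Gamma> :: real
  assumes b_continuous: "continuous_on UNIV (\<lambda>p. b (fst p) (snd p))"
    and L: "0 \<le> L" and \<mu>: "0 \<le> \<mu>" and \<Gamma>: "0 \<le> \<Gamma>" "\<Gamma> \<le> \<beta>"
    and b_lipschitz: "L2_le gaussian (\<lambda>x. b (Y k) x - b (Y k') x) (L * norm (Y k - Y k'))"
    and b_exp: "(\<integral>\<^sup>+x. ennreal (exp (2 * b (Y k) x)) \<partial>gaussian) \<le> ennreal (exp (2 * h))"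
    and mass: "(\<Sum>j\<in>UNIV. sqrt (V $ j $ j) * (norm (Y k $ j))\<^sup>2) \<le> sqrt c * \<mu>"
begin

definition score :: "real \<Rightarrow> 'w \<Rightarrow> real" where
  "score \<gamma> \<omega> = (\<Sum>t<T. b (Y (path \<gamma> (sample \<omega>) t)) (z t \<omega>))"

definition growth :: real where
  "growth = 1 + 2 * sqrt 3 * \<Gamma> * c"

lemma growth: "1 \<le> growth" using \<Gamma> c_nonneg by (simp add: growth_def)

text \<open>The sample at time \<open>s\<close> is independent of the two paths up to \<open>s\<close>, so integrating it out replaces a
  sampled change by \<open>sqrt 3\<close> times the change itself. Minkowski's inequality then leaves a scalar
  recursion with a geometric solution.\<close>

lemma amplitude_path_L2:
  assumes g: "0 \<le> \<gamma>" "\<gamma> \<le> \<gamma>'" "\<gamma>' \<le> \<Gamma>"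
  defines "\<sigma> \<equiv> sqrt 3 * (\<gamma>' - \<gamma>) * c * sqrt (real CARD('m)) * \<mu>"
  shows "t \<le> T \<Longrightarrow> L2_le M (\<lambda>\<omega>. norm (Y (path \<gamma>' (sample \<omega>) t) - Y (path \<gamma> (sample \<omega>) t)))
    (\<Sum>i<t. \<sigma> * growth ^ i)"
proof (induction t rule: less_induct)
  case (less t)
  let ?S = "\<lambda>s \<zeta>. (path \<gamma> \<zeta> s, path \<gamma>' \<zeta> s)"
  have ad: "adapted s (?S s)" for s by (intro adapted_Pair path_adapted)
  have \<sigma>0: "0 \<le> \<sigma>" using g c_nonneg \<mu> by (simp add: \<sigma>_def)
  let ?C = "\<lambda>p x. sampled_change (Y (fst p)) (Y (snd p)) x" and ?M = "\<lambda>p x. sampled_mass (Y (fst p)) x"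
  have Yc: "continuous_on S (\<lambda>x. Y (f x))" if "continuous_on S f" for S and f :: "'x::topological_space \<Rightarrow> real^'m"
    using continuous_on_compose2[OF Y_continuous that] by simp
  have mM: "(\<lambda>q. ?M (fst q) (snd q)) \<in> borel_measurable (borel :: (((real^'m) \<times> (real^'m)) \<times> (real^'n)) measure)"
    unfolding sampled_mass_def
    by (intro borel_measurable_continuous_onI continuous_intros sample_density_continuous Yc)
  have mY: "(\<lambda>p. Y (f p) $ j) \<in> borel_measurable borel"
    if "continuous_on UNIV f" for f :: "((real^'m) \<times> (real^'m)) \<times> (real^'n) \<Rightarrow> real^'m" and j
    by (intro borel_measurable_continuous_onI continuous_intros Yc that)
  have mC: "(\<lambda>q. ?C (fst q) (snd q)) \<in> borel_measurable (borel :: (((real^'m) \<times> (real^'m)) \<times> (real^'n)) measure)"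
  proof -
    have [measurable]: "(\<lambda>q :: ((real^'m) \<times> (real^'m)) \<times> (real^'n). Y (fst (fst q)) $ j) \<in> borel_measurable borel"
      "(\<lambda>q :: ((real^'m) \<times> (real^'m)) \<times> (real^'n). Y (snd (fst q)) $ j) \<in> borel_measurable borel"
      "(snd :: ((real^'m) \<times> (real^'m)) \<times> (real^'n) \<Rightarrow> real^'n) \<in> borel_measurable borel" for j
      by (intro mY borel_measurable_continuous_onI continuous_intros)+
    show ?thesis unfolding sampled_change_def L2_set_def by measurable
  qed
  have step: "L2_le M (\<lambda>\<omega>. (2 * \<gamma>' * c) * ?C (?S s (sample \<omega>)) (z s \<omega>)
       + ((\<gamma>' - \<gamma>) * sqrt (c * real CARD('m))) * ?M (?S s (sample \<omega>)) (z s \<omega>)) (\<sigma> * growth ^ s)" if s: "s < t" for s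
  proof -
    have sT: "s < T" using s less.prems by simp
    have C: "L2_le M (\<lambda>\<omega>. ?C (?S s (sample \<omega>)) (z s \<omega>)) (sqrt 3 * (\<Sum>i<s. \<sigma> * growth ^ i))"
    proof (rule L2_le_adapted[OF ad sT mC])
      show "L2_le gaussian (?C p) (sqrt 3 * norm (Y (snd p) - Y (fst p)))" for p by (rule sampled_change_L2)
      show "L2_le M (\<lambda>\<omega>. sqrt 3 * norm (Y (snd (?S s (sample \<omega>))) - Y (fst (?S s (sample \<omega>)))))
         (sqrt 3 * (\<Sum>i<s. \<sigma> * growth ^ i))"
        using L2_le_scale[OF less.IH[OF s], of "sqrt 3"] sT by simp
    qed
    have Ms: "L2_le M (\<lambda>\<omega>. ?M (?S s (sample \<omega>)) (z s \<omega>)) (sqrt 3 * (sqrt c * \<mu>))"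
    proof (rule L2_le_adapted[OF ad sT mM])
      show "L2_le gaussian (?M p) (sqrt 3 * (sqrt c * \<mu>))" for p by (intro sampled_mass_L2 mass)
      show "L2_le M (\<lambda>\<omega>. sqrt 3 * (sqrt c * \<mu>)) (sqrt 3 * (sqrt c * \<mu>))"
        using c_nonneg \<mu> by (intro L2_le_const prob_space_axioms) auto
    qed
    note L = L2_le_add[OF L2_le_scale[OF C, of "2 * \<gamma>' * c"] L2_le_scale[OF Ms, of "(\<gamma>' - \<gamma>) * sqrt (c * real CARD('m))"]]
    have "\<bar>2 * \<gamma>' * c\<bar> * (sqrt 3 * (\<Sum>i<s. \<sigma> * growth ^ i)) + \<bar>(\<gamma>' - \<gamma>) * sqrt (c * real CARD('m))\<bar> * (sqrt 3 * (sqrt c * \<mu>))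
      = (2 * sqrt 3 * \<gamma>' * c) * (\<Sum>i<s. \<sigma> * growth ^ i) + \<sigma>"
    proof -
      have "\<bar>(\<gamma>' - \<gamma>) * sqrt (c * real CARD('m))\<bar> * (sqrt 3 * (sqrt c * \<mu>)) = \<sigma>"
        using g c_nonneg by (simp add: \<sigma>_def abs_mult real_sqrt_mult)
      moreover have "\<bar>2 * \<gamma>' * c\<bar> = 2 * \<gamma>' * c" using g c_nonneg by simp
      ultimately show ?thesis by (simp only:) (simp add: mult_ac)
    qed
    also have "\<dots> \<le> (growth - 1) * (\<Sum>i<s. \<sigma> * growth ^ i) + \<sigma>"
      using g c_nonneg \<sigma>0 growth by (intro add_right_mono mult_right_mono sum_nonneg) (auto simp: growth_def mult_right_mono)
    also have "\<dots> = \<sigma> * growth ^ s" by (rule geometric_growth)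
    finally show ?thesis
      by (rule L2_le_weaken[OF L])
  qed
  have tot: "L2_le M (\<lambda>\<omega>. \<Sum>s<t. (2 * \<gamma>' * c) * ?C (?S s (sample \<omega>)) (z s \<omega>)
       + ((\<gamma>' - \<gamma>) * sqrt (c * real CARD('m))) * ?M (?S s (sample \<omega>)) (z s \<omega>)) (\<Sum>s<t. \<sigma> * growth ^ s)"
    by (intro L2_le_sum step) auto
  show ?case
  proof (rule L2_le_mono[OF tot])
    have "(\<lambda>p :: (real^'m) \<times> (real^'m). norm (Y (snd p) - Y (fst p))) \<in> borel_measurable borel"
      by (intro borel_measurable_continuous_onI continuous_intros Yc)
    from adapted_measurable[OF adapted_comp[OF ad this] less.prems]
    show "(\<lambda>\<omega>. norm (Y (path \<gamma>' (sample \<omega>) t) - Y (path \<gamma> (sample \<omega>) t))) \<in> borel_measurable M" by simp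
    show "\<bar>norm (Y (path \<gamma>' (sample \<omega>) t) - Y (path \<gamma> (sample \<omega>) t))\<bar>
      \<le> \<bar>\<Sum>s<t. (2 * \<gamma>' * c) * ?C (?S s (sample \<omega>)) (z s \<omega>)
       + ((\<gamma>' - \<gamma>) * sqrt (c * real CARD('m))) * ?M (?S s (sample \<omega>)) (z s \<omega>)\<bar>" for \<omega>
      using amplitude_difference[of \<gamma> \<gamma>' "sample \<omega>" t] g \<Gamma>
      by simp
  qed auto
qed

lemma b_measurable: "(\<lambda>p. b (Y (fst p)) (snd p)) \<in> borel_measurable borel"
proof -
  have "continuous_on UNIV (\<lambda>p :: (real^'m) \<times> (real^'n). (Y (fst p), snd p))"
    by (intro continuous_intros continuous_on_compose2[OF Y_continuous]) auto
  from continuous_on_compose2[OF b_continuous this] show ?thesis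
    by (intro borel_measurable_continuous_onI) simp
qed

lemma partial_score_adapted: "adapted t (\<lambda>\<zeta>. \<Sum>s<t. b (Y (path \<gamma> \<zeta> s)) (\<zeta> s))"
proof (induction t)
  case 0
  then show ?case by (simp add: adapted_const)
next
  case (Suc t)
  have "adapted (Suc t) (\<lambda>\<zeta>. (path \<gamma> \<zeta> t, \<zeta> t))"
    by (intro adapted_Pair adapted_mono[OF path_adapted] adapted_sample) auto
  from adapted_comp[OF this b_measurable]
  have "adapted (Suc t) (\<lambda>\<zeta>. (\<Sum>s<t. b (Y (path \<gamma> \<zeta> s)) (\<zeta> s), b (Y (path \<gamma> \<zeta> t)) (\<zeta> t)))"
    by (intro adapted_Pair adapted_mono[OF Suc]) auto
  from adapted_comp[OF this borel_measurable_continuous_onI[of "\<lambda>p. fst p + snd p"]]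
  show ?case by (simp add: continuous_intros)
qed

lemma score_measurable: "score \<gamma> \<in> borel_measurable M"
  unfolding score_def[abs_def] using adapted_measurable[OF partial_score_adapted order_refl] .

text \<open>The exponential of twice the partial score, divided by \<open>exp (2 h t)\<close>, is a supermartingale.\<close>

lemma exp_score_L2: "L2_le M (\<lambda>\<omega>. exp (score \<gamma> \<omega>)) (exp (h * real T))"
proof -
  let ?s = "\<lambda>t \<zeta>. \<Sum>s<t. b (Y (path \<gamma> \<zeta> s)) (\<zeta> s)"
  have "(\<integral>\<^sup>+\<omega>. ennreal (exp (2 * ?s t (sample \<omega>))) \<partial>M) \<le> ennreal (exp (2 * h * real t))" if "t \<le> T" for t
    using that
  proof (induction t)
    case 0
    then show ?case by (simp add: emeasure_space_1)
  next
    case (Suc t)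
    let ?S = "\<lambda>\<zeta>. (path \<gamma> \<zeta> t, ?s t \<zeta>)"
    let ?F = "\<lambda>q x. ennreal (exp (2 * snd q)) * ennreal (exp (2 * b (Y (fst q)) x))"
    have ad: "adapted t ?S" by (intro adapted_Pair path_adapted partial_score_adapted)
    have [measurable]: "(\<lambda>p :: ((real^'m) \<times> real) \<times> (real^'n). b (Y (fst (fst p))) (snd p)) \<in> borel_measurable borel"
      using measurable_compose[OF borel_measurable_continuous_onI b_measurable,
          of "\<lambda>p :: ((real^'m) \<times> real) \<times> (real^'n). (fst (fst p), snd p)"] by (simp add: continuous_intros)
    have [measurable]: "(\<lambda>p :: ((real^'m) \<times> real) \<times> (real^'n). snd (fst p)) \<in> borel_measurable borel"
      by (intro borel_measurable_continuous_onI continuous_intros)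
    have Fm: "(\<lambda>p. ?F (fst p) (snd p)) \<in> borel_measurable (borel :: (((real^'m) \<times> real) \<times> (real^'n)) measure)"
      by measurable
    have "(\<integral>\<^sup>+\<omega>. ennreal (exp (2 * ?s (Suc t) (sample \<omega>))) \<partial>M) = (\<integral>\<^sup>+\<omega>. ?F (?S (sample \<omega>)) (z t \<omega>) \<partial>M)"
      by (intro nn_integral_cong) (simp add: ennreal_mult'[symmetric] exp_add[symmetric] distrib_left)
    also have "\<dots> = (\<integral>\<^sup>+\<omega>. (\<integral>\<^sup>+x. ?F (?S (sample \<omega>)) x \<partial>gaussian) \<partial>M)"
      using Suc.prems by (intro nn_integral_adapted[OF ad _ Fm]) simp
    also have "\<dots> \<le> (\<integral>\<^sup>+\<omega>. ennreal (exp (2 * ?s t (sample \<omega>))) * ennreal (exp (2 * h)) \<partial>M)"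
    proof (rule nn_integral_mono)
      fix \<omega>
      have [measurable]: "(\<lambda>x. b (Y k) x) \<in> borel_measurable borel" for k
        using measurable_compose[OF borel_measurable_continuous_onI b_measurable, of "\<lambda>x. (k, x)"] by (simp add: continuous_intros)
      have "(\<integral>\<^sup>+x. ?F (?S (sample \<omega>)) x \<partial>gaussian)
        = ennreal (exp (2 * ?s t (sample \<omega>))) * (\<integral>\<^sup>+x. ennreal (exp (2 * b (Y (path \<gamma> (sample \<omega>) t)) x)) \<partial>gaussian)"
        by (simp add: nn_integral_cmult)
      also have "\<dots> \<le> ennreal (exp (2 * ?s t (sample \<omega>))) * ennreal (exp (2 * h))"
        by (intro mult_left_mono b_exp) auto
      finally show "(\<integral>\<^sup>+x. ?F (?S (sample \<omega>)) x \<partial>gaussian) \<le> ennreal (exp (2 * ?s t (sample \<omega>))) * ennreal (exp (2 * h))" .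
    qed
    also have "\<dots> = (\<integral>\<^sup>+\<omega>. ennreal (exp (2 * ?s t (sample \<omega>))) \<partial>M) * ennreal (exp (2 * h))"
    proof (rule nn_integral_multc)
      have "(\<lambda>\<omega>. ?s t (sample \<omega>)) \<in> borel_measurable M"
        using adapted_measurable[OF partial_score_adapted] Suc.prems by auto
      then show "(\<lambda>\<omega>. ennreal (exp (2 * ?s t (sample \<omega>)))) \<in> borel_measurable M" by measurable
    qed
    also have "\<dots> \<le> ennreal (exp (2 * h * real t)) * ennreal (exp (2 * h))"
      using Suc by (intro mult_right_mono) auto
    also have "\<dots> = ennreal (exp (2 * h * real (Suc t)))"
      by (simp add: ennreal_mult'[symmetric] exp_add[symmetric] algebra_simps)
    finally show ?case .
  qed
  from this[of T] have "(\<integral>\<^sup>+\<omega>. ennreal ((exp (score \<gamma> \<omega>))\<^sup>2) \<partial>M) \<le> ennreal ((exp (h * real T))\<^sup>2)"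
    by (simp add: score_def exp_double[symmetric] mult_ac)
  then show ?thesis using score_measurable by (simp add: L2_le_def)
qed

end


section \<open>Variation in the step size\<close>

lemma exp_difference: "\<bar>exp a - exp b\<bar> \<le> (exp a + exp b) * \<bar>a - b\<bar>" for a b :: real
proof -
  have one: "exp a - exp b \<le> (exp a + exp b) * (a - b)" if "b \<le> a" for a b :: real
  proof -
    have "1 + (b - a) \<le> exp (b - a)" by (rule exp_ge_add_one_self)
    then have "exp a * (1 + (b - a)) \<le> exp a * exp (b - a)" by (intro mult_left_mono) auto
    then have "exp a - exp b \<le> exp a * (a - b)" by (simp add: exp_diff algebra_simps)
    also have "\<dots> \<le> (exp a + exp b) * (a - b)" using that by (intro mult_right_mono) auto
    finally show ?thesis .
  qed
  show ?thesis
  proof (cases "b \<le> a")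
    case True
    then show ?thesis using one[OF True] by simp
  next
    case False
    then show ?thesis using one[of a b] by (simp add: add.commute)
  qed
qed

context scored_family
begin

text \<open>A bound for the expected total variation of \<open>exp (score \<gamma>)\<close> over \<open>0 \<le> \<gamma> \<le> \<Gamma>\<close>.\<close>

definition drift :: real where
  "drift = 2 * exp (h * real T) * L * (sqrt 3 * \<Gamma> * c * sqrt (real CARD('m)) * \<mu>)
     * (\<Sum>t<T. \<Sum>i<t. growth ^ i)"

text \<open>The increment of the exponential is at most the sum of its end values times the increment of the
  score, and Cauchy-Schwarz separates the two factors.\<close>

lemma exp_score_increment:
  assumes g: "0 \<le> \<gamma>" "\<gamma> \<le> \<gamma>'" "\<gamma>' \<le> \<Gamma>"
  defines "\<sigma> \<equiv> sqrt 3 * (\<gamma>' - \<gamma>) * c * sqrt (real CARD('m)) * \<mu>"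
  shows "(\<integral>\<^sup>+\<omega>. ennreal \<bar>exp (score \<gamma>' \<omega>) - exp (score \<gamma> \<omega>)\<bar> \<partial>M)
    \<le> ennreal (2 * exp (h * real T) * (L * (\<Sum>t<T. \<Sum>i<t. \<sigma> * growth ^ i)))"
proof -
  let ?d = "\<lambda>t \<omega>. b (Y (path \<gamma>' (sample \<omega>) t)) (z t \<omega>) - b (Y (path \<gamma> (sample \<omega>) t)) (z t \<omega>)"
  have Yc: "continuous_on S (\<lambda>x. Y (f x))" if "continuous_on S f" for S and f :: "'x::topological_space \<Rightarrow> real^'m"
    using continuous_on_compose2[OF Y_continuous that] by simp
  have bc: "continuous_on UNIV (\<lambda>q :: ((real^'m) \<times> (real^'m)) \<times> (real^'n). b (Y (f (fst q))) (snd q))"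
    if "continuous_on UNIV f" for f :: "(real^'m) \<times> (real^'m) \<Rightarrow> real^'m"
  proof -
    have "continuous_on UNIV (\<lambda>q :: ((real^'m) \<times> (real^'m)) \<times> (real^'n). (Y (f (fst q)), snd q))"
      by (intro continuous_intros Yc continuous_on_compose2[OF that]) auto
    from continuous_on_compose2[OF b_continuous this] show ?thesis by simp
  qed
  have d: "L2_le M (?d t) (L * (\<Sum>i<t. \<sigma> * growth ^ i))" if t: "t < T" for t
  proof -
    let ?S = "\<lambda>\<zeta>. (path \<gamma> \<zeta> t, path \<gamma>' \<zeta> t)"
    have ad: "adapted t ?S" by (intro adapted_Pair path_adapted)
    have Fm: "(\<lambda>q. b (Y (snd (fst q))) (snd q) - b (Y (fst (fst q))) (snd q)) \<in> borel_measurable (borel :: (((real^'m) \<times> (real^'m)) \<times> (real^'n)) measure)"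
      by (intro borel_measurable_continuous_onI continuous_intros bc)
    have "L2_le M (\<lambda>\<omega>. (\<lambda>p x. b (Y (snd p)) x - b (Y (fst p)) x) (?S (sample \<omega>)) (z t \<omega>)) (L * (\<Sum>i<t. \<sigma> * growth ^ i))"
    proof (rule L2_le_adapted[OF ad t Fm])
      show "L2_le gaussian (\<lambda>x. b (Y (snd p)) x - b (Y (fst p)) x) (L * norm (Y (snd p) - Y (fst p)))" for p
        by (rule b_lipschitz)
      show "L2_le M (\<lambda>\<omega>. L * norm (Y (snd (?S (sample \<omega>))) - Y (fst (?S (sample \<omega>))))) (L * (\<Sum>i<t. \<sigma> * growth ^ i))"
        using L2_le_scale[OF amplitude_path_L2[OF g, of t], of L] t L by (simp add: \<sigma>_def)
    qed
    then show ?thesis by simp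
  qed
  have "L2_le M (\<lambda>\<omega>. \<Sum>t<T. ?d t \<omega>) (\<Sum>t<T. L * (\<Sum>i<t. \<sigma> * growth ^ i))"
    by (intro L2_le_sum d) auto
  then have D: "L2_le M (\<lambda>\<omega>. \<bar>score \<gamma>' \<omega> - score \<gamma> \<omega>\<bar>) (L * (\<Sum>t<T. \<Sum>i<t. \<sigma> * growth ^ i))"
    by (intro L2_le_abs) (simp add: score_def sum_subtractf sum_distrib_left)
  have E: "L2_le M (\<lambda>\<omega>. exp (score \<gamma>' \<omega>) + exp (score \<gamma> \<omega>)) (2 * exp (h * real T))"
    using L2_le_add[OF exp_score_L2 exp_score_L2] by simp
  have "(\<integral>\<^sup>+\<omega>. ennreal \<bar>exp (score \<gamma>' \<omega>) - exp (score \<gamma> \<omega>)\<bar> \<partial>M)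
     \<le> (\<integral>\<^sup>+\<omega>. ennreal ((exp (score \<gamma>' \<omega>) + exp (score \<gamma> \<omega>)) * \<bar>score \<gamma>' \<omega> - score \<gamma> \<omega>\<bar>) \<partial>M)"
    by (intro nn_integral_mono ennreal_leI exp_difference)
  also have "\<dots> \<le> ennreal (2 * exp (h * real T) * (L * (\<Sum>t<T. \<Sum>i<t. \<sigma> * growth ^ i)))"
    by (rule nn_integral_mult_L2[OF E D]) (auto intro: add_nonneg_nonneg)
  finally show ?thesis .
qed

text \<open>The variation of \<open>exp (score \<gamma>)\<close> over dyadic grids of step sizes. Each grid point is a
  deterministic step size, so its path is adapted; the supremum over all real step sizes is then
  controlled by continuity.\<close>

definition grid_variation :: "nat \<Rightarrow> 'w \<Rightarrow> ennreal" where
  "grid_variation \<nu> \<omega> = (\<Sum>i<2 ^ \<nu>. ennreal \<bar>exp (score (\<Gamma> * real (Suc i) / 2 ^ \<nu>) \<omega>) - exp (score (\<Gamma> * real i / 2 ^ \<nu>) \<omega>)\<bar>)"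

definition variation :: "'w \<Rightarrow> ennreal" where
  "variation \<omega> = liminf (\<lambda>\<nu>. grid_variation \<nu> \<omega>)"

lemma grid_variation_measurable [measurable]: "grid_variation \<nu> \<in> borel_measurable M"
  unfolding grid_variation_def[abs_def] using score_measurable by measurable

lemma variation_measurable [measurable]: "variation \<in> borel_measurable M"
  unfolding variation_def[abs_def] by measurable

lemma nn_integral_grid_variation: "(\<integral>\<^sup>+\<omega>. grid_variation \<nu> \<omega> \<partial>M) \<le> ennreal drift"
proof -
  define G where "G = 2 * exp (h * real T) * (L * (\<Sum>t<T. \<Sum>i<t. (sqrt 3 * (\<Gamma> / 2 ^ \<nu>) * c * sqrt (real CARD('m)) * \<mu>) * growth ^ i))"
  have G0: "0 \<le> G"
    using L \<Gamma> \<mu> c_nonneg growth unfolding G_def by (intro mult_nonneg_nonneg sum_nonneg) auto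
  have "(\<integral>\<^sup>+\<omega>. grid_variation \<nu> \<omega> \<partial>M)
    = (\<Sum>i<2 ^ \<nu>. \<integral>\<^sup>+\<omega>. ennreal \<bar>exp (score (\<Gamma> * real (Suc i) / 2 ^ \<nu>) \<omega>) - exp (score (\<Gamma> * real i / 2 ^ \<nu>) \<omega>)\<bar> \<partial>M)"
    unfolding grid_variation_def by (rule nn_integral_sum) (use score_measurable in measurable)
  also have "\<dots> \<le> (\<Sum>i<(2::nat) ^ \<nu>. ennreal G)"
  proof (rule sum_mono)
    fix i assume "i \<in> {..<(2::nat) ^ \<nu>}"
    then have i: "real (Suc i) \<le> 2 ^ \<nu>" by (metis Suc_leI lessThan_iff of_nat_le_iff of_nat_numeral of_nat_power)
    have diff: "\<Gamma> * real (Suc i) / 2 ^ \<nu> - \<Gamma> * real i / 2 ^ \<nu> = \<Gamma> / 2 ^ \<nu>"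
      by (simp add: diff_divide_distrib[symmetric] algebra_simps)
    have "\<Gamma> * real (Suc i) / 2 ^ \<nu> \<le> \<Gamma>"
      using mult_left_mono[OF i \<Gamma>(1)] by (simp add: divide_le_eq)
    moreover have "\<Gamma> * real i / 2 ^ \<nu> \<le> \<Gamma> * real (Suc i) / 2 ^ \<nu>"
      using \<Gamma> by (intro divide_right_mono mult_left_mono) auto
    ultimately show "(\<integral>\<^sup>+\<omega>. ennreal \<bar>exp (score (\<Gamma> * real (Suc i) / 2 ^ \<nu>) \<omega>) - exp (score (\<Gamma> * real i / 2 ^ \<nu>) \<omega>)\<bar> \<partial>M) \<le> ennreal G"
      using exp_score_increment[of "\<Gamma> * real i / 2 ^ \<nu>" "\<Gamma> * real (Suc i) / 2 ^ \<nu>"] \<Gamma>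
      unfolding diff G_def by simp
  qed
  also have "\<dots> = ennreal (2 ^ \<nu> * G)" using G0 by (simp add: ennreal_mult' ennreal_of_nat_eq_real_of_nat)
  also have "2 ^ \<nu> * G = drift"
  proof -
    have "G = 2 * exp (h * real T) * (L * ((sqrt 3 * (\<Gamma> / 2 ^ \<nu>) * c * sqrt (real CARD('m)) * \<mu>) * (\<Sum>t<T. \<Sum>i<t. growth ^ i)))"
      unfolding G_def by (simp only: sum_distrib_left[symmetric])
    then show ?thesis by (simp add: drift_def)
  qed
  finally show ?thesis .
qed

lemma nn_integral_variation: "(\<integral>\<^sup>+\<omega>. variation \<omega> \<partial>M) \<le> ennreal drift"
proof -
  have "(\<integral>\<^sup>+\<omega>. variation \<omega> \<partial>M) \<le> liminf (\<lambda>\<nu>. \<integral>\<^sup>+\<omega>. grid_variation \<nu> \<omega> \<partial>M)"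
    unfolding variation_def by (rule nn_integral_liminf) measurable
  also have "\<dots> \<le> limsup (\<lambda>\<nu>. \<integral>\<^sup>+\<omega>. grid_variation \<nu> \<omega> \<partial>M)" by (rule Liminf_le_Limsup) simp
  also have "\<dots> \<le> ennreal drift"
    by (rule Limsup_bounded) (simp add: nn_integral_grid_variation)
  finally show ?thesis .
qed

lemma score_continuous: "continuous_on UNIV (\<lambda>\<gamma>. score \<gamma> \<omega>)"
proof -
  have "continuous_on UNIV (\<lambda>\<gamma>. (Y (path \<gamma> (sample \<omega>) t), z t \<omega>))" for t
    by (intro continuous_intros continuous_on_compose2[OF Y_continuous path_continuous]) auto
  from continuous_on_compose2[OF b_continuous this] show ?thesis
    unfolding score_def by (intro continuous_on_sum) simp
qed

text \<open>Step sizes on the dyadic grids converge to \<open>\<gamma>\<close> from below, and on each grid the increment from zero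
  is at most the grid variation.\<close>

lemma exp_score_le_variation:
  assumes g: "0 \<le> \<gamma>" "\<gamma> \<le> \<Gamma>"
  shows "ennreal (exp (score \<gamma> \<omega>)) \<le> ennreal (exp (score 0 \<omega>)) + variation \<omega>"
proof (cases "\<Gamma> = 0")
  case True
  then show ?thesis using g by simp
next
  case False
  then have G: "0 < \<Gamma>" using \<Gamma> by simp
  define e where "e \<gamma> = exp (score \<gamma> \<omega>)" for \<gamma>
  define j where "j \<nu> = nat \<lfloor>2 ^ \<nu> * (\<gamma> / \<Gamma>)\<rfloor>" for \<nu> :: nat
  define g' where "g' \<nu> = \<Gamma> * real (j \<nu>) / 2 ^ \<nu>" for \<nu>
  have fl: "real (j \<nu>) \<le> 2 ^ \<nu> * (\<gamma> / \<Gamma>)" "2 ^ \<nu> * (\<gamma> / \<Gamma>) \<le> real (j \<nu>) + 1" for \<nu>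
    using g G by (auto simp: j_def)
  have j: "j \<nu> \<le> 2 ^ \<nu>" for \<nu>
  proof -
    have "2 ^ \<nu> * (\<gamma> / \<Gamma>) \<le> 2 ^ \<nu> * 1" using g G by (intro mult_left_mono) auto
    then have "real (j \<nu>) \<le> 2 ^ \<nu>" using fl(1)[of \<nu>] by linarith
    then show ?thesis by (metis of_nat_le_iff of_nat_numeral of_nat_power)
  qed
  have up: "e (g' \<nu>) - e 0 \<le> (\<Sum>i<j \<nu>. \<bar>e (\<Gamma> * real (Suc i) / 2 ^ \<nu>) - e (\<Gamma> * real i / 2 ^ \<nu>)\<bar>)" for \<nu>
  proof -
    have "e (\<Gamma> * real n / 2 ^ \<nu>) - e 0 \<le> (\<Sum>i<n. \<bar>e (\<Gamma> * real (Suc i) / 2 ^ \<nu>) - e (\<Gamma> * real i / 2 ^ \<nu>)\<bar>)" for n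
    proof (induction n)
      case (Suc n)
      have "e (\<Gamma> * real (Suc n) / 2 ^ \<nu>) - e (\<Gamma> * real n / 2 ^ \<nu>)
        \<le> \<bar>e (\<Gamma> * real (Suc n) / 2 ^ \<nu>) - e (\<Gamma> * real n / 2 ^ \<nu>)\<bar>" by (rule abs_ge_self)
      with Suc show ?case unfolding sum.lessThan_Suc by linarith
    qed simp
    then show ?thesis by (simp add: g'_def)
  qed
  have "ennreal (e (g' \<nu>) - e 0) \<le> grid_variation \<nu> \<omega>" for \<nu>
  proof -
    have "ennreal (e (g' \<nu>) - e 0) \<le> ennreal (\<Sum>i<j \<nu>. \<bar>e (\<Gamma> * real (Suc i) / 2 ^ \<nu>) - e (\<Gamma> * real i / 2 ^ \<nu>)\<bar>)"
      by (rule ennreal_leI[OF up])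
    also have "\<dots> \<le> ennreal (\<Sum>i<2 ^ \<nu>. \<bar>e (\<Gamma> * real (Suc i) / 2 ^ \<nu>) - e (\<Gamma> * real i / 2 ^ \<nu>)\<bar>)"
      using j by (intro ennreal_leI sum_mono2) auto
    also have "\<dots> = grid_variation \<nu> \<omega>"
      unfolding grid_variation_def e_def by (simp add: sum_ennreal)
    finally show ?thesis .
  qed
  then have "liminf (\<lambda>\<nu>. ennreal (e (g' \<nu>) - e 0)) \<le> variation \<omega>"
    unfolding variation_def by (intro Liminf_mono always_eventually) auto
  moreover have "(\<lambda>\<nu>. ennreal (e (g' \<nu>) - e 0)) \<longlonglongrightarrow> ennreal (e \<gamma> - e 0)"
  proof -
    have "g' \<longlonglongrightarrow> \<gamma>"
    proof (rule LIMSEQ_I)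
      fix r :: real assume "0 < r"
      then obtain N where N: "(1/2) ^ N < r / \<Gamma>" using G real_arch_pow_inv[of "r / \<Gamma>" "1/2"] by auto
      have "norm (g' \<nu> - \<gamma>) < r" if "N \<le> \<nu>" for \<nu>
      proof -
        have q: "\<gamma> - g' \<nu> = (\<Gamma> / 2 ^ \<nu>) * (2 ^ \<nu> * (\<gamma> / \<Gamma>) - real (j \<nu>))"
          using G by (simp add: g'_def field_simps)
        have gen: "\<bar>a * x\<bar> \<le> a * 1" if "0 \<le> a" "0 \<le> x" "x \<le> 1" for a x :: real
          using that by (simp add: abs_mult mult_left_le)
        have "\<bar>\<gamma> - g' \<nu>\<bar> \<le> (\<Gamma> / 2 ^ \<nu>) * 1"
          unfolding q by (rule gen) (use fl[of \<nu>] G in auto)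
        also have "\<dots> = \<Gamma> * (1/2) ^ \<nu>" by (simp add: power_divide)
        also have "\<dots> \<le> \<Gamma> * (1/2) ^ N"
          using G that by (intro mult_left_mono power_decreasing) auto
        also have "\<dots> < r" using N G by (simp add: field_simps)
        finally show ?thesis by (simp add: abs_minus_commute)
      qed
      then show "\<exists>N. \<forall>\<nu>\<ge>N. norm (g' \<nu> - \<gamma>) < r" by blast
    qed
    moreover have "isCont e \<gamma>"
      using score_continuous[of \<omega>] unfolding e_def by (auto simp: continuous_on_eq_continuous_at intro!: continuous_intros)
    ultimately have "(\<lambda>\<nu>. e (g' \<nu>)) \<longlonglongrightarrow> e \<gamma>" by (rule isCont_tendsto_compose[rotated])
    then show ?thesis by (intro tendsto_ennrealI tendsto_intros)
  qed
  then have "liminf (\<lambda>\<nu>. ennreal (e (g' \<nu>) - e 0)) = ennreal (e \<gamma> - e 0)"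
    by (intro lim_imp_Liminf) auto
  ultimately have "ennreal (e \<gamma> - e 0) \<le> variation \<omega>" by simp
  have "ennreal (e \<gamma>) \<le> ennreal (e 0) + ennreal (e \<gamma> - e 0)"
  proof (cases "e 0 \<le> e \<gamma>")
    case True
    then show ?thesis by (simp add: ennreal_plus[symmetric] e_def del: ennreal_plus)
  next
    case False
    then show ?thesis by (simp add: ennreal_neg) (simp add: ennreal_leI)
  qed
  also have "\<dots> \<le> ennreal (e 0) + variation \<omega>"
    using \<open>ennreal (e \<gamma> - e 0) \<le> variation \<omega>\<close> by (rule add_left_mono)
  finally show ?thesis by (simp add: e_def)
qed

end


section \<open>Sampled mass and reaction\<close>

definition mass_density :: "real^'n^'m \<Rightarrow> real^'m" where
  "mass_density y = (\<chi> j. (norm (y $ j))\<^sup>2)"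

locale admissible_amplitudes =
  fixes V :: "real^'m^'m" and c \<tau> :: real
  assumes V: "pos_semidef V" and c: "0 < c" and \<tau>: "1 \<le> \<tau>"
begin

definition admissible :: "real^'n^'m \<Rightarrow> bool" where
  "admissible y \<longleftrightarrow> (\<forall>i. (\<Sum>j\<in>UNIV. \<bar>V $ i $ j\<bar> * (norm (y $ j))\<^sup>2) \<le> c) \<and> (norm y)\<^sup>2 \<le> \<tau>"

lemma V_symmetric: "V $ i $ j = V $ j $ i"
proof -
  have "V $ i $ j = transpose V $ j $ i" by (simp add: transpose_def)
  then show ?thesis using V by (simp add: pos_semidef_def)
qed

lemma sum_rows_le:
  assumes "admissible y" "admissible y'"
  shows "(\<Sum>j\<in>UNIV. norm (y $ j - y' $ j) * norm (y $ j + y' $ j)) \<le> 2 * sqrt \<tau> * norm (y - y')"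
proof -
  have n: "norm y \<le> sqrt \<tau>" "norm y' \<le> sqrt \<tau>"
    using assms real_le_rsqrt by (auto simp: admissible_def)
  have "(\<Sum>j\<in>UNIV. norm (y $ j - y' $ j) * norm (y $ j + y' $ j))
     \<le> L2_set (\<lambda>j. norm ((y - y') $ j)) UNIV * L2_set (\<lambda>j. norm ((y + y') $ j)) UNIV"
    using L2_set_mult_ineq[of "\<lambda>j. norm ((y - y') $ j)" "\<lambda>j. norm ((y + y') $ j)" UNIV] by simp
  also have "\<dots> = norm (y - y') * norm (y + y')" by (simp only: norm_vec_def[symmetric])
  also have "\<dots> \<le> norm (y - y') * (2 * sqrt \<tau>)"
    using n norm_triangle_ineq[of y y'] by (intro mult_left_mono) auto
  finally show ?thesis by (simp add: mult_ac)
qed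

lemma mass_diff_le:
  assumes "admissible y" "admissible y'"
  shows "(\<Sum>j\<in>UNIV. \<bar>mass_density y $ j - mass_density y' $ j\<bar>) \<le> 2 * sqrt \<tau> * norm (y - y')"
proof -
  have "\<bar>mass_density y $ j - mass_density y' $ j\<bar> \<le> norm (y $ j - y' $ j) * norm (y $ j + y' $ j)" for j
  proof -
    have "mass_density y $ j - mass_density y' $ j = (y $ j - y' $ j) \<bullet> (y $ j + y' $ j)"
      by (simp add: mass_density_def power2_norm_eq_inner inner_diff_left inner_diff_right inner_add_right inner_commute)
    then show ?thesis using Cauchy_Schwarz_ineq2[of "y $ j - y' $ j" "y $ j + y' $ j"] by simp
  qed
  then have "(\<Sum>j\<in>UNIV. \<bar>mass_density y $ j - mass_density y' $ j\<bar>)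
     \<le> (\<Sum>j\<in>UNIV. norm (y $ j - y' $ j) * norm (y $ j + y' $ j))" by (intro sum_mono)
  also have "\<dots> \<le> 2 * sqrt \<tau> * norm (y - y')" by (rule sum_rows_le[OF assms])
  finally show ?thesis .
qed

lemma sample_diff_L2:
  "L2_le gaussian (\<lambda>z. sample_density y z $ j - sample_density y' z $ j) (sqrt 3 * (norm (y $ j - y' $ j) * norm (y $ j + y' $ j)))"
proof -
  have "(\<lambda>z. sample_density y z $ j - sample_density y' z $ j) = (\<lambda>z. ((y $ j - y' $ j) \<bullet> z) * ((y $ j + y' $ j) \<bullet> z))"
    by (simp add: sample_density_def fun_eq_iff inner_diff_left inner_add_left power2_eq_square algebra_simps)
  then show ?thesis by (simp only: gaussian_square_square)
qed

lemma sample_measurable [measurable]: "(\<lambda>z. sample_density y z $ j) \<in> borel_measurable gaussian"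
  by (simp add: sample_density_def)

definition total :: "real^'n^'m \<Rightarrow> real^'n \<Rightarrow> real" where
  "total y z = (\<Sum>j\<in>UNIV. sample_density y z $ j)"

lemma total_nonneg: "0 \<le> total y z"
  by (simp add: total_def sample_density_def sum_nonneg)

lemma total_measurable [measurable]: "total y \<in> borel_measurable gaussian"
  unfolding total_def[abs_def] by measurable

lemma total_diff_L2:
  assumes "admissible y" "admissible y'"
  shows "L2_le gaussian (\<lambda>z. total y z - total y' z) (sqrt 3 * (2 * sqrt \<tau> * norm (y - y')))"
proof -
  have L: "L2_le gaussian (\<lambda>z. \<Sum>j\<in>UNIV. sample_density y z $ j - sample_density y' z $ j)
     (\<Sum>j\<in>UNIV. sqrt 3 * (norm (y $ j - y' $ j) * norm (y $ j + y' $ j)))"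
    by (intro L2_le_sum sample_diff_L2) auto
  have C: "(\<Sum>j\<in>UNIV. sqrt 3 * (norm (y $ j - y' $ j) * norm (y $ j + y' $ j)))
     \<le> sqrt 3 * (2 * sqrt \<tau> * norm (y - y'))"
    unfolding sum_distrib_left[symmetric] using sum_rows_le[OF assms] by (intro mult_left_mono) auto
  have E: "(\<lambda>z. \<Sum>j\<in>UNIV. sample_density y z $ j - sample_density y' z $ j) = (\<lambda>z. total y z - total y' z)"
    by (simp add: total_def sum_subtractf)
  show ?thesis using L2_le_weaken[OF L C] by (simp only: E)
qed

text \<open>The masses of the rows, divided by \<open>\<tau>\<close>, serve as weights, and each normalized summand is a quarter of
  a squared standard normal variable.\<close>

lemma exp_total:
  assumes y: "admissible y"
  shows "(\<integral>\<^sup>+z. ennreal (exp (total y z / (4 * \<tau>))) \<partial>gaussian) \<le> ennreal (sqrt 2)"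
proof -
  let ?\<pi> = "\<lambda>j. (norm (y $ j))\<^sup>2 / \<tau>" and ?x = "\<lambda>j z. (1 / (4 * (norm (y $ j))\<^sup>2)) * (y $ j \<bullet> z)\<^sup>2"
  have s\<pi>: "(\<Sum>j\<in>UNIV. ?\<pi> j) = (norm y)\<^sup>2 / \<tau>" by (simp add: norm_matrix_square sum_divide_distrib)
  have eq: "total y z / (4 * \<tau>) = (\<Sum>j\<in>UNIV. ?\<pi> j * ?x j z)" for z
  proof -
    have "?\<pi> j * ?x j z = (y $ j \<bullet> z)\<^sup>2 / (4 * \<tau>)" for j by (cases "y $ j = 0") auto
    then show ?thesis by (simp add: total_def sample_density_def sum_divide_distrib)
  qed
  have "(\<integral>\<^sup>+z. ennreal (exp (total y z / (4 * \<tau>))) \<partial>gaussian) \<le> ennreal (1 + (\<Sum>j\<in>UNIV. ?\<pi> j * (sqrt 2 - 1)))"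
    unfolding eq
  proof (rule nn_integral_exp_weighted_sum[OF prob_space_gaussian])
    show "(\<integral>\<^sup>+z. ennreal (exp (?x j z)) \<partial>gaussian) \<le> ennreal (1 + (sqrt 2 - 1))" for j
    proof (cases "y $ j = 0")
      case True
      have "(\<integral>\<^sup>+z. ennreal (exp (?x j z)) \<partial>gaussian) = ennreal 1"
        using True prob_space.emeasure_space_1[OF prob_space_gaussian] by (simp add: one_ennreal_def[symmetric])
      also have "\<dots> \<le> ennreal (1 + (sqrt 2 - 1))" by (intro ennreal_leI) simp
      finally show ?thesis .
    next
      case False
      then have e: "2 * (1 / (4 * (norm (y $ j))\<^sup>2)) * (norm (y $ j))\<^sup>2 = 1 / 2" by simp
      have "1 / sqrt (1 - 1 / 2) = sqrt (2 :: real)" by (simp add: real_sqrt_divide)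
      then show ?thesis using gaussian_exp_square[of "1 / (4 * (norm (y $ j))\<^sup>2)" "y $ j"] unfolding e by simp
    qed
  qed (use y \<tau> s\<pi> in \<open>auto simp: admissible_def\<close>)
  also have "\<dots> \<le> ennreal (sqrt 2)"
  proof (rule ennreal_leI)
    have "(norm y)\<^sup>2 / \<tau> \<le> 1" using y \<tau> by (simp add: admissible_def)
    then have A: "(norm y)\<^sup>2 / \<tau> * (sqrt 2 - 1) \<le> 1 * (sqrt 2 - 1)" by (intro mult_right_mono) auto
    have B: "(\<Sum>j\<in>UNIV. ?\<pi> j * (sqrt 2 - 1)) = (norm y)\<^sup>2 / \<tau> * (sqrt 2 - 1)"
      by (simp only: s\<pi>[symmetric] sum_distrib_right)
    show "1 + (\<Sum>j\<in>UNIV. ?\<pi> j * (sqrt 2 - 1)) \<le> sqrt 2"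
      unfolding B by (rule order_trans[OF add_left_mono[OF A]]) simp
  qed
  finally show ?thesis .
qed

text \<open>The response of the interaction energy to the sampled density.\<close>

definition reaction :: "real^'n^'m \<Rightarrow> real^'n \<Rightarrow> real" where
  "reaction y z = sample_density y z \<bullet> (V *v sample_density y z)"

lemma reaction_nonneg: "0 \<le> reaction y z"
  using V by (simp add: reaction_def pos_semidef_def)

lemma reaction_eq: "reaction y z = (\<Sum>i\<in>UNIV. \<Sum>j\<in>UNIV. V $ i $ j * (sample_density y z $ i * sample_density y z $ j))"
  by (simp add: reaction_def inner_vec_def matrix_vector_mult_def sum_distrib_left mult_ac)

lemma reaction_measurable [measurable]: "reaction y \<in> borel_measurable gaussian"
  unfolding reaction_eq[abs_def] by measurable

lemma reaction_L2:
  assumes y: "admissible y"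
  shows "L2_le gaussian (reaction y) (sqrt 105 * (c * \<tau>))"
proof -
  have L: "L2_le gaussian (\<lambda>z. \<Sum>i\<in>UNIV. \<Sum>j\<in>UNIV. V $ i $ j * ((y $ i \<bullet> z) * (y $ i \<bullet> z) * (y $ j \<bullet> z)\<^sup>2))
     (\<Sum>i\<in>UNIV. \<Sum>j\<in>UNIV. \<bar>V $ i $ j\<bar> * (sqrt 105 * (norm (y $ i) * norm (y $ i) * (norm (y $ j))\<^sup>2)))"
    by (intro L2_le_sum L2_le_scale gaussian_density_density) auto
  have E: "(\<lambda>z. \<Sum>i\<in>UNIV. \<Sum>j\<in>UNIV. V $ i $ j * ((y $ i \<bullet> z) * (y $ i \<bullet> z) * (y $ j \<bullet> z)\<^sup>2)) = reaction y"
    by (simp add: reaction_eq sample_density_def fun_eq_iff power2_eq_square mult_ac)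
  have C: "(\<Sum>i\<in>UNIV. \<Sum>j\<in>UNIV. \<bar>V $ i $ j\<bar> * (sqrt 105 * (norm (y $ i) * norm (y $ i) * (norm (y $ j))\<^sup>2)))
     \<le> sqrt 105 * (c * \<tau>)"
  proof -
    have "(\<Sum>i\<in>UNIV. \<Sum>j\<in>UNIV. \<bar>V $ i $ j\<bar> * (sqrt 105 * (norm (y $ i) * norm (y $ i) * (norm (y $ j))\<^sup>2)))
      = sqrt 105 * (\<Sum>i\<in>UNIV. (norm (y $ i))\<^sup>2 * (\<Sum>j\<in>UNIV. \<bar>V $ i $ j\<bar> * (norm (y $ j))\<^sup>2))"
      by (simp add: sum_distrib_left power2_eq_square mult_ac)
    also have "\<dots> \<le> sqrt 105 * (\<Sum>i\<in>UNIV. (norm (y $ i))\<^sup>2 * c)"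
      using y by (intro mult_left_mono sum_mono) (auto simp: admissible_def)
    also have "\<dots> = sqrt 105 * (c * (norm y)\<^sup>2)"
      by (simp add: norm_matrix_square sum_distrib_left mult_ac)
    also have "\<dots> \<le> sqrt 105 * (c * \<tau>)" using y c by (intro mult_left_mono) (auto simp: admissible_def)
    finally show ?thesis .
  qed
  show ?thesis using L2_le_weaken[OF L C] by (simp only: E)
qed

lemma reaction_diff_L2:
  assumes y: "admissible y" "admissible y'"
  shows "L2_le gaussian (\<lambda>z. reaction y z - reaction y' z) (sqrt 105 * (2 * c) * (2 * sqrt \<tau> * norm (y - y')))"
proof -
  let ?u = "\<lambda>i. y $ i - y' $ i" and ?v = "\<lambda>i. y $ i + y' $ i"
  have L: "L2_le gaussian (\<lambda>z. \<Sum>i\<in>UNIV. \<Sum>j\<in>UNIV. V $ i $ j * ((?u i \<bullet> z) * (?v i \<bullet> z) * (y $ j \<bullet> z)\<^sup>2 + (?u i \<bullet> z) * (?v i \<bullet> z) * (y' $ j \<bullet> z)\<^sup>2))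
     (\<Sum>i\<in>UNIV. \<Sum>j\<in>UNIV. \<bar>V $ i $ j\<bar> * (sqrt 105 * (norm (?u i) * norm (?v i) * (norm (y $ j))\<^sup>2)
        + sqrt 105 * (norm (?u i) * norm (?v i) * (norm (y' $ j))\<^sup>2)))"
    by (intro L2_le_sum L2_le_scale L2_le_add gaussian_density_density) auto
  have E: "(\<Sum>i\<in>UNIV. \<Sum>j\<in>UNIV. V $ i $ j * ((?u i \<bullet> z) * (?v i \<bullet> z) * (y $ j \<bullet> z)\<^sup>2 + (?u i \<bullet> z) * (?v i \<bullet> z) * (y' $ j \<bullet> z)\<^sup>2))
     = reaction y z - reaction y' z" for z
  proof -
    let ?a = "\<lambda>i. sample_density y z $ i" and ?b = "\<lambda>i. sample_density y' z $ i"
    have uv: "(?u i \<bullet> z) * (?v i \<bullet> z) = ?a i - ?b i" for i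
      by (simp add: sample_density_def inner_diff_left inner_add_left power2_eq_square algebra_simps)
    have "(\<Sum>i\<in>UNIV. \<Sum>j\<in>UNIV. V $ i $ j * (?a i * ?b j)) = (\<Sum>i\<in>UNIV. \<Sum>j\<in>UNIV. V $ i $ j * (?b i * ?a j))"
      by (subst sum.swap) (simp add: V_symmetric mult_ac)
    then show ?thesis
      unfolding reaction_eq uv sample_density_def[of y, symmetric]
      by (simp add: algebra_simps sum.distrib sum_subtractf) (simp add: sample_density_def algebra_simps)
  qed
  have C: "(\<Sum>i\<in>UNIV. \<Sum>j\<in>UNIV. \<bar>V $ i $ j\<bar> * (sqrt 105 * (norm (?u i) * norm (?v i) * (norm (y $ j))\<^sup>2)
        + sqrt 105 * (norm (?u i) * norm (?v i) * (norm (y' $ j))\<^sup>2))) \<le> sqrt 105 * (2 * c) * (2 * sqrt \<tau> * norm (y - y'))"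
  proof -
    have "(\<Sum>i\<in>UNIV. \<Sum>j\<in>UNIV. \<bar>V $ i $ j\<bar> * (sqrt 105 * (norm (?u i) * norm (?v i) * (norm (y $ j))\<^sup>2)
        + sqrt 105 * (norm (?u i) * norm (?v i) * (norm (y' $ j))\<^sup>2)))
      = sqrt 105 * (\<Sum>i\<in>UNIV. (norm (?u i) * norm (?v i)) * ((\<Sum>j\<in>UNIV. \<bar>V $ i $ j\<bar> * (norm (y $ j))\<^sup>2) + (\<Sum>j\<in>UNIV. \<bar>V $ i $ j\<bar> * (norm (y' $ j))\<^sup>2)))"
      by (simp add: sum_distrib_left sum.distrib[symmetric] distrib_left mult_ac)
    also have "\<dots> \<le> sqrt 105 * (\<Sum>i\<in>UNIV. (norm (?u i) * norm (?v i)) * (c + c))"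
      using y by (intro mult_left_mono sum_mono add_mono) (auto simp: admissible_def)
    also have "\<dots> = sqrt 105 * (2 * c) * (\<Sum>i\<in>UNIV. norm (?u i) * norm (?v i))"
      by (simp add: sum_distrib_left mult_ac)
    also have "\<dots> \<le> sqrt 105 * (2 * c) * (2 * sqrt \<tau> * norm (y - y'))"
      using c by (intro mult_left_mono sum_rows_le y) auto
    finally show ?thesis .
  qed
  show ?thesis using L2_le_weaken[OF L C] by (simp only: E)
qed

definition total_score :: "real^'n^'m \<Rightarrow> real^'n \<Rightarrow> real" where
  "total_score y z = total y z / (8 * \<tau>)"

lemma total_score_lipschitz:
  assumes "admissible y" "admissible y'"
  shows "L2_le gaussian (\<lambda>z. total_score y z - total_score y' z) (sqrt 3 / 4 * norm (y - y'))"
proof -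
  have L: "L2_le gaussian (\<lambda>z. (1 / (8 * \<tau>)) * (total y z - total y' z)) (\<bar>1 / (8 * \<tau>)\<bar> * (sqrt 3 * (2 * sqrt \<tau> * norm (y - y'))))"
    by (intro L2_le_scale total_diff_L2 assms)
  have C1: "\<bar>1 / (8 * \<tau>)\<bar> * (sqrt 3 * (2 * sqrt \<tau> * norm (y - y'))) = (sqrt \<tau> / \<tau>) * (sqrt 3 / 4 * norm (y - y'))"
    using \<tau> by simp
  have C2: "(sqrt \<tau> / \<tau>) * (sqrt 3 / 4 * norm (y - y')) \<le> 1 * (sqrt 3 / 4 * norm (y - y'))"
  proof (rule mult_right_mono)
    have "sqrt \<tau> \<le> \<tau>" using \<tau> by (intro real_le_lsqrt) (auto simp: power2_eq_square)
    then show "sqrt \<tau> / \<tau> \<le> 1" using \<tau> by simp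
  qed auto
  have E: "(\<lambda>z. (1 / (8 * \<tau>)) * (total y z - total y' z)) = (\<lambda>z. total_score y z - total_score y' z)"
    by (simp add: fun_eq_iff total_score_def diff_divide_distrib)
  have C: "\<bar>1 / (8 * \<tau>)\<bar> * (sqrt 3 * (2 * sqrt \<tau> * norm (y - y'))) \<le> sqrt 3 / 4 * norm (y - y')"
    using C2 unfolding C1 mult_1_left .
  show ?thesis using L2_le_weaken[OF L C] by (simp only: E)
qed

lemma total_score_exp:
  assumes "admissible y"
  shows "(\<integral>\<^sup>+z. ennreal (exp (2 * total_score y z)) \<partial>gaussian) \<le> ennreal (exp (2 * (ln 2 / 4)))"
proof -
  have "exp (2 * (ln 2 / 4)) = sqrt (2 :: real)"
  proof -
    have "ln (sqrt 2) = 2 * (ln 2 / 4 :: real)" by (simp add: ln_sqrt)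
    then have "exp (2 * (ln 2 / 4)) = exp (ln (sqrt 2 :: real))" by (simp only:)
    then show ?thesis by simp
  qed
  moreover have "2 * total_score y z = total y z / (4 * \<tau>)" for z by (simp add: total_score_def)
  ultimately show ?thesis using exp_total[OF assms] by simp
qed

text \<open>The reaction is a polynomial of degree four in the sample and has no exponential moments; the
  truncation at the total mass restores them.\<close>

definition reaction_score :: "real \<Rightarrow> real^'n^'m \<Rightarrow> real^'n \<Rightarrow> real" where
  "reaction_score e y z = min (e / c * reaction y z) (total y z) / (16 * \<tau>)"

lemma reaction_score_lipschitz:
  assumes y: "admissible y" "admissible y'" and e: "0 \<le> e"
  shows "L2_le gaussian (\<lambda>z. reaction_score e y z - reaction_score e y' z) ((1 + 3 * e) * norm (y - y'))"
proof -
  let ?g = "\<lambda>z. (1 / (16 * \<tau>)) * (\<bar>(e / c) * (reaction y z - reaction y' z)\<bar> + \<bar>total y z - total y' z\<bar>)"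
  have g: "L2_le gaussian ?g (\<bar>1 / (16 * \<tau>)\<bar> * (\<bar>e / c\<bar> * (sqrt 105 * (2 * c) * (2 * sqrt \<tau> * norm (y - y'))) + sqrt 3 * (2 * sqrt \<tau> * norm (y - y'))))"
    by (intro L2_le_scale L2_le_add L2_le_abs reaction_diff_L2 total_diff_L2 y)
  have bd: "\<bar>1 / (16 * \<tau>)\<bar> * (\<bar>e / c\<bar> * (sqrt 105 * (2 * c) * (2 * sqrt \<tau> * norm (y - y'))) + sqrt 3 * (2 * sqrt \<tau> * norm (y - y')))
    \<le> (1 + 3 * e) * norm (y - y')"
  proof -
    have "\<bar>1 / (16 * \<tau>)\<bar> * (\<bar>e / c\<bar> * (sqrt 105 * (2 * c) * (2 * sqrt \<tau> * norm (y - y'))) + sqrt 3 * (2 * sqrt \<tau> * norm (y - y')))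
      = (sqrt \<tau> / \<tau>) * ((e * sqrt 105 / 4 + sqrt 3 / 8) * norm (y - y'))"
      using \<tau> c e by (simp add: field_simps)
    also have "\<dots> \<le> 1 * ((e * sqrt 105 / 4 + sqrt 3 / 8) * norm (y - y'))"
    proof (rule mult_right_mono)
      have "sqrt \<tau> \<le> \<tau>" using \<tau> by (intro real_le_lsqrt) (auto simp: power2_eq_square)
      then show "sqrt \<tau> / \<tau> \<le> 1" using \<tau> by simp
    qed (use e in auto)
    also have "\<dots> \<le> 1 * ((1 + 3 * e) * norm (y - y'))"
    proof (intro mult_left_mono mult_right_mono)
      have "sqrt 105 \<le> (12 :: real)" "sqrt 3 \<le> (2 :: real)" by (rule real_le_lsqrt; simp)+
      then have "e * sqrt 105 \<le> e * 12" using e by (intro mult_left_mono)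
      then show "e * sqrt 105 / 4 + sqrt 3 / 8 \<le> 1 + 3 * e" using \<open>sqrt 3 \<le> 2\<close> by simp
    qed auto
    finally show ?thesis by simp
  qed
  show ?thesis
  proof (rule L2_le_mono[OF g _ _ bd])
    show "(\<lambda>z. reaction_score e y z - reaction_score e y' z) \<in> borel_measurable gaussian"
      unfolding reaction_score_def by measurable
    fix z
    have m: "\<bar>min a b - min a' b'\<bar> \<le> \<bar>a - a'\<bar> + \<bar>b - b'\<bar>" for a b a' b' :: real by linarith
    have "\<bar>reaction_score e y z - reaction_score e y' z\<bar>
      = (1 / (16 * \<tau>)) * \<bar>min (e / c * reaction y z) (total y z) - min (e / c * reaction y' z) (total y' z)\<bar>"
      using \<tau> by (simp add: reaction_score_def diff_divide_distrib[symmetric] abs_divide)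
    also have "\<dots> \<le> ?g z"
      using \<tau> m by (intro mult_left_mono) (auto simp: right_diff_distrib)
    also have "\<dots> \<le> \<bar>?g z\<bar>" by (rule abs_ge_self)
    finally show "\<bar>reaction_score e y z - reaction_score e y' z\<bar> \<le> \<bar>?g z\<bar>" .
  qed
qed

text \<open>Since \<open>exp x \<le> 1 + x exp x\<close>, the score is bounded by the reaction in the first factor and by the
  total mass in the exponent.\<close>

lemma reaction_score_exp:
  assumes y: "admissible y" and e: "0 \<le> e"
  shows "(\<integral>\<^sup>+z. ennreal (exp (2 * reaction_score e y z)) \<partial>gaussian) \<le> ennreal (exp (2 * e))"
proof -
  let ?E = "\<lambda>z. exp (total y z / (8 * \<tau>))"
  have E: "L2_le gaussian ?E (sqrt (sqrt 2))"
  proof -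
    have "(?E z)\<^sup>2 = exp (total y z / (4 * \<tau>))" for z
      by (simp add: exp_double[symmetric])
    then show ?thesis using exp_total[OF y] by (simp add: L2_le_def)
  qed
  have "(\<integral>\<^sup>+z. ennreal (reaction y z * ?E z) \<partial>gaussian) \<le> ennreal (sqrt 105 * (c * \<tau>) * sqrt (sqrt 2))"
    by (rule nn_integral_mult_L2[OF reaction_L2[OF y] E]) (auto simp: reaction_nonneg)
  note I = this
  have pw: "exp (2 * reaction_score e y z) \<le> 1 + (e / (8 * c * \<tau>)) * (reaction y z * ?E z)" for z
  proof -
    let ?x = "2 * reaction_score e y z"
    have x: "0 \<le> ?x" "?x \<le> e / (8 * c * \<tau>) * reaction y z" "?x \<le> total y z / (8 * \<tau>)"
    proof -
      have m: "min (e / c * reaction y z) (total y z) \<le> e / c * reaction y z" "min (e / c * reaction y z) (total y z) \<le> total y z"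
        "0 \<le> min (e / c * reaction y z) (total y z)"
        using e c by (auto simp: reaction_nonneg total_nonneg)
      show "0 \<le> ?x" using m(3) \<tau> by (simp add: reaction_score_def)
      have "min (e / c * reaction y z) (total y z) / (8 * \<tau>) \<le> (e / c * reaction y z) / (8 * \<tau>)"
        using m(1) \<tau> by (intro divide_right_mono) auto
      then show "?x \<le> e / (8 * c * \<tau>) * reaction y z" by (simp add: reaction_score_def mult_ac)
      have "min (e / c * reaction y z) (total y z) / (8 * \<tau>) \<le> total y z / (8 * \<tau>)"
        using m(2) \<tau> by (intro divide_right_mono) auto
      then show "?x \<le> total y z / (8 * \<tau>)" by (simp add: reaction_score_def)
    qed
    have "1 + (- ?x) \<le> exp (- ?x)" by (rule exp_ge_add_one_self)
    then have "exp ?x * (1 + (- ?x)) \<le> exp ?x * exp (- ?x)" by (intro mult_left_mono) auto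
    then have "exp ?x \<le> 1 + ?x * exp ?x" by (simp add: exp_minus algebra_simps)
    also have "?x * exp ?x \<le> (e / (8 * c * \<tau>) * reaction y z) * ?E z"
      by (rule mult_mono[OF x(2)]) (use x order_trans[OF x(1) x(2)] in simp_all)
    finally show ?thesis by (simp add: mult.assoc)
  qed
  have k: "0 \<le> e / (8 * c * \<tau>)" using e c \<tau> by simp
  have [measurable]: "(\<lambda>z. ennreal (reaction y z * ?E z)) \<in> borel_measurable gaussian" by measurable
  have "(\<integral>\<^sup>+z. ennreal (exp (2 * reaction_score e y z)) \<partial>gaussian)
    \<le> (\<integral>\<^sup>+z. 1 + ennreal (e / (8 * c * \<tau>)) * ennreal (reaction y z * ?E z) \<partial>gaussian)"
  proof (rule nn_integral_mono)
    fix z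
    have "ennreal (exp (2 * reaction_score e y z)) \<le> ennreal (1 + (e / (8 * c * \<tau>)) * (reaction y z * ?E z))"
      by (rule ennreal_leI[OF pw])
    also have "\<dots> = 1 + ennreal (e / (8 * c * \<tau>)) * ennreal (reaction y z * ?E z)"
      using k reaction_nonneg[of y z]
      by (subst ennreal_plus) (auto intro!: mult_nonneg_nonneg simp del: times_divide_eq_left simp: ennreal_mult'[OF k])
    finally show "ennreal (exp (2 * reaction_score e y z)) \<le> 1 + ennreal (e / (8 * c * \<tau>)) * ennreal (reaction y z * ?E z)" .
  qed
  also have "\<dots> = 1 + ennreal (e / (8 * c * \<tau>)) * (\<integral>\<^sup>+z. ennreal (reaction y z * ?E z) \<partial>gaussian)"
    using prob_space.emeasure_space_1[OF prob_space_gaussian]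
    by (subst nn_integral_add) (auto simp: nn_integral_cmult)
  also have "\<dots> \<le> 1 + ennreal (e / (8 * c * \<tau>)) * ennreal (sqrt 105 * (c * \<tau>) * sqrt (sqrt 2))"
    by (intro add_left_mono mult_left_mono I) auto
  also have "\<dots> = ennreal (1 + e * (sqrt 105 * sqrt (sqrt 2) / 8))"
  proof -
    have "e / (8 * c * \<tau>) * (sqrt 105 * (c * \<tau>) * sqrt (sqrt 2)) = e * (sqrt 105 * sqrt (sqrt 2) / 8)"
      using c \<tau> by (simp add: field_simps)
    then have "ennreal (e / (8 * c * \<tau>)) * ennreal (sqrt 105 * (c * \<tau>) * sqrt (sqrt 2)) = ennreal (e * (sqrt 105 * sqrt (sqrt 2) / 8))"
      by (simp only: ennreal_mult'[OF k, symmetric])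
    moreover have "ennreal (1 + e * (sqrt 105 * sqrt (sqrt 2) / 8)) = 1 + ennreal (e * (sqrt 105 * sqrt (sqrt 2) / 8))"
      using e by (subst ennreal_plus) auto
    ultimately show ?thesis by (simp only:)
  qed
  also have "\<dots> \<le> ennreal (exp (2 * e))"
  proof (rule ennreal_leI)
    have "sqrt 105 \<le> (32/3 :: real)" by (rule real_le_lsqrt) (auto simp: power2_eq_square)
    moreover have "sqrt (sqrt 2) \<le> (3/2 :: real)"
      by (intro real_le_lsqrt) (auto simp: power2_eq_square)
    ultimately have "sqrt 105 * sqrt (sqrt 2) \<le> 32/3 * (3/2)" by (intro mult_mono) auto
    then have "e * (sqrt 105 * sqrt (sqrt 2) / 8) \<le> e * 2" using e by (intro mult_left_mono) auto
    then show "1 + e * (sqrt 105 * sqrt (sqrt 2) / 8) \<le> exp (2 * e)"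
      using exp_ge_add_one_self[of "2 * e"] by linarith
  qed
  finally show ?thesis .
qed

end


section \<open>Centered noise\<close>

context admissible_amplitudes
begin

definition force :: "real^'m \<Rightarrow> real^'n^'m \<Rightarrow> real^'m" where
  "force \<rho>s y = V *v (mass_density y - \<rho>s)"

definition gap :: "real^'m \<Rightarrow> real^'n^'m \<Rightarrow> real" where
  "gap \<rho>s y = (mass_density y - \<rho>s) \<bullet> force \<rho>s y"

definition noise :: "real^'m \<Rightarrow> real^'n^'m \<Rightarrow> real^'n \<Rightarrow> real" where
  "noise \<rho>s y z = (\<Sum>j\<in>UNIV. force \<rho>s y $ j * (mass_density y $ j - sample_density y z $ j))"

text \<open>At this scale the exponential moment of twice the noise term is at most \<open>exp (gap / (32 \<tau> c))\<close>, which is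
  what twice the gap term removes (\<open>noise_score_exp\<close>).\<close>

definition noise_score :: "real^'m \<Rightarrow> real^'n^'m \<Rightarrow> real^'n \<Rightarrow> real" where
  "noise_score \<rho>s y z = (noise \<rho>s y z - gap \<rho>s y / 2) / (32 * \<tau> * c)"

text \<open>The bounds on the density of the minimizer that make the force bounded.\<close>

definition reference :: "real^'m \<Rightarrow> bool" where
  "reference \<rho>s \<longleftrightarrow> (\<forall>j. 0 \<le> \<rho>s $ j) \<and> (\<forall>i. (\<Sum>j\<in>UNIV. \<bar>V $ i $ j\<bar> * \<rho>s $ j) \<le> c)"

lemma gap_nonneg: "0 \<le> gap \<rho>s y"
  using V by (simp add: gap_def force_def pos_semidef_def)

lemma admissible_potential: "admissible y \<Longrightarrow> (\<Sum>j\<in>UNIV. \<bar>V $ i $ j\<bar> * mass_density y $ j) \<le> c"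
  by (simp add: admissible_def mass_density_def)

lemma mass_density_nonneg: "0 \<le> mass_density y $ j"
  by (simp add: mass_density_def)

lemma abs_matrix_vector_le: "\<bar>(V *v x) $ i\<bar> \<le> (\<Sum>j\<in>UNIV. \<bar>V $ i $ j\<bar> * \<bar>x $ j\<bar>)"
  unfolding matrix_vector_mult_def by (simp, rule order_trans[OF sum_abs]) (simp add: abs_mult)

lemma force_bound:
  assumes y: "admissible y" and r: "reference \<rho>s"
  shows "\<bar>force \<rho>s y $ i\<bar> \<le> 2 * c"
proof -
  have "\<bar>force \<rho>s y $ i\<bar> \<le> (\<Sum>j\<in>UNIV. \<bar>V $ i $ j\<bar> * \<bar>mass_density y $ j - \<rho>s $ j\<bar>)"
    unfolding force_def using abs_matrix_vector_le[of "mass_density y - \<rho>s" i] by simp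
  also have "\<dots> \<le> (\<Sum>j\<in>UNIV. \<bar>V $ i $ j\<bar> * mass_density y $ j + \<bar>V $ i $ j\<bar> * \<rho>s $ j)"
  proof (rule sum_mono)
    fix j
    have "\<bar>mass_density y $ j - \<rho>s $ j\<bar> \<le> mass_density y $ j + \<rho>s $ j"
      using r mass_density_nonneg[of y j] by (auto simp: reference_def abs_le_iff intro: add_increasing2 order_trans[OF _ add_increasing])
    from mult_left_mono[OF this, of "\<bar>V $ i $ j\<bar>"]
    show "\<bar>V $ i $ j\<bar> * \<bar>mass_density y $ j - \<rho>s $ j\<bar> \<le> \<bar>V $ i $ j\<bar> * mass_density y $ j + \<bar>V $ i $ j\<bar> * \<rho>s $ j"
      by (simp add: distrib_left)
  qed
  also have "\<dots> \<le> c + c"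
    using admissible_potential[OF y, of i] r unfolding sum.distrib by (intro add_mono) (auto simp: reference_def)
  finally show ?thesis by simp
qed

text \<open>The variance of the noise is dominated by the curvature gap, because \<open>V R V \<preceq> c V\<close> for the
  diagonal matrix \<open>R\<close> of the masses. This self-bounding property makes the noise cheap.\<close>

lemma weighted_force_le_gap:
  assumes y: "admissible y"
  shows "(\<Sum>j\<in>UNIV. mass_density y $ j * (force \<rho>s y $ j)\<^sup>2) \<le> c * gap \<rho>s y"
proof -
  let ?m = "\<lambda>j. mass_density y $ j" and ?w = "\<lambda>j. force \<rho>s y $ j" and ?\<Delta> = "mass_density y - \<rho>s"
  define u :: "real^'m" where "u = (\<chi> j. ?m j * ?w j)"
  define Z where "Z = (\<Sum>j\<in>UNIV. ?m j * (?w j)\<^sup>2)"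
  have Z0: "0 \<le> Z" unfolding Z_def by (intro sum_nonneg mult_nonneg_nonneg mass_density_nonneg) auto
  have Zu: "Z = u \<bullet> (V *v ?\<Delta>)"
    by (simp add: Z_def u_def inner_vec_def force_def[symmetric] power2_eq_square mult_ac)
  have uVu: "u \<bullet> (V *v u) \<le> c * Z"
  proof -
    have "u \<bullet> (V *v u) = (\<Sum>i\<in>UNIV. \<Sum>j\<in>UNIV. V $ i $ j * (?m i * ?m j) * (?w i * ?w j))"
      by (simp add: u_def inner_vec_def matrix_vector_mult_def sum_distrib_left mult_ac)
    also have "\<dots> \<le> (\<Sum>i\<in>UNIV. \<Sum>j\<in>UNIV. \<bar>V $ i $ j\<bar> * (?m i * ?m j) * (((?w i)\<^sup>2 + (?w j)\<^sup>2) / 2))"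
    proof (intro sum_mono)
      fix i j
      have "\<bar>?w i * ?w j\<bar> \<le> ((?w i)\<^sup>2 + (?w j)\<^sup>2) / 2"
        using zero_le_power2[of "?w i - ?w j"] zero_le_power2[of "?w i + ?w j"]
        unfolding abs_le_iff by (simp add: power2_eq_square algebra_simps)
      moreover have "0 \<le> \<bar>V $ i $ j\<bar> * (?m i * ?m j)" by (intro mult_nonneg_nonneg mass_density_nonneg) auto
      ultimately have "\<bar>V $ i $ j\<bar> * (?m i * ?m j) * \<bar>?w i * ?w j\<bar> \<le> \<bar>V $ i $ j\<bar> * (?m i * ?m j) * (((?w i)\<^sup>2 + (?w j)\<^sup>2) / 2)"
        by (rule mult_left_mono)
      moreover have "V $ i $ j * (?m i * ?m j) * (?w i * ?w j) \<le> \<bar>V $ i $ j * (?m i * ?m j) * (?w i * ?w j)\<bar>"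
        by (rule abs_ge_self)
      moreover have "\<bar>V $ i $ j * (?m i * ?m j) * (?w i * ?w j)\<bar> = \<bar>V $ i $ j\<bar> * (?m i * ?m j) * \<bar>?w i * ?w j\<bar>"
        by (simp add: abs_mult mass_density_nonneg)
      ultimately show "V $ i $ j * (?m i * ?m j) * (?w i * ?w j) \<le> \<bar>V $ i $ j\<bar> * (?m i * ?m j) * (((?w i)\<^sup>2 + (?w j)\<^sup>2) / 2)"
        by linarith
    qed
    also have "\<dots> = (\<Sum>i\<in>UNIV. \<Sum>j\<in>UNIV. \<bar>V $ i $ j\<bar> * (?m i * ?m j) * (?w i)\<^sup>2 / 2)
        + (\<Sum>i\<in>UNIV. \<Sum>j\<in>UNIV. \<bar>V $ i $ j\<bar> * (?m i * ?m j) * (?w j)\<^sup>2 / 2)"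
      by (simp add: sum.distrib[symmetric] add_divide_distrib distrib_left)
    also have "(\<Sum>i\<in>UNIV. \<Sum>j\<in>UNIV. \<bar>V $ i $ j\<bar> * (?m i * ?m j) * (?w j)\<^sup>2 / 2)
        = (\<Sum>i\<in>UNIV. \<Sum>j\<in>UNIV. \<bar>V $ i $ j\<bar> * (?m i * ?m j) * (?w i)\<^sup>2 / 2)"
      by (subst sum.swap) (simp add: V_symmetric mult_ac)
    also have "(\<Sum>i\<in>UNIV. \<Sum>j\<in>UNIV. \<bar>V $ i $ j\<bar> * (?m i * ?m j) * (?w i)\<^sup>2 / 2)
        + (\<Sum>i\<in>UNIV. \<Sum>j\<in>UNIV. \<bar>V $ i $ j\<bar> * (?m i * ?m j) * (?w i)\<^sup>2 / 2)
      = (\<Sum>i\<in>UNIV. (?m i * (?w i)\<^sup>2) * (\<Sum>j\<in>UNIV. \<bar>V $ i $ j\<bar> * ?m j))"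
    proof -
      have "a / 2 + a / 2 = a" for a :: real by simp
      then show ?thesis by (simp add: sum.distrib[symmetric] sum_distrib_left mult_ac)
    qed
    also have "\<dots> \<le> (\<Sum>i\<in>UNIV. (?m i * (?w i)\<^sup>2) * c)"
      by (intro sum_mono mult_left_mono admissible_potential y mult_nonneg_nonneg mass_density_nonneg) auto
    also have "\<dots> = c * Z" by (simp add: Z_def sum_distrib_right[symmetric])
    finally show ?thesis .
  qed
  have "Z\<^sup>2 \<le> (u \<bullet> (V *v u)) * gap \<rho>s y"
    unfolding Zu gap_def force_def by (rule pos_semidef_cauchy_schwarz[OF V])
  also have "\<dots> \<le> (c * Z) * gap \<rho>s y" using uVu gap_nonneg by (rule mult_right_mono)
  finally have "Z * Z \<le> (c * gap \<rho>s y) * Z" by (simp add: power2_eq_square mult_ac)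
  then have "Z \<le> c * gap \<rho>s y"
    using Z0 c gap_nonneg[of \<rho>s y] by (cases "Z = 0") (auto simp: mult_le_cancel_right)
  then show ?thesis by (simp add: Z_def)
qed

text \<open>The exact value is \<open>exp v / sqrt (1 + 2 v)\<close>; the terms of first order in \<open>v\<close> cancel because the
  summand is centered.\<close>

lemma exp_centered_square:
  fixes v :: real and y :: "real^'n"
  assumes v: "\<bar>v\<bar> \<le> 1 / 8" and y: "y \<noteq> 0"
  shows "(\<integral>\<^sup>+z. ennreal (exp (v - v / (norm y)\<^sup>2 * (y \<bullet> z)\<^sup>2)) \<partial>gaussian) \<le> ennreal (1 + 8 * v\<^sup>2)"
proof -
  have e: "2 * (- v / (norm y)\<^sup>2) * (norm y)\<^sup>2 = - (2 * v)" using y by simp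
  have "(\<integral>\<^sup>+z. ennreal (exp (v - v / (norm y)\<^sup>2 * (y \<bullet> z)\<^sup>2)) \<partial>gaussian)
    = (\<integral>\<^sup>+z. ennreal (exp v) * ennreal (exp ((- v / (norm y)\<^sup>2) * (y \<bullet> z)\<^sup>2)) \<partial>gaussian)"
    by (intro nn_integral_cong) (simp add: ennreal_mult'[symmetric] exp_add[symmetric])
  also have "\<dots> = ennreal (exp v) * (\<integral>\<^sup>+z. ennreal (exp ((- v / (norm y)\<^sup>2) * (y \<bullet> z)\<^sup>2)) \<partial>gaussian)"
    by (rule nn_integral_cmult) measurable
  also have "\<dots> = ennreal (exp v) * ennreal (1 / sqrt (1 + 2 * v))"
    using gaussian_exp_square[of "- v / (norm y)\<^sup>2" y] v unfolding e by simp
  also have "\<dots> = ennreal (exp v * (1 / sqrt (1 + 2 * v)))" by (simp only: ennreal_mult'[OF exp_ge_zero])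
  also have "\<dots> \<le> ennreal (1 + 8 * v\<^sup>2)"
  proof (rule ennreal_leI)
    have "\<bar>ln (1 + 2 * v) - 2 * v\<bar> \<le> 2 * (2 * v)\<^sup>2"
      using v by (intro abs_ln_one_plus_x_minus_x_bound) auto
    then have l: "v - ln (1 + 2 * v) / 2 \<le> 4 * v\<^sup>2" by (simp add: power_mult_distrib)
    have v2: "4 * v\<^sup>2 \<le> 1"
    proof -
      have "v\<^sup>2 \<le> (1 / 8)\<^sup>2" using v by (simp add: abs_le_square_iff[symmetric])
      then show ?thesis by (simp add: power2_eq_square)
    qed
    have pos: "0 < 1 + 2 * v" using v by linarith
    have "1 / sqrt (1 + 2 * v) = exp (- (ln (1 + 2 * v) / 2))"
    proof -
      have "exp (ln (1 + 2 * v) / 2) = exp (ln (sqrt (1 + 2 * v)))" using pos by (simp add: ln_sqrt)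
      then have "exp (ln (1 + 2 * v) / 2) = sqrt (1 + 2 * v)" using pos by simp
      then show ?thesis by (simp add: exp_minus inverse_eq_divide)
    qed
    then have "exp v * (1 / sqrt (1 + 2 * v)) = exp (v - ln (1 + 2 * v) / 2)"
      by (simp add: exp_diff exp_minus inverse_eq_divide)
    also have "\<dots> \<le> exp (4 * v\<^sup>2)" using l by simp
    also have "\<dots> \<le> 1 + 4 * v\<^sup>2 + (4 * v\<^sup>2)\<^sup>2" using v2 by (intro exp_bound) auto
    also have "(4 * v\<^sup>2)\<^sup>2 \<le> 4 * v\<^sup>2 * 1"
      unfolding power2_eq_square[of "4 * v\<^sup>2"] using v2 by (intro mult_left_mono) auto
    finally show "exp v * (1 / sqrt (1 + 2 * v)) \<le> 1 + 8 * v\<^sup>2" by simp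
  qed
  finally show ?thesis .
qed

text \<open>The row masses divided by \<open>\<tau>\<close> are the weights of a convexity argument. Only terms of second order
  remain, and they add up to the force weighted by the masses, which the gap dominates.\<close>

lemma noise_score_exp:
  assumes y: "admissible y" and r: "reference \<rho>s"
  shows "(\<integral>\<^sup>+z. ennreal (exp (2 * noise_score \<rho>s y z)) \<partial>gaussian) \<le> ennreal (exp (2 * 0))"
proof -
  define l where "l = 1 / (16 * \<tau> * c)"
  have l: "0 < l" "l * c * \<tau> = 1 / 16" using c \<tau> by (auto simp: l_def)
  let ?\<pi> = "\<lambda>j. (norm (y $ j))\<^sup>2 / \<tau>" and ?v = "\<lambda>j. l * \<tau> * force \<rho>s y $ j"
  let ?x = "\<lambda>j z. if y $ j = 0 then 0 else ?v j - ?v j / (norm (y $ j))\<^sup>2 * (y $ j \<bullet> z)\<^sup>2"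
  have v: "\<bar>?v j\<bar> \<le> 1 / 8" for j
  proof -
    have "\<bar>?v j\<bar> \<le> l * \<tau> * (2 * c)"
      using force_bound[OF y r, of j] l \<tau> by (simp add: abs_mult mult_left_mono)
    also have "\<dots> = 1 / 8" using l(2) by (simp add: mult_ac)
    finally show ?thesis .
  qed
  have s\<pi>: "(\<Sum>j\<in>UNIV. ?\<pi> j) = (norm y)\<^sup>2 / \<tau>" by (simp add: norm_matrix_square sum_divide_distrib)
  have eq: "l * noise \<rho>s y z = (\<Sum>j\<in>UNIV. ?\<pi> j * ?x j z)" for z
  proof -
    have "?\<pi> j * ?x j z = l * (force \<rho>s y $ j * (mass_density y $ j - sample_density y z $ j))" for j
      using \<tau> by (cases "y $ j = 0") (simp_all add: mass_density_def sample_density_def field_simps)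
    then show ?thesis by (simp add: noise_def sum_distrib_left)
  qed
  have "(\<integral>\<^sup>+z. ennreal (exp (l * noise \<rho>s y z)) \<partial>gaussian) \<le> ennreal (1 + (\<Sum>j\<in>UNIV. ?\<pi> j * (8 * (?v j)\<^sup>2)))"
    unfolding eq
  proof (rule nn_integral_exp_weighted_sum[OF prob_space_gaussian])
    show "(\<integral>\<^sup>+z. ennreal (exp (?x j z)) \<partial>gaussian) \<le> ennreal (1 + 8 * (?v j)\<^sup>2)" for j
    proof (cases "y $ j = 0")
      case True
      have "(\<integral>\<^sup>+z. ennreal (exp (?x j z)) \<partial>gaussian) = ennreal 1"
        using True prob_space.emeasure_space_1[OF prob_space_gaussian] by (simp add: one_ennreal_def[symmetric])
      also have "\<dots> \<le> ennreal (1 + 8 * (?v j)\<^sup>2)" by (intro ennreal_leI) simp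
      finally show ?thesis .
    next
      case False
      then show ?thesis using exp_centered_square[OF v False] by simp
    qed
    show "(\<Sum>j\<in>UNIV. ?\<pi> j) \<le> 1" unfolding s\<pi> using y \<tau> by (simp add: admissible_def)
    show "?x j \<in> borel_measurable gaussian" for j by (cases "y $ j = 0") simp_all
  qed (use \<tau> in auto)
  also have "\<dots> \<le> ennreal (exp (l * (gap \<rho>s y / 2)))"
  proof (rule ennreal_leI)
    have "(\<Sum>j\<in>UNIV. ?\<pi> j * (8 * (?v j)\<^sup>2)) = (8 * l\<^sup>2 * \<tau>) * (\<Sum>j\<in>UNIV. mass_density y $ j * (force \<rho>s y $ j)\<^sup>2)"
      using \<tau> by (simp add: sum_distrib_left mass_density_def power2_eq_square field_simps)
    also have "\<dots> \<le> (8 * l\<^sup>2 * \<tau>) * (c * gap \<rho>s y)"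
      using \<tau> by (intro mult_left_mono weighted_force_le_gap y) auto
    also have "\<dots> = 8 * l * (l * c * \<tau>) * gap \<rho>s y" by (simp add: power2_eq_square)
    also have "\<dots> = l * (gap \<rho>s y / 2)" unfolding l(2) by simp
    finally show "1 + (\<Sum>j\<in>UNIV. ?\<pi> j * (8 * (?v j)\<^sup>2)) \<le> exp (l * (gap \<rho>s y / 2))"
      using exp_ge_add_one_self[of "l * (gap \<rho>s y / 2)"] by linarith
  qed
  finally have I: "(\<integral>\<^sup>+z. ennreal (exp (l * noise \<rho>s y z)) \<partial>gaussian) \<le> ennreal (exp (l * (gap \<rho>s y / 2)))" .
  have [measurable]: "noise \<rho>s y \<in> borel_measurable gaussian"
    unfolding noise_def[abs_def] by measurable
  have "(\<integral>\<^sup>+z. ennreal (exp (2 * noise_score \<rho>s y z)) \<partial>gaussian)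
    = (\<integral>\<^sup>+z. ennreal (exp (- (l * (gap \<rho>s y / 2)))) * ennreal (exp (l * noise \<rho>s y z)) \<partial>gaussian)"
  proof (intro nn_integral_cong)
    fix z
    have "2 * noise_score \<rho>s y z = - (l * (gap \<rho>s y / 2)) + l * noise \<rho>s y z"
      using c \<tau> by (simp add: noise_score_def l_def field_simps)
    then show "ennreal (exp (2 * noise_score \<rho>s y z)) = ennreal (exp (- (l * (gap \<rho>s y / 2)))) * ennreal (exp (l * noise \<rho>s y z))"
      by (simp only: exp_add ennreal_mult'[OF exp_ge_zero])
  qed
  also have "\<dots> = ennreal (exp (- (l * (gap \<rho>s y / 2)))) * (\<integral>\<^sup>+z. ennreal (exp (l * noise \<rho>s y z)) \<partial>gaussian)"
    by (rule nn_integral_cmult) measurable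
  also have "\<dots> \<le> ennreal (exp (- (l * (gap \<rho>s y / 2)))) * ennreal (exp (l * (gap \<rho>s y / 2)))"
    by (intro mult_left_mono I) auto
  also have "\<dots> = ennreal (exp (2 * 0))" by (simp add: ennreal_mult'[symmetric] exp_add[symmetric])
  finally show ?thesis .
qed

text \<open>The noise is bilinear in the force and the centered sample, so its change splits into a change of each
  factor; the change of the gap is that of a quadratic form.\<close>

lemma noise_score_lipschitz:
  assumes y: "admissible y" "admissible y'" and r: "reference \<rho>s"
  shows "L2_le gaussian (\<lambda>z. noise_score \<rho>s y z - noise_score \<rho>s y' z) (1 * norm (y - y'))"
proof -
  let ?m = "\<lambda>y j. mass_density y $ j" and ?s = "\<lambda>y z j. sample_density y z $ j" and ?w = "\<lambda>y j. force \<rho>s y $ j"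
  let ?N = "norm (y - y')"
  let ?S = "\<Sum>j\<in>UNIV. \<bar>?m y j - ?m y' j\<bar>"
  have S: "?S \<le> 2 * sqrt \<tau> * ?N" by (rule mass_diff_le[OF y])
  define k where "k = (1 / 2) * (gap \<rho>s y' - gap \<rho>s y)"
  have split: "noise_score \<rho>s y z - noise_score \<rho>s y' z = (1 / (32 * \<tau> * c)) *
     ((\<Sum>j\<in>UNIV. ?w y' j * ((?m y j - ?m y' j) + (- 1) * (?s y z j - ?s y' z j)))
      + ((\<Sum>i\<in>UNIV. (?m y i - ?m y' i) * (\<Sum>j\<in>UNIV. V $ i $ j * (?m y j + (- 1) * ?s y z j))) + k))" for z
  proof -
    have w: "?w y j - ?w y' j = (\<Sum>i\<in>UNIV. V $ i $ j * (?m y i - ?m y' i))" for j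
    proof -
      have "?w y j - ?w y' j = (V *v (mass_density y - mass_density y')) $ j"
        by (simp add: force_def matrix_vector_mult_diff_distrib)
      then show ?thesis by (simp add: matrix_vector_mult_def V_symmetric[of j])
    qed
    have "(\<Sum>i\<in>UNIV. (?m y i - ?m y' i) * (\<Sum>j\<in>UNIV. V $ i $ j * (?m y j + (- 1) * ?s y z j)))
      = (\<Sum>j\<in>UNIV. (?w y j - ?w y' j) * (?m y j - ?s y z j))"
      unfolding w by (simp add: sum_distrib_left sum_distrib_right mult_ac) (rule sum.swap)
    then have "noise \<rho>s y z - noise \<rho>s y' z = (\<Sum>j\<in>UNIV. ?w y' j * ((?m y j - ?m y' j) + (- 1) * (?s y z j - ?s y' z j)))
      + (\<Sum>i\<in>UNIV. (?m y i - ?m y' i) * (\<Sum>j\<in>UNIV. V $ i $ j * (?m y j + (- 1) * ?s y z j)))"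
      unfolding noise_def by (simp add: sum.distrib[symmetric] sum_subtractf[symmetric] algebra_simps)
    then show ?thesis using c \<tau> by (simp add: noise_score_def k_def diff_divide_distrib[symmetric] add_divide_distrib[symmetric]) (simp add: field_simps)
  qed
  have ps: "prob_space (gaussian :: (real^'b) measure)" by (rule prob_space_gaussian)
  have c1: "L2_le gaussian (\<lambda>z::real^'b. a) \<bar>a\<bar>" for a
    using L2_le_mono[OF L2_le_const[OF ps, of "\<bar>a\<bar>"], of "\<lambda>z. a" "\<bar>a\<bar>"] by simp
  have sd: "L2_le gaussian (\<lambda>z. ?s y z j) (sqrt 3 * ?m y j)" for j
    using gaussian_square_square[of "y $ j" "y $ j"] by (simp add: sample_density_def mass_density_def power2_eq_square)
  have L: "L2_le gaussian (\<lambda>z. noise_score \<rho>s y z - noise_score \<rho>s y' z)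
    (\<bar>1 / (32 * \<tau> * c)\<bar> * ((\<Sum>j\<in>UNIV. \<bar>?w y' j\<bar> * (\<bar>?m y j - ?m y' j\<bar> + \<bar>- 1\<bar> * (sqrt 3 * (norm (y $ j - y' $ j) * norm (y $ j + y' $ j)))))
      + ((\<Sum>i\<in>UNIV. \<bar>?m y i - ?m y' i\<bar> * (\<Sum>j\<in>UNIV. \<bar>V $ i $ j\<bar> * (\<bar>?m y j\<bar> + \<bar>- 1\<bar> * (sqrt 3 * ?m y j)))) + \<bar>k\<bar>)))"
    unfolding split by (intro L2_le_scale L2_le_add L2_le_sum c1 sample_diff_L2 sd) auto
  have s3: "sqrt 3 \<le> (2 :: real)" by (rule real_le_lsqrt) auto
  have A: "(\<Sum>j\<in>UNIV. \<bar>?w y' j\<bar> * (\<bar>?m y j - ?m y' j\<bar> + \<bar>- 1\<bar> * (sqrt 3 * (norm (y $ j - y' $ j) * norm (y $ j + y' $ j)))))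
     \<le> 2 * c * (6 * sqrt \<tau> * ?N)"
  proof -
    have "(\<Sum>j\<in>UNIV. \<bar>?w y' j\<bar> * (\<bar>?m y j - ?m y' j\<bar> + \<bar>- 1\<bar> * (sqrt 3 * (norm (y $ j - y' $ j) * norm (y $ j + y' $ j)))))
      \<le> (\<Sum>j\<in>UNIV. (2 * c) * (\<bar>?m y j - ?m y' j\<bar> + 2 * (norm (y $ j - y' $ j) * norm (y $ j + y' $ j))))"
    proof (rule sum_mono)
      fix j
      have "sqrt 3 * (norm (y $ j - y' $ j) * norm (y $ j + y' $ j)) \<le> 2 * (norm (y $ j - y' $ j) * norm (y $ j + y' $ j))"
        by (rule mult_right_mono[OF s3]) simp
      then have "\<bar>?m y j - ?m y' j\<bar> + \<bar>- 1\<bar> * (sqrt 3 * (norm (y $ j - y' $ j) * norm (y $ j + y' $ j)))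
        \<le> \<bar>?m y j - ?m y' j\<bar> + 2 * (norm (y $ j - y' $ j) * norm (y $ j + y' $ j))" by simp
      then show "\<bar>?w y' j\<bar> * (\<bar>?m y j - ?m y' j\<bar> + \<bar>- 1\<bar> * (sqrt 3 * (norm (y $ j - y' $ j) * norm (y $ j + y' $ j))))
        \<le> (2 * c) * (\<bar>?m y j - ?m y' j\<bar> + 2 * (norm (y $ j - y' $ j) * norm (y $ j + y' $ j)))"
        using c by (rule_tac mult_mono[OF force_bound[OF y(2) r, of j]]) auto
    qed
    also have "\<dots> = (2 * c) * (?S + 2 * (\<Sum>j\<in>UNIV. norm (y $ j - y' $ j) * norm (y $ j + y' $ j)))"
      by (simp only: sum_distrib_left[symmetric] sum.distrib)
    also have "\<dots> \<le> (2 * c) * (2 * sqrt \<tau> * ?N + 2 * (2 * sqrt \<tau> * ?N))"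
      using c by (intro mult_left_mono add_mono S sum_rows_le y) auto
    finally show ?thesis by simp
  qed
  have B: "(\<Sum>i\<in>UNIV. \<bar>?m y i - ?m y' i\<bar> * (\<Sum>j\<in>UNIV. \<bar>V $ i $ j\<bar> * (\<bar>?m y j\<bar> + \<bar>- 1\<bar> * (sqrt 3 * ?m y j)))) \<le> 3 * c * (2 * sqrt \<tau> * ?N)"
  proof -
    have "(\<Sum>j\<in>UNIV. \<bar>V $ i $ j\<bar> * (\<bar>?m y j\<bar> + \<bar>- 1\<bar> * (sqrt 3 * ?m y j))) \<le> 3 * c" for i
    proof -
      have "(\<Sum>j\<in>UNIV. \<bar>V $ i $ j\<bar> * (\<bar>?m y j\<bar> + \<bar>- 1\<bar> * (sqrt 3 * ?m y j))) \<le> (\<Sum>j\<in>UNIV. 3 * (\<bar>V $ i $ j\<bar> * ?m y j))"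
      proof (rule sum_mono)
        fix j
        have "\<bar>?m y j\<bar> + \<bar>- 1\<bar> * (sqrt 3 * ?m y j) \<le> 3 * ?m y j"
          using mult_right_mono[OF s3 mass_density_nonneg[of y j]] mass_density_nonneg[of y j] by simp
        from mult_left_mono[OF this, of "\<bar>V $ i $ j\<bar>"]
        show "\<bar>V $ i $ j\<bar> * (\<bar>?m y j\<bar> + \<bar>- 1\<bar> * (sqrt 3 * ?m y j)) \<le> 3 * (\<bar>V $ i $ j\<bar> * ?m y j)" by simp
      qed
      also have "\<dots> \<le> 3 * c" unfolding sum_distrib_left[symmetric] using admissible_potential[OF y(1)] by simp
      finally show ?thesis .
    qed
    then have "(\<Sum>i\<in>UNIV. \<bar>?m y i - ?m y' i\<bar> * (\<Sum>j\<in>UNIV. \<bar>V $ i $ j\<bar> * (\<bar>?m y j\<bar> + \<bar>- 1\<bar> * (sqrt 3 * ?m y j)))) \<le> (\<Sum>i\<in>UNIV. \<bar>?m y i - ?m y' i\<bar> * (3 * c))"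
      by (intro sum_mono mult_left_mono) auto
    also have "\<dots> = 3 * c * ?S" by (simp add: sum_distrib_right[symmetric])
    also have "\<dots> \<le> 3 * c * (2 * sqrt \<tau> * ?N)" using S c by (intro mult_left_mono) auto
    finally show ?thesis .
  qed
  have C: "\<bar>k\<bar> \<le> (1/2) * (4 * c * (2 * sqrt \<tau> * ?N))"
  proof -
    let ?\<Delta> = "mass_density y - \<rho>s" and ?\<Delta>' = "mass_density y' - \<rho>s"
    have sym: "a \<bullet> (V *v b) = b \<bullet> (V *v a)" for a b
      using symmetric_inner_mult[of V a b] V by (simp add: pos_semidef_def inner_commute)
    have "gap \<rho>s y' - gap \<rho>s y = (mass_density y' - mass_density y) \<bullet> (force \<rho>s y + force \<rho>s y')"
    proof -
      have "a \<bullet> (V *v a) - b \<bullet> (V *v b) = (a - b) \<bullet> (V *v b + V *v a)" for a b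
        using sym[of a b] by (simp add: inner_diff_left inner_add_right)
      from this[of ?\<Delta>' ?\<Delta>] show ?thesis by (simp add: gap_def force_def)
    qed
    also have "\<bar>\<dots>\<bar> \<le> (\<Sum>j\<in>UNIV. \<bar>?m y j - ?m y' j\<bar> * (4 * c))"
      unfolding inner_vec_def
    proof (simp, rule order_trans[OF sum_abs], rule sum_mono)
      fix j
      have "\<bar>?w y j + ?w y' j\<bar> \<le> 4 * c"
        using force_bound[OF y(1) r, of j] force_bound[OF y(2) r, of j] by linarith
      then show "\<bar>(?m y' j - ?m y j) * (?w y j + ?w y' j)\<bar> \<le> \<bar>?m y j - ?m y' j\<bar> * (4 * c)"
        unfolding abs_mult by (simp add: abs_minus_commute mult_left_mono)
    qed
    also have "\<dots> = 4 * c * ?S" by (simp add: sum_distrib_right[symmetric])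
    also have "\<dots> \<le> 4 * c * (2 * sqrt \<tau> * ?N)" using S c by (intro mult_left_mono) auto
    finally show ?thesis by (simp add: k_def abs_mult)
  qed
  have "\<bar>1 / (32 * \<tau> * c)\<bar> * ((\<Sum>j\<in>UNIV. \<bar>?w y' j\<bar> * (\<bar>?m y j - ?m y' j\<bar> + \<bar>- 1\<bar> * (sqrt 3 * (norm (y $ j - y' $ j) * norm (y $ j + y' $ j)))))
      + ((\<Sum>i\<in>UNIV. \<bar>?m y i - ?m y' i\<bar> * (\<Sum>j\<in>UNIV. \<bar>V $ i $ j\<bar> * (\<bar>?m y j\<bar> + \<bar>- 1\<bar> * (sqrt 3 * ?m y j)))) + \<bar>k\<bar>))
    \<le> \<bar>1 / (32 * \<tau> * c)\<bar> * (2 * c * (6 * sqrt \<tau> * ?N) + (3 * c * (2 * sqrt \<tau> * ?N) + (1/2) * (4 * c * (2 * sqrt \<tau> * ?N))))"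
    by (intro mult_left_mono add_mono A B C) auto
  also have "\<dots> = (22 / 32) * (sqrt \<tau> / \<tau>) * ?N"
    using c \<tau> by (simp add: field_simps)
  also have "\<dots> \<le> 1 * ?N"
  proof (rule mult_right_mono)
    have "sqrt \<tau> \<le> \<tau>" using \<tau> by (intro real_le_lsqrt) (auto simp: power2_eq_square)
    then show "(22 / 32) * (sqrt \<tau> / \<tau>) \<le> 1" using \<tau> by simp
  qed auto
  finally show ?thesis by (rule L2_le_weaken[OF L])
qed

end


section \<open>Mirror and proximal steps in log-odds coordinates\<close>

lemma matrix_inv_eq:
  fixes A B :: "real^'n^'n"
  assumes "A ** B = mat 1" "B ** A = mat 1"
  shows "matrix_inv A = B"
proof -
  have "A ** matrix_inv A = mat 1 \<and> matrix_inv A ** A = mat 1"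
    unfolding matrix_inv_def by (rule someI[of _ B]) (simp add: assms)
  then have "matrix_inv A ** A = mat 1" by simp
  then have "matrix_inv A ** (A ** B) = B" by (simp add: matrix_mul_assoc)
  then show ?thesis by (simp add: assms(1))
qed

lemma grad_S_FD_mat_fun:
  assumes A: "transpose A = A" and g: "\<And>l. is_eigenvalue A l \<Longrightarrow> 0 < g l \<and> g l < 1"
  shows "grad_S_FD (mat_fun g A) = mat_fun (\<lambda>x. ln (g x / (1 - g x))) A"
proof -
  have one: "mat 1 = mat_fun (\<lambda>x. 1) A" by (simp add: mat_fun_const_one A)
  have m: "mat 1 - mat_fun g A = mat_fun (\<lambda>x. 1 - g x) A"
    unfolding one by (rule mat_fun_diff[OF A])
  have "matrix_inv (mat 1 - mat_fun g A) = mat_fun (\<lambda>x. 1 / (1 - g x)) A"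
    unfolding m
  proof (rule matrix_inv_eq)
    show "mat_fun (\<lambda>x. 1 - g x) A ** mat_fun (\<lambda>x. 1 / (1 - g x)) A = mat 1"
      unfolding mat_fun_mult[OF A] one by (rule mat_fun_cong[OF A]) (use g in force)
    show "mat_fun (\<lambda>x. 1 / (1 - g x)) A ** mat_fun (\<lambda>x. 1 - g x) A = mat 1"
      unfolding mat_fun_mult[OF A] one by (rule mat_fun_cong[OF A]) (use g in force)
  qed
  then show ?thesis
    unfolding grad_S_FD_def by (simp add: mat_fun_mult[OF A] mat_fun_compose[OF A])
qed

lemma ln_fermi: "ln (fermi 1 x / (1 - fermi 1 x)) = - x"
  using fermi_log_odds[of x] fermi_bounds[of 1 x] by (simp add: ln_div)

lemma grad_S_FD_logistic:
  assumes H: "transpose H = H"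
  shows "grad_S_FD (logistic H) = - H"
proof -
  have "grad_S_FD (logistic H) = mat_fun (\<lambda>x. (- 1) * x) H"
    by (simp add: grad_S_FD_mat_fun[OF H] fermi_bounds ln_fermi)
  also have "\<dots> = - H" unfolding mat_fun_scaleR[OF H, symmetric] by (simp add: mat_fun_id H)
  finally show ?thesis .
qed

text \<open>The logistic function inverts the log-odds of every eigenvalue, so the gradient of the entropy
  determines the state.\<close>

lemma eq_logistic_of_grad:
  assumes X: "pos_def X" "pos_def (mat 1 - X)" and grad: "grad_S_FD X = - H"
  shows "X = logistic H"
proof -
  have s: "transpose X = X" using X by (simp add: pos_def_def)
  have e: "0 < l \<and> l < 1" if "is_eigenvalue X l" for l
    using pos_def_eigenvalue[OF X(1) that] pos_def_eigenvalue[OF X(2) eigenvalue_one_minus[OF that]] by simp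
  have "grad_S_FD X = mat_fun (\<lambda>x. ln (x / (1 - x))) X"
    using grad_S_FD_mat_fun[of X "\<lambda>x. x", OF s e] by (simp add: mat_fun_id[OF s])
  then have "H = (- 1) *\<^sub>R mat_fun (\<lambda>x. ln (x / (1 - x))) X" using grad by (metis minus_equation_iff scaleR_minus1_left)
  then have "logistic H = mat_fun (\<lambda>x. fermi 1 (- 1 * ln (x / (1 - x)))) X"
    unfolding mat_fun_scaleR[OF s] by (simp only: mat_fun_compose[OF s])
  also have "\<dots> = mat_fun (\<lambda>x. x) X"
  proof (rule mat_fun_cong[OF s])
    fix l assume "is_eigenvalue X l"
    from e[OF this] have l: "0 < l" "l < 1" by auto
    then have "exp (- ln (l / (1 - l))) = (1 - l) / l" by (simp add: exp_minus)
    then show "fermi 1 (- 1 * ln (l / (1 - l))) = l"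
      using l by (simp add: fermi_def add_divide_eq_iff)
  qed
  finally show ?thesis by (simp add: mat_fun_id[OF s])
qed

definition gibbs :: "real^'n^'n \<Rightarrow> real^'n^'n \<Rightarrow> real" where
  "gibbs H X = H \<bullet> X + S_FD X"

lemma gibbs_variational: "transpose H = H \<Longrightarrow> Y \<in> feasible \<Longrightarrow>
  (norm (msqrt Y - msqrt (logistic H)))\<^sup>2 \<le> gibbs H Y - gibbs H (logistic H)"
  unfolding gibbs_def by (rule gibbs_gap)

lemma gibbs_le_imp_eq:
  assumes H: "transpose H = H" and Y: "Y \<in> feasible" and le: "gibbs H Y \<le> gibbs H (logistic H)"
  shows "Y = logistic H"
proof -
  have "(norm (msqrt Y - msqrt (logistic H)))\<^sup>2 \<le> 0" using gibbs_variational[OF H Y] le by linarith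
  then have "msqrt Y = msqrt (logistic H)" by simp
  then have "msqrt Y ** msqrt Y = msqrt (logistic H) ** msqrt (logistic H)" by (simp only:)
  then show ?thesis
    unfolding msqrt_square[OF feasible_pos_semidef[OF Y]]
      msqrt_square[OF feasible_pos_semidef[OF logistic_feasible[OF H]]] .
qed

lemma bregman_logistic:
  "transpose H = H \<Longrightarrow> bregman Y (logistic H) = gibbs H Y - gibbs H (logistic H)"
  by (simp add: bregman_def grad_S_FD_logistic gibbs_def inner_diff_right)

lemma X_init_logistic:
  assumes C: "transpose C = C"
  shows "X_init C \<mu> \<beta> = logistic (\<beta> *\<^sub>R (C - \<mu> *\<^sub>R mat 1))"
proof -
  let ?A = "C - \<mu> *\<^sub>R mat 1"
  have A: "transpose ?A = ?A" by (simp add: transpose_diff transpose_scaleR C)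
  have "\<beta> *\<^sub>R ?A = mat_fun (\<lambda>x. \<beta> * x) ?A"
    using mat_fun_scaleR[OF A, of \<beta> "\<lambda>x. x"] by (simp add: mat_fun_id[OF A])
  then show ?thesis by (simp add: X_init_def mat_fun_compose[OF A] fermi_def[abs_def])
qed

lemma free_energy_gibbs:
  assumes C: "transpose C = C" and \<beta>: "0 < \<beta>"
  shows "free_energy \<Psi> V C \<beta> X - \<mu> * trace X
    = E_tilde \<Psi> V X + inverse \<beta> * gibbs (\<beta> *\<^sub>R (C - \<mu> *\<^sub>R mat 1)) X"
proof -
  have "trace (C ** X) = C \<bullet> X" by (simp add: inner_matrix_eq_trace C)
  then show ?thesis using \<beta>
    by (simp add: free_energy_def energy_def gibbs_def trace_eq_inner_mat_one inner_diff_left field_simps)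
qed

lemma outer_prod_mult: "outer_prod u v *v x = (v \<bullet> x) *\<^sub>R u"
proof -
  have "(outer_prod u v *v x) $ i = u $ i * (\<Sum>j\<in>UNIV. v $ j * x $ j)" for i
    by (simp add: outer_prod_def matrix_vector_mult_def sum_distrib_left mult.assoc)
  then show ?thesis by (simp add: vec_eq_iff inner_vec_def)
qed

lemma unit_projection_feasible:
  fixes u :: "real^'n"
  assumes u: "norm u = 1"
  shows "outer_prod u u \<in> feasible"
proof -
  have "(u \<bullet> x)\<^sup>2 \<le> x \<bullet> x" for x
    using Cauchy_Schwarz_ineq[of u x] u by (simp add: power2_norm_eq_inner[symmetric])
  moreover have "transpose (outer_prod u u) = outer_prod u u"
    by (simp add: vec_eq_iff outer_prod_def transpose_def)
  ultimately show ?thesis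
    by (simp add: feasible_def pos_semidef_def outer_prod_mult matrix_vector_mult_diff_rdistrib
        inner_diff_right transpose_diff power2_eq_square inner_commute)
qed

text \<open>With \<open>H0 = \<beta>(C - \<mu>I)\<close> the objective is \<open>E_tilde + gibbs H0 / \<beta>\<close> (\<open>free_energy_gibbs\<close>). The last
  assumption is the sign condition on the gradients of the interaction energy.\<close>

locale mean_field = orthonormal_columns \<Psi>
  for \<Psi> :: "real^'n^'m" +
  fixes V :: "real^'m^'m" and H0 :: "real^'n^'n" and \<beta> :: real
  assumes V: "pos_semidef V" and H0: "transpose H0 = H0" and \<beta>: "0 < \<beta>"
    and repulsive: "\<And>Y. Y \<in> feasible \<Longrightarrow> pos_semidef (penalty (V *v rho \<Psi> Y))"
begin

abbreviation density :: "real^'m \<Rightarrow> real^'n^'n" where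
  "density k \<equiv> logistic (H0 + penalty k)"

lemma density_sym: "transpose (H0 + penalty k) = H0 + penalty k"
  by (simp add: transpose_add H0)

lemma density_feasible: "density k \<in> feasible"
  by (rule logistic_feasible[OF density_sym])

text \<open>A sampled density is a multiple of the density of a projection of rank one, so its potential
  inherits the sign condition.\<close>

lemma sample_repulsive:
  assumes X: "transpose X = X"
  shows "pos_semidef (penalty (V *v sample_density (\<Psi> ** msqrt X) z))"
proof -
  define w where "w = msqrt X *v z"
  have s: "sample_density (\<Psi> ** msqrt X) z $ j = (\<Psi> $ j \<bullet> w)\<^sup>2" for j
    unfolding w_def sample_density_def matrix_mul_row transpose_mat_fun[OF X]
    using symmetric_inner_mult[of "msqrt X" "\<Psi> $ j" z] by (simp add: X)
  obtain u where u: "norm u = 1" "w = norm w *\<^sub>R u"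
  proof (cases "w = 0")
    case True
    show ?thesis by (rule that[of "axis undefined 1"]) (simp_all add: True)
  next
    case False
    show ?thesis by (rule that[of "(1 / norm w) *\<^sub>R w"]) (simp_all add: False)
  qed
  have "sample_density (\<Psi> ** msqrt X) z = (norm w)\<^sup>2 *\<^sub>R rho \<Psi> (outer_prod u u)"
    unfolding vec_eq_iff s rho_entry outer_prod_mult vector_scaleR_component
    by (subst u(2)) (simp add: power_mult_distrib power2_eq_square inner_commute)
  moreover have "pos_semidef (penalty (V *v rho \<Psi> (outer_prod u u)))"
    by (rule repulsive[OF unit_projection_feasible[OF u(1)]])
  ultimately show ?thesis
    by (simp add: matrix_vector_mult_scaleR penalty_scaleR pos_semidef_def transpose_scaleR scaleR_matrix_vector_assoc[symmetric])
qed

text \<open>The algorithm in log-odds coordinates: the state at time \<open>t\<close> is \<open>density (iterate \<gamma> \<zeta> t)\<close>.\<close>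

fun iterate :: "real \<Rightarrow> (nat \<Rightarrow> real^'n) \<Rightarrow> nat \<Rightarrow> real^'m" where
  "iterate \<gamma> \<zeta> 0 = 0"
| "iterate \<gamma> \<zeta> (Suc t) = (1 - \<gamma> / \<beta>) *\<^sub>R iterate \<gamma> \<zeta> t
    + \<gamma> *\<^sub>R (V *v sample_density (\<Psi> ** msqrt (density (iterate \<gamma> \<zeta> t))) (\<zeta> t))"

lemma pos_semidef_combination:
  assumes "pos_semidef A" "pos_semidef B" "0 \<le> a" "0 \<le> b"
  shows "pos_semidef (a *\<^sub>R A + b *\<^sub>R B)"
proof -
  have "x \<bullet> ((a *\<^sub>R A + b *\<^sub>R B) *v x) = a * (x \<bullet> (A *v x)) + b * (x \<bullet> (B *v x))" for x
    by (simp only: matrix_vector_mult_add_rdistrib scaleR_matrix_vector_assoc[symmetric] inner_add_right inner_scaleR_right)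
  then show ?thesis using assms by (simp add: pos_semidef_def transpose_add transpose_scaleR)
qed

lemma iterate_repulsive:
  assumes "0 \<le> \<gamma>" "\<gamma> \<le> \<beta>"
  shows "pos_semidef (penalty (iterate \<gamma> \<zeta> t))"
proof (induction t)
  case 0
  have "transpose (0 :: real^'n^'n) = 0" by (simp add: vec_eq_iff transpose_def)
  then show ?case by (simp add: pos_semidef_def)
next
  case (Suc t)
  then show ?case using assms \<beta>
    by (simp only: iterate.simps penalty_add penalty_scaleR)
       (intro pos_semidef_combination sample_repulsive feasible_symmetric[OF density_feasible], auto)
qed

text \<open>The penalties are nonnegative combinations of positive semidefinite ones, and penalizing lowers the
  trace.\<close>

lemma iterate_trace:
  assumes "0 \<le> \<gamma>" "\<gamma> \<le> \<beta>"
  shows "trace (density (iterate \<gamma> \<zeta> t)) \<le> trace (logistic H0)"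
  by (rule trace_logistic_antimono[OF H0 iterate_repulsive[OF assms]])

lemma iterate_zero: "iterate 0 \<zeta> t = 0"
  by (induction t) simp_all

text \<open>The step sizes satisfy \<open>1/\<gamma> = 1/\<eta> + 1/\<beta>\<close>, so the new functional is a weighted sum of the old one, of the
  unpenalized one and of the sampled linear term.\<close>

lemma gibbs_step:
  assumes \<eta>: "0 < \<eta>" and \<gamma>: "\<gamma> = \<eta> * \<beta> / (\<eta> + \<beta>)"
  shows "gibbs (H0 + penalty ((1 - \<gamma> / \<beta>) *\<^sub>R k + \<gamma> *\<^sub>R g)) Y
    = \<gamma> * (gibbs (H0 + penalty k) Y / \<eta> + gibbs H0 Y / \<beta> + g \<bullet> rho \<Psi> Y)"
proof -
  have "\<gamma> / \<eta> = \<beta> / (\<eta> + \<beta>)" "\<gamma> / \<beta> = \<eta> / (\<eta> + \<beta>)" using \<eta> \<beta> by (simp_all add: \<gamma>)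
  then have e: "\<gamma> / \<eta> = 1 - \<gamma> / \<beta>" using \<eta> \<beta> by (simp add: eq_diff_eq add_divide_distrib[symmetric])
  have "\<gamma> * (gibbs (H0 + penalty k) Y / \<eta> + gibbs H0 Y / \<beta> + g \<bullet> rho \<Psi> Y)
    = (\<gamma> / \<eta>) * gibbs (H0 + penalty k) Y + (\<gamma> / \<beta>) * gibbs H0 Y + \<gamma> * (g \<bullet> rho \<Psi> Y)"
    by (simp add: algebra_simps)
  then show ?thesis unfolding e
    by (simp add: gibbs_def penalty_add penalty_scaleR inner_add_left penalty_inner algebra_simps)
qed

lemma stoch_grad_density:
  assumes C: "H0 = \<beta> *\<^sub>R (C - \<mu> *\<^sub>R mat 1)"
  shows "stoch_grad \<Psi> V C (density k) z - \<mu> *\<^sub>R mat 1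
    = inverse \<beta> *\<^sub>R H0 + penalty (V *v sample_density (\<Psi> ** msqrt (density k)) z)"
proof -
  have r: "rho \<Psi> (X_hat (density k) z) = sample_density (\<Psi> ** msqrt (density k)) z"
    by (simp add: vec_eq_iff rho_X_hat[OF feasible_symmetric[OF density_feasible]] sample_density_def)
  have "inverse \<beta> *\<^sub>R H0 = C - \<mu> *\<^sub>R mat 1" using \<beta> unfolding C by simp
  moreover have "grad_E_tilde \<Psi> V Y = penalty (V *v rho \<Psi> Y)" for Y
    by (simp add: grad_E_tilde_def penalty_def)
  ultimately show ?thesis unfolding stoch_grad_def by (simp add: r)
qed

text \<open>Up to a constant the proximal objective is the Gibbs functional of the new log-odds matrix, whose
  minimizer is explicit. The mirror form states the same change for the gradients.\<close>

lemma prox_step_density: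
  assumes \<eta>: "0 < \<eta>" and \<gamma>: "\<gamma> = \<eta> * \<beta> / (\<eta> + \<beta>)" and C: "transpose C = C" "H0 = \<beta> *\<^sub>R (C - \<mu> *\<^sub>R mat 1)"
    and step: "prox_step \<Psi> V C \<mu> \<beta> \<eta> (density k) z X'"
  shows "X' = density ((1 - \<gamma> / \<beta>) *\<^sub>R k + \<gamma> *\<^sub>R (V *v sample_density (\<Psi> ** msqrt (density k)) z))"
proof -
  let ?X = "density k" and ?g = "V *v sample_density (\<Psi> ** msqrt (density k)) z"
  let ?k = "(1 - \<gamma> / \<beta>) *\<^sub>R k + \<gamma> *\<^sub>R ?g"
  let ?obj = "\<lambda>Y. energy \<Psi> V C ?X + (stoch_grad \<Psi> V C ?X z - \<mu> *\<^sub>R mat 1) \<bullet> (Y - ?X)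
            + inverse \<beta> * S_FD Y + inverse \<eta> * bregman Y ?X"
  note g = stoch_grad_density[OF C(2), of k z]
  have \<gamma>0: "0 < \<gamma>" using \<eta> \<beta> by (simp add: \<gamma>)
  define const where "const = energy \<Psi> V C ?X - (inverse \<beta> *\<^sub>R H0 + penalty ?g) \<bullet> ?X - inverse \<eta> * gibbs (H0 + penalty k) ?X"
  have obj: "?obj Y = const + gibbs (H0 + penalty ?k) Y / \<gamma>" for Y
  proof -
    have "gibbs (H0 + penalty ?k) Y / \<gamma> = gibbs (H0 + penalty k) Y / \<eta> + gibbs H0 Y / \<beta> + ?g \<bullet> rho \<Psi> Y"
      unfolding gibbs_step[OF \<eta> \<gamma>] using \<gamma>0 by simp
    also have "\<dots> = inverse \<eta> * gibbs (H0 + penalty k) Y + inverse \<beta> * (H0 \<bullet> Y + S_FD Y) + penalty ?g \<bullet> Y"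
      by (simp add: gibbs_def[of H0] divide_inverse penalty_inner mult.commute)
    finally show ?thesis
      unfolding g bregman_logistic[OF density_sym] const_def
      by (simp add: inner_diff_right inner_add_left algebra_simps)
  qed
  have X': "X' \<in> feasible" and "?obj X' \<le> ?obj (density ?k)"
    using step density_feasible[of ?k] unfolding prox_step_def is_arg_min_linorder by auto
  then have "gibbs (H0 + penalty ?k) X' \<le> gibbs (H0 + penalty ?k) (density ?k)"
    unfolding obj using \<gamma>0 by (simp add: divide_le_cancel)
  from gibbs_le_imp_eq[OF density_sym X' this] show ?thesis .
qed

lemma mirror_step_density:
  assumes C: "transpose C = C" "H0 = \<beta> *\<^sub>R (C - \<mu> *\<^sub>R mat 1)"
    and step: "mirror_step \<Psi> V C \<mu> \<beta> \<gamma> (density k) z X'"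
  shows "X' = density ((1 - \<gamma> / \<beta>) *\<^sub>R k + \<gamma> *\<^sub>R (V *v sample_density (\<Psi> ** msqrt (density k)) z))"
proof -
  let ?X = "density k" and ?g = "V *v sample_density (\<Psi> ** msqrt (density k)) z"
  note g = stoch_grad_density[OF C(2), of k z]
  have "grad_S_FD X' = - (H0 + penalty ((1 - \<gamma> / \<beta>) *\<^sub>R k + \<gamma> *\<^sub>R ?g))"
  proof -
    have "(1 - inverse \<beta> * \<gamma>) *\<^sub>R (- (A + K)) - \<gamma> *\<^sub>R (inverse \<beta> *\<^sub>R A + G)
      = - (A + ((1 - \<gamma> / \<beta>) *\<^sub>R K + \<gamma> *\<^sub>R G))" for A K G :: "real^'n^'n"
      unfolding vec_eq_iff by (simp add: divide_inverse algebra_simps)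
    moreover have "grad_S_FD X' = (1 - inverse \<beta> * \<gamma>) *\<^sub>R (- (H0 + penalty k)) - \<gamma> *\<^sub>R (inverse \<beta> *\<^sub>R H0 + penalty ?g)"
      using step unfolding mirror_step_def g grad_S_FD_logistic[OF density_sym] by (elim conjE)
    ultimately show ?thesis unfolding penalty_add penalty_scaleR by (simp only:)
  qed
  moreover have "pos_def X'" "pos_def (mat 1 - X')" using step by (simp_all add: mirror_step_def)
  ultimately show ?thesis by (intro eq_logistic_of_grad)
qed

end


section \<open>The pathwise regret\<close>

context mean_field
begin

abbreviation state :: "real \<Rightarrow> (nat \<Rightarrow> real^'n) \<Rightarrow> nat \<Rightarrow> real^'n^'n" where
  "state \<gamma> \<zeta> t \<equiv> density (iterate \<gamma> \<zeta> t)"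

abbreviation root :: "real \<Rightarrow> (nat \<Rightarrow> real^'n) \<Rightarrow> nat \<Rightarrow> real^'n^'m" where
  "root \<gamma> \<zeta> t \<equiv> \<Psi> ** msqrt (state \<gamma> \<zeta> t)"

definition divergence :: "real^'m \<Rightarrow> real^'n^'n \<Rightarrow> real" where
  "divergence k Y = gibbs (H0 + penalty k) Y - gibbs (H0 + penalty k) (density k)"

lemma divergence_ge: "Y \<in> feasible \<Longrightarrow> (norm (msqrt Y - msqrt (density k)))\<^sup>2 \<le> divergence k Y"
  unfolding divergence_def by (rule gibbs_variational[OF density_sym])

lemma divergence_nonneg: "Y \<in> feasible \<Longrightarrow> 0 \<le> divergence k Y"
  by (rule order_trans[OF zero_le_power2 divergence_ge])

definition excess :: "real^'n^'n \<Rightarrow> real^'n^'n \<Rightarrow> real" where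
  "excess Xs Y = (E_tilde \<Psi> V Y - E_tilde \<Psi> V Xs) + (gibbs H0 Y - gibbs H0 Xs) / \<beta>"

text \<open>What remains of step \<open>t\<close> after the divergences to \<open>Xs\<close> have been telescoped.\<close>

definition loss :: "real \<Rightarrow> real \<Rightarrow> (nat \<Rightarrow> real^'n) \<Rightarrow> real^'n^'n \<Rightarrow> nat \<Rightarrow> real" where
  "loss \<eta> \<gamma> \<zeta> Xs t = E_tilde \<Psi> V (state \<gamma> \<zeta> t) - E_tilde \<Psi> V Xs
     + (V *v sample_density (root \<gamma> \<zeta> t) (\<zeta> t)) \<bullet> (rho \<Psi> Xs - rho \<Psi> (state \<gamma> \<zeta> (Suc t)))
     - divergence (iterate \<gamma> \<zeta> t) (state \<gamma> \<zeta> (Suc t)) / \<eta>"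

text \<open>The mirror step telescopes the divergence to the minimizer. The last iterate has no step of its
  own: since the initial point minimizes the unpenalized functional, its contribution is paid by
  shifting the entropic parts by one step.\<close>

lemma regret:
  assumes \<eta>: "0 < \<eta>" and \<gamma>: "\<gamma> = \<eta> * \<beta> / (\<eta> + \<beta>)" and Xs: "Xs \<in> feasible"
  shows "(\<Sum>t\<le>n. excess Xs (state \<gamma> \<zeta> t))
    \<le> (divergence 0 Xs - divergence (iterate \<gamma> \<zeta> n) Xs) / \<eta> + (\<Sum>t<n. loss \<eta> \<gamma> \<zeta> Xs t)
      + (E_tilde \<Psi> V (state \<gamma> \<zeta> n) - E_tilde \<Psi> V Xs)"
proof (induction n)
  case 0
  have "gibbs H0 (density 0) - gibbs H0 Xs \<le> 0"
    using divergence_nonneg[OF Xs, of 0] by (simp add: divergence_def)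
  then have "(gibbs H0 (density 0) - gibbs H0 Xs) / \<beta> \<le> 0" using \<beta> by (simp add: divide_nonpos_pos)
  then show ?case by (simp add: excess_def)
next
  case (Suc n)
  let ?k = "iterate \<gamma> \<zeta> n" and ?k' = "iterate \<gamma> \<zeta> (Suc n)" and ?X' = "state \<gamma> \<zeta> (Suc n)"
  let ?g = "V *v sample_density (root \<gamma> \<zeta> n) (\<zeta> n)"
  have \<gamma>0: "0 < \<gamma>" and i\<gamma>: "1 / \<gamma> = 1 / \<eta> + 1 / \<beta>" using \<eta> \<beta> by (simp_all add: \<gamma> field_simps)
  have step: "gibbs (H0 + penalty ?k') Y / \<gamma> = gibbs (H0 + penalty ?k) Y / \<eta> + gibbs H0 Y / \<beta> + ?g \<bullet> rho \<Psi> Y" for Y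
    unfolding iterate.simps gibbs_step[OF \<eta> \<gamma>] using \<gamma>0 by simp
  have "divergence ?k' Xs / \<gamma> = (divergence ?k Xs - divergence ?k ?X') / \<eta>
      + (gibbs H0 Xs - gibbs H0 ?X') / \<beta> + ?g \<bullet> (rho \<Psi> Xs - rho \<Psi> ?X')"
    using step[of Xs] step[of ?X']
    unfolding divergence_def inner_diff_right diff_divide_distrib by linarith
  moreover have "divergence ?k' Xs / \<eta> \<le> divergence ?k' Xs / \<gamma>"
  proof -
    have "1 / \<eta> \<le> 1 / \<gamma>" using \<beta> by (simp add: i\<gamma>)
    from mult_left_mono[OF this divergence_nonneg[OF Xs, of ?k']] show ?thesis by simp
  qed
  ultimately have "(gibbs H0 ?X' - gibbs H0 Xs) / \<beta> \<le> (divergence ?k Xs - divergence ?k' Xs) / \<eta>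
      - divergence ?k ?X' / \<eta> + ?g \<bullet> (rho \<Psi> Xs - rho \<Psi> ?X')"
    unfolding diff_divide_distrib by linarith
  then have "excess Xs ?X' \<le> (E_tilde \<Psi> V ?X' - E_tilde \<Psi> V Xs) + (divergence ?k Xs - divergence ?k' Xs) / \<eta>
      - divergence ?k ?X' / \<eta> + ?g \<bullet> (rho \<Psi> Xs - rho \<Psi> ?X')"
    unfolding excess_def by linarith
  moreover have "loss \<eta> \<gamma> \<zeta> Xs n = E_tilde \<Psi> V (state \<gamma> \<zeta> n) - E_tilde \<Psi> V Xs
    + ?g \<bullet> (rho \<Psi> Xs - rho \<Psi> ?X') - divergence ?k ?X' / \<eta>" by (simp only: loss_def)
  ultimately show ?case using Suc unfolding sum.atMost_Suc sum.lessThan_Suc diff_divide_distrib by linarith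
qed

end

lemma quadratic_form_abs_le:
  fixes V :: "real^'m^'m"
  shows "\<bar>x \<bullet> (V *v y)\<bar> \<le> (\<Sum>i\<in>UNIV. \<bar>x $ i\<bar> * (\<Sum>j\<in>UNIV. \<bar>V $ i $ j\<bar> * \<bar>y $ j\<bar>))"
  unfolding inner_vec_def
proof (rule order_trans[OF sum_abs], rule sum_mono)
  fix i
  have "\<bar>(V *v y) $ i\<bar> \<le> (\<Sum>j\<in>UNIV. \<bar>V $ i $ j\<bar> * \<bar>y $ j\<bar>)"
    unfolding matrix_vector_mult_def by (simp, rule order_trans[OF sum_abs]) (simp add: abs_mult)
  then show "\<bar>x $ i \<bullet> (V *v y) $ i\<bar> \<le> \<bar>x $ i\<bar> * (\<Sum>j\<in>UNIV. \<bar>V $ i $ j\<bar> * \<bar>y $ j\<bar>)"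
    by (simp add: abs_mult mult_left_mono)
qed

text \<open>Schur's test for the density change caused by a change of the amplitudes.\<close>

lemma (in admissible_amplitudes) mass_change_form:
  assumes y: "admissible y" and y': "admissible y'"
  defines "d \<equiv> mass_density y - mass_density y'"
  shows "d \<bullet> (V *v d) \<le> 4 * c * (norm (y - y'))\<^sup>2"
proof -
  let ?q = "\<lambda>j. norm (y $ j) + norm (y' $ j)" and ?\<delta> = "\<lambda>j. norm ((y - y') $ j)"
  have d: "\<bar>d $ j\<bar> \<le> ?\<delta> j * ?q j" for j
  proof -
    have "d $ j = (y $ j - y' $ j) \<bullet> (y $ j + y' $ j)"
      by (simp add: d_def mass_density_def power2_norm_eq_inner inner_diff_left inner_diff_right inner_add_right inner_commute)
    then have "\<bar>d $ j\<bar> \<le> ?\<delta> j * norm (y $ j + y' $ j)"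
      using Cauchy_Schwarz_ineq2[of "y $ j - y' $ j" "y $ j + y' $ j"] by simp
    also have "\<dots> \<le> ?\<delta> j * ?q j" by (intro mult_left_mono norm_triangle_ineq) simp
    finally show ?thesis .
  qed
  have pot: "(\<Sum>j\<in>UNIV. \<bar>V $ i $ j\<bar> * (?q j)\<^sup>2) \<le> 4 * c" for i
  proof -
    have "(\<Sum>j\<in>UNIV. \<bar>V $ i $ j\<bar> * (?q j)\<^sup>2)
      \<le> (\<Sum>j\<in>UNIV. 2 * (\<bar>V $ i $ j\<bar> * (norm (y $ j))\<^sup>2) + 2 * (\<bar>V $ i $ j\<bar> * (norm (y' $ j))\<^sup>2))"
    proof (rule sum_mono)
      fix j
      have "(?q j)\<^sup>2 \<le> 2 * (norm (y $ j))\<^sup>2 + 2 * (norm (y' $ j))\<^sup>2"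
        using zero_le_power2[of "norm (y $ j) - norm (y' $ j)"] by (simp add: power2_eq_square algebra_simps)
      from mult_left_mono[OF this, of "\<bar>V $ i $ j\<bar>"]
      show "\<bar>V $ i $ j\<bar> * (?q j)\<^sup>2 \<le> 2 * (\<bar>V $ i $ j\<bar> * (norm (y $ j))\<^sup>2) + 2 * (\<bar>V $ i $ j\<bar> * (norm (y' $ j))\<^sup>2)"
        by (simp add: distrib_left mult.left_commute)
    qed
    also have "\<dots> \<le> 4 * c"
    proof -
      have "(\<Sum>j\<in>UNIV. \<bar>V $ i $ j\<bar> * (norm (y $ j))\<^sup>2) \<le> c" "(\<Sum>j\<in>UNIV. \<bar>V $ i $ j\<bar> * (norm (y' $ j))\<^sup>2) \<le> c"
        using y y' by (simp_all add: admissible_def)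
      then show ?thesis unfolding sum.distrib sum_distrib_left[symmetric] by linarith
    qed
    finally show ?thesis .
  qed
  let ?S = "\<Sum>i\<in>UNIV. \<Sum>j\<in>UNIV. \<bar>V $ i $ j\<bar> * ((?\<delta> i)\<^sup>2 * (?q j)\<^sup>2)"
  have "d \<bullet> (V *v d) \<le> (\<Sum>i\<in>UNIV. \<bar>d $ i\<bar> * (\<Sum>j\<in>UNIV. \<bar>V $ i $ j\<bar> * \<bar>d $ j\<bar>))"
    using quadratic_form_abs_le[of d V d] by linarith
  also have "\<dots> \<le> (\<Sum>i\<in>UNIV. (?\<delta> i * ?q i) * (\<Sum>j\<in>UNIV. \<bar>V $ i $ j\<bar> * (?\<delta> j * ?q j)))"
    by (intro sum_mono mult_mono d sum_nonneg mult_left_mono) auto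
  also have "\<dots> = (\<Sum>i\<in>UNIV. \<Sum>j\<in>UNIV. \<bar>V $ i $ j\<bar> * ((?\<delta> i * ?q j) * (?\<delta> j * ?q i)))"
    by (simp add: sum_distrib_left mult_ac)
  also have "\<dots> \<le> (\<Sum>i\<in>UNIV. \<Sum>j\<in>UNIV. \<bar>V $ i $ j\<bar> * (((?\<delta> i)\<^sup>2 * (?q j)\<^sup>2 + (?\<delta> j)\<^sup>2 * (?q i)\<^sup>2) / 2))"
  proof (intro sum_mono mult_left_mono)
    fix i j
    have "u * v \<le> (u\<^sup>2 + v\<^sup>2) / 2" for u v :: real using sum_squares_bound[of u v] by simp
    from this[of "?\<delta> i * ?q j" "?\<delta> j * ?q i"] show "(?\<delta> i * ?q j) * (?\<delta> j * ?q i) \<le> ((?\<delta> i)\<^sup>2 * (?q j)\<^sup>2 + (?\<delta> j)\<^sup>2 * (?q i)\<^sup>2) / 2"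
      by (simp only: power_mult_distrib)
  qed simp
  also have "\<dots> = (?S + (\<Sum>i\<in>UNIV. \<Sum>j\<in>UNIV. \<bar>V $ i $ j\<bar> * ((?\<delta> j)\<^sup>2 * (?q i)\<^sup>2))) / 2"
    by (simp add: sum.distrib[symmetric] sum_divide_distrib distrib_left add_divide_distrib)
  also have "(\<Sum>i\<in>UNIV. \<Sum>j\<in>UNIV. \<bar>V $ i $ j\<bar> * ((?\<delta> j)\<^sup>2 * (?q i)\<^sup>2)) = ?S"
    by (subst sum.swap) (simp only: V_symmetric)
  also have "(?S + ?S) / 2 = ?S" by (rule field_sum_of_halves[of ?S, folded add_divide_distrib])
  also have "?S = (\<Sum>i\<in>UNIV. (?\<delta> i)\<^sup>2 * (\<Sum>j\<in>UNIV. \<bar>V $ i $ j\<bar> * (?q j)\<^sup>2))"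
    by (simp add: sum_distrib_left mult.left_commute)
  also have "\<dots> \<le> (\<Sum>i\<in>UNIV. (?\<delta> i)\<^sup>2 * (4 * c))"
    by (intro sum_mono mult_left_mono pot) simp
  also have "\<dots> = 4 * c * (norm (y - y'))\<^sup>2"
    by (simp add: norm_matrix_square[of "y - y'"] sum_distrib_left mult_ac)
  finally show ?thesis .
qed

context mean_field
begin

lemma mass_density_root: "mass_density (\<Psi> ** msqrt (density k)) = rho \<Psi> (density k)"
  by (simp add: vec_eq_iff mass_density_def rho_amplitude[OF feasible_pos_semidef[OF density_feasible]])

lemma rho_nonneg: "X \<in> feasible \<Longrightarrow> 0 \<le> rho \<Psi> X $ j"
  by (simp add: rho_amplitude[OF feasible_pos_semidef])

lemma trace_rho: "X \<in> feasible \<Longrightarrow> (\<Sum>j\<in>UNIV. rho \<Psi> X $ j) = trace X"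
  using trace_amplitude[OF feasible_pos_semidef, of X]
  by (simp add: norm_matrix_square rho_amplitude[OF feasible_pos_semidef])

definition bounded_potential :: "real \<Rightarrow> real^'n^'n \<Rightarrow> bool" where
  "bounded_potential c X \<longleftrightarrow> (\<forall>i. (abs_mat V *v rho \<Psi> X) $ i \<le> c)"

lemma bounded_potential_sum:
  "bounded_potential c X \<Longrightarrow> (\<Sum>j\<in>UNIV. \<bar>V $ i $ j\<bar> * rho \<Psi> X $ j) \<le> c"
  by (simp add: bounded_potential_def matrix_vector_mult_def abs_mat_def)

lemma pairing_bound:
  assumes X: "X \<in> feasible" "bounded_potential c X" and x: "\<And>j. 0 \<le> x $ j"
  shows "(V *v x) \<bullet> rho \<Psi> X \<le> c * (\<Sum>j\<in>UNIV. x $ j)"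
proof -
  have "(V *v x) \<bullet> rho \<Psi> X = x \<bullet> (V *v rho \<Psi> X)"
    using symmetric_inner_mult[of V x "rho \<Psi> X"] V by (simp add: pos_semidef_def)
  also have "\<dots> \<le> (\<Sum>i\<in>UNIV. \<bar>x $ i\<bar> * (\<Sum>j\<in>UNIV. \<bar>V $ i $ j\<bar> * \<bar>rho \<Psi> X $ j\<bar>))"
    using quadratic_form_abs_le[of x V "rho \<Psi> X"] by linarith
  also have "\<dots> \<le> (\<Sum>i\<in>UNIV. x $ i * c)"
    using bounded_potential_sum[OF X(2)] x rho_nonneg[OF X(1)] by (intro sum_mono) (simp add: mult_left_mono)
  also have "\<dots> = c * (\<Sum>j\<in>UNIV. x $ j)" by (simp add: sum_distrib_left mult.commute)
  finally show ?thesis .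
qed

lemma sample_pairing_nonneg:
  assumes "X \<in> feasible"
  shows "0 \<le> (V *v sample_density (\<Psi> ** msqrt (density k)) z) \<bullet> rho \<Psi> X"
  unfolding penalty_inner[symmetric]
  by (intro pos_semidef_inner_nonneg sample_repulsive feasible_pos_semidef assms feasible_symmetric[OF density_feasible])

lemma E_tilde_nonneg: "0 \<le> E_tilde \<Psi> V X"
  using V by (simp add: E_tilde_def pos_semidef_def)

lemma E_tilde_le:
  assumes X: "X \<in> feasible" "bounded_potential c X" "trace X \<le> \<tau>" and c: "0 \<le> c"
  shows "E_tilde \<Psi> V X \<le> c * \<tau> / 2"
proof -
  have "rho \<Psi> X \<bullet> (V *v rho \<Psi> X) \<le> c * trace X"
    using pairing_bound[OF X(1,2), of "rho \<Psi> X"] rho_nonneg[OF X(1)] trace_rho[OF X(1)]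
    by (simp add: inner_commute)
  also have "\<dots> \<le> c * \<tau>" using X(3) c by (rule mult_left_mono)
  finally show ?thesis by (simp add: E_tilde_def)
qed

text \<open>The sampled potential pairs nonnegatively with every state, so the next iterate can be dropped and
  only the potential of \<open>Xs\<close> is paid.\<close>

lemma loss_crude:
  assumes c: "0 < c" and \<tau>: "1 \<le> \<tau>" and \<eta>: "0 < \<eta>"
    and Xs: "Xs \<in> feasible" "bounded_potential c Xs"
    and Xt: "bounded_potential c (state \<gamma> \<zeta> t)" "trace (state \<gamma> \<zeta> t) \<le> \<tau>"
  shows "loss \<eta> \<gamma> \<zeta> Xs t \<le> c * \<tau> / 2 + c * admissible_amplitudes.total (root \<gamma> \<zeta> t) (\<zeta> t)"
proof -
  interpret A: admissible_amplitudes V c \<tau> by standard (use V c \<tau> in auto)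
  have "(V *v sample_density (root \<gamma> \<zeta> t) (\<zeta> t)) \<bullet> rho \<Psi> Xs \<le> c * A.total (root \<gamma> \<zeta> t) (\<zeta> t)"
    unfolding A.total_def by (rule pairing_bound[OF Xs]) (simp add: sample_density_def)
  moreover have "0 \<le> (V *v sample_density (root \<gamma> \<zeta> t) (\<zeta> t)) \<bullet> rho \<Psi> (state \<gamma> \<zeta> (Suc t))"
    by (rule sample_pairing_nonneg[OF density_feasible])
  moreover have "E_tilde \<Psi> V (state \<gamma> \<zeta> t) \<le> c * \<tau> / 2"
    using c by (intro E_tilde_le density_feasible Xt) auto
  moreover have "0 \<le> divergence (iterate \<gamma> \<zeta> t) (state \<gamma> \<zeta> (Suc t)) / \<eta>"
    using \<eta> by (intro divide_nonneg_pos divergence_nonneg density_feasible)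
  moreover have "0 \<le> E_tilde \<Psi> V Xs" by (rule E_tilde_nonneg)
  ultimately show ?thesis unfolding loss_def inner_diff_right by linarith
qed

text \<open>The movement of the density between consecutive iterates is measured by the divergence, which
  absorbs it up to the quadratic form of the sampled density.\<close>

lemma loss_refined:
  assumes c: "0 < c" and \<tau>: "1 \<le> \<tau>" and \<eta>: "0 < \<eta>"
    and Xt: "bounded_potential c (state \<gamma> \<zeta> t)" "trace (state \<gamma> \<zeta> t) \<le> \<tau>"
    and Xt': "bounded_potential c (state \<gamma> \<zeta> (Suc t))" "trace (state \<gamma> \<zeta> (Suc t)) \<le> \<tau>"
  shows "loss \<eta> \<gamma> \<zeta> Xs t
    \<le> (admissible_amplitudes.noise V (rho \<Psi> Xs) (root \<gamma> \<zeta> t) (\<zeta> t)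
        - admissible_amplitudes.gap V (rho \<Psi> Xs) (root \<gamma> \<zeta> t) / 2)
      + c * min (\<eta> * admissible_amplitudes.reaction V (root \<gamma> \<zeta> t) (\<zeta> t))
          (admissible_amplitudes.total (root \<gamma> \<zeta> t) (\<zeta> t))"
proof -
  interpret A: admissible_amplitudes V c \<tau> by standard (use V c \<tau> in auto)
  let ?y = "root \<gamma> \<zeta> t" and ?y' = "root \<gamma> \<zeta> (Suc t)" and ?X = "state \<gamma> \<zeta> t" and ?X' = "state \<gamma> \<zeta> (Suc t)"
  let ?s = "sample_density ?y (\<zeta> t)" and ?D = "divergence (iterate \<gamma> \<zeta> t) ?X'"
  let ?\<rho> = "rho \<Psi> ?X" and ?\<rho>' = "rho \<Psi> ?X'" and ?\<rho>s = "rho \<Psi> Xs"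
  have sym: "x \<bullet> (V *v y) = y \<bullet> (V *v x)" for x y
    using symmetric_inner_mult[of V x y] V by (simp add: pos_semidef_def inner_commute)
  have adm: "A.admissible (\<Psi> ** msqrt (density k))" if "bounded_potential c (density k)" "trace (density k) \<le> \<tau>" for k
    unfolding A.admissible_def using bounded_potential_sum[OF that(1)] that(2)
    by (simp add: rho_amplitude[OF feasible_pos_semidef[OF density_feasible]]
        trace_amplitude[OF feasible_pos_semidef[OF density_feasible]])
  define stab where "stab = (V *v ?s) \<bullet> (?\<rho> - ?\<rho>') - ?D / \<eta>"
  have D: "(norm (?y - ?y'))\<^sup>2 \<le> ?D"
    using divergence_ge[of "state \<gamma> \<zeta> (Suc t)" "iterate \<gamma> \<zeta> t", OF density_feasible]
    by (simp only: amplitude_diff norm_amplitude norm_minus_commute)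
  have D0: "0 \<le> ?D" using D zero_le_power2 by (rule order_trans[rotated])
  have "loss \<eta> \<gamma> \<zeta> Xs t = (A.noise ?\<rho>s ?y (\<zeta> t) - A.gap ?\<rho>s ?y / 2) + stab"
  proof -
    have n: "A.noise ?\<rho>s ?y (\<zeta> t) = (V *v (?\<rho> - ?\<rho>s)) \<bullet> (?\<rho> - ?s)"
      unfolding A.noise_def A.force_def mass_density_root inner_vec_def by simp
    have g: "A.gap ?\<rho>s ?y = (?\<rho> - ?\<rho>s) \<bullet> (V *v (?\<rho> - ?\<rho>s))"
      unfolding A.gap_def A.force_def mass_density_root by simp
    show ?thesis
      unfolding n g stab_def loss_def E_tilde_def
      using sym[of ?\<rho> ?\<rho>s] sym[of ?\<rho> ?s] sym[of ?\<rho>s ?s]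
      by (simp add: matrix_vector_mult_diff_distrib inner_diff_left inner_diff_right inner_commute[of "V *v _"]
          diff_divide_distrib add_divide_distrib)
  qed
  moreover have "stab \<le> c * A.total ?y (\<zeta> t)"
  proof -
    have "(V *v ?s) \<bullet> ?\<rho> \<le> c * A.total ?y (\<zeta> t)"
      unfolding A.total_def by (rule pairing_bound[OF density_feasible Xt(1)]) (simp add: sample_density_def)
    moreover have "0 \<le> (V *v ?s) \<bullet> ?\<rho>'" by (rule sample_pairing_nonneg[OF density_feasible])
    moreover have "0 \<le> ?D / \<eta>" using D0 \<eta> by simp
    ultimately show ?thesis unfolding stab_def inner_diff_right by linarith
  qed
  moreover have "stab \<le> c * (\<eta> * A.reaction ?y (\<zeta> t))"
  proof -
    define R where "R = A.reaction ?y (\<zeta> t)"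
    define N where "N = norm (?y - ?y')"
    have R0: "0 \<le> R" unfolding R_def by (rule A.reaction_nonneg)
    have Q: "(?\<rho> - ?\<rho>') \<bullet> (V *v (?\<rho> - ?\<rho>')) \<le> 4 * c * N\<^sup>2"
      using A.mass_change_form[OF adm[OF Xt] adm[OF Xt']] unfolding mass_density_root N_def .
    have "((V *v ?s) \<bullet> (?\<rho> - ?\<rho>'))\<^sup>2 \<le> R * ((?\<rho> - ?\<rho>') \<bullet> (V *v (?\<rho> - ?\<rho>')))"
      using pos_semidef_cauchy_schwarz[OF V, of "?\<rho> - ?\<rho>'" ?s] unfolding R_def A.reaction_def
      by (simp only: inner_commute mult.commute)
    also have "\<dots> \<le> R * (4 * c * N\<^sup>2)" using Q R0 by (rule mult_left_mono)
    also have "\<dots> \<le> (c * \<eta> * R + N\<^sup>2 / \<eta>)\<^sup>2"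
    proof -
      have "(c * \<eta> * R + N\<^sup>2 / \<eta>)\<^sup>2 - R * (4 * c * N\<^sup>2) = (c * \<eta> * R - N\<^sup>2 / \<eta>)\<^sup>2"
        using \<eta> by (simp add: power2_eq_square field_simps)
      then show ?thesis using zero_le_power2[of "c * \<eta> * R - N\<^sup>2 / \<eta>"] by linarith
    qed
    finally have "(V *v ?s) \<bullet> (?\<rho> - ?\<rho>') \<le> c * \<eta> * R + N\<^sup>2 / \<eta>"
      by (rule power2_le_imp_le) (use c \<eta> R0 in auto)
    moreover have "N\<^sup>2 / \<eta> \<le> ?D / \<eta>" using D \<eta> unfolding N_def by (simp add: divide_right_mono)
    ultimately show ?thesis unfolding stab_def R_def[symmetric] by (simp add: mult.assoc)
  qed
  ultimately show ?thesis using c by (simp add: min_def)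
qed

end


section \<open>Uniformity over step sizes and cells\<close>

text \<open>The sum is majorized through a function \<open>g\<close> whose increments under \<open>x \<mapsto> sqrt 2 x\<close> dominate
  \<open>min (1/x) x\<close> and which is bounded by \<open>3 + 2 sqrt 2\<close>.\<close>

lemma sum_two_sided_geometric:
  fixes q :: real
  assumes q: "0 < q"
  shows "(\<Sum>k<K. min (q / sqrt 2 ^ k) (sqrt 2 ^ k / q)) \<le> 6"
proof -
  define s where "s = sqrt (2 :: real)"
  have s2: "s * s = 2" by (simp add: s_def)
  have s1: "1 < s" by (simp add: s_def)
  have s3: "s \<le> 3 / 2" unfolding s_def by (rule real_le_lsqrt) (auto simp: power2_eq_square)
  define g where "g x = (if x \<le> 1 then (s + 1) * x else 3 + 2 * s - (2 + s) / x)" for x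
  have step: "min (1 / x) x \<le> g (s * x) - g x" if x: "0 < x" for x
  proof -
    consider "s * x \<le> 1" | "x \<le> 1" "1 < s * x" | "1 < x" by linarith
    then show ?thesis
    proof cases
      case 1
      have "x \<le> s * x" using x s1 by simp
      then have "x \<le> 1" using 1 by linarith
      then have "g (s * x) - g x = (s * s - 1) * x" using 1 by (simp add: g_def algebra_simps)
      then show ?thesis by (simp add: s2)
    next
      case 2
      have "0 \<le> (1 - x) * ((s + 1) * (s * x - 1))" using 2 s1 by (intro mult_nonneg_nonneg) auto
      also have "(1 - x) * ((s + 1) * (s * x - 1)) = (3 + 2 * s) * x - (s + 1) - (s + 2) * x * x"
        using s2 by (simp add: algebra_simps) (simp add: mult.assoc[symmetric] s2)
      finally have "(s + 2) * x * x + (s + 1) \<le> (3 + 2 * s) * x" by linarith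
      moreover have "((s + 2) * x + (s + 1) / x) * x = (s + 2) * x * x + (s + 1)"
        using x by (simp add: distrib_right[of "(s + 2) * x"])
      ultimately have "((s + 2) * x + (s + 1) / x) * x \<le> (3 + 2 * s) * x" by linarith
      then have "(s + 2) * x + (s + 1) / x \<le> 3 + 2 * s" using x by simp
      moreover have "(2 + s) / (s * x) = (s + 1) / x"
      proof -
        have "2 + s = s * (s + 1)" using s2 by (simp add: algebra_simps)
        then show ?thesis using s1 by simp
      qed
      ultimately have "x \<le> g (s * x) - g x" using 2 by (simp add: g_def algebra_simps)
      then show ?thesis by simp
    next
      case 3
      moreover have "x < s * x" using s1 x by simp
      ultimately have "1 < s * x" by linarith
      moreover have "(2 + s) / (s * x) = (s + 1) / x"
      proof -
        have "2 + s = s * (s + 1)" using s2 by (simp add: algebra_simps)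
        then show ?thesis using s1 by simp
      qed
      ultimately have "g (s * x) - g x = 1 / x" using 3 by (simp add: g_def diff_divide_distrib[symmetric])
      then show ?thesis by simp
    qed
  qed
  have "(\<Sum>k<K. min (q / s ^ k) (s ^ k / q)) \<le> g (s ^ K / q)"
  proof (induction K)
    case 0
    show ?case
    proof (cases "1 / q \<le> 1")
      case True
      then show ?thesis using q s1 by (simp add: g_def)
    next
      case False
      then have "(2 + s) * q \<le> (2 + s) * 1" using q s1 by (intro mult_left_mono) (auto simp: field_simps)
      also have "\<dots> \<le> 3 + 2 * s" using s1 by simp
      finally show ?thesis using False by (simp add: g_def)
    qed
  next
    case (Suc K)
    have "min (q / s ^ K) (s ^ K / q) \<le> g (s ^ Suc K / q) - g (s ^ K / q)"
      using step[of "s ^ K / q"] q s1 by simp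
    then show ?case using Suc by simp
  qed
  also have "g x \<le> 6" if "0 < x" for x
  proof (cases "x \<le> 1")
    case True
    then have "(s + 1) * x \<le> (s + 1) * 1" using s1 by (intro mult_left_mono) auto
    then show ?thesis using True s3 by (simp add: g_def)
  next
    case False
    then have "0 \<le> (2 + s) / x" using s1 by simp
    then show ?thesis using False s3 unfolding g_def by simp
  qed
  finally show ?thesis using q s1 by (simp add: s_def)
qed

text \<open>Row \<open>j\<close> contributes appreciably only where \<open>V\<^sub>j\<^sub>j\<close> and \<open>c\<close> are of the same order, which makes the sum over
  dyadic levels \<open>c\<close> finite.\<close>

definition crossover :: "real^'m^'m \<Rightarrow> real \<Rightarrow> real" where
  "crossover V c = (\<Sum>j\<in>UNIV. min (sqrt (V $ j $ j) / sqrt c) (sqrt c / sqrt (V $ j $ j)))"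

lemma sum_crossover:
  fixes V :: "real^'m^'m"
  assumes V: "pos_semidef V" and a: "0 < a"
  shows "(\<Sum>k<K. crossover V (a * 2 ^ k)) \<le> 6 * real CARD('m)"
proof -
  have "(\<Sum>k<K. crossover V (a * 2 ^ k))
    = (\<Sum>j\<in>UNIV. \<Sum>k<K. min (sqrt (V $ j $ j) / sqrt (a * 2 ^ k)) (sqrt (a * 2 ^ k) / sqrt (V $ j $ j)))"
    unfolding crossover_def by (rule sum.swap)
  also have "\<dots> \<le> (\<Sum>j\<in>(UNIV :: 'm set). 6)"
  proof (rule sum_mono)
    fix j
    show "(\<Sum>k<K. min (sqrt (V $ j $ j) / sqrt (a * 2 ^ k)) (sqrt (a * 2 ^ k) / sqrt (V $ j $ j))) \<le> 6"
    proof (cases "V $ j $ j = 0")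
      case True
      then show ?thesis by simp
    next
      case False
      then have v: "0 < V $ j $ j" using pos_semidef_diag_nonneg[OF V, of j] by simp
      have "sqrt (V $ j $ j) / sqrt (a * 2 ^ k) = (sqrt (V $ j $ j) / sqrt a) / sqrt 2 ^ k"
        "sqrt (a * 2 ^ k) / sqrt (V $ j $ j) = sqrt 2 ^ k / (sqrt (V $ j $ j) / sqrt a)" for k
        by (simp_all add: real_sqrt_mult real_sqrt_power mult.commute)
      moreover have "0 < sqrt (V $ j $ j) / sqrt a" using v a by simp
      ultimately show ?thesis using sum_two_sided_geometric[of "sqrt (V $ j $ j) / sqrt a" K] by (simp only:)
    qed
  qed
  finally show ?thesis by simp
qed

text \<open>A row of large \<open>V\<^sub>j\<^sub>j\<close> has a small amplitude because of the potential bound; for the other rows the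
  amplitude is at most one.\<close>

lemma (in amplitude_family) mass_le_crossover:
  assumes c: "0 < c"
  shows "(\<Sum>j\<in>UNIV. sqrt (V $ j $ j) * (norm (Y k $ j))\<^sup>2) \<le> sqrt c * crossover V c"
  unfolding crossover_def sum_distrib_left
proof (rule sum_mono)
  fix j
  let ?v = "sqrt (V $ j $ j)" and ?r = "norm (Y k $ j)"
  have v: "0 \<le> ?v" using pos_semidef_diag_nonneg[OF V, of j] by simp
  have "?v * ?r\<^sup>2 \<le> ?v * 1" using row[of k j] v by (intro mult_left_mono) (auto simp: power_le_one)
  also have "\<dots> = sqrt c * (?v / sqrt c)" using c by simp
  finally have 1: "?v * ?r\<^sup>2 \<le> sqrt c * (?v / sqrt c)" .
  have 2: "?v * ?r\<^sup>2 \<le> sqrt c * (sqrt c / ?v)"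
  proof (cases "?v = 0")
    case False
    then have v0: "0 < ?v" using v by simp
    have "(?v * ?r) * (?v * ?r) \<le> sqrt c * sqrt c" using diag_amplitude[of j k] v c by (intro mult_mono) auto
    then have "?v * ?r\<^sup>2 * ?v \<le> sqrt c * sqrt c" by (simp add: power2_eq_square mult_ac)
    then show ?thesis using v0 by (simp add: pos_le_divide_eq)
  qed simp
  show "?v * ?r\<^sup>2 \<le> sqrt c * min (?v / sqrt c) (sqrt c / ?v)" using 1 2 by (simp add: min_def)
qed

lemma (in scored_family) drift_le:
  assumes e: "\<Gamma> * c \<le> 2 * e" "0 \<le> e"
  shows "drift \<le> exp (h * real T) * (L * (7 / 2 * e * sqrt (real CARD('m)) * (real T)\<^sup>2 * exp (7 * e * real T)) * \<mu>)"
proof -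
  have s3: "sqrt 3 \<le> (7 / 4 :: real)" by (rule real_le_lsqrt) (auto simp: power2_eq_square)
  have \<Gamma>c: "0 \<le> \<Gamma> * c" using \<Gamma> c_nonneg by simp
  have g: "sqrt 3 * (\<Gamma> * c) \<le> 7 / 4 * (2 * e)" using mult_mono[OF s3 e(1) _ \<Gamma>c] by simp
  have "growth = 1 + 2 * (sqrt 3 * (\<Gamma> * c))" by (simp add: growth_def)
  then have "growth \<le> exp (7 * e)" using g exp_ge_add_one_self[of "7 * e"] by linarith
  then have "growth ^ i \<le> exp (7 * e * real T)" if "i < T" for i
  proof -
    have "growth ^ i \<le> exp (7 * e) ^ i" using growth \<open>growth \<le> _\<close> by (intro power_mono) auto
    also have "\<dots> = exp (7 * e * real i)" by (simp add: exp_of_nat_mult[symmetric] mult.commute)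
    also have "\<dots> \<le> exp (7 * e * real T)" using e that by (simp add: mult_left_mono)
    finally show ?thesis .
  qed
  then have "(\<Sum>t<T. \<Sum>i<t. growth ^ i) \<le> (\<Sum>t<T. \<Sum>i<t. exp (7 * e * real T))"
    by (intro sum_mono) auto
  also have "\<dots> = exp (7 * e * real T) * (\<Sum>t<T. real t)" by (simp add: sum_distrib_right mult.commute)
  also have "\<dots> \<le> exp (7 * e * real T) * ((real T)\<^sup>2 / 2)"
  proof -
    have "(\<Sum>t<n. real t) \<le> (real n)\<^sup>2 / 2" for n by (induction n) (auto simp: power2_eq_square field_simps)
    then show ?thesis by (intro mult_left_mono) auto
  qed
  finally have S: "(\<Sum>t<T. \<Sum>i<t. growth ^ i) \<le> exp (7 * e * real T) * ((real T)\<^sup>2 / 2)" .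
  have "drift = (2 * exp (h * real T) * L * sqrt (real CARD('m)) * \<mu>) * ((sqrt 3 * (\<Gamma> * c)) * (\<Sum>t<T. \<Sum>i<t. growth ^ i))"
    by (simp add: drift_def)
  also have "\<dots> \<le> (2 * exp (h * real T) * L * sqrt (real CARD('m)) * \<mu>) * ((7 / 4 * (2 * e)) * (exp (7 * e * real T) * ((real T)\<^sup>2 / 2)))"
  proof (rule mult_left_mono)
    show "(sqrt 3 * (\<Gamma> * c)) * (\<Sum>t<T. \<Sum>i<t. growth ^ i) \<le> (7 / 4 * (2 * e)) * (exp (7 * e * real T) * ((real T)\<^sup>2 / 2))"
      using growth e by (intro mult_mono[OF g S]) (auto intro!: sum_nonneg)
  qed (use L \<mu> in auto)
  also have "\<dots> = exp (h * real T) * (L * (7 / 2 * e * sqrt (real CARD('m)) * (real T)\<^sup>2 * exp (7 * e * real T)) * \<mu>)"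
    by simp
  finally show ?thesis .
qed

text \<open>The supremum over all step sizes and all cells is dominated by one random variable: the value
  at step size zero, which the cells share, plus the variations of all cells.\<close>

lemma scores_uniform:
  fixes Y :: "nat \<Rightarrow> real^'m \<Rightarrow> real^'n^'m" and b :: "nat \<Rightarrow> real^'n^'m \<Rightarrow> real^'n \<Rightarrow> real" and c \<Gamma> \<mu> :: "nat \<Rightarrow> real"
  assumes fam: "\<And>k. scored_family V (Y k) (c k) \<tau> \<beta> M z n (b k) h L (\<mu> k) (\<Gamma> k)"
    and base: "\<And>k \<omega>. scored_family.score V (Y k) \<beta> z n (b k) 0 \<omega> \<le> max 0 (scored_family.score V (Y 0) \<beta> z n (b 0) 0 \<omega>)"
    and h: "0 \<le> h" and \<delta>: "0 < \<delta>" and B: "0 \<le> B"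
    and \<Gamma>c: "\<And>k. \<Gamma> k * c k \<le> 2 * e" and e: "0 \<le> e"
    and sum\<mu>: "\<And>K. (\<Sum>k<K. \<mu> k) \<le> S"
    and BS: "L * (7 / 2 * e * sqrt (real CARD('m)) * (real n)\<^sup>2 * exp (7 * e * real n)) * S \<le> B"
  obtains N where "N \<in> sets M" "measure M N \<le> \<delta>"
    "\<And>\<omega> k \<gamma>. \<omega> \<in> space M - N \<Longrightarrow> 0 \<le> \<gamma> \<Longrightarrow> \<gamma> \<le> \<Gamma> k \<Longrightarrow>
       scored_family.score V (Y k) \<beta> z n (b k) \<gamma> \<omega> \<le> h * real n + ln ((2 + B) / \<delta>)"
proof -
  interpret F: scored_family V "Y k" "c k" \<tau> \<beta> M z n "b k" h L "\<mu> k" "\<Gamma> k" for k :: nat by (rule fam)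
  define D where "D = L * (7 / 2 * e * sqrt (real CARD('m)) * (real n)\<^sup>2 * exp (7 * e * real n))"
  have D0: "0 \<le> D" using F.L e by (simp add: D_def)
  define \<Phi> where "\<Phi> \<omega> = (1 + ennreal (exp (F.score 0 0 \<omega>))) + (\<Sum>k. F.variation k \<omega>)" for \<omega>
  have sm [measurable]: "F.score 0 0 \<in> borel_measurable M" by (rule F.score_measurable)
  have \<Phi>m [measurable]: "\<Phi> \<in> borel_measurable M" unfolding \<Phi>_def[abs_def] by measurable
  have dom: "ennreal (exp (F.score k \<gamma> \<omega>)) \<le> \<Phi> \<omega>" if g: "0 \<le> \<gamma>" "\<gamma> \<le> \<Gamma> k" for k \<gamma> \<omega>
  proof -
    have "exp (F.score k 0 \<omega>) \<le> 1 + exp (F.score 0 0 \<omega>)"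
    proof (cases "0 \<le> F.score 0 0 \<omega>")
      case True
      then have "exp (F.score k 0 \<omega>) \<le> exp (F.score 0 0 \<omega>)" using base[of k \<omega>] by simp
      then show ?thesis by linarith
    next
      case False
      then have "exp (F.score k 0 \<omega>) \<le> exp 0" using base[of k \<omega>] by simp
      then show ?thesis using exp_ge_zero[of "F.score 0 0 \<omega>"] unfolding exp_zero by linarith
    qed
    then have "ennreal (exp (F.score k 0 \<omega>)) \<le> ennreal (1 + exp (F.score 0 0 \<omega>))" by (rule ennreal_leI)
    also have "\<dots> = 1 + ennreal (exp (F.score 0 0 \<omega>))" by simp
    finally have 1: "ennreal (exp (F.score k 0 \<omega>)) \<le> 1 + ennreal (exp (F.score 0 0 \<omega>))" .
    have 2: "F.variation k \<omega> \<le> (\<Sum>k. F.variation k \<omega>)"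
      using sum_le_suminf[OF summableI, of "{k}" "\<lambda>k. F.variation k \<omega>"] by simp
    show ?thesis unfolding \<Phi>_def using order_trans[OF F.exp_score_le_variation[OF g] add_mono[OF 1 2]] .
  qed
  define E where "E = exp (h * real n)"
  have E1: "1 \<le> E" using h by (simp add: E_def)
  have one: "L2_le M (\<lambda>\<omega>. 1) 1" by (rule L2_le_const[OF F.prob_space_axioms]) simp
  have I1: "(\<integral>\<^sup>+\<omega>. ennreal (exp (F.score 0 0 \<omega>)) \<partial>M) \<le> ennreal E"
    using nn_integral_mult_L2[OF F.exp_score_L2 one] by (simp add: E_def)
  have I2: "(\<integral>\<^sup>+\<omega>. (\<Sum>k. F.variation k \<omega>) \<partial>M) \<le> ennreal (E * B)"
  proof -
    have "(\<integral>\<^sup>+\<omega>. (\<Sum>k. F.variation k \<omega>) \<partial>M) = (\<Sum>k. \<integral>\<^sup>+\<omega>. F.variation k \<omega> \<partial>M)"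
      by (rule nn_integral_suminf) measurable
    also have "\<dots> \<le> ennreal (E * B)"
    proof (rule suminf_le_const[OF summableI])
      fix K
      have "(\<Sum>k<K. \<integral>\<^sup>+\<omega>. F.variation k \<omega> \<partial>M) \<le> (\<Sum>k<K. ennreal (E * (D * \<mu> k)))"
      proof (rule sum_mono)
        fix k
        have "F.drift k \<le> E * (D * \<mu> k)" unfolding E_def D_def by (rule F.drift_le[OF \<Gamma>c e])
        then show "(\<integral>\<^sup>+\<omega>. F.variation k \<omega> \<partial>M) \<le> ennreal (E * (D * \<mu> k))"
          using F.nn_integral_variation[of k] by (meson ennreal_leI order_trans)
      qed
      also have "\<dots> = ennreal (\<Sum>k<K. E * (D * \<mu> k))"
        using E1 D0 F.\<mu> by (intro sum_ennreal) auto
      also have "\<dots> \<le> ennreal (E * B)"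
      proof (rule ennreal_leI)
        have "(\<Sum>k<K. E * (D * \<mu> k)) = E * (D * (\<Sum>k<K. \<mu> k))" by (simp add: sum_distrib_left)
        also have "\<dots> \<le> E * (D * S)" using sum\<mu>[of K] D0 E1 by (intro mult_left_mono) auto
        also have "\<dots> \<le> E * B" using BS E1 unfolding D_def by (intro mult_left_mono) auto
        finally show "(\<Sum>k<K. E * (D * \<mu> k)) \<le> E * B" .
      qed
      finally show "(\<Sum>k<K. \<integral>\<^sup>+\<omega>. F.variation k \<omega> \<partial>M) \<le> ennreal (E * B)" .
    qed
    finally show ?thesis .
  qed
  have I: "(\<integral>\<^sup>+\<omega>. \<Phi> \<omega> \<partial>M) \<le> ennreal (E * (2 + B))"
  proof -
    have "(\<integral>\<^sup>+\<omega>. \<Phi> \<omega> \<partial>M) = (\<integral>\<^sup>+\<omega>. 1 + ennreal (exp (F.score 0 0 \<omega>)) \<partial>M) + (\<integral>\<^sup>+\<omega>. (\<Sum>k. F.variation k \<omega>) \<partial>M)"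
      unfolding \<Phi>_def by (rule nn_integral_add) measurable
    also have "(\<integral>\<^sup>+\<omega>. 1 + ennreal (exp (F.score 0 0 \<omega>)) \<partial>M) = 1 + (\<integral>\<^sup>+\<omega>. ennreal (exp (F.score 0 0 \<omega>)) \<partial>M)"
      by (subst nn_integral_add) (simp_all add: F.emeasure_space_1)
    also have "1 + (\<integral>\<^sup>+\<omega>. ennreal (exp (F.score 0 0 \<omega>)) \<partial>M) + (\<integral>\<^sup>+\<omega>. (\<Sum>k. F.variation k \<omega>) \<partial>M)
      \<le> 1 + ennreal E + ennreal (E * B)" by (intro add_mono order_refl I1 I2)
    also have "\<dots> = ennreal (1 + E + E * B)" using E1 B by simp
    also have "\<dots> \<le> ennreal (E * (2 + B))" using E1 by (intro ennreal_leI) (simp add: algebra_simps)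
    finally show ?thesis .
  qed
  define q where "q = \<delta> / (E * (2 + B))"
  have q: "0 < q" using \<delta> E1 B by (simp add: q_def)
  define N where "N = {\<omega> \<in> space M. 1 \<le> ennreal q * \<Phi> \<omega>}"
  have N: "N \<in> sets M" unfolding N_def by measurable
  have "emeasure M N \<le> ennreal q * (\<integral>\<^sup>+\<omega>. \<Phi> \<omega> * indicator (space M) \<omega> \<partial>M)"
    unfolding N_def by (rule nn_integral_Markov_inequality) auto
  also have "(\<integral>\<^sup>+\<omega>. \<Phi> \<omega> * indicator (space M) \<omega> \<partial>M) = (\<integral>\<^sup>+\<omega>. \<Phi> \<omega> \<partial>M)"
    by (intro nn_integral_cong) simp
  also have "ennreal q * \<dots> \<le> ennreal q * ennreal (E * (2 + B))" by (intro mult_left_mono I) simp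
  also have "\<dots> = ennreal \<delta>" using q E1 B by (simp add: ennreal_mult[symmetric] q_def)
  finally have mN: "measure M N \<le> \<delta>" using \<delta> by (simp add: F.emeasure_eq_measure)
  show ?thesis
  proof (rule that[OF N mN])
    fix \<omega> k \<gamma> assume w: "\<omega> \<in> space M - N" and g: "0 \<le> \<gamma>" "\<gamma> \<le> \<Gamma> k"
    have "ennreal (q * exp (F.score k \<gamma> \<omega>)) = ennreal q * ennreal (exp (F.score k \<gamma> \<omega>))"
      using q by (simp add: ennreal_mult)
    also have "\<dots> \<le> ennreal q * \<Phi> \<omega>" by (intro mult_left_mono dom g) simp
    also have "\<dots> < 1" using w by (auto simp: N_def not_le)
    finally have "q * exp (F.score k \<gamma> \<omega>) < 1" by (simp add: ennreal_less_one_iff)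
    then have "exp (F.score k \<gamma> \<omega>) < 1 / q" using q by (simp add: pos_less_divide_eq mult.commute)
    also have "1 / q = E * ((2 + B) / \<delta>)" by (simp add: q_def)
    also have "\<dots> = exp (h * real n + ln ((2 + B) / \<delta>))" using \<delta> B by (simp add: exp_add E_def)
    finally show "F.score k \<gamma> \<omega> \<le> h * real n + ln ((2 + B) / \<delta>)" by simp
  qed
qed


section \<open>Bounds along the iterates\<close>

context admissible_amplitudes
begin

lemma total_continuous: "continuous_on UNIV (\<lambda>p. total (fst p) (snd p) :: real)"
  unfolding total_def by (intro continuous_intros sample_density_continuous)

lemma reaction_continuous: "continuous_on UNIV (\<lambda>p. reaction (fst p) (snd p))"
  unfolding reaction_def by (intro continuous_intros sample_density_continuous matrix_vector_continuous)

lemma mass_density_continuous: "continuous_on S f \<Longrightarrow> continuous_on S (\<lambda>x. mass_density (f x))"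
  unfolding mass_density_def by (intro continuous_intros)

lemma noise_score_continuous: "continuous_on UNIV (\<lambda>p. noise_score \<rho>s (fst p) (snd p))"
  unfolding noise_score_def noise_def gap_def force_def
  using c \<tau> by (intro continuous_intros sample_density_continuous matrix_vector_continuous mass_density_continuous) auto

lemma total_score_continuous: "continuous_on UNIV (\<lambda>p. total_score (fst p) (snd p))"
  unfolding total_score_def using \<tau> by (intro continuous_intros total_continuous) auto

lemma reaction_score_continuous: "continuous_on UNIV (\<lambda>p. reaction_score e (fst p) (snd p))"
  unfolding reaction_score_def using \<tau>
  by (intro continuous_intros total_continuous reaction_continuous) auto

end

text \<open>Cell \<open>k\<close> is made for trajectories whose observed potential \<open>v\<close> lies between \<open>level k / 2\<close> and
  \<open>level k\<close>. The algorithm takes \<open>\<eta> = \<epsilon> / v\<close> with a deterministic \<open>\<epsilon>\<close>, so its step sizes in that cell are at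
  most \<open>step_limit k\<close>.\<close>

locale cells = mean_field \<Psi> V H0 \<beta> + gaussian_sequence M z n
  for \<Psi> :: "real^'n^'m" and V :: "real^'m^'m" and H0 :: "real^'n^'n" and \<beta> :: real
    and M :: "'w measure" and z :: "nat \<Rightarrow> 'w \<Rightarrow> real^'n" and n :: nat +
  fixes a \<tau> \<epsilon> :: real
  assumes a: "0 < a" and \<tau>: "1 \<le> \<tau>" and \<epsilon>: "0 \<le> \<epsilon>"
    and initial: "bounded_potential a (logistic H0)" "trace (logistic H0) \<le> \<tau>"
begin

definition level :: "nat \<Rightarrow> real" where
  "level k = a * 2 ^ k"

definition step_limit :: "nat \<Rightarrow> real" where
  "step_limit k = min \<beta> (2 * \<epsilon> / level k)"

abbreviation amp :: "nat \<Rightarrow> real^'m \<Rightarrow> real^'n^'m" where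
  "amp k \<equiv> window.amplitude \<Psi> V H0 (level k) \<tau>"

lemma level_pos: "0 < level k"
  using a by (simp add: level_def)

lemma level_ge: "a \<le> level k"
  using a by (simp add: level_def)

lemma window: "window \<Psi> V H0 (level k) \<tau>"
proof
  show "(abs_mat V *v rho \<Psi> (logistic H0)) $ i \<le> level k" for i
    using initial(1) level_ge[of k] unfolding bounded_potential_def by (meson order_trans)
qed (use V H0 initial in auto)

lemma amplitude_family: "amplitude_family V (amp k) (level k) \<tau> \<beta>"
  by standard (use V \<beta> \<tau> window.amplitude_potential[OF window] window.amplitude_trace[OF window]
    window.amplitude_row[OF window] window.amplitude_lipschitz[OF window] in auto)

lemma admissible_amplitudes: "admissible_amplitudes V (level k) \<tau>"
  by standard (use V level_pos \<tau> in auto)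

lemma amp_admissible: "admissible_amplitudes.admissible V (level k) \<tau> (amp k \<kappa>)"
  unfolding admissible_amplitudes.admissible_def[OF admissible_amplitudes]
  using window.amplitude_potential[OF window] window.amplitude_trace[OF window] by auto

lemma amp_zero: "amp k 0 = \<Psi> ** msqrt (logistic H0)"
  by (rule window.amplitude_zero[OF window])

lemma amp_root:
  assumes g: "0 \<le> \<gamma>" "\<gamma> \<le> \<beta>" and p: "bounded_potential (level k) (state \<gamma> \<zeta> t)"
  shows "amp k (iterate \<gamma> \<zeta> t) = root \<gamma> \<zeta> t"
proof -
  have "state \<gamma> \<zeta> t \<in> window.window \<Psi> V (level k) \<tau>"
    unfolding window.window_def[OF window]
    using density_feasible p order_trans[OF iterate_trace[OF g] initial(2)]
    by (auto simp: bounded_potential_def)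
  then show ?thesis
    by (simp only: window.amplitude_def[OF window] window.proxy_eq_logistic[OF window])
qed

lemma path_eq_iterate:
  assumes g: "0 \<le> \<gamma>" "\<gamma> \<le> \<beta>"
  shows "(\<And>s. s < t \<Longrightarrow> bounded_potential (level k) (state \<gamma> \<zeta> s)) \<Longrightarrow>
    amplitude_family.path V (amp k) \<beta> \<gamma> \<zeta> t = iterate \<gamma> \<zeta> t"
proof (induction t)
  case 0
  then show ?case by (simp add: amplitude_family.path.simps[OF amplitude_family])
next
  case (Suc t)
  have IH: "amplitude_family.path V (amp k) \<beta> \<gamma> \<zeta> t = iterate \<gamma> \<zeta> t"
    by (rule Suc.IH) (simp add: Suc.prems)
  have "amp k (iterate \<gamma> \<zeta> t) = root \<gamma> \<zeta> t" by (rule amp_root[OF g]) (simp add: Suc.prems)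
  then show ?case by (simp only: amplitude_family.path.simps[OF amplitude_family] IH iterate.simps)
qed

text \<open>As long as the iterates stay in the window of a cell they follow the proxy of that cell, so
  a bound that is uniform over the proxies holds for the algorithm with its random step size.\<close>

lemma iterates_uniform:
  fixes b :: "nat \<Rightarrow> real^'n^'m \<Rightarrow> real^'n \<Rightarrow> real"
  assumes cont: "\<And>k. continuous_on UNIV (\<lambda>p. b k (fst p) (snd p))" and L: "0 \<le> L" and h: "0 \<le> h" and \<delta>: "0 < \<delta>"
    and lip: "\<And>k y y'. admissible_amplitudes.admissible V (level k) \<tau> y \<Longrightarrow> admissible_amplitudes.admissible V (level k) \<tau> y' \<Longrightarrow>
      L2_le gaussian (\<lambda>x. b k y x - b k y' x) (L * norm (y - y'))"
    and exp: "\<And>k y. admissible_amplitudes.admissible V (level k) \<tau> y \<Longrightarrow>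
      (\<integral>\<^sup>+x. ennreal (exp (2 * b k y x)) \<partial>gaussian) \<le> ennreal (exp (2 * h))"
    and base: "\<And>k y \<zeta>. (\<Sum>t<n. b k y (\<zeta> t)) \<le> max 0 (\<Sum>t<n. b 0 y (\<zeta> t))"
  obtains N where "N \<in> sets M" "measure M N \<le> \<delta>"
    "\<And>\<omega> k \<gamma>. \<omega> \<in> space M - N \<Longrightarrow> 0 \<le> \<gamma> \<Longrightarrow> \<gamma> \<le> step_limit k \<Longrightarrow>
       (\<And>t. t < n \<Longrightarrow> bounded_potential (level k) (state \<gamma> (sample \<omega>) t)) \<Longrightarrow>
       (\<Sum>t<n. b k (root \<gamma> (sample \<omega>) t) (z t \<omega>))
         \<le> h * real n + ln ((2 + 21 * L * \<epsilon> * real CARD('m) * sqrt (real CARD('m)) * (real n)\<^sup>2 * exp (7 * \<epsilon> * real n)) / \<delta>)"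
proof -
  define B where "B = 21 * L * \<epsilon> * real CARD('m) * sqrt (real CARD('m)) * (real n)\<^sup>2 * exp (7 * \<epsilon> * real n)"
  have fam: "scored_family V (amp k) (level k) \<tau> \<beta> M z n (b k) h L (crossover V (level k)) (step_limit k)" for k
  proof -
    interpret A: amplitude_family V "amp k" "level k" \<tau> \<beta> by (rule amplitude_family)
    show ?thesis
    proof
      show "0 \<le> crossover V (level k)"
        unfolding crossover_def using level_pos[of k] pos_semidef_diag_nonneg[OF V] by (intro sum_nonneg) auto
      show "0 \<le> step_limit k" using \<beta> \<epsilon> level_pos[of k] by (simp add: step_limit_def)
    qed (use cont L lip exp amp_admissible A.mass_le_crossover[OF level_pos] in \<open>auto simp: step_limit_def\<close>)
  qed
  have sc: "scored_family.score V (amp k) \<beta> z n (b k) \<gamma> \<omega>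
    = (\<Sum>t<n. b k (amp k (amplitude_family.path V (amp k) \<beta> \<gamma> (sample \<omega>) t)) (z t \<omega>))" for k \<gamma> \<omega>
    by (rule scored_family.score_def[OF fam])
  have path0: "amplitude_family.path V (amp k) \<beta> 0 \<zeta> t = 0" for k \<zeta> t
    by (induction t) (simp_all add: amplitude_family.path.simps[OF amplitude_family])
  have "\<exists>N \<in> sets M. measure M N \<le> \<delta> \<and> (\<forall>\<omega> k \<gamma>. \<omega> \<in> space M - N \<longrightarrow> 0 \<le> \<gamma> \<longrightarrow> \<gamma> \<le> step_limit k \<longrightarrow>
     scored_family.score V (amp k) \<beta> z n (b k) \<gamma> \<omega> \<le> h * real n + ln ((2 + B) / \<delta>))"
  proof (rule scores_uniform[OF fam, where e = \<epsilon> and \<delta> = \<delta> and B = B and S = "6 * real CARD('m)"])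
    show "scored_family.score V (amp k) \<beta> z n (b k) 0 \<omega> \<le> max 0 (scored_family.score V (amp 0) \<beta> z n (b 0) 0 \<omega>)" for k \<omega>
      unfolding sc path0 amp_zero by (rule base)
    show "0 \<le> B" using L \<epsilon> by (simp add: B_def)
    show "step_limit k * level k \<le> 2 * \<epsilon>" for k
    proof -
      have "step_limit k * level k \<le> (2 * \<epsilon> / level k) * level k"
        using level_pos[of k] by (intro mult_right_mono) (auto simp: step_limit_def)
      then show ?thesis using level_pos[of k] by simp
    qed
    show "(\<Sum>k<K. crossover V (level k)) \<le> 6 * real CARD('m)" for K
      unfolding level_def by (rule sum_crossover[OF V a])
    show "L * (7 / 2 * \<epsilon> * sqrt (real CARD('m)) * (real n)\<^sup>2 * exp (7 * \<epsilon> * real n)) * (6 * real CARD('m)) \<le> B"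
      by (simp add: B_def)
  qed (use h \<delta> \<epsilon> in blast)+
  then obtain N where N: "N \<in> sets M" "measure M N \<le> \<delta>"
    "\<And>\<omega> k \<gamma>. \<omega> \<in> space M - N \<Longrightarrow> 0 \<le> \<gamma> \<Longrightarrow> \<gamma> \<le> step_limit k \<Longrightarrow>
     scored_family.score V (amp k) \<beta> z n (b k) \<gamma> \<omega> \<le> h * real n + ln ((2 + B) / \<delta>)"
    by blast
  show ?thesis
  proof (rule that[OF N(1,2)])
    fix \<omega> k \<gamma>
    assume w: "\<omega> \<in> space M - N" and g: "0 \<le> \<gamma>" "\<gamma> \<le> step_limit k"
      and p: "\<And>t. t < n \<Longrightarrow> bounded_potential (level k) (state \<gamma> (sample \<omega>) t)"
    have g\<beta>: "\<gamma> \<le> \<beta>" using g(2) by (simp add: step_limit_def)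
    have "amp k (amplitude_family.path V (amp k) \<beta> \<gamma> (sample \<omega>) t) = root \<gamma> (sample \<omega>) t" if "t < n" for t
    proof -
      have "amplitude_family.path V (amp k) \<beta> \<gamma> (sample \<omega>) t = iterate \<gamma> (sample \<omega>) t"
        by (rule path_eq_iterate[OF g(1) g\<beta>]) (use p that in auto)
      then show ?thesis using amp_root[OF g(1) g\<beta> p[OF that]] by simp
    qed
    then have "scored_family.score V (amp k) \<beta> z n (b k) \<gamma> \<omega> = (\<Sum>t<n. b k (root \<gamma> (sample \<omega>) t) (z t \<omega>))"
      unfolding sc by (intro sum.cong) simp_all
    then show "(\<Sum>t<n. b k (root \<gamma> (sample \<omega>) t) (z t \<omega>))
         \<le> h * real n + ln ((2 + 21 * L * \<epsilon> * real CARD('m) * sqrt (real CARD('m)) * (real n)\<^sup>2 * exp (7 * \<epsilon> * real n)) / \<delta>)"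
      using N(3)[OF w g] unfolding B_def by simp
  qed
qed

lemma total_uniform:
  assumes \<delta>: "0 < \<delta>"
  obtains N where "N \<in> sets M" "measure M N \<le> \<delta>"
    "\<And>\<omega> k \<gamma>. \<omega> \<in> space M - N \<Longrightarrow> 0 \<le> \<gamma> \<Longrightarrow> \<gamma> \<le> step_limit k \<Longrightarrow>
       (\<And>t. t < n \<Longrightarrow> bounded_potential (level k) (state \<gamma> (sample \<omega>) t)) \<Longrightarrow>
       (\<Sum>t<n. admissible_amplitudes.total (root \<gamma> (sample \<omega>) t) (z t \<omega>))
         \<le> 8 * \<tau> * (ln 2 / 4 * real n + ln ((2 + 21 * (sqrt 3 / 4) * \<epsilon> * real CARD('m) * sqrt (real CARD('m)) * (real n)\<^sup>2 * exp (7 * \<epsilon> * real n)) / \<delta>))"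
proof -
  let ?b = "\<lambda>k :: nat. admissible_amplitudes.total_score \<tau> :: real^'n^'m \<Rightarrow> real^'n \<Rightarrow> real"
  let ?x = "ln 2 / 4 * real n + ln ((2 + 21 * (sqrt 3 / 4) * \<epsilon> * real CARD('m) * sqrt (real CARD('m)) * (real n)\<^sup>2 * exp (7 * \<epsilon> * real n)) / \<delta>)"
  note A = admissible_amplitudes
  obtain N where N: "N \<in> sets M" "measure M N \<le> \<delta>"
    "\<And>\<omega> k \<gamma>. \<omega> \<in> space M - N \<Longrightarrow> 0 \<le> \<gamma> \<Longrightarrow> \<gamma> \<le> step_limit k \<Longrightarrow>
       (\<And>t. t < n \<Longrightarrow> bounded_potential (level k) (state \<gamma> (sample \<omega>) t)) \<Longrightarrow>
       (\<Sum>t<n. ?b k (root \<gamma> (sample \<omega>) t) (z t \<omega>)) \<le> ?x"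
  proof (rule iterates_uniform[of ?b "sqrt 3 / 4" "ln 2 / 4" \<delta>])
    show "continuous_on UNIV (\<lambda>p. ?b k (fst p) (snd p))" for k
      by (rule admissible_amplitudes.total_score_continuous[OF A])
    show "L2_le gaussian (\<lambda>x. ?b k y x - ?b k y' x) (sqrt 3 / 4 * norm (y - y'))"
      if "admissible_amplitudes.admissible V (level k) \<tau> y" "admissible_amplitudes.admissible V (level k) \<tau> y'" for k y y'
      by (rule admissible_amplitudes.total_score_lipschitz[OF A that])
    show "(\<integral>\<^sup>+x. ennreal (exp (2 * ?b k y x)) \<partial>gaussian) \<le> ennreal (exp (2 * (ln 2 / 4)))"
      if "admissible_amplitudes.admissible V (level k) \<tau> y" for k y
      by (rule admissible_amplitudes.total_score_exp[OF A that])
  qed (use \<delta> in auto)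
  show ?thesis
  proof (rule that[OF N(1,2)])
    fix \<omega> k \<gamma>
    assume *: "\<omega> \<in> space M - N" "0 \<le> \<gamma>" "\<gamma> \<le> step_limit k"
      "\<And>t. t < n \<Longrightarrow> bounded_potential (level k) (state \<gamma> (sample \<omega>) t)"
    have "(\<Sum>t<n. ?b k (root \<gamma> (sample \<omega>) t) (z t \<omega>))
      = (\<Sum>t<n. admissible_amplitudes.total (root \<gamma> (sample \<omega>) t) (z t \<omega>)) / (8 * \<tau>)"
      by (simp add: admissible_amplitudes.total_score_def[OF A] sum_divide_distrib)
    then have "(\<Sum>t<n. admissible_amplitudes.total (root \<gamma> (sample \<omega>) t) (z t \<omega>)) / (8 * \<tau>) \<le> ?x"
      using N(3)[OF *] by simp
    then show "(\<Sum>t<n. admissible_amplitudes.total (root \<gamma> (sample \<omega>) t) (z t \<omega>)) \<le> 8 * \<tau> * ?x"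
      using \<tau> by (simp add: pos_divide_le_eq mult.commute)
  qed
qed

lemma noise_uniform:
  assumes \<delta>: "0 < \<delta>" and Xs: "Xs \<in> feasible" "bounded_potential a Xs"
  obtains N where "N \<in> sets M" "measure M N \<le> \<delta>"
    "\<And>\<omega> k \<gamma>. \<omega> \<in> space M - N \<Longrightarrow> 0 \<le> \<gamma> \<Longrightarrow> \<gamma> \<le> step_limit k \<Longrightarrow>
       (\<And>t. t < n \<Longrightarrow> bounded_potential (level k) (state \<gamma> (sample \<omega>) t)) \<Longrightarrow>
       (\<Sum>t<n. admissible_amplitudes.noise V (rho \<Psi> Xs) (root \<gamma> (sample \<omega>) t) (z t \<omega>)
          - admissible_amplitudes.gap V (rho \<Psi> Xs) (root \<gamma> (sample \<omega>) t) / 2)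
         \<le> 32 * \<tau> * level k * ln ((2 + 21 * 1 * \<epsilon> * real CARD('m) * sqrt (real CARD('m)) * (real n)\<^sup>2 * exp (7 * \<epsilon> * real n)) / \<delta>)"
proof -
  let ?b = "\<lambda>k. admissible_amplitudes.noise_score V (level k) \<tau> (rho \<Psi> Xs) :: real^'n^'m \<Rightarrow> real^'n \<Rightarrow> real"
  let ?x = "0 * real n + ln ((2 + 21 * 1 * \<epsilon> * real CARD('m) * sqrt (real CARD('m)) * (real n)\<^sup>2 * exp (7 * \<epsilon> * real n)) / \<delta>)"
  note A = admissible_amplitudes
  have ref: "admissible_amplitudes.reference V (level k) (rho \<Psi> Xs)" for k
    unfolding admissible_amplitudes.reference_def[OF A]
    using rho_nonneg[OF Xs(1)] bounded_potential_sum[OF Xs(2)] level_ge[of k] by (meson order_trans)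
  have b: "?b k y x = (admissible_amplitudes.noise V (rho \<Psi> Xs) y x - admissible_amplitudes.gap V (rho \<Psi> Xs) y / 2) / (32 * \<tau> * level k)" for k y x
    by (rule admissible_amplitudes.noise_score_def[OF A])
  obtain N where N: "N \<in> sets M" "measure M N \<le> \<delta>"
    "\<And>\<omega> k \<gamma>. \<omega> \<in> space M - N \<Longrightarrow> 0 \<le> \<gamma> \<Longrightarrow> \<gamma> \<le> step_limit k \<Longrightarrow>
       (\<And>t. t < n \<Longrightarrow> bounded_potential (level k) (state \<gamma> (sample \<omega>) t)) \<Longrightarrow>
       (\<Sum>t<n. ?b k (root \<gamma> (sample \<omega>) t) (z t \<omega>)) \<le> ?x"
  proof (rule iterates_uniform[of ?b 1 0 \<delta>])
    show "continuous_on UNIV (\<lambda>p. ?b k (fst p) (snd p))" for k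
      by (rule admissible_amplitudes.noise_score_continuous[OF A])
    show "L2_le gaussian (\<lambda>x. ?b k y x - ?b k y' x) (1 * norm (y - y'))"
      if "admissible_amplitudes.admissible V (level k) \<tau> y" "admissible_amplitudes.admissible V (level k) \<tau> y'" for k y y'
      by (rule admissible_amplitudes.noise_score_lipschitz[OF A that ref])
    show "(\<integral>\<^sup>+x. ennreal (exp (2 * ?b k y x)) \<partial>gaussian) \<le> ennreal (exp (2 * 0))"
      if "admissible_amplitudes.admissible V (level k) \<tau> y" for k y
      by (rule admissible_amplitudes.noise_score_exp[OF A that ref])
    show "(\<Sum>t<n. ?b k y (\<zeta> t)) \<le> max 0 (\<Sum>t<n. ?b 0 y (\<zeta> t))" for k y \<zeta>
    proof -
      have r: "?b k y x = (1 / 2 ^ k) * ?b 0 y x" for x unfolding b by (simp add: level_def)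
      let ?S = "\<Sum>t<n. ?b 0 y (\<zeta> t)"
      have "(\<Sum>t<n. ?b k y (\<zeta> t)) = (1 / 2 ^ k) * ?S" unfolding r sum_distrib_left ..
      also have "\<dots> \<le> (1 / 2 ^ k) * max 0 ?S" by (intro mult_left_mono) auto
      also have "\<dots> \<le> 1 * max 0 ?S" by (intro mult_right_mono) auto
      finally show ?thesis by simp
    qed
  qed (use \<delta> in auto)
  show ?thesis
  proof (rule that[OF N(1,2)])
    fix \<omega> k \<gamma>
    assume *: "\<omega> \<in> space M - N" "0 \<le> \<gamma>" "\<gamma> \<le> step_limit k"
      "\<And>t. t < n \<Longrightarrow> bounded_potential (level k) (state \<gamma> (sample \<omega>) t)"
    let ?S = "\<Sum>t<n. admissible_amplitudes.noise V (rho \<Psi> Xs) (root \<gamma> (sample \<omega>) t) (z t \<omega>)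
          - admissible_amplitudes.gap V (rho \<Psi> Xs) (root \<gamma> (sample \<omega>) t) / 2"
    have "(\<Sum>t<n. ?b k (root \<gamma> (sample \<omega>) t) (z t \<omega>)) = ?S / (32 * \<tau> * level k)"
      unfolding b sum_divide_distrib ..
    then have "?S / (32 * \<tau> * level k) \<le> ?x" using N(3)[OF *] by simp
    moreover have "0 < 32 * \<tau> * level k" using \<tau> level_pos[of k] by simp
    ultimately show "?S \<le> 32 * \<tau> * level k * ln ((2 + 21 * 1 * \<epsilon> * real CARD('m) * sqrt (real CARD('m)) * (real n)\<^sup>2 * exp (7 * \<epsilon> * real n)) / \<delta>)"
      by (simp add: pos_divide_le_eq mult.commute)
  qed
qed

lemma reaction_uniform:
  assumes \<delta>: "0 < \<delta>"
  obtains N where "N \<in> sets M" "measure M N \<le> \<delta>"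
    "\<And>\<omega> k \<gamma>. \<omega> \<in> space M - N \<Longrightarrow> 0 \<le> \<gamma> \<Longrightarrow> \<gamma> \<le> step_limit k \<Longrightarrow>
       (\<And>t. t < n \<Longrightarrow> bounded_potential (level k) (state \<gamma> (sample \<omega>) t)) \<Longrightarrow>
       (\<Sum>t<n. min (2 * \<epsilon> / level k * admissible_amplitudes.reaction V (root \<gamma> (sample \<omega>) t) (z t \<omega>))
          (admissible_amplitudes.total (root \<gamma> (sample \<omega>) t) (z t \<omega>)))
         \<le> 16 * \<tau> * (2 * \<epsilon> * real n + ln ((2 + 21 * (1 + 3 * (2 * \<epsilon>)) * \<epsilon> * real CARD('m) * sqrt (real CARD('m)) * (real n)\<^sup>2 * exp (7 * \<epsilon> * real n)) / \<delta>))"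
proof -
  let ?b = "\<lambda>k. admissible_amplitudes.reaction_score V (level k) \<tau> (2 * \<epsilon>) :: real^'n^'m \<Rightarrow> real^'n \<Rightarrow> real"
  let ?x = "2 * \<epsilon> * real n + ln ((2 + 21 * (1 + 3 * (2 * \<epsilon>)) * \<epsilon> * real CARD('m) * sqrt (real CARD('m)) * (real n)\<^sup>2 * exp (7 * \<epsilon> * real n)) / \<delta>)"
  note A = admissible_amplitudes
  have e: "0 \<le> 2 * \<epsilon>" using \<epsilon> by simp
  have b: "?b k y x = min (2 * \<epsilon> / level k * admissible_amplitudes.reaction V y x) (admissible_amplitudes.total y x) / (16 * \<tau>)" for k y x
    by (rule admissible_amplitudes.reaction_score_def[OF A])
  obtain N where N: "N \<in> sets M" "measure M N \<le> \<delta>"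
    "\<And>\<omega> k \<gamma>. \<omega> \<in> space M - N \<Longrightarrow> 0 \<le> \<gamma> \<Longrightarrow> \<gamma> \<le> step_limit k \<Longrightarrow>
       (\<And>t. t < n \<Longrightarrow> bounded_potential (level k) (state \<gamma> (sample \<omega>) t)) \<Longrightarrow>
       (\<Sum>t<n. ?b k (root \<gamma> (sample \<omega>) t) (z t \<omega>)) \<le> ?x"
  proof (rule iterates_uniform[of ?b "1 + 3 * (2 * \<epsilon>)" "2 * \<epsilon>" \<delta>])
    show "continuous_on UNIV (\<lambda>p. ?b k (fst p) (snd p))" for k
      by (rule admissible_amplitudes.reaction_score_continuous[OF A])
    show "L2_le gaussian (\<lambda>x. ?b k y x - ?b k y' x) ((1 + 3 * (2 * \<epsilon>)) * norm (y - y'))"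
      if "admissible_amplitudes.admissible V (level k) \<tau> y" "admissible_amplitudes.admissible V (level k) \<tau> y'" for k y y'
      by (rule admissible_amplitudes.reaction_score_lipschitz[OF A that e])
    show "(\<integral>\<^sup>+x. ennreal (exp (2 * ?b k y x)) \<partial>gaussian) \<le> ennreal (exp (2 * (2 * \<epsilon>)))"
      if "admissible_amplitudes.admissible V (level k) \<tau> y" for k y
      by (rule admissible_amplitudes.reaction_score_exp[OF A that e])
    show "(\<Sum>t<n. ?b k y (\<zeta> t)) \<le> max 0 (\<Sum>t<n. ?b 0 y (\<zeta> t))" for k y \<zeta>
    proof -
      have "?b k y x \<le> ?b 0 y x" for x
      proof -
        have "2 * \<epsilon> / level k \<le> 2 * \<epsilon> / level 0"
          using level_ge[of k] a e by (intro divide_left_mono) (auto simp: level_def)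
        then have "2 * \<epsilon> / level k * admissible_amplitudes.reaction V y x \<le> 2 * \<epsilon> / level 0 * admissible_amplitudes.reaction V y x"
          by (rule mult_right_mono) (rule admissible_amplitudes.reaction_nonneg[OF A])
        then show ?thesis unfolding b using \<tau> by (intro divide_right_mono min.mono) auto
      qed
      then have "(\<Sum>t<n. ?b k y (\<zeta> t)) \<le> (\<Sum>t<n. ?b 0 y (\<zeta> t))" by (intro sum_mono)
      then show ?thesis by simp
    qed
  qed (use \<delta> e in auto)
  show ?thesis
  proof (rule that[OF N(1,2)])
    fix \<omega> k \<gamma>
    assume *: "\<omega> \<in> space M - N" "0 \<le> \<gamma>" "\<gamma> \<le> step_limit k"
      "\<And>t. t < n \<Longrightarrow> bounded_potential (level k) (state \<gamma> (sample \<omega>) t)"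
    let ?S = "\<Sum>t<n. min (2 * \<epsilon> / level k * admissible_amplitudes.reaction V (root \<gamma> (sample \<omega>) t) (z t \<omega>))
          (admissible_amplitudes.total (root \<gamma> (sample \<omega>) t) (z t \<omega>))"
    have "(\<Sum>t<n. ?b k (root \<gamma> (sample \<omega>) t) (z t \<omega>)) = ?S / (16 * \<tau>)"
      unfolding b sum_divide_distrib ..
    then have "?S / (16 * \<tau>) \<le> ?x" using N(3)[OF *] by simp
    then show "?S \<le> 16 * \<tau> * ?x" using \<tau> by (simp add: pos_divide_le_eq mult.commute)
  qed
qed

end


section \<open>The numerical budget\<close>

text \<open>The drift of the uniform bound enters only through its logarithm, where it costs at most three halves
  of the logarithm in the confidence constant and a term linear in the rate \<open>r\<close>.\<close>

lemma log_failure_bound: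
  fixes m \<delta> P B r :: real
  assumes m: "1 \<le> m" and \<delta>: "0 < \<delta>" "\<delta> \<le> 1" and P: "2 \<le> P" and r: "0 \<le> r" and B: "0 \<le> B"
    and le: "B \<le> P * (m * sqrt m) * real n * exp (r * real n)"
  shows "ln ((2 + B) / \<delta>) \<le> ln P - ln 2 + 3 / 2 * ln (2 * real (Suc n) * m / \<delta>) + r * real (Suc n)"
proof -
  define T where "T = real (Suc n)"
  have T: "1 \<le> T" "real n = T - 1" by (simp_all add: T_def)
  define Q where "Q = P * (m * sqrt m) * exp (r * T)"
  have m1: "1 \<le> m * sqrt m" using m mult_mono[of 1 m 1 "sqrt m"] by simp
  have "2 * 1 * 1 \<le> Q" unfolding Q_def using P m1 r T by (intro mult_mono) auto
  moreover have "B \<le> Q * (T - 1)"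
  proof -
    have "exp (r * real n) \<le> exp (r * T)" using r by (simp add: T_def mult_left_mono)
    then have "P * (m * sqrt m) * real n * exp (r * real n) \<le> P * (m * sqrt m) * real n * exp (r * T)"
      using P m1 by (intro mult_left_mono) auto
    then show ?thesis using le by (simp add: Q_def T mult_ac)
  qed
  ultimately have "2 + B \<le> Q * T" by (simp add: algebra_simps)
  then have "ln ((2 + B) / \<delta>) \<le> ln (Q * T / \<delta>)"
    using \<delta> B T by (subst ln_le_cancel_iff) (auto simp: divide_right_mono intro!: divide_pos_pos)
  also have "\<dots> = ln P + 3 / 2 * ln m + r * T + ln T - ln \<delta>"
    using P m T \<delta> by (simp add: Q_def ln_mult ln_div ln_sqrt)
  also have "\<dots> \<le> ln P - ln 2 + 3 / 2 * ln (2 * T * m / \<delta>) + r * T"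
  proof -
    have e: "ln (2 * T * m / \<delta>) = ln 2 + ln T + ln m - ln \<delta>"
      using m T \<delta> by (simp add: ln_mult ln_div)
    have *: "x + 3 / 2 * y + w + u - d \<le> x - k + 3 / 2 * (k + u + y - d) + w"
      if "0 \<le> u" "d \<le> 0" "0 \<le> k" for x y w u d k :: real using that by (simp add: field_simps)
    show ?thesis unfolding e by (rule *) (use T \<delta> in auto)
  qed
  finally show ?thesis unfolding T_def .
qed

lemma le_exp: "x \<le> exp (x :: real)"
  using exp_ge_add_one_self[of x] by linarith

lemma ln_two_bounds: "2 / 3 \<le> ln (2 :: real)" "ln 2 \<le> (25 / 36 :: real)"
  by (rule ln2_ge_two_thirds, rule ln2_le_25_over_36)

text \<open>With fewer than 144 iterations the mean of the sampled mass, which is linear in \<open>T\<close>, still fits below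
  \<open>2 c sqrt T\<close>; the terms linear in \<open>\<epsilon>\<close> are paid by \<open>\<epsilon> c\<^sup>2 T / 2\<close>.\<close>

lemma budget_short:
  fixes n :: nat and m \<delta> \<epsilon> c :: real
  assumes n: "1 \<le> n" "n < 143" and m: "1 \<le> m" and \<delta>: "0 < \<delta>" "\<delta> \<le> 1" and \<epsilon>: "0 \<le> \<epsilon>"
    and c: "c = 2 * (1 + 4 * ln (2 * real (Suc n) * m / \<delta>))"
  shows "real (Suc n) / 2 + 8 * (ln 2 / 4 * real n
      + ln ((2 + 21 * (sqrt 3 / 4) * \<epsilon> * m * sqrt m * (real n)\<^sup>2 * exp (7 * \<epsilon> * real n)) / \<delta>))
    \<le> \<epsilon> * c\<^sup>2 * real (Suc n) / 2 + 2 * c * sqrt (real (Suc n))"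
proof -
  define T where "T = real (Suc n)"
  define l where "l = ln (2 * T * m / \<delta>)"
  define s where "s = sqrt T"
  have T: "2 \<le> T" "T < 144" "real n \<le> T" using n by (simp_all add: T_def)
  have "7 / 5 \<le> s" unfolding s_def by (rule real_le_rsqrt) (use T in \<open>simp add: power2_eq_square\<close>)
  moreover have "s \<le> 12" unfolding s_def by (rule real_le_lsqrt) (use T in \<open>simp_all add: power2_eq_square\<close>)
  moreover have "s * s = T" using T by (simp add: s_def)
  ultimately have s: "7 / 5 \<le> s" "s \<le> 12" "s * s = T" by auto
  have l: "4 / 3 \<le> l"
  proof -
    have "4 \<le> 2 * T * m / \<delta>"
    proof -
      have "4 * \<delta> \<le> 4 * 1" using \<delta> by simp
      also have "4 * 1 \<le> (2 * T) * m" using T m by (intro mult_mono) auto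
      finally show ?thesis using \<delta> by (simp add: pos_le_divide_eq)
    qed
    then have "ln (2 * 2) \<le> l" unfolding l_def by (subst ln_le_cancel_iff) auto
    moreover have "ln (2 * 2) = ln 2 + ln (2 :: real)" using ln_mult[of 2 "2 :: real"] by simp
    ultimately show ?thesis using ln_two_bounds by linarith
  qed
  define B where "B = 21 * (sqrt 3 / 4) * \<epsilon> * m * sqrt m * (real n)\<^sup>2 * exp (7 * \<epsilon> * real n)"
  have lB: "ln ((2 + B) / \<delta>) \<le> ln 10 - ln 2 + 3 / 2 * l + (8 * \<epsilon>) * T"
    unfolding l_def T_def
  proof (rule log_failure_bound[OF m \<delta>])
    show "0 \<le> B" unfolding B_def using \<epsilon> m by (intro mult_nonneg_nonneg) auto
    have "sqrt 3 \<le> (7 / 4 :: real)" by (rule real_le_lsqrt) (auto simp: power2_eq_square)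
    then have q: "21 * (sqrt 3 / 4) \<le> (10 :: real)" by simp
    have x: "\<epsilon> * real n * exp (7 * \<epsilon> * real n) \<le> exp (8 * \<epsilon> * real n)"
      using mult_right_mono[OF le_exp[of "\<epsilon> * real n"], of "exp (7 * \<epsilon> * real n)"]
      by (simp add: exp_add[symmetric] algebra_simps)
    have "B = (21 * (sqrt 3 / 4)) * (((m * sqrt m) * real n) * (\<epsilon> * real n * exp (7 * \<epsilon> * real n)))"
      by (simp add: B_def power2_eq_square)
    also have "\<dots> \<le> 10 * (((m * sqrt m) * real n) * exp (8 * \<epsilon> * real n))"
      using m \<epsilon> by (intro mult_mono[OF q mult_left_mono[OF x]]) auto
    finally show "B \<le> 10 * (m * sqrt m) * real n * exp (8 * \<epsilon> * real n)" by (simp add: mult_ac)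
  qed (use \<epsilon> in auto)
  have ln5: "ln 10 - ln 2 \<le> (7 / 3 * (25 / 36) :: real)"
  proof -
    have "3 * ln 5 = ln (5 ^ 3 :: real)" using ln_realpow[of "5 :: real" 3] by simp
    also have "\<dots> \<le> ln (2 ^ 7)" by (subst ln_le_cancel_iff) auto
    also have "\<dots> = 7 * ln 2" using ln_realpow[of "2 :: real" 7] by simp
    finally have "ln 5 \<le> (7 / 3) * ln (2 :: real)" by simp
    moreover have "ln 10 = ln 2 + ln (5 :: real)" using ln_mult[of 2 "5 :: real"] by simp
    ultimately show ?thesis using ln_two_bounds by linarith
  qed
  have "64 * (\<epsilon> * T) \<le> c\<^sup>2 / 2 * (\<epsilon> * T)"
  proof (rule mult_right_mono)
    have "12 \<le> c" using l by (simp add: c l_def T_def)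
    then have "12 * 12 \<le> c * c" by (intro mult_mono) auto
    then show "64 \<le> c\<^sup>2 / 2" by (simp add: power2_eq_square)
  qed (use \<epsilon> T in simp)
  moreover have "T / 2 + 8 * (25 / 144 * T + 7 / 3 * (25 / 36)) + 12 * l \<le> 4 * s + 16 * (s * l)"
  proof -
    have "0 \<le> (16 * s - 12) * (l - 4 / 3)" using s l by (intro mult_nonneg_nonneg) auto
    then have 1: "12 * l + 64 / 3 * s - 16 \<le> 16 * (s * l)" by (simp add: algebra_simps)
    have "0 \<le> (s - 7 / 5) * (12 - s)" using s by (intro mult_nonneg_nonneg) auto
    moreover have "(s - 7 / 5) * (12 - s) = (67 / 5) * s - s * s - 84 / 5" by (simp add: field_simps)
    ultimately have "T \<le> (67 / 5) * s - 84 / 5" unfolding s(3) by linarith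
    moreover have "T / 2 + 8 * (25 / 144 * T + 7 / 3 * (25 / 36)) = 17 / 9 * T + 350 / 27" by simp
    ultimately show ?thesis using 1 s(1) by linarith
  qed
  moreover have "ln 2 / 4 * real n \<le> 25 / 144 * T"
    using mult_mono[of "ln 2 / 4" "25 / 144" "real n" T] ln_two_bounds T by simp
  moreover have "2 * c * s = 4 * s + 16 * (s * l)" by (simp add: c l_def T_def algebra_simps)
  moreover have "\<epsilon> * c\<^sup>2 * T / 2 = c\<^sup>2 / 2 * (\<epsilon> * T)" by simp
  ultimately have "T / 2 + 8 * (ln 2 / 4 * real n + ln ((2 + B) / \<delta>)) \<le> \<epsilon> * c\<^sup>2 * T / 2 + 2 * c * s"
    using lB ln5 by (simp add: algebra_simps)
  then show ?thesis unfolding B_def T_def s_def .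
qed

text \<open>From 144 iterations on, the logarithms are small against \<open>2 c sqrt T\<close>. The factors are the
  normalizations of the noise score, doubled since the level of a cell may be twice the potential, and
  of the reaction score.\<close>

lemma budget_long:
  fixes n :: nat and m \<delta> \<epsilon> c :: real
  assumes n: "143 \<le> n" and m: "1 \<le> m" and \<delta>: "0 < \<delta>" "\<delta> \<le> 1" and \<epsilon>: "0 \<le> \<epsilon>"
    and c: "c = 2 * (1 + 4 * ln (2 * real (Suc n) * m / \<delta>))"
  shows "1 / 2 + 64 * ln ((2 + 21 * 1 * \<epsilon> * m * sqrt m * (real n)\<^sup>2 * exp (7 * \<epsilon> * real n)) / (\<delta> / 2))
      + 16 * (2 * \<epsilon> * real n
      + ln ((2 + 21 * (1 + 3 * (2 * \<epsilon>)) * \<epsilon> * m * sqrt m * (real n)\<^sup>2 * exp (7 * \<epsilon> * real n)) / (\<delta> / 2)))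
    \<le> \<epsilon> * c\<^sup>2 * real (Suc n) / 2 + 2 * c * sqrt (real (Suc n))"
proof -
  define T where "T = real (Suc n)"
  define l where "l = ln (2 * T * m / \<delta>)"
  define s where "s = sqrt T"
  have T: "144 \<le> T" "real n \<le> T" using n by (simp_all add: T_def)
  have s: "12 \<le> s" unfolding s_def by (rule real_le_rsqrt) (use T in \<open>simp add: power2_eq_square\<close>)
  have l: "16 / 3 \<le> l"
  proof -
    have "256 \<le> 2 * T * m / \<delta>"
    proof -
      have "256 * \<delta> \<le> 256 * 1" using \<delta> by simp
      also have "256 * 1 \<le> (2 * T) * m" using T m by (intro mult_mono) auto
      finally show ?thesis using \<delta> by (simp add: pos_le_divide_eq)
    qed
    then have "ln (2 ^ 8) \<le> l" unfolding l_def by (subst ln_le_cancel_iff) auto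
    moreover have "ln (2 ^ 8) = 8 * ln (2 :: real)" using ln_realpow[of "2 :: real" 8] by simp
    ultimately show ?thesis using ln_two_bounds by linarith
  qed
  define B1 where "B1 = 21 * 1 * \<epsilon> * m * sqrt m * (real n)\<^sup>2 * exp (7 * \<epsilon> * real n)"
  define B2 where "B2 = 21 * (1 + 3 * (2 * \<epsilon>)) * \<epsilon> * m * sqrt m * (real n)\<^sup>2 * exp (7 * \<epsilon> * real n)"
  have half: "ln ((2 + B) / (\<delta> / 2)) = ln 2 + ln ((2 + B) / \<delta>)" if "0 \<le> B" for B
  proof -
    have "(2 + B) / (\<delta> / 2) = 2 * ((2 + B) / \<delta>)" by simp
    then show ?thesis using that \<delta> by (simp only: ln_mult) (simp add: ln_mult)
  qed
  have B0: "0 \<le> B1" "0 \<le> B2" unfolding B1_def B2_def using \<epsilon> m by (intro mult_nonneg_nonneg; simp)+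
  have x1: "\<epsilon> * real n * exp (7 * \<epsilon> * real n) \<le> exp (8 * \<epsilon> * real n)"
    using mult_right_mono[OF le_exp[of "\<epsilon> * real n"], of "exp (7 * \<epsilon> * real n)"]
    by (simp add: exp_add[symmetric] algebra_simps)
  have l1: "ln ((2 + B1) / \<delta>) \<le> ln 21 - ln 2 + 3 / 2 * l + (8 * \<epsilon>) * T"
    unfolding l_def T_def
  proof (rule log_failure_bound[OF m \<delta>])
    have "B1 = 21 * (((m * sqrt m) * real n) * (\<epsilon> * real n * exp (7 * \<epsilon> * real n)))"
      by (simp add: B1_def power2_eq_square)
    also have "\<dots> \<le> 21 * (((m * sqrt m) * real n) * exp (8 * \<epsilon> * real n))"
      using m \<epsilon> by (intro mult_left_mono x1) auto
    finally show "B1 \<le> 21 * (m * sqrt m) * real n * exp (8 * \<epsilon> * real n)" by (simp add: mult_ac)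
  qed (use \<epsilon> B0 in auto)
  have l2: "ln ((2 + B2) / \<delta>) \<le> ln 21 - ln 2 + 3 / 2 * l + (9 * \<epsilon>) * T"
    unfolding l_def T_def
  proof (rule log_failure_bound[OF m \<delta>])
    have "\<epsilon> * 6 \<le> \<epsilon> * real n" using n \<epsilon> by (intro mult_left_mono) auto
    then have x0: "1 + 3 * (2 * \<epsilon>) \<le> exp (\<epsilon> * real n)"
      using exp_ge_add_one_self[of "\<epsilon> * real n"] by linarith
    have x2: "(1 + 3 * (2 * \<epsilon>)) * (\<epsilon> * real n * exp (7 * \<epsilon> * real n)) \<le> exp (\<epsilon> * real n) * exp (8 * \<epsilon> * real n)"
      using \<epsilon> by (intro mult_mono x0 x1) auto
    have "B2 = 21 * (((m * sqrt m) * real n) * ((1 + 3 * (2 * \<epsilon>)) * (\<epsilon> * real n * exp (7 * \<epsilon> * real n))))"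
      by (simp add: B2_def power2_eq_square)
    also have "\<dots> \<le> 21 * (((m * sqrt m) * real n) * (exp (\<epsilon> * real n) * exp (8 * \<epsilon> * real n)))"
      using m by (intro mult_left_mono x2) auto
    also have "exp (\<epsilon> * real n) * exp (8 * \<epsilon> * real n) = exp (9 * \<epsilon> * real n)"
      by (simp add: exp_add[symmetric])
    finally show "B2 \<le> 21 * (m * sqrt m) * real n * exp (9 * \<epsilon> * real n)" by (simp add: mult_ac)
  qed (use \<epsilon> B0 in auto)
  have ln21: "ln 21 \<le> (5 * (25 / 36) :: real)"
  proof -
    have "ln 21 \<le> ln (2 ^ 5 :: real)" by (subst ln_le_cancel_iff) auto
    also have "\<dots> = 5 * ln 2" using ln_realpow[of "2 :: real" 5] by simp
    finally show ?thesis using ln_two_bounds by linarith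
  qed
  have "688 * (\<epsilon> * T) \<le> c\<^sup>2 / 2 * (\<epsilon> * T)"
  proof (rule mult_right_mono)
    have "40 \<le> c" using l by (simp add: c l_def T_def)
    then have "40 * 40 \<le> c * c" by (intro mult_mono) auto
    then show "688 \<le> c\<^sup>2 / 2" by (simp add: power2_eq_square)
  qed (use \<epsilon> T in simp)
  moreover have "1 / 2 + 80 * (5 * (25 / 36)) + 120 * l \<le> 4 * s + 16 * (s * l)"
  proof -
    have "12 * l \<le> s * l" using s l by (intro mult_right_mono) auto
    then show ?thesis using s l by linarith
  qed
  moreover have "\<epsilon> * real n \<le> \<epsilon> * T" using T \<epsilon> by (intro mult_left_mono) auto
  moreover have "2 * c * s = 4 * s + 16 * (s * l)" by (simp add: c l_def T_def algebra_simps)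
  moreover have "\<epsilon> * c\<^sup>2 * T / 2 = c\<^sup>2 / 2 * (\<epsilon> * T)" by simp
  moreover have "ln ((2 + B1) / (\<delta> / 2)) \<le> ln 21 + 3 / 2 * l + 8 * (\<epsilon> * T)"
    using l1 unfolding half[OF B0(1)] mult.assoc by linarith
  moreover have "ln ((2 + B2) / (\<delta> / 2)) \<le> ln 21 + 3 / 2 * l + 9 * (\<epsilon> * T)"
    using l2 unfolding half[OF B0(2)] mult.assoc by linarith
  ultimately have "1 / 2 + 64 * ln ((2 + B1) / (\<delta> / 2)) + 16 * (2 * \<epsilon> * real n + ln ((2 + B2) / (\<delta> / 2)))
    \<le> \<epsilon> * c\<^sup>2 * T / 2 + 2 * c * s"
    using ln21 unfolding distrib_left mult.assoc by linarith
  then show ?thesis unfolding B1_def B2_def T_def s_def .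
qed

context cells
begin

lemma level_exists:
  assumes "a \<le> v"
  obtains k where "v \<le> level k" "level k \<le> 2 * v"
proof -
  have "\<exists>k. v \<le> level k"
  proof -
    obtain k where "v / a < 2 ^ k" using real_arch_pow[of 2 "v / a"] by auto
    then have "v \<le> level k" using a by (simp add: level_def pos_divide_less_eq mult.commute)
    then show ?thesis ..
  qed
  then have k: "v \<le> level (LEAST k. v \<le> level k)" by (rule LeastI_ex)
  moreover have "level (LEAST k. v \<le> level k) \<le> 2 * v"
  proof (cases "LEAST k. v \<le> level k")
    case 0
    then show ?thesis using assms a by (simp add: level_def)
  next
    case (Suc j)
    then have "\<not> v \<le> level j" using not_less_Least[of j "\<lambda>k. v \<le> level k"] by simp
    then show ?thesis unfolding Suc by (simp add: level_def)
  qed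
  ultimately show ?thesis by (rule that)
qed

lemma bounded_potential_mono: "bounded_potential c X \<Longrightarrow> c \<le> c' \<Longrightarrow> bounded_potential c' X"
  unfolding bounded_potential_def by (meson order_trans)

text \<open>The regret bound with the random step size \<open>\<epsilon> / v\<close>, where \<open>v\<close> is the observed potential.
  For few iterations the sampled mass alone is a sufficient control of the losses; for many
  iterations the noise must be centered.\<close>

lemma regret_high_probability:
  fixes \<delta> :: real
  defines "conf \<equiv> c_conf (Suc n) CARD('m) \<delta>"
  assumes \<delta>: "0 < \<delta>" "\<delta> \<le> 1" and \<epsilon>0: "0 < \<epsilon>"
    and Xs: "Xs \<in> feasible" "bounded_potential a Xs"
    and D: "divergence 0 Xs = \<epsilon>\<^sup>2 * \<tau> * conf\<^sup>2 * real (Suc n) / 2"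
  obtains N where "N \<in> sets M" "measure M N \<le> \<delta>"
    "\<And>\<omega> v \<eta> \<gamma>. \<omega> \<in> space M - N \<Longrightarrow> a \<le> v \<Longrightarrow> \<eta> = \<epsilon> / v \<Longrightarrow> \<gamma> = \<eta> * \<beta> / (\<eta> + \<beta>) \<Longrightarrow>
       (\<And>t. t \<le> n \<Longrightarrow> bounded_potential v (state \<gamma> (sample \<omega>) t)) \<Longrightarrow>
       (\<Sum>t\<le>n. excess Xs (state \<gamma> (sample \<omega>) t))
         \<le> v * \<tau> * (\<epsilon> * conf\<^sup>2 * real (Suc n) + 2 * conf * sqrt (real (Suc n)))"
proof -
  let ?m = "real CARD('m)" and ?T = "real (Suc n)"
  have m: "1 \<le> ?m" using card_gt_0_iff[of "UNIV :: 'm set"] by simp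
  have conf: "conf = 2 * (1 + 4 * ln (2 * ?T * ?m / \<delta>))" by (simp add: conf_def c_conf_def)
  define slack where "slack = \<epsilon> * conf\<^sup>2 * ?T / 2 + 2 * conf * sqrt ?T"
  have step: "0 \<le> \<gamma> \<and> \<gamma> \<le> \<beta> \<and> \<gamma> \<le> \<eta>" if "0 < \<eta>" "\<gamma> = \<eta> * \<beta> / (\<eta> + \<beta>)" for \<eta> \<gamma>
  proof (intro conjI)
    have p: "0 < \<eta> + \<beta>" using that(1) \<beta> by simp
    show "0 \<le> \<gamma>" "\<gamma> \<le> \<beta>" "\<gamma> \<le> \<eta>"
      unfolding that(2) using that(1) \<beta> by (simp_all add: pos_divide_le_eq[OF p] distrib_left mult.commute)
  qed
  have reg: "(\<Sum>t\<le>n. excess Xs (state \<gamma> \<zeta> t)) \<le> v * \<tau> * (\<epsilon> * conf\<^sup>2 * ?T + 2 * conf * sqrt ?T)"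
    if v: "a \<le> v" and \<eta>: "\<eta> = \<epsilon> / v" and \<gamma>: "\<gamma> = \<eta> * \<beta> / (\<eta> + \<beta>)"
      and p: "bounded_potential v (state \<gamma> \<zeta> n)"
      and L: "(\<Sum>t<n. loss \<eta> \<gamma> \<zeta> Xs t) \<le> v * \<tau> * x" and x: "x + 1 / 2 \<le> slack" for v \<eta> \<gamma> \<zeta> x
  proof -
    have v0: "0 < v" using v a by simp
    have \<eta>0: "0 < \<eta>" using \<epsilon>0 v0 by (simp add: \<eta>)
    have g: "0 \<le> \<gamma>" "\<gamma> \<le> \<beta>" using step[OF \<eta>0 \<gamma>] by auto
    have "E_tilde \<Psi> V (state \<gamma> \<zeta> n) \<le> v * \<tau> / 2"
      using p order_trans[OF iterate_trace[OF g] initial(2)] v0 by (intro E_tilde_le density_feasible) auto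
    moreover have "0 \<le> E_tilde \<Psi> V Xs" by (rule E_tilde_nonneg)
    moreover have "0 \<le> divergence (iterate \<gamma> \<zeta> n) Xs / \<eta>" using divergence_nonneg[OF Xs(1)] \<eta>0 by simp
    moreover have "divergence 0 Xs / \<eta> = v * \<tau> * (\<epsilon> * conf\<^sup>2 * ?T / 2)"
      using \<epsilon>0 v0 by (simp add: D \<eta> power2_eq_square field_simps)
    ultimately have "(\<Sum>t\<le>n. excess Xs (state \<gamma> \<zeta> t)) \<le> v * \<tau> * (\<epsilon> * conf\<^sup>2 * ?T / 2) + v * \<tau> * x + v * \<tau> * (1 / 2)"
      using regret[OF \<eta>0 \<gamma> Xs(1), where n = n and \<zeta> = \<zeta>] L unfolding diff_divide_distrib by linarith
    also have "\<dots> = v * \<tau> * (\<epsilon> * conf\<^sup>2 * ?T / 2 + (x + 1 / 2))" by (simp add: algebra_simps)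
    also have "\<dots> \<le> v * \<tau> * (\<epsilon> * conf\<^sup>2 * ?T / 2 + slack)"
      using x v0 \<tau> by (intro mult_left_mono add_left_mono) auto
    also have "\<epsilon> * conf\<^sup>2 * ?T / 2 + slack = \<epsilon> * conf\<^sup>2 * ?T + 2 * conf * sqrt ?T"
      unfolding slack_def by linarith
    finally show ?thesis .
  qed
  have limit: "\<gamma> \<le> step_limit k" if "0 < v" "level k \<le> 2 * v" "\<eta> = \<epsilon> / v" "\<gamma> = \<eta> * \<beta> / (\<eta> + \<beta>)" for v k \<eta> \<gamma>
  proof -
    have "\<eta> = 2 * \<epsilon> / (2 * v)" using that by simp
    also have "\<dots> \<le> 2 * \<epsilon> / level k" using that level_pos[of k] \<epsilon> by (intro divide_left_mono) auto
    finally have "\<eta> \<le> 2 * \<epsilon> / level k" .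
    then show ?thesis using step[of \<eta> \<gamma>] that \<epsilon>0 by (simp add: step_limit_def)
  qed
  consider "n = 0" | "1 \<le> n" "n < 143" | "143 \<le> n" by linarith
  then show ?thesis
  proof cases
    case 1
    show ?thesis
    proof (rule that[of "{}"])
      fix \<omega> v \<eta> \<gamma> assume *: "a \<le> v" "\<eta> = \<epsilon> / v" "\<gamma> = \<eta> * \<beta> / (\<eta> + \<beta>)"
        "\<And>t. t \<le> n \<Longrightarrow> bounded_potential v (state \<gamma> (sample \<omega>) t)"
      have "1 \<le> 2 * ?T * ?m / \<delta>"
      proof -
        have "1 * \<delta> \<le> 1" using \<delta> by simp
        also have "1 \<le> (2 * ?T) * ?m" using m mult_mono[of 1 "2 * ?T" 1 ?m] by simp
        finally show ?thesis using \<delta> by (simp add: pos_le_divide_eq)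
      qed
      then have "2 \<le> conf" unfolding conf by simp
      moreover have "0 \<le> \<epsilon> * conf\<^sup>2" using \<epsilon> by simp
      ultimately have "0 + 1 / 2 \<le> slack" unfolding slack_def using 1 by simp
      moreover have "(\<Sum>t<n. loss \<eta> \<gamma> (sample \<omega>) Xs t) \<le> v * \<tau> * 0" using 1 by simp
      ultimately show "(\<Sum>t\<le>n. excess Xs (state \<gamma> (sample \<omega>) t)) \<le> v * \<tau> * (\<epsilon> * conf\<^sup>2 * ?T + 2 * conf * sqrt ?T)"
        by (rule reg[OF *(1-3) *(4)[OF order_refl], rotated])
    qed (use \<delta> in auto)
  next
    case 2
    let ?x = "ln 2 / 4 * real n + ln ((2 + 21 * (sqrt 3 / 4) * \<epsilon> * ?m * sqrt ?m * (real n)\<^sup>2 * exp (7 * \<epsilon> * real n)) / \<delta>)"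
    obtain N where N: "N \<in> sets M" "measure M N \<le> \<delta>"
      "\<And>\<omega> k \<gamma>. \<omega> \<in> space M - N \<Longrightarrow> 0 \<le> \<gamma> \<Longrightarrow> \<gamma> \<le> step_limit k \<Longrightarrow>
       (\<And>t. t < n \<Longrightarrow> bounded_potential (level k) (state \<gamma> (sample \<omega>) t)) \<Longrightarrow>
       (\<Sum>t<n. admissible_amplitudes.total (root \<gamma> (sample \<omega>) t) (z t \<omega>)) \<le> 8 * \<tau> * ?x"
      by (rule total_uniform[OF \<delta>(1)]) auto
    show ?thesis
    proof (rule that[OF N(1,2)])
      fix \<omega> v \<eta> \<gamma> assume w: "\<omega> \<in> space M - N" and *: "a \<le> v" "\<eta> = \<epsilon> / v" "\<gamma> = \<eta> * \<beta> / (\<eta> + \<beta>)"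
        and p: "\<And>t. t \<le> n \<Longrightarrow> bounded_potential v (state \<gamma> (sample \<omega>) t)"
      have v0: "0 < v" using *(1) a by simp
      have \<eta>0: "0 < \<eta>" using \<epsilon>0 v0 by (simp add: *)
      have g: "0 \<le> \<gamma>" "\<gamma> \<le> \<beta>" using step[OF \<eta>0 *(3)] by auto
      obtain k where k: "v \<le> level k" "level k \<le> 2 * v" by (rule level_exists[OF *(1)])
      have tot: "(\<Sum>t<n. admissible_amplitudes.total (root \<gamma> (sample \<omega>) t) (z t \<omega>)) \<le> 8 * \<tau> * ?x"
        by (rule N(3)[OF w g(1) limit[OF v0 k(2) *(2,3)]]) (use bounded_potential_mono[OF p k(1)] in auto)
      have "(\<Sum>t<n. loss \<eta> \<gamma> (sample \<omega>) Xs t)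
        \<le> (\<Sum>t<n. v * \<tau> / 2 + v * admissible_amplitudes.total (root \<gamma> (sample \<omega>) t) (z t \<omega>))"
        by (intro sum_mono loss_crude[OF v0 \<tau> \<eta>0 Xs(1) bounded_potential_mono[OF Xs(2) *(1)]] p
            order_trans[OF iterate_trace[OF g] initial(2)]) auto
      also have "\<dots> = real n * (v * \<tau> / 2) + v * (\<Sum>t<n. admissible_amplitudes.total (root \<gamma> (sample \<omega>) t) (z t \<omega>))"
        by (simp add: sum.distrib sum_distrib_left)
      also have "\<dots> \<le> real n * (v * \<tau> / 2) + v * (8 * \<tau> * ?x)"
        using tot v0 by (intro add_left_mono mult_left_mono) auto
      also have "\<dots> = v * \<tau> * (real n / 2 + 8 * ?x)" by (simp add: algebra_simps)
      finally have L: "(\<Sum>t<n. loss \<eta> \<gamma> (sample \<omega>) Xs t) \<le> v * \<tau> * (real n / 2 + 8 * ?x)" .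
      have "?T / 2 + 8 * ?x \<le> slack" unfolding slack_def by (rule budget_short[OF 2 m \<delta> \<epsilon> conf])
      moreover have "?T / 2 = real n / 2 + 1 / 2" by (simp add: add_divide_distrib)
      ultimately have "(real n / 2 + 8 * ?x) + 1 / 2 \<le> slack" by linarith
      from reg[OF * p[OF order_refl] L this]
      show "(\<Sum>t\<le>n. excess Xs (state \<gamma> (sample \<omega>) t)) \<le> v * \<tau> * (\<epsilon> * conf\<^sup>2 * ?T + 2 * conf * sqrt ?T)" .
    qed
  next
    case 3
    define x1 where "x1 = ln ((2 + 21 * 1 * \<epsilon> * ?m * sqrt ?m * (real n)\<^sup>2 * exp (7 * \<epsilon> * real n)) / (\<delta> / 2))"
    define x2 where "x2 = 2 * \<epsilon> * real n + ln ((2 + 21 * (1 + 3 * (2 * \<epsilon>)) * \<epsilon> * ?m * sqrt ?m * (real n)\<^sup>2 * exp (7 * \<epsilon> * real n)) / (\<delta> / 2))"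
    let ?noise = "\<lambda>\<gamma> \<omega> t. admissible_amplitudes.noise V (rho \<Psi> Xs) (root \<gamma> (sample \<omega>) t) (z t \<omega>)
          - admissible_amplitudes.gap V (rho \<Psi> Xs) (root \<gamma> (sample \<omega>) t) / 2"
    let ?R = "\<lambda>\<gamma> \<omega> t. admissible_amplitudes.reaction V (root \<gamma> (sample \<omega>) t) (z t \<omega>)"
    let ?S = "\<lambda>\<gamma> \<omega> t. admissible_amplitudes.total (root \<gamma> (sample \<omega>) t) (z t \<omega>)"
    have \<delta>2: "0 < \<delta> / 2" using \<delta> by simp
    obtain N1 where N1: "N1 \<in> sets M" "measure M N1 \<le> \<delta> / 2"
      "\<And>\<omega> k \<gamma>. \<omega> \<in> space M - N1 \<Longrightarrow> 0 \<le> \<gamma> \<Longrightarrow> \<gamma> \<le> step_limit k \<Longrightarrow>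
       (\<And>t. t < n \<Longrightarrow> bounded_potential (level k) (state \<gamma> (sample \<omega>) t)) \<Longrightarrow>
       (\<Sum>t<n. ?noise \<gamma> \<omega> t) \<le> 32 * \<tau> * level k * x1"
      unfolding x1_def by (rule noise_uniform[OF \<delta>2 Xs]) auto
    obtain N2 where N2: "N2 \<in> sets M" "measure M N2 \<le> \<delta> / 2"
      "\<And>\<omega> k \<gamma>. \<omega> \<in> space M - N2 \<Longrightarrow> 0 \<le> \<gamma> \<Longrightarrow> \<gamma> \<le> step_limit k \<Longrightarrow>
       (\<And>t. t < n \<Longrightarrow> bounded_potential (level k) (state \<gamma> (sample \<omega>) t)) \<Longrightarrow>
       (\<Sum>t<n. min (2 * \<epsilon> / level k * ?R \<gamma> \<omega> t) (?S \<gamma> \<omega> t)) \<le> 16 * \<tau> * x2"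
      unfolding x2_def by (rule reaction_uniform[OF \<delta>2]) auto
    show ?thesis
    proof (rule that[of "N1 \<union> N2"])
      show "N1 \<union> N2 \<in> sets M" using N1 N2 by simp
      show "measure M (N1 \<union> N2) \<le> \<delta>"
        using measure_Un_le[OF N1(1) N2(1)] N1(2) N2(2) by simp
    next
      fix \<omega> v \<eta> \<gamma> assume w: "\<omega> \<in> space M - (N1 \<union> N2)" and *: "a \<le> v" "\<eta> = \<epsilon> / v" "\<gamma> = \<eta> * \<beta> / (\<eta> + \<beta>)"
        and p: "\<And>t. t \<le> n \<Longrightarrow> bounded_potential v (state \<gamma> (sample \<omega>) t)"
      have v0: "0 < v" using *(1) a by simp
      have \<eta>0: "0 < \<eta>" using \<epsilon>0 v0 by (simp add: *)
      have g: "0 \<le> \<gamma>" "\<gamma> \<le> \<beta>" using step[OF \<eta>0 *(3)] by auto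
      have tr: "trace (state \<gamma> (sample \<omega>) t) \<le> \<tau>" for t by (rule order_trans[OF iterate_trace[OF g] initial(2)])
      obtain k where k: "v \<le> level k" "level k \<le> 2 * v" by (rule level_exists[OF *(1)])
      have pk: "bounded_potential (level k) (state \<gamma> (sample \<omega>) t)" if "t < n" for t
        by (rule bounded_potential_mono[OF p k(1)]) (use that in simp)
      have noise: "(\<Sum>t<n. ?noise \<gamma> \<omega> t) \<le> 32 * \<tau> * level k * x1"
        by (rule N1(3)[OF _ g(1) limit[OF v0 k(2) *(2,3)] pk]) (use w in auto)
      have react: "(\<Sum>t<n. min (2 * \<epsilon> / level k * ?R \<gamma> \<omega> t) (?S \<gamma> \<omega> t)) \<le> 16 * \<tau> * x2"
        by (rule N2(3)[OF _ g(1) limit[OF v0 k(2) *(2,3)] pk]) (use w in auto)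
      have R0: "0 \<le> ?R \<gamma> \<omega> t" for t by (rule admissible_amplitudes.reaction_nonneg[OF admissible_amplitudes])
      have \<eta>k: "\<eta> \<le> 2 * \<epsilon> / level k"
      proof -
        have "\<eta> = 2 * \<epsilon> / (2 * v)" using * by simp
        also have "\<dots> \<le> 2 * \<epsilon> / level k" using k(2) level_pos[of k] \<epsilon> v0 by (intro divide_left_mono) auto
        finally show ?thesis .
      qed
      have "(\<Sum>t<n. loss \<eta> \<gamma> (sample \<omega>) Xs t) \<le> (\<Sum>t<n. ?noise \<gamma> \<omega> t + v * min (2 * \<epsilon> / level k * ?R \<gamma> \<omega> t) (?S \<gamma> \<omega> t))"
      proof (rule sum_mono)
        fix t assume t: "t \<in> {..<n}"
        have "loss \<eta> \<gamma> (sample \<omega>) Xs t \<le> ?noise \<gamma> \<omega> t + v * min (\<eta> * ?R \<gamma> \<omega> t) (?S \<gamma> \<omega> t)"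
          by (rule loss_refined[OF v0 \<tau> \<eta>0 p tr p tr]) (use t in auto)
        also have "\<dots> \<le> ?noise \<gamma> \<omega> t + v * min (2 * \<epsilon> / level k * ?R \<gamma> \<omega> t) (?S \<gamma> \<omega> t)"
          using mult_right_mono[OF \<eta>k R0[of t]] v0 by (intro add_left_mono mult_left_mono min.mono) auto
        finally show "loss \<eta> \<gamma> (sample \<omega>) Xs t \<le> ?noise \<gamma> \<omega> t + v * min (2 * \<epsilon> / level k * ?R \<gamma> \<omega> t) (?S \<gamma> \<omega> t)" .
      qed
      also have "\<dots> = (\<Sum>t<n. ?noise \<gamma> \<omega> t) + v * (\<Sum>t<n. min (2 * \<epsilon> / level k * ?R \<gamma> \<omega> t) (?S \<gamma> \<omega> t))"
        by (simp only: sum.distrib sum_distrib_left)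
      also have "\<dots> \<le> 32 * \<tau> * level k * x1 + v * (16 * \<tau> * x2)"
        using noise react v0 by (intro add_mono mult_left_mono) auto
      also have "\<dots> \<le> 32 * \<tau> * (2 * v) * x1 + v * (16 * \<tau> * x2)"
      proof -
        have "0 \<le> x1"
        proof -
          have "0 \<le> 21 * 1 * \<epsilon> * ?m * sqrt ?m * (real n)\<^sup>2 * exp (7 * \<epsilon> * real n)"
            using \<epsilon> m by (intro mult_nonneg_nonneg) auto
          then show ?thesis unfolding x1_def using \<delta> by (intro ln_ge_zero) (simp add: pos_le_divide_eq)
        qed
        then show ?thesis using k(2) \<tau> by (intro add_right_mono mult_right_mono mult_left_mono) auto
      qed
      also have "\<dots> = v * \<tau> * (64 * x1 + 16 * x2)" by (simp add: algebra_simps)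
      finally have L: "(\<Sum>t<n. loss \<eta> \<gamma> (sample \<omega>) Xs t) \<le> v * \<tau> * (64 * x1 + 16 * x2)" .
      have "(64 * x1 + 16 * x2) + 1 / 2 \<le> slack"
        using budget_long[OF 3 m \<delta> \<epsilon> conf] unfolding slack_def x1_def x2_def by linarith
      from reg[OF * p[OF order_refl] L this]
      show "(\<Sum>t\<le>n. excess Xs (state \<gamma> (sample \<omega>) t)) \<le> v * \<tau> * (\<epsilon> * conf\<^sup>2 * ?T + 2 * conf * sqrt ?T)" .
    qed
  qed
qed

end


section \<open>Measurability of the iterates\<close>

lemma (in mean_field) penalty_linear: "linear penalty"
  by (intro linearI penalty_add penalty_scaleR)

lemma logistic_continuous: "continuous_on {H. transpose H = H} (logistic :: real^'n^'n \<Rightarrow> real^'n^'n)"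
  unfolding continuous_on_iff
proof (intro ballI allI impI)
  fix H :: "real^'n^'n" and e :: real assume H: "H \<in> {H. transpose H = H}" and e: "0 < e"
  show "\<exists>d>0. \<forall>H'\<in>{H. transpose H = H}. dist H' H < d \<longrightarrow> dist (logistic H') (logistic H) < e"
    using logistic_lipschitz H e by (intro exI[of _ e]) (auto simp: dist_norm intro: le_less_trans)
qed

context mean_field
begin

lemma density_continuous: "continuous_on UNIV density"
proof -
  have p: "continuous_on UNIV penalty" by (rule linear_continuous_on) (simp add: penalty_linear linear_conv_bounded_linear[symmetric])
  show ?thesis
    by (rule continuous_on_compose2[OF logistic_continuous]) (use density_sym in \<open>auto intro!: continuous_intros p\<close>)
qed

lemma root_continuous: "continuous_on UNIV (\<lambda>k. \<Psi> ** msqrt (density k))"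
proof -
  have "continuous_on feasible (msqrt :: real^'n^'n \<Rightarrow> real^'n^'n)"
    by (intro mat_fun_continuous_on_feasible continuous_intros)
  then have "continuous_on UNIV (\<lambda>k. msqrt (density k))"
    by (rule continuous_on_compose2[OF _ density_continuous]) (use density_feasible in auto)
  then show ?thesis unfolding matrix_matrix_mult_def by (intro continuous_intros)
qed

lemma iterate_measurable:
  assumes \<gamma>: "\<gamma> \<in> borel_measurable M"
  shows "(\<And>i. i < t \<Longrightarrow> z i \<in> borel_measurable M) \<Longrightarrow> (\<lambda>\<omega>. iterate (\<gamma> \<omega>) (\<lambda>i. z i \<omega>) t) \<in> borel_measurable M"
proof (induction t)
  case (Suc t)
  let ?G = "\<lambda>p :: real \<times> ((real^'m) \<times> (real^'n)). (1 - fst p / \<beta>) *\<^sub>R fst (snd p)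
    + fst p *\<^sub>R (V *v sample_density (\<Psi> ** msqrt (density (fst (snd p)))) (snd (snd p)))"
  have "continuous_on UNIV ?G"
    using \<beta> by (intro continuous_intros matrix_vector_continuous sample_density_continuous
        continuous_on_compose2[OF root_continuous]) auto
  then have G: "?G \<in> borel_measurable borel" by (rule borel_measurable_continuous_onI)
  have "(\<lambda>\<omega>. (\<gamma> \<omega>, (iterate (\<gamma> \<omega>) (\<lambda>i. z i \<omega>) t, z t \<omega>))) \<in> borel_measurable M"
    using \<gamma> Suc by (intro borel_measurable_Pair) auto
  from measurable_compose[OF this G] show ?case by simp
qed simp

lemma state_functional_measurable:
  assumes "\<gamma> \<in> borel_measurable M" "\<And>i. i < t \<Longrightarrow> z i \<in> borel_measurable M"
    and F: "continuous_on feasible (F :: real^'n^'n \<Rightarrow> real)"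
  shows "(\<lambda>\<omega>. F (state (\<gamma> \<omega>) (\<lambda>i. z i \<omega>) t)) \<in> borel_measurable M"
proof -
  have "continuous_on UNIV (\<lambda>k. F (density k))"
    by (rule continuous_on_compose2[OF F density_continuous]) (use density_feasible in auto)
  from measurable_compose[OF iterate_measurable[OF assms(1,2)] borel_measurable_continuous_onI[OF this]]
  show ?thesis by simp
qed

lemma E_tilde_continuous: "continuous_on S (E_tilde \<Psi> V)"
  unfolding E_tilde_def[abs_def] by (intro continuous_intros rho_continuous matrix_vector_continuous)

lemma gibbs_continuous: "continuous_on feasible (gibbs H)"
  unfolding gibbs_def[abs_def] by (intro continuous_intros S_FD_continuous)

end


section \<open>The convergence bound\<close>

theorem theorem28:
  fixes \<Psi> :: "real ^ 'n ^ 'm" and V :: "real ^ 'm ^ 'm" and C X\<^sub>s :: "real ^ 'n ^ 'n"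
    and \<mu> \<beta> \<delta> :: real and T :: nat
    and M :: "'w measure" and z :: "nat \<Rightarrow> 'w \<Rightarrow> real ^ 'n"
    and \<eta> :: "'w \<Rightarrow> real" and X :: "nat \<Rightarrow> 'w \<Rightarrow> real ^ 'n ^ 'n"
  assumes "transpose \<Psi> ** \<Psi> = mat 1"
    and "pos_semidef V"
    and "transpose C = C"
    and "0 < \<beta>"
    and "\<forall>Y\<in>feasible. pos_semidef (grad_E_tilde \<Psi> V Y)"
    and "0 < T"
    and "0 < \<delta>" and "\<delta> \<le> 1"
    and "is_arg_min (\<lambda>Y. free_energy \<Psi> V C \<beta> Y - \<mu> * trace Y) (\<lambda>Y. Y \<in> feasible) X\<^sub>s"
    and "prob_space M"
    and "prob_space.indep_vars M (\<lambda>_. borel) z {..<T}"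
    and "\<forall>t<T. distributed M lborel (z t) std_gaussian_density"
    and "\<eta> \<in> borel_measurable M"
    and "\<forall>\<omega>\<in>space M. X 0 \<omega> = X_init C \<mu> \<beta>"
    and "(\<forall>\<omega>\<in>space M. 0 < \<eta> \<omega> \<and>
            (\<forall>t<T. prox_step \<Psi> V C \<mu> \<beta> (\<eta> \<omega>) (X t \<omega>) (z t \<omega>) (X (Suc t) \<omega>)))
       \<or> (\<forall>\<omega>\<in>space M. \<forall>t<T. mirror_step \<Psi> V C \<mu> \<beta> (\<eta> \<omega> * \<beta> / (\<eta> \<omega> + \<beta>))
            (X t \<omega>) (z t \<omega>) (X (Suc t) \<omega>))"
    and "\<forall>\<omega>\<in>space M. \<eta> \<omega> =
          sqrt (2 * bregman X\<^sub>s (X_init C \<mu> \<beta>)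
            / (tau C \<mu> \<beta> * (c_conf T CARD('m) \<delta>)\<^sup>2
               * (c_h \<Psi> V T X\<^sub>s (\<lambda>t. X t \<omega>))\<^sup>2 * real T))"
  shows "measure M {\<omega> \<in> space M.
           (\<Sum>t<T. free_energy \<Psi> V C \<beta> (X t \<omega>) - \<mu> * trace (X t \<omega>)) / real T
           \<le> free_energy \<Psi> V C \<beta> X\<^sub>s - \<mu> * trace X\<^sub>s
             + (sqrt (2 * tau C \<mu> \<beta> * bregman X\<^sub>s (X_init C \<mu> \<beta>)) + 2 * tau C \<mu> \<beta>)
               * c_conf T CARD('m) \<delta> * c_h \<Psi> V T X\<^sub>s (\<lambda>t. X t \<omega>) / sqrt (real T)}
         \<ge> 1 - \<delta>"
proof -
  note orth = assms(1) and V = assms(2) and C = assms(3) and \<beta> = assms(4) and repulsive = assms(5)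
    and T = assms(6) and \<delta> = assms(7,8) and opt = assms(9) and M = assms(10) and indep = assms(11)
    and law = assms(12) and \<eta>_measurable = assms(13) and start = assms(14) and steps = assms(15) and \<eta>_eq = assms(16)
  define H0 where "H0 = \<beta> *\<^sub>R (C - \<mu> *\<^sub>R mat 1)"
  interpret O: orthonormal_columns \<Psi> by standard (rule orth)
  interpret mean_field \<Psi> V H0 \<beta>
  proof
    show "transpose H0 = H0" by (simp add: H0_def transpose_scaleR transpose_diff C)
    show "pos_semidef (O.penalty (V *v rho \<Psi> Y))" if "Y \<in> feasible" for Y
      using repulsive that by (simp add: O.penalty_def grad_E_tilde_def)
  qed (use V \<beta> in auto)
  obtain n where n: "T = Suc n" using T by (cases T) auto
  define X0 where "X0 = X_init C \<mu> \<beta>"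
  have X0: "X0 = logistic H0" unfolding X0_def H0_def by (rule X_init_logistic[OF C])
  have X0_feasible: "X0 \<in> feasible" unfolding X0 by (rule logistic_feasible[OF H0])
  define \<tau> where "\<tau> = tau C \<mu> \<beta>"
  have \<tau>: "1 \<le> \<tau>" "trace X0 \<le> \<tau>" by (simp_all add: \<tau>_def tau_def X0_def)
  define cc where "cc = c_conf T CARD('m) \<delta>"
  have cc: "0 < cc"
  proof -
    have "1 \<le> 2 * real T * real CARD('m) / \<delta>"
    proof -
      have "1 \<le> real T * real CARD('m)" using T by (simp add: Suc_le_eq flip: of_nat_mult)
      then have "1 * \<delta> \<le> 2 * real T * real CARD('m)" using \<delta> by simp
      then show ?thesis using \<delta> by (simp add: pos_le_divide_eq)
    qed
    then have "0 \<le> ln (2 * real T * real CARD('m) / \<delta>)" by (rule ln_ge_zero)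
    then show ?thesis unfolding cc_def c_conf_def by simp
  qed
  define D where "D = bregman X\<^sub>s X0"
  have D: "D = divergence 0 X\<^sub>s" unfolding D_def X0 bregman_logistic[OF H0] divergence_def by simp
  have X\<^sub>s: "X\<^sub>s \<in> feasible" and Xs_min: "\<And>Y. Y \<in> feasible \<Longrightarrow>
      free_energy \<Psi> V C \<beta> X\<^sub>s - \<mu> * trace X\<^sub>s \<le> free_energy \<Psi> V C \<beta> Y - \<mu> * trace Y"
    using opt by (auto simp: is_arg_min_linorder)
  have D0: "0 \<le> D" unfolding D by (rule divergence_nonneg[OF X\<^sub>s])
  have F: "free_energy \<Psi> V C \<beta> Y - \<mu> * trace Y = E_tilde \<Psi> V Y + inverse \<beta> * gibbs H0 Y" for Y
    unfolding H0_def by (rule free_energy_gibbs[OF C \<beta>])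
  have F_excess: "free_energy \<Psi> V C \<beta> Y - \<mu> * trace Y = (free_energy \<Psi> V C \<beta> X\<^sub>s - \<mu> * trace X\<^sub>s) + excess X\<^sub>s Y" for Y
    unfolding F excess_def by (simp add: divide_inverse mult.commute right_diff_distrib)
  define ch where "ch \<omega> = c_h \<Psi> V T X\<^sub>s (\<lambda>t. X t \<omega>)" for \<omega>
  have ch0: "0 \<le> ch \<omega>" for \<omega> unfolding ch_def c_h_def by (rule max.coboundedI1) (rule infnorm_pos_le)
  have \<eta>: "\<eta> \<omega> = sqrt (2 * D / (\<tau> * cc\<^sup>2 * (ch \<omega>)\<^sup>2 * real T))" if "\<omega> \<in> space M" for \<omega>
    using \<eta>_eq that by (simp add: D_def X0_def \<tau>_def cc_def ch_def)
  have \<eta>0: "0 \<le> \<eta> \<omega>" if "\<omega> \<in> space M" for \<omega>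
    unfolding \<eta>[OF that] using D0 \<tau> by simp
  define \<gamma> where "\<gamma> \<omega> = \<eta> \<omega> * \<beta> / (\<eta> \<omega> + \<beta>)" for \<omega>
  have X_state: "X t \<omega> = state (\<gamma> \<omega>) (\<lambda>i. z i \<omega>) t" if w: "\<omega> \<in> space M" and t: "t \<le> T" for t \<omega>
    using t
  proof (induction t)
    case 0
    show ?case using start w by (simp add: X0[symmetric] X0_def)
  next
    case (Suc t)
    then have IH: "X t \<omega> = state (\<gamma> \<omega>) (\<lambda>i. z i \<omega>) t" and t: "t < T" by auto
    show ?case
      using steps
    proof
      assume "\<forall>\<omega>\<in>space M. 0 < \<eta> \<omega> \<and> (\<forall>t<T. prox_step \<Psi> V C \<mu> \<beta> (\<eta> \<omega>) (X t \<omega>) (z t \<omega>) (X (Suc t) \<omega>))"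
      then have "0 < \<eta> \<omega>" "prox_step \<Psi> V C \<mu> \<beta> (\<eta> \<omega>) (state (\<gamma> \<omega>) (\<lambda>i. z i \<omega>) t) (z t \<omega>) (X (Suc t) \<omega>)"
        using w t by (auto simp: IH[symmetric])
      from prox_step_density[OF this(1) \<gamma>_def C H0_def this(2)] show ?case by (simp only: iterate.simps)
    next
      assume "\<forall>\<omega>\<in>space M. \<forall>t<T. mirror_step \<Psi> V C \<mu> \<beta> (\<eta> \<omega> * \<beta> / (\<eta> \<omega> + \<beta>)) (X t \<omega>) (z t \<omega>) (X (Suc t) \<omega>)"
      then have "mirror_step \<Psi> V C \<mu> \<beta> (\<gamma> \<omega>) (state (\<gamma> \<omega>) (\<lambda>i. z i \<omega>) t) (z t \<omega>) (X (Suc t) \<omega>)"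
        unfolding IH[symmetric] using w t by (simp add: \<gamma>_def)
      from mirror_step_density[OF C H0_def this] show ?case by (simp only: iterate.simps)
    qed
  qed
  define A where "A = {\<omega> \<in> space M. (\<Sum>t<T. free_energy \<Psi> V C \<beta> (X t \<omega>) - \<mu> * trace (X t \<omega>)) / real T
      \<le> free_energy \<Psi> V C \<beta> X\<^sub>s - \<mu> * trace X\<^sub>s + (sqrt (2 * \<tau> * D) + 2 * \<tau>) * cc * ch \<omega> / sqrt (real T)}"
  have in_A: "\<omega> \<in> A" if w: "\<omega> \<in> space M"
    and le: "(\<Sum>t<T. excess X\<^sub>s (X t \<omega>)) \<le> (sqrt (2 * \<tau> * D) + 2 * \<tau>) * cc * ch \<omega> * sqrt (real T)" for \<omega>
  proof -
    define K where "K = (sqrt (2 * \<tau> * D) + 2 * \<tau>) * cc * ch \<omega>"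
    have "K * sqrt (real T) / real T = K / sqrt (real T)"
    proof -
      have "K * sqrt (real T) / real T = K * (sqrt (real T) / real T)" by (rule times_divide_eq_right[symmetric])
      also have "sqrt (real T) / real T = inverse (sqrt (real T))" using sqrt_divide_self_eq[of "real T"] by simp
      finally show ?thesis by (simp only: divide_inverse)
    qed
    moreover have "(\<Sum>t<T. free_energy \<Psi> V C \<beta> (X t \<omega>) - \<mu> * trace (X t \<omega>)) / real T
      = (free_energy \<Psi> V C \<beta> X\<^sub>s - \<mu> * trace X\<^sub>s) + (\<Sum>t<T. excess X\<^sub>s (X t \<omega>)) / real T"
    proof -
      have "(\<Sum>t<T. free_energy \<Psi> V C \<beta> (X t \<omega>) - \<mu> * trace (X t \<omega>))
        = (\<Sum>t<T. (free_energy \<Psi> V C \<beta> X\<^sub>s - \<mu> * trace X\<^sub>s) + excess X\<^sub>s (X t \<omega>))"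
        by (rule sum.cong[OF refl F_excess])
      also have "\<dots> = real T * (free_energy \<Psi> V C \<beta> X\<^sub>s - \<mu> * trace X\<^sub>s) + (\<Sum>t<T. excess X\<^sub>s (X t \<omega>))"
        by (simp only: sum.distrib sum_constant card_lessThan)
      finally show ?thesis using T by (simp only: add_divide_distrib) simp
    qed
    moreover have "(\<Sum>t<T. excess X\<^sub>s (X t \<omega>)) / real T \<le> K * sqrt (real T) / real T"
      using le by (intro divide_right_mono) (auto simp: K_def)
    ultimately show ?thesis using w unfolding A_def K_def by simp
  qed
  interpret prob_space M by (rule M)
  have "1 - \<delta> \<le> measure M A"
  proof (cases "D = 0")
    case True
    \<comment> \<open>The step size vanishes, so every iterate is the initial state, which is the minimizer.\<close>
    have "X\<^sub>s = logistic H0"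
      using D True by (intro gibbs_le_imp_eq[OF H0 X\<^sub>s]) (simp add: divergence_def)
    have "\<omega> \<in> A" if w: "\<omega> \<in> space M" for \<omega>
    proof (rule in_A[OF w])
      have "\<gamma> \<omega> = 0" by (simp add: \<gamma>_def \<eta>[OF w] True)
      then have "X t \<omega> = X\<^sub>s" if "t < T" for t
        using X_state[OF w, of t] that by (simp add: iterate_zero \<open>X\<^sub>s = logistic H0\<close>)
      then have "(\<Sum>t<T. excess X\<^sub>s (X t \<omega>)) = 0" by (simp add: excess_def)
      then show "(\<Sum>t<T. excess X\<^sub>s (X t \<omega>)) \<le> (sqrt (2 * \<tau> * D) + 2 * \<tau>) * cc * ch \<omega> * sqrt (real T)"
        using \<tau> cc ch0[of \<omega>] True by simp
    qed
    then have "A = space M" by (auto simp: A_def)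
    then show ?thesis using \<delta> prob_space by simp
  next
    case False
    then have Dpos: "0 < D" using D0 by simp
    define pot where "pot Y = infnorm (abs_mat V *v rho \<Psi> Y)" for Y
    have pot_bound: "bounded_potential v Y" if "pot Y \<le> v" for Y v
      unfolding bounded_potential_def
      using component_le_infnorm_cart[of "abs_mat V *v rho \<Psi> Y"] that unfolding pot_def
      by (meson abs_ge_self order_trans)
    define a where "a = max (pot X0) (pot X\<^sub>s)"
    \<comment> \<open>If both potentials vanished, the interaction energy would vanish at both states, and then the
      initial state would be as good as the minimizer.\<close>
    have a: "0 < a"
    proof (rule ccontr)
      assume "\<not> 0 < a"
      then have "pot X0 \<le> 0" "pot X\<^sub>s \<le> 0" by (auto simp: a_def)
      then have "E_tilde \<Psi> V X0 \<le> 0" "E_tilde \<Psi> V X\<^sub>s \<le> 0"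
        using E_tilde_le[OF X0_feasible pot_bound, of 0 "trace X0"] E_tilde_le[OF X\<^sub>s pot_bound, of 0 "trace X\<^sub>s"] by auto
      then have "E_tilde \<Psi> V X0 = 0" "E_tilde \<Psi> V X\<^sub>s = 0" using E_tilde_nonneg by (auto intro: antisym)
      then have "inverse \<beta> * gibbs H0 X\<^sub>s \<le> inverse \<beta> * gibbs H0 X0"
        using Xs_min[OF X0_feasible] unfolding F by simp
      then have "gibbs H0 X\<^sub>s \<le> gibbs H0 X0" using \<beta> by simp
      then show False using Dpos unfolding D divergence_def X0 by simp
    qed
    \<comment> \<open>The step size is random only through \<open>ch\<close>; the product of the two is this constant.\<close>
    define \<epsilon> where "\<epsilon> = sqrt (2 * D / (\<tau> * cc\<^sup>2 * real T))"
    have pos: "0 < \<epsilon>" unfolding \<epsilon>_def using Dpos \<tau> cc T by simp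
    have \<epsilon>2: "\<epsilon>\<^sup>2 * \<tau> * cc\<^sup>2 * real T = 2 * D"
      unfolding \<epsilon>_def using Dpos \<tau> cc T by simp
    interpret cells \<Psi> V H0 \<beta> M z n a \<tau> \<epsilon>
    proof
      show "indep_vars (\<lambda>_. borel) z {..<n}" using indep by (rule indep_vars_subset) (simp add: n)
      show "distr M borel (z t) = gaussian" if "t < n" for t
      proof -
        have "distr M borel (z t) = distr M lborel (z t)" by (rule distr_cong) auto
        also have "\<dots> = gaussian"
          using law that unfolding gaussian_def by (intro distributed_distr_eq_density) (simp add: n)
        finally show ?thesis .
      qed
      show "bounded_potential a (logistic H0)" by (rule pot_bound) (simp add: a_def X0)
    qed (use a \<tau> pos X0 in auto)
    have a_ch: "a \<le> ch \<omega>" and pot_ch: "t < T \<Longrightarrow> pot (X t \<omega>) \<le> ch \<omega>" if w: "\<omega> \<in> space M" for \<omega> t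
    proof -
      have pot_ch: "pot (X t \<omega>) \<le> ch \<omega>" if "t < T" for t
        unfolding ch_def c_h_def pot_def using that by (intro max.coboundedI2 Max_ge) auto
      have "X 0 \<omega> = X0" using start w by (simp add: X0_def)
      moreover have "pot X\<^sub>s \<le> ch \<omega>" unfolding ch_def c_h_def pot_def by simp
      ultimately show "a \<le> ch \<omega>" using pot_ch[of 0] T by (simp add: a_def)
      show "t < T \<Longrightarrow> pot (X t \<omega>) \<le> ch \<omega>" by (rule pot_ch)
    qed
    obtain N where N: "N \<in> sets M" "measure M N \<le> \<delta>"
      "\<And>\<omega> v \<eta> \<gamma>. \<omega> \<in> space M - N \<Longrightarrow> a \<le> v \<Longrightarrow> \<eta> = \<epsilon> / v \<Longrightarrow> \<gamma> = \<eta> * \<beta> / (\<eta> + \<beta>) \<Longrightarrow>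
       (\<And>t. t \<le> n \<Longrightarrow> bounded_potential v (state \<gamma> (\<lambda>i. z i \<omega>) t)) \<Longrightarrow>
       (\<Sum>t\<le>n. excess X\<^sub>s (state \<gamma> (\<lambda>i. z i \<omega>) t))
         \<le> v * \<tau> * (\<epsilon> * cc\<^sup>2 * real (Suc n) + 2 * cc * sqrt (real (Suc n)))"
    proof (rule regret_high_probability[OF \<delta> pos X\<^sub>s])
      show "bounded_potential a X\<^sub>s" by (rule pot_bound) (simp add: a_def)
      show "divergence 0 X\<^sub>s = \<epsilon>\<^sup>2 * \<tau> * (c_conf (Suc n) CARD('m) \<delta>)\<^sup>2 * real (Suc n) / 2"
        using \<epsilon>2 unfolding D cc_def n by simp
    qed (auto simp: cc_def n)
    have sub: "space M - N \<subseteq> A"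
    proof
      fix \<omega> assume w: "\<omega> \<in> space M - N"
      then have w': "\<omega> \<in> space M" by simp
      have chpos: "0 < ch \<omega>" using a a_ch[OF w'] by simp
      have \<eta>\<epsilon>: "\<eta> \<omega> = \<epsilon> / ch \<omega>"
      proof -
        have "2 * D / (\<tau> * cc\<^sup>2 * (ch \<omega>)\<^sup>2 * real T) = (2 * D / (\<tau> * cc\<^sup>2 * real T)) / (ch \<omega>)\<^sup>2" by simp
        then show ?thesis unfolding \<eta>[OF w'] \<epsilon>_def using chpos by (simp only: real_sqrt_divide real_sqrt_abs abs_of_pos)
      qed
      have root: "sqrt (2 * \<tau> * D) = \<epsilon> * \<tau> * cc * sqrt (real T)"
      proof (rule real_sqrt_unique)
        have "(\<epsilon> * \<tau> * cc * sqrt (real T))\<^sup>2 = (\<epsilon>\<^sup>2 * \<tau> * cc\<^sup>2 * real T) * \<tau>"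
          by (simp add: power_mult_distrib) (simp add: power2_eq_square)
        then show "(\<epsilon> * \<tau> * cc * sqrt (real T))\<^sup>2 = 2 * \<tau> * D" unfolding \<epsilon>2 by simp
      qed (use \<epsilon> \<tau> cc in auto)
      have "(\<Sum>t<T. excess X\<^sub>s (X t \<omega>)) = (\<Sum>t\<le>n. excess X\<^sub>s (state (\<gamma> \<omega>) (\<lambda>i. z i \<omega>) t))"
        unfolding n lessThan_Suc_atMost by (rule sum.cong) (use X_state[OF w'] n in auto)
      also have "\<dots> \<le> ch \<omega> * \<tau> * (\<epsilon> * cc\<^sup>2 * real (Suc n) + 2 * cc * sqrt (real (Suc n)))"
      proof (rule N(3)[OF w a_ch[OF w'] \<eta>\<epsilon> \<gamma>_def])
        fix t assume "t \<le> n"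
        then show "bounded_potential (ch \<omega>) (state (\<gamma> \<omega>) (\<lambda>i. z i \<omega>) t)"
          using pot_bound[OF pot_ch[OF w']] X_state[OF w'] n by (metis le_imp_less_Suc less_imp_le)
      qed
      also have "\<dots> = (sqrt (2 * \<tau> * D) + 2 * \<tau>) * cc * ch \<omega> * sqrt (real T)"
      proof -
        have "real T = sqrt (real T) * sqrt (real T)" by simp
        then show ?thesis unfolding root n[symmetric] by (simp add: power2_eq_square algebra_simps)
      qed
      finally show "\<omega> \<in> A" by (rule in_A[OF w'])
    qed
    have \<gamma>m: "\<gamma> \<in> borel_measurable M" unfolding \<gamma>_def using \<eta>_measurable by simp
    have state_m: "(\<lambda>\<omega>. G (X t \<omega>)) \<in> borel_measurable M" if "continuous_on feasible G" "t < T" for G :: "real^'n^'n \<Rightarrow> real" and t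
    proof -
      have "(\<lambda>\<omega>. G (state (\<gamma> \<omega>) (\<lambda>i. z i \<omega>) t)) \<in> borel_measurable M"
        by (rule state_functional_measurable[OF \<gamma>m _ that(1)]) (use that(2) n z_measurable in auto)
      then show ?thesis by (subst measurable_cong[of M _ "\<lambda>\<omega>. G (state (\<gamma> \<omega>) (\<lambda>i. z i \<omega>) t)"]) (use X_state that(2) in auto)
    qed
    have "A \<in> sets M"
    proof -
      have "(\<lambda>\<omega>. free_energy \<Psi> V C \<beta> (X t \<omega>) - \<mu> * trace (X t \<omega>)) \<in> borel_measurable M" if "t < T" for t
        unfolding F by (rule state_m[OF _ that]) (intro continuous_intros E_tilde_continuous gibbs_continuous)
      then have sum_m: "(\<lambda>\<omega>. \<Sum>t<T. free_energy \<Psi> V C \<beta> (X t \<omega>) - \<mu> * trace (X t \<omega>)) \<in> borel_measurable M"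
        by (intro borel_measurable_sum) auto
      have "(\<lambda>\<omega>. infnorm (abs_mat V *v rho \<Psi> (X t \<omega>))) \<in> borel_measurable M" if "t < T" for t
        by (rule state_m[OF _ that]) (intro continuous_on_infnorm matrix_vector_continuous rho_continuous)
      then have ch_m: "ch \<in> borel_measurable M"
        unfolding ch_def[abs_def] c_h_def by (intro borel_measurable_max borel_measurable_const borel_measurable_Max) auto
      show ?thesis
        unfolding A_def
        by (intro borel_measurable_le borel_measurable_divide borel_measurable_add borel_measurable_times
            borel_measurable_const sum_m ch_m)
    qed
    then have "measure M (space M - N) \<le> measure M A" by (intro finite_measure_mono sub)
    then show ?thesis using prob_compl[OF N(1)] N(2) by simp
  qed
  then show ?thesis unfolding A_def \<tau>_def D_def X0_def cc_def ch_def .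
qed

end
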